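(* Let $d\ge 2$ and let $\Sigma\subset\mathbb{R}^d$ be an admissible $C^2$-hypersurface with constant $\beta>0$ (see context). Let $Q\in L^\infty(\mathbb{R}^d)$ be real valued and let $V\in L^\infty(\mathbb{R}^d)$ be real valued with support in $\Omega_\beta$. Define $\alpha\in L^\infty(\Sigma)$ by $$\alpha(x_\Sigma):=\int_{-\beta}^{\beta}V(x_\Sigma+s\,\nu(x_\Sigma))\,\mathrm{d}s\quad\text{for a.e. }x_\Sigma\in\Sigma,$$ let $A_{\delta,\alpha}$ be the Schrödinger operator with $\delta$-interaction of strength $\alpha$ supported on $\Sigma$, and let $H_\varepsilon$ be the Schrödinger operators with the scaled potentials $V_\varepsilon$ (both defined in the context). Then there exists $\lambda_0<0$ such that $(-\infty,\lambda_0)\subset\rho(A_{\delta,\alpha}+Q)\cap\rho(H_\varepsilon+Q)$ for all sufficiently small $\varepsilon>0$, and for every $\lambda\in(-\infty,\lambda_0)$ there is a constant $c=c(d,\lambda,\Sigma,V,Q)>0$, independent of $\varepsilon$, such that $$\left\|(H_\varepsilon+Q-\lambda)^{-1}-(A_{\delta,\alpha}+Q-\lambda)^{-1}\right\|\le c\,\varepsilon\,(1+|\ln\varepsilon|)$$ holds for all sufficiently small $\varepsilon>0$. In particular, $H_\varepsilon+Q$ converges to $A_{\delta,\alpha}+Q$ in the norm resolvent sense as $\varepsilon\to0+$.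
   Context: $C^2$-hypersurface: $\Sigma\subset\mathbb{R}^d$ is a $C^2$-hypersurface with parametrization $\{\varphi_i,U_i,V_i\}_{i\in I}$ if $I$ is a finite index set and (a) $U_i\subset\mathbb{R}^{d-1}$, $V_i\subset\mathbb{R}^d$ are open and $\varphi_i:U_i\to V_i$ is $C^2$ for all $i$; (b) $\mathrm{rank}\,D\varphi_i(u)=d-1$ for all $u\in U_i$, $i\in I$; (c) $\varphi_i(U_i)=V_i\cap\Sigma$ and $\varphi_i:U_i\to V_i\cap\Sigma$ is a homeomorphism; (d) $\Sigma\subset\bigcup_{i\in I}V_i$; (e) there is $C>0$ with $|\varphi_i(u)-\varphi_i(v)|\le C|u-v|$ for all $u,v\in U_i$, $i\in I$. ($\Sigma$ may be unbounded and need not be closed.) $\Sigma$ is orientable if it has a globally continuous unit normal vector field; such a field $\nu$ is fixed. For $x=\varphi_i(u)\in\Sigma$, $T_x=\mathrm{span}\{\partial_1\varphi_i(u),\dots,\partial_{d-1}\varphi_i(u)\}$ and the Weingarten map $W(x):T_x\to T_x$ is the linear map with $W(x)\partial_j\varphi_i(u)=-\partial_j\,\nu(\varphi_i(u))$ (independent of the parametrization). Set $\iota_\Sigma(x_\Sigma,t)=x_\Sigma+t\nu(x_\Sigma)$ for $(x_\Sigma,t)\in\Sigma\times\mathbb{R}$, and $\iota_{\varphi_i}(u,t)=\varphi_i(u)+t\nu(\varphi_i(u))$ for $(u,t)\in U_i\times\mathbb{R}$. Admissible: $\Sigma$ is called an admissible $C^2$-hypersurface with constant $\beta>0$ if it is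 an orientable $C^2$-hypersurface with parametrization $\{\varphi_i,U_i,V_i\}_{i\in I}$ such that: (i) $\iota_\Sigma$ is injective on $\Sigma\times(-\beta,\beta)$; (ii) there is $\eta\in(0,1)$ with $\det(1-tW(x_\Sigma))\in(1-\eta,1+\eta)$ for all $x_\Sigma\in\Sigma$, $t\in(-\beta,\beta)$; (iii) there is $c>0$ with $|\iota_{\varphi_i}(u,t)-\iota_{\varphi_i}(v,s)|^2\ge c^2(|u-v|^2+|s-t|^2)$ for all $u,v\in U_i$, $s,t\in(-\beta,\beta)$, $i\in I$. Layers: $\Omega_\varepsilon:=\{x_\Sigma+t\nu(x_\Sigma):x_\Sigma\in\Sigma,\ t\in(-\varepsilon,\varepsilon)\}$ for $0<\varepsilon\le\beta$. $\sigma$ is the $(d-1)$-dimensional Hausdorff (surface) measure on $\Sigma$. Operators: $A_{\delta,\alpha}$ is the unique self-adjoint operator in $L^2(\mathbb{R}^d)$ associated with the densely defined, closed, semibounded form $\mathfrak{a}_{\delta,\alpha}[f,g]=(\nabla f,\nabla g)_{L^2(\mathbb{R}^d;\mathbb{C}^d)}-\int_\Sigma\alpha f|_\Sigma\overline{g|_\Sigma}\,\mathrm{d}\sigma$, $\mathrm{dom}\,\mathfrak{a}_{\delta,\alpha}=H^1(\mathbb{R}^d)$, where $f|_\Sigma,g|_\Sigma$ are traces. The scaled potentials are $V_\varepsilon(x)=\frac{\beta}{\varepsilon}V\big(x_\Sigma+\frac{\beta}{\varepsilon}t\nu(x_\Sigma)\big)$ if $x=x_\Sigma+t\nu(x_\Sigma)\in\Omega_\varepsilon$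 and $V_\varepsilon(x)=0$ otherwise, $\varepsilon\in(0,\beta]$; $H_\varepsilon f=-\Delta f-V_\varepsilon f$ with $\mathrm{dom}\,H_\varepsilon=H^2(\mathbb{R}^d)$. $Q$ also denotes the multiplication operator by $Q$; $\rho(\cdot)$ is the resolvent set. *)

theory Defs
  imports "HOL-Analysis.Analysis"
begin

section \<open>The Hilbert space of square integrable complex functions\<close>

definition square_integrable :: "'b measure \<Rightarrow> ('b \<Rightarrow> complex) \<Rightarrow> bool" where
  "square_integrable M f \<longleftrightarrow>
     f \<in> borel_measurable M \<and> integrable M (\<lambda>x. (cmod (f x))\<^sup>2)"

lemma square_integrable_add:
  assumes "square_integrable M f" "square_integrable M g"
  shows "square_integrable M (\<lambda>x. f x + g x)"
proof -
  have m: "f \<in> borel_measurable M" "g \<in> borel_measurable M"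
    and i: "integrable M (\<lambda>x. (cmod (f x))\<^sup>2)" "integrable M (\<lambda>x. (cmod (g x))\<^sup>2)"
    using assms by (auto simp: square_integrable_def)
  have "(cmod (f x + g x))\<^sup>2 \<le> 2 * (cmod (f x))\<^sup>2 + 2 * (cmod (g x))\<^sup>2" for x
  proof -
    have "(cmod (f x + g x))\<^sup>2 \<le> (cmod (f x) + cmod (g x))\<^sup>2"
      by (intro power_mono norm_triangle_ineq) auto
    also have "\<dots> \<le> 2 * (cmod (f x))\<^sup>2 + 2 * (cmod (g x))\<^sup>2"
      using sum_squares_bound[of "cmod (f x)" "cmod (g x)"] by (simp add: power2_sum)
    finally show ?thesis .
  qed
  then have b: "norm ((cmod (f x + g x))\<^sup>2) \<le> norm (2 * (cmod (f x))\<^sup>2 + 2 * (cmod (g x))\<^sup>2)" for x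
    by simp
  have "integrable M (\<lambda>x. (cmod (f x + g x))\<^sup>2)"
  proof (rule Bochner_Integration.integrable_bound)
    show "integrable M (\<lambda>x. 2 * (cmod (f x))\<^sup>2 + 2 * (cmod (g x))\<^sup>2)"
      using i by simp
    show "(\<lambda>x. (cmod (f x + g x))\<^sup>2) \<in> borel_measurable M"
      using m by measurable
    show "AE x in M. norm ((cmod (f x + g x))\<^sup>2) \<le> norm (2 * (cmod (f x))\<^sup>2 + 2 * (cmod (g x))\<^sup>2)"
      using b by (rule AE_I2)
  qed
  with m show ?thesis by (simp add: square_integrable_def)
qed

lemma square_integrable_scale:
  "square_integrable M f \<Longrightarrow> square_integrable M (\<lambda>x. c * f x)"
  by (auto simp: square_integrable_def norm_mult power_mult_distrib)

lemma square_integrable_uminus: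
  "square_integrable M f \<Longrightarrow> square_integrable M (\<lambda>x. - f x)"
  by (auto simp: square_integrable_def)

lemma square_integrable_mult_cnj:
  assumes "square_integrable M f" "square_integrable M g"
  shows "integrable M (\<lambda>x. f x * cnj (g x))"
proof -
  have m: "f \<in> borel_measurable M" "g \<in> borel_measurable M"
    and i: "integrable M (\<lambda>x. (cmod (f x))\<^sup>2)" "integrable M (\<lambda>x. (cmod (g x))\<^sup>2)"
    using assms by (auto simp: square_integrable_def)
  have mc: "(\<lambda>x. cnj (g x)) \<in> borel_measurable M"
    by (intro borel_measurable_continuous_on[OF _ m(2)] continuous_intros)
  have b: "cmod (f x * cnj (g x)) \<le> norm ((cmod (f x))\<^sup>2 + (cmod (g x))\<^sup>2)" for x
  proof -
    have "2 * (cmod (f x) * cmod (g x)) \<le> (cmod (f x))\<^sup>2 + (cmod (g x))\<^sup>2"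
      using sum_squares_bound[of "cmod (f x)" "cmod (g x)"] by simp
    moreover have "0 \<le> cmod (f x) * cmod (g x)" by simp
    ultimately have "cmod (f x) * cmod (g x) \<le> (cmod (f x))\<^sup>2 + (cmod (g x))\<^sup>2"
      by linarith
    then show ?thesis by (simp add: norm_mult)
  qed
  show ?thesis
  proof (rule Bochner_Integration.integrable_bound)
    show "integrable M (\<lambda>x. (cmod (f x))\<^sup>2 + (cmod (g x))\<^sup>2)"
      using i by (rule Bochner_Integration.integrable_add)
    show "(\<lambda>x. f x * cnj (g x)) \<in> borel_measurable M"
      using m(1) mc by (rule borel_measurable_times)
    show "AE x in M. cmod (f x * cnj (g x)) \<le> norm ((cmod (f x))\<^sup>2 + (cmod (g x))\<^sup>2)"
      using b by (rule AE_I2)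
  qed
qed

definition L2_rel :: "('a::euclidean_space \<Rightarrow> complex) \<Rightarrow> ('a \<Rightarrow> complex) \<Rightarrow> bool" where
  "L2_rel f g \<longleftrightarrow> square_integrable lebesgue f \<and> square_integrable lebesgue g \<and>
     (AE x in lebesgue. f x = g x)"

quotient_type (overloaded) 'a l2 = "'a::euclidean_space \<Rightarrow> complex" / partial: L2_rel
proof (rule part_equivpI)
  show "\<exists>f::'a \<Rightarrow> complex. L2_rel f f"
    by (intro exI[of _ "\<lambda>_. 0"]) (auto simp: L2_rel_def square_integrable_def)
  show "symp (L2_rel :: ('a \<Rightarrow> complex) \<Rightarrow> _)"
    by (rule sympI) (simp add: L2_rel_def eq_commute)
  show "transp (L2_rel :: ('a \<Rightarrow> complex) \<Rightarrow> _)"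
  proof (rule transpI)
    fix f g h :: "'a \<Rightarrow> complex"
    assume "L2_rel f g" "L2_rel g h"
    moreover from this have "AE x in lebesgue. f x = g x" "AE x in lebesgue. g x = h x"
      by (simp_all add: L2_rel_def)
    then have "AE x in lebesgue. f x = h x"
      by eventually_elim simp
    ultimately show "L2_rel f h"
      by (simp add: L2_rel_def)
  qed
qed

lift_definition scaleC_l2 :: "complex \<Rightarrow> 'a::euclidean_space l2 \<Rightarrow> 'a l2"
  is "\<lambda>c f x. c * f x"
  by (simp add: L2_rel_def square_integrable_scale)

lift_definition cinner_l2 :: "'a::euclidean_space l2 \<Rightarrow> 'a l2 \<Rightarrow> complex"
  is "\<lambda>f g. LINT x|lebesgue. f x * cnj (g x)"
proof -
  fix f f' g g' :: "'a \<Rightarrow> complex"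
  assume a: "L2_rel f f'" "L2_rel g g'"
  then have "AE x in lebesgue. f x = f' x" "AE x in lebesgue. g x = g' x"
    by (simp_all add: L2_rel_def)
  then have "AE x in lebesgue. f x * cnj (g x) = f' x * cnj (g' x)"
    by eventually_elim simp
  moreover have "integrable lebesgue (\<lambda>x. f x * cnj (g x))"
    "integrable lebesgue (\<lambda>x. f' x * cnj (g' x))"
    using a by (simp_all add: L2_rel_def square_integrable_mult_cnj)
  ultimately show "(LINT x|lebesgue. f x * cnj (g x)) = (LINT x|lebesgue. f' x * cnj (g' x))"
    by (intro integral_cong_AE borel_measurable_integrable)
qed

text \<open>The class \<open>real_inner\<close> supplies norm and topology; its inner product is
  the real part of the complex one, which yields the usual norm of \<open>L\<^sup>2\<close>.\<close>

instantiation l2 :: (euclidean_space) real_inner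
begin

lift_definition zero_l2 :: "'a l2" is "\<lambda>_. 0"
  by (auto simp: L2_rel_def square_integrable_def)

lift_definition plus_l2 :: "'a l2 \<Rightarrow> 'a l2 \<Rightarrow> 'a l2" is "\<lambda>f g x. f x + g x"
  by (auto simp: L2_rel_def square_integrable_add)

lift_definition uminus_l2 :: "'a l2 \<Rightarrow> 'a l2" is "\<lambda>f x. - f x"
  by (auto simp: L2_rel_def square_integrable_uminus)

definition minus_l2 :: "'a l2 \<Rightarrow> 'a l2 \<Rightarrow> 'a l2" where
  "minus_l2 f g = f + (- g)"

definition scaleR_l2 :: "real \<Rightarrow> 'a l2 \<Rightarrow> 'a l2" where
  "scaleR_l2 r f = scaleC_l2 (complex_of_real r) f"

definition inner_l2 :: "'a l2 \<Rightarrow> 'a l2 \<Rightarrow> real" where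
  "inner_l2 f g = Re (cinner_l2 f g)"

definition norm_l2 :: "'a l2 \<Rightarrow> real" where
  "norm_l2 f = sqrt (inner f f)"

definition dist_l2 :: "'a l2 \<Rightarrow> 'a l2 \<Rightarrow> real" where
  "dist_l2 f g = norm (f - g)"

definition sgn_l2 :: "'a l2 \<Rightarrow> 'a l2" where
  "sgn_l2 f = inverse (norm f) *\<^sub>R f"

definition uniformity_l2 :: "('a l2 \<times> 'a l2) filter" where
  "uniformity_l2 = (INF e\<in>{0<..}. principal {(x, y). dist x y < e})"

definition open_l2 :: "'a l2 set \<Rightarrow> bool" where
  "open_l2 U = (\<forall>x\<in>U. eventually (\<lambda>(x', y). x' = x \<longrightarrow> y \<in> U) uniformity)"

lemma l2_self_inner:
  "square_integrable lebesgue (f::'a \<Rightarrow> complex) \<Longrightarrow>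
    (LINT x|lebesgue. f x * cnj (f x)) =
      complex_of_real (LINT x|lebesgue. (cmod (f x))\<^sup>2)"
  by (simp only: complex_norm_square [symmetric] integral_complex_of_real)

instance
proof
  fix x y z :: "'a l2" and a b r :: real
  show "x + y + z = x + (y + z)"
    by transfer (auto simp: L2_rel_def add.assoc intro!: square_integrable_add)
  show "x + y = y + x"
    by transfer (auto simp: L2_rel_def add.commute intro!: square_integrable_add)
  show "0 + x = x"
    by transfer (auto simp: L2_rel_def)
  show "- x + x = 0"
    by transfer (auto simp: L2_rel_def square_integrable_def)
  show "x - y = x + - y"
    by (rule minus_l2_def)
  show "a *\<^sub>R (x + y) = a *\<^sub>R x + a *\<^sub>R y"
    unfolding scaleR_l2_def
    by transfer (auto simp: L2_rel_def distrib_left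
        intro!: square_integrable_add square_integrable_scale)
  show "(a + b) *\<^sub>R x = a *\<^sub>R x + b *\<^sub>R x"
    unfolding scaleR_l2_def
    by transfer (auto simp: L2_rel_def distrib_right
        intro!: square_integrable_add square_integrable_scale)
  show "a *\<^sub>R b *\<^sub>R x = (a * b) *\<^sub>R x"
    unfolding scaleR_l2_def
    by transfer (auto simp: L2_rel_def mult.assoc intro!: square_integrable_scale)
  show "1 *\<^sub>R x = x"
    unfolding scaleR_l2_def by transfer (auto simp: L2_rel_def)
  show "dist x y = norm (x - y)"
    by (rule dist_l2_def)
  show "sgn x = inverse (norm x) *\<^sub>R x"
    by (rule sgn_l2_def)
  show "uniformity = (INF e\<in>{0<..}. principal {(x::'a l2, y). dist x y < e})"
    by (rule uniformity_l2_def)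
  show "open U = (\<forall>x\<in>U. \<forall>\<^sub>F (x', y) in uniformity. x' = x \<longrightarrow> y \<in> U)" for U :: "'a l2 set"
    by (rule open_l2_def)
  show "inner x y = inner y x"
    unfolding inner_l2_def
  proof transfer
    fix f g :: "'a \<Rightarrow> complex"
    have "(LINT x|lebesgue. f x * cnj (g x)) = cnj (LINT x|lebesgue. g x * cnj (f x))"
      using Bochner_Integration.integral_cnj[where M = lebesgue and f = "\<lambda>x. g x * cnj (f x)"]
      by (simp only: complex_cnj_mult complex_cnj_cnj mult.commute)
    then show "Re (LINT x|lebesgue. f x * cnj (g x)) = Re (LINT x|lebesgue. g x * cnj (f x))"
      by simp
  qed
  show "inner (x + y) z = inner x z + inner y z"
    unfolding inner_l2_def
    by transfer (simp add: L2_rel_def distrib_right square_integrable_mult_cnj)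
  show "inner (r *\<^sub>R x) y = r * inner x y"
    unfolding inner_l2_def scaleR_l2_def
    by transfer (simp add: mult.assoc)
  show "0 \<le> inner x x"
    unfolding inner_l2_def
    by transfer (simp add: L2_rel_def l2_self_inner)
  show "inner x x = 0 \<longleftrightarrow> x = 0"
    unfolding inner_l2_def
  proof transfer
    fix f :: "'a \<Rightarrow> complex"
    assume "L2_rel f f"
    then have f: "square_integrable lebesgue f" by (simp add: L2_rel_def)
    then have "(LINT x|lebesgue. (cmod (f x))\<^sup>2) = 0 \<longleftrightarrow> (AE x in lebesgue. (cmod (f x))\<^sup>2 = 0)"
      by (intro integral_nonneg_eq_0_iff_AE) (auto simp: square_integrable_def)
    with f show "Re (LINT x|lebesgue. f x * cnj (f x)) = 0 \<longleftrightarrow> L2_rel f (\<lambda>_. 0)"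
      by (simp add: l2_self_inner L2_rel_def) (simp add: square_integrable_def)
  qed
  show "norm x = sqrt (inner x x)"
    by (rule norm_l2_def)
qed

end

definition L_infinity :: "'b measure \<Rightarrow> ('b \<Rightarrow> real) \<Rightarrow> bool" where
  "L_infinity M q \<longleftrightarrow> q \<in> borel_measurable M \<and> (\<exists>C. AE x in M. \<bar>q x\<bar> \<le> C)"

definition mult_l2 :: "('a::euclidean_space \<Rightarrow> real) \<Rightarrow> 'a l2 \<Rightarrow> 'a l2" where
  "mult_l2 q f = abs_l2 (\<lambda>x. complex_of_real (q x) * rep_l2 f x)"


section \<open>Unbounded operators\<close>

text \<open>An operator is represented by its graph, so that its domain is \<^term>\<open>Domain A\<close>.\<close>

type_synonym 'a l2_op = "('a l2 \<times> 'a l2) set"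

definition adjoint_op :: "'a::euclidean_space l2_op \<Rightarrow> 'a l2_op" where
  "adjoint_op A = {(f, g). \<forall>(h, k) \<in> A. cinner_l2 k f = cinner_l2 h g}"

text \<open>\<open>A = A\<^sup>*\<close> makes \<open>A\<close> a linear relation, and density of the domain
  makes it single-valued.\<close>

definition self_adjoint :: "'a::euclidean_space l2_op \<Rightarrow> bool" where
  "self_adjoint A \<longleftrightarrow> closure (Domain A) = UNIV \<and> adjoint_op A = A"

definition perturb :: "'a::euclidean_space l2_op \<Rightarrow> ('a \<Rightarrow> real) \<Rightarrow> 'a l2_op" where
  "perturb A q = {(f, g + mult_l2 q f) | f g. (f, g) \<in> A}"

definition resolvent :: "'a::euclidean_space l2_op \<Rightarrow> complex \<Rightarrow> 'a l2 \<Rightarrow> 'a l2" where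
  "resolvent A z f = (THE u. (u, f + scaleC_l2 z u) \<in> A)"

definition resolvent_set :: "'a::euclidean_space l2_op \<Rightarrow> complex set" where
  "resolvent_set A =
     {z. (\<forall>f. \<exists>!u. (u, f + scaleC_l2 z u) \<in> A) \<and> bounded_linear (resolvent A z)}"

definition norm_resolvent_convergent ::
  "('b \<Rightarrow> 'a::euclidean_space l2_op) \<Rightarrow> 'a l2_op \<Rightarrow> 'b filter \<Rightarrow> bool" where
  "norm_resolvent_convergent H A F \<longleftrightarrow>
     (\<forall>z. Im z \<noteq> 0 \<longrightarrow>
        z \<in> resolvent_set A \<and> (\<forall>\<^sub>F e in F. z \<in> resolvent_set (H e)) \<and>
        ((\<lambda>e. onorm (\<lambda>f. resolvent (H e) z f - resolvent A z f)) \<longlongrightarrow> 0) F)"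

text \<open>The self-adjoint operator that the first representation theorem associates with a
  densely defined, closed, semibounded form \<open>a\<close> with domain \<open>D\<close>.\<close>

definition form_operator ::
  "'a::euclidean_space l2 set \<Rightarrow> ('a l2 \<Rightarrow> 'a l2 \<Rightarrow> complex) \<Rightarrow> 'a l2_op" where
  "form_operator D a =
     (THE A. self_adjoint A \<and> Domain A \<subseteq> D \<and>
        (\<forall>(f, h) \<in> A. \<forall>g \<in> D. a f g = cinner_l2 h g))"


section \<open>Sobolev spaces\<close>

definition partial_deriv ::
  "'n::finite \<Rightarrow> (real^'n \<Rightarrow> 'b::real_normed_vector) \<Rightarrow> real^'n \<Rightarrow> 'b" where
  "partial_deriv j f x = frechet_derivative f (at x) (axis j 1)"

definition smooth :: "(real^'n::finite \<Rightarrow> complex) \<Rightarrow> bool" where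
  "smooth f \<longleftrightarrow> (\<forall>js x. foldr partial_deriv js f differentiable (at x))"

definition test_function :: "(real^'n::finite \<Rightarrow> complex) \<Rightarrow> bool" where
  "test_function f \<longleftrightarrow> smooth f \<and> compact (closure {x. f x \<noteq> 0})"

definition has_weak_partial ::
  "'n::finite \<Rightarrow> (real^'n) l2 \<Rightarrow> (real^'n) l2 \<Rightarrow> bool" where
  "has_weak_partial j f g \<longleftrightarrow>
     (\<forall>\<phi>. test_function \<phi> \<longrightarrow>
        (LINT x|lebesgue. rep_l2 f x * partial_deriv j \<phi> x) =
        - (LINT x|lebesgue. rep_l2 g x * \<phi> x))"

definition weak_partial :: "'n::finite \<Rightarrow> (real^'n) l2 \<Rightarrow> (real^'n) l2" where
  "weak_partial j f = (THE g. has_weak_partial j f g)"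

primrec sobolev :: "nat \<Rightarrow> (real^'n::finite) l2 set" where
  "sobolev 0 = UNIV"
| "sobolev (Suc k) = {f. \<forall>j. \<exists>g \<in> sobolev k. has_weak_partial j f g}"

definition laplacian :: "(real^'n::finite) l2 \<Rightarrow> (real^'n) l2" where
  "laplacian f = (\<Sum>j\<in>UNIV. weak_partial j (weak_partial j f))"


section \<open>Hausdorff measure and traces\<close>

text \<open>\<open>k\<close>-dimensional Hausdorff measure for \<open>k \<ge> 1\<close>, normalised so that it coincides with
  Lebesgue measure on \<open>k\<close>-dimensional Euclidean space and with the surface measure on
  \<open>k\<close>-dimensional \<open>C\<^sup>1\<close>-submanifolds.\<close>

definition hausdorff_content :: "real \<Rightarrow> nat \<Rightarrow> 'a::metric_space set \<Rightarrow> ennreal" where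
  "hausdorff_content \<delta> k A =
     (INF C \<in> {C :: nat \<Rightarrow> 'a set. A \<subseteq> (\<Union>i. C i) \<and>
                 (\<forall>i. bounded (C i) \<and> diameter (C i) \<le> \<delta>)}.
        \<Sum>i. ennreal (unit_ball_vol (real k) * (diameter (C i) / 2) ^ k))"

definition hausdorff_measure :: "nat \<Rightarrow> 'a::metric_space measure" where
  "hausdorff_measure k =
     measure_of UNIV (sets borel) (\<lambda>A. SUP \<delta>\<in>{0<..}. hausdorff_content \<delta> k A)"

definition surface_measure :: "(real^'n::finite) set \<Rightarrow> (real^'n) measure" where
  "surface_measure S = restrict_space (hausdorff_measure (CARD('n) - 1)) S"

text \<open>The trace operator is the continuous extension to \<open>H\<^sup>1\<close> of the restriction
  of test functions to \<open>S\<close>, with values in \<open>L\<^sup>2\<close> of the surface measure; \<open>sobolev_trace\<close> picks a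
  representative, which is unique up to null sets.\<close>

definition has_trace ::
  "(real^'n::finite) set \<Rightarrow> (real^'n) l2 \<Rightarrow> (real^'n \<Rightarrow> complex) \<Rightarrow> bool" where
  "has_trace S f g \<longleftrightarrow> square_integrable (surface_measure S) g \<and>
     (\<exists>\<phi>. (\<forall>k. test_function (\<phi> k) \<and> square_integrable (surface_measure S) (\<phi> k)) \<and>
        (\<lambda>k. abs_l2 (\<phi> k)) \<longlonglongrightarrow> f \<and>
        (\<forall>j. (\<lambda>k. abs_l2 (partial_deriv j (\<phi> k))) \<longlonglongrightarrow> weak_partial j f) \<and>
        (\<lambda>k. LINT x|surface_measure S. (cmod (\<phi> k x - g x))\<^sup>2) \<longlonglongrightarrow> 0)"

definition sobolev_trace ::
  "(real^'n::finite) set \<Rightarrow> (real^'n) l2 \<Rightarrow> real^'n \<Rightarrow> complex" where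
  "sobolev_trace S f = (SOME g. has_trace S f g)"


section \<open>Admissible hypersurfaces\<close>

definition C2_on :: "('a::real_normed_vector \<Rightarrow> 'b::real_normed_vector) \<Rightarrow> 'a set \<Rightarrow> bool" where
  "C2_on f U \<longleftrightarrow>
     (\<exists>(f' :: 'a \<Rightarrow> 'a \<Rightarrow>\<^sub>L 'b) (f'' :: 'a \<Rightarrow> 'a \<Rightarrow>\<^sub>L 'a \<Rightarrow>\<^sub>L 'b).
        (\<forall>u\<in>U. (f has_derivative blinfun_apply (f' u)) (at u)) \<and>
        (\<forall>u\<in>U. (f' has_derivative blinfun_apply (f'' u)) (at u)) \<and>
        continuous_on U f'')"

text \<open>In what follows \<open>'n\<close> indexes the coordinates of the ambient space and \<open>'m\<close> those of the
  parameter domains, with \<open>CARD('m) = CARD('n) - 1\<close>.\<close>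

definition C2_hypersurface ::
  "'i set \<Rightarrow> ('i \<Rightarrow> real^'m::finite \<Rightarrow> real^'n::finite) \<Rightarrow> ('i \<Rightarrow> (real^'m) set) \<Rightarrow>
   ('i \<Rightarrow> (real^'n) set) \<Rightarrow> (real^'n) set \<Rightarrow> bool" where
  "C2_hypersurface I \<phi> U V S \<longleftrightarrow>
     CARD('m) = CARD('n) - 1 \<and> finite I \<and>
     (\<forall>i\<in>I. open (U i) \<and> open (V i) \<and> C2_on (\<phi> i) (U i)) \<and>
     (\<forall>i\<in>I. \<forall>u\<in>U i. rank (matrix (frechet_derivative (\<phi> i) (at u))) = CARD('n) - 1) \<and>
     (\<forall>i\<in>I. \<exists>\<psi>. homeomorphism (U i) (V i \<inter> S) (\<phi> i) \<psi>) \<and>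
     S \<subseteq> (\<Union>i\<in>I. V i) \<and>
     (\<exists>C>0. \<forall>i\<in>I. \<forall>u\<in>U i. \<forall>v\<in>U i. norm (\<phi> i u - \<phi> i v) \<le> C * norm (u - v))"

definition tangent_space ::
  "(real^'m::finite \<Rightarrow> real^'n::finite) \<Rightarrow> real^'m \<Rightarrow> (real^'n) set" where
  "tangent_space \<phi> u = span (range (\<lambda>j. partial_deriv j \<phi> u))"

definition unit_normal_field ::
  "'i set \<Rightarrow> ('i \<Rightarrow> real^'m::finite \<Rightarrow> real^'n::finite) \<Rightarrow> ('i \<Rightarrow> (real^'m) set) \<Rightarrow>
   (real^'n) set \<Rightarrow> (real^'n \<Rightarrow> real^'n) \<Rightarrow> bool" where
  "unit_normal_field I \<phi> U S \<nu> \<longleftrightarrow>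
     continuous_on S \<nu> \<and> (\<forall>x\<in>S. norm (\<nu> x) = 1) \<and>
     (\<forall>i\<in>I. \<forall>u\<in>U i. \<forall>y\<in>tangent_space (\<phi> i) u. \<nu> (\<phi> i u) \<bullet> y = 0)"

text \<open>Only the restriction of the Weingarten map to the tangent space is determined by this
  condition, and only that restriction is used.\<close>

definition weingarten ::
  "(real^'m::finite \<Rightarrow> real^'n::finite) \<Rightarrow> (real^'n \<Rightarrow> real^'n) \<Rightarrow> real^'m \<Rightarrow>
   real^'n \<Rightarrow> real^'n" where
  "weingarten \<phi> \<nu> u =
     (SOME W. linear W \<and>
        (\<forall>j. W (partial_deriv j \<phi> u) = - partial_deriv j (\<lambda>w. \<nu> (\<phi> w)) u))"

text \<open>The determinant of the restriction of \<open>L\<close> to an invariant subspace \<open>T\<close>: the Leibniz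
  formula for the matrix of \<open>L\<close> with respect to a basis \<open>B\<close> of \<open>T\<close>.\<close>

definition det_on :: "'a::euclidean_space set \<Rightarrow> ('a \<Rightarrow> 'a) \<Rightarrow> real" where
  "det_on T L =
     (let B = (SOME B. independent B \<and> span B = T)
      in \<Sum>p | p permutes B. of_int (sign p) * (\<Prod>b\<in>B. representation B (L b) (p b)))"

definition normal_shift :: "('a::real_vector \<Rightarrow> 'a) \<Rightarrow> 'a \<times> real \<Rightarrow> 'a" where
  "normal_shift \<nu> = (\<lambda>(x, t). x + t *\<^sub>R \<nu> x)"

definition admissible ::
  "'i set \<Rightarrow> ('i \<Rightarrow> real^'m::finite \<Rightarrow> real^'n::finite) \<Rightarrow> ('i \<Rightarrow> (real^'m) set) \<Rightarrow>
   ('i \<Rightarrow> (real^'n) set) \<Rightarrow> (real^'n) set \<Rightarrow> (real^'n \<Rightarrow> real^'n) \<Rightarrow> real \<Rightarrow> bool" where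
  "admissible I \<phi> U V S \<nu> \<beta> \<longleftrightarrow>
     0 < \<beta> \<and> C2_hypersurface I \<phi> U V S \<and> unit_normal_field I \<phi> U S \<nu> \<and>
     inj_on (normal_shift \<nu>) (S \<times> {-\<beta><..<\<beta>}) \<and>
     (\<exists>\<eta>. 0 < \<eta> \<and> \<eta> < 1 \<and>
        (\<forall>i\<in>I. \<forall>u\<in>U i. \<forall>t\<in>{-\<beta><..<\<beta>}.
           det_on (tangent_space (\<phi> i) u) (\<lambda>y. y - t *\<^sub>R weingarten (\<phi> i) \<nu> u y)
             \<in> {1 - \<eta><..<1 + \<eta>})) \<and>
     (\<exists>c>0. \<forall>i\<in>I. \<forall>u\<in>U i. \<forall>v\<in>U i. \<forall>s\<in>{-\<beta><..<\<beta>}. \<forall>t\<in>{-\<beta><..<\<beta>}.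
        (norm (normal_shift \<nu> (\<phi> i u, t) - normal_shift \<nu> (\<phi> i v, s)))\<^sup>2
          \<ge> c\<^sup>2 * ((norm (u - v))\<^sup>2 + \<bar>s - t\<bar>\<^sup>2))"

definition layer :: "'a::real_vector set \<Rightarrow> ('a \<Rightarrow> 'a) \<Rightarrow> real \<Rightarrow> 'a set" where
  "layer S \<nu> \<epsilon> = normal_shift \<nu> ` (S \<times> {-\<epsilon><..<\<epsilon>})"


section \<open>The Schroedinger operators\<close>

definition scaled_potential ::
  "'a::real_vector set \<Rightarrow> ('a \<Rightarrow> 'a) \<Rightarrow> real \<Rightarrow> ('a \<Rightarrow> real) \<Rightarrow> real \<Rightarrow> 'a \<Rightarrow> real" where
  "scaled_potential S \<nu> \<beta> V \<epsilon> x =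
     (if x \<in> layer S \<nu> \<epsilon>
      then (let (y, t) = inv_into (S \<times> {-\<epsilon><..<\<epsilon>}) (normal_shift \<nu>) x
            in \<beta> / \<epsilon> * V (normal_shift \<nu> (y, \<beta> / \<epsilon> * t)))
      else 0)"

definition schroedinger :: "(real^'n::finite \<Rightarrow> real) \<Rightarrow> (real^'n) l2_op" where
  "schroedinger V = {(f, - laplacian f - mult_l2 V f) | f. f \<in> sobolev 2}"

definition delta_form ::
  "(real^'n::finite) set \<Rightarrow> (real^'n \<Rightarrow> real) \<Rightarrow> (real^'n) l2 \<Rightarrow> (real^'n) l2 \<Rightarrow> complex" where
  "delta_form S \<alpha> f g =
     (\<Sum>j\<in>UNIV. cinner_l2 (weak_partial j f) (weak_partial j g)) -
     (LINT x|surface_measure S.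
        complex_of_real (\<alpha> x) * sobolev_trace S f x * cnj (sobolev_trace S g x))"

definition delta_operator ::
  "(real^'n::finite) set \<Rightarrow> (real^'n \<Rightarrow> real) \<Rightarrow> (real^'n) l2_op" where
  "delta_operator S \<alpha> = form_operator (sobolev 1) (delta_form S \<alpha>)"

end

theory Submission
 imports Defs
begin

text \<open>The two operators belong to forms \<open>grad_form f g - b f g\<close> on \<open>H1\<close> whose perturbations satisfy
 \<open>|b f g| \<le> K * interp_norm f * interp_norm g\<close> with \<open>(interp_norm f)\<^sup>2 = norm f * sqrt (h1_sq f)\<close>. In the coordinates
 \<open>(x, s) \<mapsto> x + (\<epsilon>/\<beta>) s \<nu> x\<close> the potential of \<open>H \<epsilon>\<close> acts, up to a Jacobian factor \<open>1 + O(\<epsilon>)\<close>, as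
 \<open>\<integral> V f\<^sub>\<epsilon> (cnj g\<^sub>\<epsilon>)\<close> with \<open>f\<^sub>\<epsilon> (x, s) = f (x + (\<epsilon>/\<beta>) s \<nu> x)\<close>, and the delta interaction is the case \<open>\<epsilon> = 0\<close>. Hence
 the difference of the resolvents is controlled by \<open>D u = \<parallel>u\<^sub>\<epsilon> - u\<^sub>0\<parallel>\<close> for \<open>u\<close> in their ranges, where \<open>D u\<close> is bounded by
 \<open>interp_norm u\<close> and by \<open>\<epsilon>\<close> times the sum of the \<open>interp_norm (\<partial>\<^sub>j u)\<close>. Decomposing \<open>u\<close> dyadically in frequency gives
 \<open>|ln \<epsilon>|\<close> pieces that contribute \<open>O(\<epsilon>)\<close> each. The Jacobian bound compares the Hausdorff measure of nearly flat pieces of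
 the surface with Lebesgue measure, for which the isodiametric inequality is needed.\<close>

text \<open>The logarithm is the price of an endpoint. \<open>interp_norm\<close> plays the role of
  a Besov norm of order 1/2 with summation over frequencies. Both forms are bounded by it, so
  elements in the ranges of the resolvents have regularity 3/2 only with a supremum over
  frequencies, whereas the O(\<epsilon>) bound for \<open>D\<close> asks for regularity 3/2 with a
  sum. About |ln \<epsilon>| frequencies matter, hence the factor. The resolvents are compared by
  duality: their difference is tested against itself, which puts an element of one range into each
  slot of the difference of the forms, so that neither slot has to lie in H2. Surface measure is
  built from diameters of covering sets, so distances and not Jacobian determinants are the natural
  data: a chart with Lipschitz constants 1 + O(\<epsilon>) in both directions changes all measures
  by factors 1 + O(\<epsilon>), provided that the Hausdorff measure in full dimension equals
  Lebesgue measure with constant exactly 1. Such charts exist because the normal, although only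
  continuous by assumption, turns out to be strictly differentiable with a derivative bounded by 1 /
  \<beta>.\<close>

abbreviation wD where "wD \<equiv> weak_partial"
abbreviation pD where "pD \<equiv> partial_deriv"
notation LIMSEQ (infix "---->" 60)
abbreviation "lborel_Pi I \<equiv> Pi\<^sub>M I (%_. lborel :: real measure)"

section \<open>The isodiametric inequality\<close>

text \<open>Squared Euclidean distance for coordinate functions; points are kept as functions on an
  index set so that Fubini can single out one coordinate.\<close>

definition fdist2 :: "'i set => ('i => real) => ('i => real) => real" where
 "fdist2 I x y = (\<Sum>i\<in>I. (x i - y i)^2)"

text \<open>Steiner symmetrisation in coordinate \<open>i\<close>: the section of \<open>K\<close>
  along every line in direction \<open>i\<close> is replaced by the centred open interval of the
  same length. Null sections disappear because the inequality is strict.\<close>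

definition steiner :: "'i set => 'i => ('i => real) set => ('i => real) set" where
 "steiner I i K = {x \<in> space (lborel_Pi I).
   ennreal (2 * \<bar>x i\<bar>) < emeasure lborel {s. x(i := s) \<in> K}}"

lemma emeasure_real_interval_symmetric:
 "emeasure lborel {s::real. ennreal (2 * \<bar>s\<bar>) < m} = m"
proof (cases m)
 case (real r)
 have "{s::real. ennreal (2 * \<bar>s\<bar>) < m} = {- r / 2 <..< r / 2}"
  using real by (auto simp: ennreal_less_iff abs_less_iff)
 thus ?thesis using real by (cases "r = 0") auto
next
 case top
 thus ?thesis by simp
qed

lemma emeasure_real_le_of_diam:
 fixes A :: "real set"
 assumes "A ~= {}" "bdd_above A" "bdd_below A"
 shows "emeasure lborel A <= ennreal (Sup A - Inf A)"
proof -
 have "A \<subseteq> {Inf A..Sup A}" using assms by (auto intro: cInf_lower cSup_upper)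
 hence "emeasure lborel A <= emeasure lborel {Inf A..Sup A}"
  by (intro emeasure_mono) auto
 moreover have "Inf A <= Sup A" using assms by (meson cInf_le_cSup)
 ultimately show ?thesis by simp
qed

lemma steiner_measurable_slice:
 assumes I: "finite I" "i \<in> I" and K: "K \<in> sets (lborel_Pi I)"
 shows "(%x. emeasure lborel {s. x(i := s) \<in> K}) \<in> borel_measurable (Pi\<^sub>M (I - {i}) (%_. lborel))"
  and "(%x. emeasure lborel {s. x(i := s) \<in> K}) \<in> borel_measurable (lborel_Pi I)"
  and "!!x. x \<in> space (Pi\<^sub>M (I - {i}) (%_. lborel :: real measure)) ==> {s. x(i := s) \<in> K} \<in> sets lborel"
proof -
 define J where "J = I - {i}"
 have IJ: "I = insert i J" using I by (auto simp: J_def)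
 have m: "(%(f, y). f(i := y)) \<in> measurable (lborel_Pi J \<Otimes>\<^sub>M lborel) (lborel_Pi I)"
  using measurable_add_dim[of i J "%_. lborel"] unfolding IJ by simp
 let ?Q = "(%(f, y). f(i := y)) -` K \<inter> space (lborel_Pi J \<Otimes>\<^sub>M lborel)"
 have Q: "?Q \<in> sets (lborel_Pi J \<Otimes>\<^sub>M lborel)"
  using measurable_sets[OF m K] .
 have eq: "Pair x -` ?Q = {s. x(i := s) \<in> K}" if "x \<in> space (lborel_Pi J)" for x
  using that by (auto simp: space_pair_measure)
 have "(%x. emeasure lborel (Pair x -` ?Q)) \<in> borel_measurable (lborel_Pi J)"
  by (rule lborel.measurable_emeasure_Pair[OF Q])
 thus 1: "(%x. emeasure lborel {s. x(i := s) \<in> K}) \<in> borel_measurable (Pi\<^sub>M (I - {i}) (%_. lborel))"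
  unfolding J_def[symmetric] by (subst (asm) measurable_cong[OF arg_cong[where f="emeasure lborel"], OF eq]) auto
 have r: "(%x. restrict x J) \<in> measurable (lborel_Pi I) (lborel_Pi J)"
  by (rule measurable_restrict_subset) (auto simp: IJ)
 have "(%x. emeasure lborel {s. (restrict x J)(i := s) \<in> K}) \<in> borel_measurable (lborel_Pi I)"
  using measurable_compose[OF r 1[folded J_def]] by simp
 moreover have "(restrict x J)(i := s) = x(i := s)" if "x \<in> space (lborel_Pi I)" for x s
  using that by (auto simp: IJ space_PiM PiE_def extensional_def restrict_def fun_eq_iff)
 ultimately show "(%x. emeasure lborel {s. x(i := s) \<in> K}) \<in> borel_measurable (lborel_Pi I)"
  by (subst measurable_cong[where g="%x. emeasure lborel {s. (restrict x J)(i := s) \<in> K}"]) auto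
 show "{s. x(i := s) \<in> K} \<in> sets lborel" if x: "x \<in> space (Pi\<^sub>M (I - {i}) (%_. lborel :: real measure))" for x
  using sets_Pair1[OF Q, of x] eq[of x] x by (auto simp: J_def)
qed

lemma steiner_sets:
 assumes I: "finite I" "i \<in> I" and K: "K \<in> sets (lborel_Pi I)"
 shows "steiner I i K \<in> sets (lborel_Pi I)"
proof -
 note [measurable] = steiner_measurable_slice(2)[OF assms]
 have [measurable]: "(%x. x i) \<in> borel_measurable (lborel_Pi I)"
  using measurable_component_singleton[OF I(2), of "%_. lborel :: real measure"] by simp
 show ?thesis unfolding steiner_def by measurable
qed

text \<open>By Fubini it suffices that every section in direction \<open>i\<close> keeps its
  length.\<close>

lemma steiner_emeasure:
 assumes I: "finite I" "i \<in> I" and K: "K \<in> sets (lborel_Pi I)"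
 shows "emeasure (lborel_Pi I) (steiner I i K) = emeasure (lborel_Pi I) K"
proof -
 interpret product_sigma_finite "%_. lborel :: real measure" by standard
 define J where "J = I - {i}"
 have IJ: "I = insert i J" "i \<notin> J" "finite J" using I by (auto simp: J_def)
 have *: "emeasure (lborel_Pi I) B = (\<integral>\<^sup>+x. emeasure lborel {s. x(i := s) \<in> B} \<partial>lborel_Pi J)"
  if B: "B \<in> sets (lborel_Pi I)" for B
 proof -
  have "emeasure (lborel_Pi I) B = (\<integral>\<^sup>+x. indicator B x \<partial>lborel_Pi I)" using B by simp
  also have "... = (\<integral>\<^sup>+x. (\<integral>\<^sup>+s. indicator B (x(i := s)) \<partial>lborel) \<partial>lborel_Pi J)"
   unfolding IJ(1) by (rule product_nn_integral_insert) (use IJ B in auto)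
  also have "... = (\<integral>\<^sup>+x. emeasure lborel {s. x(i := s) \<in> B} \<partial>lborel_Pi J)"
  proof (rule nn_integral_cong)
   fix x assume "x \<in> space (lborel_Pi J)"
   hence "{s. x(i := s) \<in> B} \<in> sets lborel"
    using steiner_measurable_slice(3)[OF I B] by (auto simp: J_def)
   hence "emeasure lborel {s. x(i := s) \<in> B} = (\<integral>\<^sup>+s. indicator {s. x(i := s) \<in> B} s \<partial>lborel)"
    by simp
   also have "... = (\<integral>\<^sup>+s. indicator B (x(i := s)) \<partial>lborel)"
    by (intro nn_integral_cong) (auto simp: indicator_def)
   finally show "(\<integral>\<^sup>+s. indicator B (x(i := s)) \<partial>lborel) = emeasure lborel {s. x(i := s) \<in> B}" by simp
  qed
  finally show ?thesis .
 qed
 have "{s. x(i := s) \<in> steiner I i K} = {s. ennreal (2 * \<bar>s\<bar>) < emeasure lborel {s. x(i := s) \<in> K}}"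
  if "x \<in> space (lborel_Pi J)" for x
  using that by (auto simp: steiner_def IJ(1) space_PiM PiE_def extensional_def)
 thus ?thesis
  unfolding *[OF steiner_sets[OF assms]] *[OF K]
  by (intro nn_integral_cong) (simp add: emeasure_real_interval_symmetric)
qed

text \<open>Only coordinate \<open>i\<close> changes, so one needs points of the two sections
  \<open>A\<close> and \<open>B\<close> at least |x i - y i| apart. Otherwise Sup A - Inf B and Sup
  B - Inf A are at most |x i - y i|, and adding them bounds the sum of the lengths by 2 |x i - y i|,
  although the lengths exceed 2 |x i| and 2 |y i|.\<close>

lemma steiner_diam:
 assumes I: "finite I" "i \<in> I"
  and d: "!!x y. x \<in> K ==> y \<in> K ==> fdist2 I x y <= D"
  and xy: "x \<in> steiner I i K" "y \<in> steiner I i K"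
 shows "fdist2 I x y <= D"
proof -
 define A where "A = {s. x(i := s) \<in> K}"
 define B where "B = {s. y(i := s) \<in> K}"
 have mA: "ennreal (2 * \<bar>x i\<bar>) < emeasure lborel A" and mB: "ennreal (2 * \<bar>y i\<bar>) < emeasure lborel B"
  using xy by (auto simp: steiner_def A_def B_def)
 have ne: "A ~= {}" "B ~= {}" using mA mB by auto
 have "\<exists>s\<in>A. \<exists>r\<in>B. \<bar>x i - y i\<bar> <= \<bar>s - r\<bar>"
 proof (rule ccontr)
  assume "\<not> ?thesis"
  hence less: "\<bar>s - r\<bar> < \<bar>x i - y i\<bar>" if "s \<in> A" "r \<in> B" for s r using that by force
  obtain a0 b0 where ab: "a0 \<in> A" "b0 \<in> B" using ne by auto
  define d where "d = \<bar>x i - y i\<bar>"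
  have bA: "bdd_above A" "bdd_below A"
   using less[OF _ ab(2)] by (auto intro!: bdd_aboveI[of _ "b0 + d"] bdd_belowI[of _ "b0 - d"] simp: d_def)
    (smt (verit) abs_less_iff)+
  have bB: "bdd_above B" "bdd_below B"
   using less[OF ab(1)] by (auto intro!: bdd_aboveI[of _ "a0 + d"] bdd_belowI[of _ "a0 - d"] simp: d_def)
    (smt (verit) abs_less_iff)+
  have "Sup A <= Inf B + d"
  proof (rule cSup_least[OF ne(1)])
   fix s assume s: "s \<in> A"
   have "s - d <= Inf B" by (rule cInf_greatest[OF ne(2)]) (use less[OF s] in \<open>fastforce simp: d_def\<close>)
   thus "s <= Inf B + d" by simp
  qed
  moreover have "Sup B <= Inf A + d"
  proof (rule cSup_least[OF ne(2)])
   fix r assume r: "r \<in> B"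
   have "r - d <= Inf A" by (rule cInf_greatest[OF ne(1)]) (use less[OF _ r] in \<open>fastforce simp: d_def\<close>)
   thus "r <= Inf A + d" by simp
  qed
  moreover have "2 * \<bar>x i\<bar> < Sup A - Inf A"
   using mA emeasure_real_le_of_diam[OF ne(1) bA] by (smt (verit) ennreal_less_iff order.strict_trans2 abs_ge_zero)
  moreover have "2 * \<bar>y i\<bar> < Sup B - Inf B"
   using mB emeasure_real_le_of_diam[OF ne(2) bB] by (smt (verit) ennreal_less_iff order.strict_trans2 abs_ge_zero)
  ultimately show False unfolding d_def by linarith
 qed
 then obtain s r where sr: "s \<in> A" "r \<in> B" "\<bar>x i - y i\<bar> <= \<bar>s - r\<bar>" by blast
 have split: "fdist2 I u v = (u i - v i)^2 + (\<Sum>j\<in>I-{i}. (u j - v j)^2)" for u v :: "'a => real"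
  unfolding fdist2_def using I by (rule sum.remove)
 have "fdist2 I x y <= fdist2 I (x(i := s)) (y(i := r))"
  unfolding split using sr(3) by (simp add: abs_le_square_iff)
 also have "... <= D" using d sr by (auto simp: A_def B_def)
 finally show ?thesis .
qed

lemma steiner_reflect:
 assumes "i \<in> I" "x \<in> steiner I i K"
 shows "x(i := - x i) \<in> steiner I i K"
 using assms by (auto simp: steiner_def space_PiM PiE_def extensional_def)

text \<open>Reflection symmetries gained in earlier coordinates survive later symmetrisations,
  because reflected lines have the same sections.\<close>

lemma steiner_reflect_other:
 assumes "i \<in> I" "j \<in> I" "i ~= j" and sym: "!!x. x \<in> K ==> x(j := - x j) \<in> K"
  and x: "x \<in> steiner I i K"
 shows "x(j := - x j) \<in> steiner I i K"
proof -
 have "x(j := - x j, i := s) \<in> K \<longleftrightarrow> x(i := s) \<in> K" for s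
  using sym[of "x(i := s)"] sym[of "x(j := - x j, i := s)"] assms(3)
  by (auto simp: fun_upd_twist[of j i]) (metis fun_upd_triv fun_upd_upd fun_upd_twist)
 thus ?thesis using assms by (auto simp: steiner_def space_PiM PiE_def extensional_def)
qed

text \<open>After symmetrisation in every coordinate the set contains with \<open>x\<close> also the
  point with all signs changed; their distance 2 |x| is at most \<open>D\<close>, so the set lies in
  the ball of radius D / 2.\<close>

lemma isodiametric_PiM:
 assumes I: "finite I" and K: "K \<in> sets (lborel_Pi I)"
  and d: "!!x y. x \<in> K ==> y \<in> K ==> fdist2 I x y <= D^2" and D: "0 < D"
 shows "emeasure (lborel_Pi I) K <= ennreal (unit_ball_vol (real (card I)) * (D / 2) ^ card I)"
proof -
 have "\<exists>K'. K' \<in> sets (lborel_Pi I) \<and>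
   emeasure (lborel_Pi I) K' = emeasure (lborel_Pi I) K \<and>
   (\<forall>x\<in>K'. \<forall>y\<in>K'. fdist2 I x y <= D^2) \<and> (\<forall>x\<in>K'. \<forall>j\<in>J. x(j := - x j) \<in> K')"
  if "finite J" "J \<subseteq> I" for J
  using that
 proof (induction J)
  case empty
  thus ?case using K d by auto
 next
  case (insert i J)
  then obtain K' where K': "K' \<in> sets (lborel_Pi I)"
   "emeasure (lborel_Pi I) K' = emeasure (lborel_Pi I) K"
   "\<forall>x\<in>K'. \<forall>y\<in>K'. fdist2 I x y <= D^2" "\<forall>x\<in>K'. \<forall>j\<in>J. x(j := - x j) \<in> K'" by blast
  have i: "i \<in> I" using insert by auto
  show ?case
  proof (intro exI[of _ "steiner I i K'"] conjI ballI)
   show "steiner I i K' \<in> sets (lborel_Pi I)" using steiner_sets I i K'(1) .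
   show "emeasure (lborel_Pi I) (steiner I i K') = emeasure (lborel_Pi I) K"
    using steiner_emeasure[OF I i K'(1)] K'(2) by simp
   show "fdist2 I x y <= D^2" if "x \<in> steiner I i K'" "y \<in> steiner I i K'" for x y
    by (rule steiner_diam[OF I i _ that]) (use K'(3) in auto)
   show "x(j := - x j) \<in> steiner I i K'" if "x \<in> steiner I i K'" "j \<in> insert i J" for x j
    using that steiner_reflect[OF i] steiner_reflect_other[OF i _ _ _ that(1), of j] insert K'(4) by (cases "j = i") auto
  qed
 qed
 from this[OF I order.refl] obtain K' where K': "K' \<in> sets (lborel_Pi I)"
   "emeasure (lborel_Pi I) K' = emeasure (lborel_Pi I) K"
   "\<forall>x\<in>K'. \<forall>y\<in>K'. fdist2 I x y <= D^2" "\<forall>x\<in>K'. \<forall>j\<in>I. x(j := - x j) \<in> K'" by auto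
 have ref: "(%i. if i \<in> J then - x i else x i) \<in> K'" if "finite J" "J \<subseteq> I" "x \<in> K'" for x J
  using that
 proof (induction J)
  case (insert j J)
  hence "(%i. if i \<in> J then - x i else x i) \<in> K'" by auto
  hence "(%i. if i \<in> J then - x i else x i)(j := - (%i. if i \<in> J then - x i else x i) j) \<in> K'"
   using K'(4) insert by blast
  also have "(%i. if i \<in> J then - x i else x i)(j := - (%i. if i \<in> J then - x i else x i) j) = (%i. if i \<in> insert j J then - x i else x i)"
   using insert by (auto simp: fun_eq_iff)
  finally show ?case .
 qed simp
 have "K' \<subseteq> {f. sqrt (\<Sum>i\<in>I. (f i)^2) <= D / 2} \<inter> space (lborel_Pi I)"
 proof
  fix x assume x: "x \<in> K'"
  have "fdist2 I x (%i. if i \<in> I then - x i else x i) <= D^2"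
   using K'(3) x ref[OF I order.refl x] by auto
  hence "4 * (\<Sum>i\<in>I. (x i)^2) <= D^2"
   by (simp add: fdist2_def power2_eq_square sum_distrib_left algebra_simps)
  hence "(\<Sum>i\<in>I. (x i)^2) <= (D / 2)^2" by (simp add: power_divide)
  hence "sqrt (\<Sum>i\<in>I. (x i)^2) <= D / 2" using D by (meson half_gt_zero less_eq_real_def real_le_lsqrt sum_nonneg zero_le_power2)
  thus "x \<in> {f. sqrt (\<Sum>i\<in>I. (f i)^2) <= D / 2} \<inter> space (lborel_Pi I)"
   using sets.sets_into_space[OF K'(1)] x by auto
 qed
 moreover have "{f. sqrt (\<Sum>i\<in>I. (f i)^2) <= D / 2} \<inter> space (lborel_Pi I) \<in> sets (lborel_Pi I)"
 proof -
  have "(%f. sqrt (\<Sum>i\<in>I. (f i)^2)) \<in> borel_measurable (lborel_Pi I)"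
   by measurable
  hence "{f\<in>space (lborel_Pi I). sqrt (\<Sum>i\<in>I. (f i)^2) <= D / 2} \<in> sets (lborel_Pi I)"
   by measurable
  thus ?thesis by (simp add: Collect_conj_eq Int_commute)
 qed
 ultimately have "emeasure (lborel_Pi I) K' <= emeasure (lborel_Pi I) ({f. sqrt (\<Sum>i\<in>I. (f i)^2) <= D / 2} \<inter> space (lborel_Pi I))"
  by (rule emeasure_mono)
 thus ?thesis unfolding K'(2) using emeasure_cball_aux[OF I, of "D / 2"] D by simp
qed

lemma isodiametric:
 fixes K :: "'a::euclidean_space set"
 assumes K: "K \<in> sets borel" "bounded K"
 shows "emeasure lborel K <= ennreal (unit_ball_vol (real DIM('a)) * (diameter K / 2) ^ DIM('a))"
proof -
 let ?g = "%f. \<Sum>b\<in>Basis. f b *\<^sub>R b :: 'a"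
 have g[measurable]: "?g \<in> borel_measurable (lborel_Pi Basis)" by measurable
 define K' where "K' = ?g -` K \<inter> space (lborel_Pi Basis)"
 have K': "K' \<in> sets (lborel_Pi Basis)"
  unfolding K'_def using measurable_sets[OF g K(1)] .
 have e: "emeasure lborel K = emeasure (lborel_Pi Basis) K'"
  unfolding K'_def by (subst lborel_eq, subst emeasure_distr) (use K in auto)
 have dist: "fdist2 Basis x y = (dist (?g x) (?g y))^2" for x y
  by (subst euclidean_dist_l2) (simp add: L2_set_def fdist2_def dist_real_def sum_nonneg)
 have *: "emeasure lborel K <= ennreal (unit_ball_vol (real DIM('a)) * (D / 2) ^ DIM('a))" if "D > diameter K" for D
  unfolding e
 proof (rule isodiametric_PiM[OF finite_Basis K'])
  have D0: "0 <= diameter K" using K(2) by (rule diameter_ge_0)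
  thus "0 < D" using that by simp
  fix x y assume "x \<in> K'" "y \<in> K'"
  hence "dist (?g x) (?g y) <= diameter K" using diameter_bounded_bound[OF K(2)] by (auto simp: K'_def)
  thus "fdist2 Basis x y <= D^2" unfolding dist using that by (intro power_mono) auto
 qed
 have "((%D. ennreal (unit_ball_vol (real DIM('a)) * (D / 2) ^ DIM('a))) \<longlongrightarrow> ennreal (unit_ball_vol (real DIM('a)) * (diameter K / 2) ^ DIM('a))) (at_right (diameter K))"
  by (intro tendsto_intros) auto
 thus ?thesis
  by (rule tendsto_lowerbound) (auto intro!: * always_eventually simp: eventually_at_filter)
qed

section \<open>Hausdorff measure\<close>

definition hausdorff_outer :: "nat => 'a::metric_space set => ennreal" where
 "hausdorff_outer k A = (SUP \<delta>\<in>{0<..}. hausdorff_content \<delta> k A)"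

definition ball_gauge :: "nat => 'a::metric_space set => ennreal" where
 "ball_gauge k C = ennreal (unit_ball_vol (real k) * (diameter C / 2) ^ k)"

lemma hausdorff_content_le:
 assumes "A \<subseteq> (\<Union>i. C i)" "!!i::nat. bounded (C i)" "!!i. diameter (C i) <= \<delta>"
 shows "hausdorff_content \<delta> k A <= (\<Sum>i. ball_gauge k (C i))"
 unfolding hausdorff_content_def ball_gauge_def by (rule INF_lower) (use assms in auto)

lemma hausdorff_content_less:
 assumes "hausdorff_content \<delta> k A < x"
 obtains C where "A \<subseteq> (\<Union>i. C i)" "!!i::nat. bounded (C i)" "!!i. diameter (C i) <= \<delta>"
  "(\<Sum>i. ball_gauge k (C i)) < x"
 using assms unfolding hausdorff_content_def ball_gauge_def by (auto simp: INF_less_iff)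

lemma hausdorff_content_greatest:
 assumes "!!C. A \<subseteq> (\<Union>i. C i) ==> (!!i::nat. bounded (C i)) ==> (!!i. diameter (C i) <= \<delta>)
   ==> x <= (\<Sum>i. ball_gauge k (C i))"
 shows "x <= hausdorff_content \<delta> k A"
 unfolding hausdorff_content_def by (rule INF_greatest) (use assms in \<open>auto simp: ball_gauge_def\<close>)

lemma ball_gauge_empty [simp]: "1 <= k ==> ball_gauge k {} = 0"
 by (simp add: ball_gauge_def)

lemma hausdorff_content_mono: "A \<subseteq> B ==> hausdorff_content \<delta> k A <= hausdorff_content \<delta> k B"
 by (rule hausdorff_content_greatest, rule hausdorff_content_le) auto

lemma hausdorff_content_antimono: "\<delta> <= \<delta>' ==> hausdorff_content \<delta>' k A <= hausdorff_content \<delta> k A"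
 by (rule hausdorff_content_greatest, rule hausdorff_content_le) (auto intro: order_trans)

lemma hausdorff_content_empty: "1 <= k ==> 0 <= \<delta> ==> hausdorff_content \<delta> k {} = 0"
 using hausdorff_content_le[of "{}" "%_. {}" \<delta> k] by simp

lemma hausdorff_content_UN:
 "hausdorff_content \<delta> k (\<Union>i::nat. A i) <= (\<Sum>i. hausdorff_content \<delta> k (A i))"
\<comment> \<open>If some content is infinite, no cover has a gauge sum strictly below content plus
  error, so this case is separate.\<close>
proof (cases "\<exists>i. hausdorff_content \<delta> k (A i) = top")
 case True
 then obtain i where i: "hausdorff_content \<delta> k (A i) = top" by blast
 have "(\<Sum>i. hausdorff_content \<delta> k (A i)) \<ge> hausdorff_content \<delta> k (A i)"
  using sum_le_suminf[of "%i. hausdorff_content \<delta> k (A i)" "{i}"] by auto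
 thus ?thesis by (simp add: i top_unique)
next
 case False
 show ?thesis
 proof (rule ennreal_le_epsilon)
  fix e :: real assume e: "0 < e"
  have "\<exists>C. A i \<subseteq> (\<Union>n. C n) \<and> (\<forall>n::nat. bounded (C n) \<and> diameter (C n) <= \<delta>) \<and>
   (\<Sum>n. ball_gauge k (C n)) < hausdorff_content \<delta> k (A i) + ennreal (e * (1/2)^Suc i)" for i
  proof -
   have "hausdorff_content \<delta> k (A i) < hausdorff_content \<delta> k (A i) + ennreal (e * (1/2)^Suc i)"
    using False e by (simp add: less_top)
   from hausdorff_content_less[OF this] show ?thesis by metis
  qed
  then obtain C where C: "!!i. A i \<subseteq> (\<Union>n. C i n)" "!!i n. bounded (C i (n::nat))" "!!i n. diameter (C i n) <= \<delta>"
   "!!i. (\<Sum>n. ball_gauge k (C i n)) < hausdorff_content \<delta> k (A i) + ennreal (e * (1/2)^Suc i)" by metis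
  have "hausdorff_content \<delta> k (\<Union>i. A i) <= (\<Sum>m. ball_gauge k (case prod_decode m of (i, n) => C i n))"
  proof (rule hausdorff_content_le)
   show "(\<Union>i. A i) \<subseteq> (\<Union>m. case prod_decode m of (i, n) => C i n)"
   proof
    fix x assume "x \<in> (\<Union>i. A i)"
    then obtain i n where "x \<in> C i n" using C(1) by blast
    thus "x \<in> (\<Union>m. case prod_decode m of (i, n) => C i n)"
     by (intro UN_I[of "prod_encode (i, n)"]) auto
   qed
  qed (auto split: prod.split intro: C)
  also have "... = (\<Sum>i. \<Sum>n. ball_gauge k (C i n))"
   using suminf_ennreal_2dimen[of "%i. \<Sum>n. ball_gauge k (C i n)" "%p. ball_gauge k (case p of (i, n) => C i n)"]
   by simp
  also have "... <= (\<Sum>i. hausdorff_content \<delta> k (A i) + ennreal (e * (1/2)^Suc i))"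
   by (intro suminf_le summableI less_imp_le C)
  also have "... = (\<Sum>i. hausdorff_content \<delta> k (A i)) + (\<Sum>i. ennreal (e * (1/2)^Suc i))"
   by (rule suminf_add[symmetric]) auto
  also have "(\<Sum>i. ennreal (e * (1/2)^Suc i)) = ennreal e"
  proof (rule suminf_ennreal_eq)
   show "(%i. e * (1/2)^Suc i) sums e"
    using sums_mult[OF power_half_series, of e] by simp
  qed (use e in auto)
  finally show "hausdorff_content \<delta> k (\<Union>i. A i) <= (\<Sum>i. hausdorff_content \<delta> k (A i)) + ennreal e" .
 qed
qed

lemma hausdorff_content_Un:
 assumes "1 <= k" "0 <= \<delta>" shows "hausdorff_content \<delta> k (A \<union> B) <= hausdorff_content \<delta> k A + hausdorff_content \<delta> k B"
proof -
 let ?f = "%i::nat. if i = 0 then A else if i = 1 then B else {}"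
 have "(\<Union>i. ?f i) = A \<union> B" by (auto split: if_splits)
 hence "hausdorff_content \<delta> k (A \<union> B) <= (\<Sum>i. hausdorff_content \<delta> k (?f i))"
  using hausdorff_content_UN[of \<delta> k ?f] by simp
 also have "... = (\<Sum>i\<in>{0,1}. hausdorff_content \<delta> k (?f i))"
  by (rule suminf_finite) (use assms in \<open>auto simp: hausdorff_content_empty\<close>)
 finally show ?thesis by simp
qed

section \<open>The outer measure and Caratheodory's criterion\<close>

lemma hausdorff_content_le_outer: "0 < \<delta> ==> hausdorff_content \<delta> k A <= hausdorff_outer k A"
 unfolding hausdorff_outer_def by (rule SUP_upper) auto

lemma hausdorff_outer_mono: "A \<subseteq> B ==> hausdorff_outer k A <= hausdorff_outer k B"
 unfolding hausdorff_outer_def by (intro SUP_mono) (auto intro: hausdorff_content_mono)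

lemma hausdorff_outer_empty [simp]: "1 <= k ==> hausdorff_outer k {} = 0"
 unfolding hausdorff_outer_def by (simp add: hausdorff_content_empty)

lemma hausdorff_outer_UN: "hausdorff_outer k (\<Union>i::nat. A i) <= (\<Sum>i. hausdorff_outer k (A i))"
 unfolding hausdorff_outer_def[of _ "\<Union>i. A i"]
proof (rule SUP_least)
 fix \<delta> :: real assume "\<delta> \<in> {0<..}"
 thus "hausdorff_content \<delta> k (\<Union>i. A i) <= (\<Sum>i. hausdorff_outer k (A i))"
  by (intro order_trans[OF hausdorff_content_UN] suminf_le) (auto intro: hausdorff_content_le_outer)
qed

lemma hausdorff_outer_Un:
 assumes "1 <= k" shows "hausdorff_outer k (A \<union> B) <= hausdorff_outer k A + hausdorff_outer k B"
 unfolding hausdorff_outer_def[of k "A \<union> B"]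
 by (intro SUP_least order_trans[OF hausdorff_content_Un[OF assms] add_mono] hausdorff_content_le_outer) auto

text \<open>A covering set of diameter below \<open>d\<close> cannot meet both \<open>A\<close> and
  \<open>B\<close>, so a fine cover of the union splits into a cover of each.\<close>

lemma hausdorff_outer_separated:
 assumes k: "1 <= k" and d: "0 < d" "!!x y. x \<in> A ==> y \<in> B ==> d <= dist x y"
 shows "hausdorff_outer k A + hausdorff_outer k B <= hausdorff_outer k (A \<union> B)"
proof -
 have 1: "hausdorff_content \<delta> k A + hausdorff_content \<delta> k B <= hausdorff_content \<delta> k (A \<union> B)"
  if \<delta>: "0 < \<delta>" "\<delta> < d" for \<delta>
 proof (rule hausdorff_content_greatest)
  fix C :: "nat => 'a set"
  assume C: "A \<union> B \<subseteq> (\<Union>i. C i)" "!!i. bounded (C i)" "!!i. diameter (C i) <= \<delta>"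
  define CA where "CA i = (if C i \<inter> A ~= {} then C i else {})" for i
  define CB where "CB i = (if C i \<inter> A = {} then C i else {})" for i
  have "hausdorff_content \<delta> k A <= (\<Sum>i. ball_gauge k (CA i))"
  proof (rule hausdorff_content_le)
   show "A \<subseteq> (\<Union>i. CA i)" using C(1) by (fastforce simp: CA_def)
  qed (use C \<delta> in \<open>auto simp: CA_def\<close>)
  moreover have "hausdorff_content \<delta> k B <= (\<Sum>i. ball_gauge k (CB i))"
  proof (rule hausdorff_content_le)
   show "B \<subseteq> (\<Union>i. CB i)"
   proof
    fix y assume y: "y \<in> B"
    then obtain i where i: "y \<in> C i" using C(1) by blast
    have "C i \<inter> A = {}"
    proof (rule ccontr)
     assume "C i \<inter> A ~= {}"
     then obtain x where "x \<in> C i" "x \<in> A" by blast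
     thus False using diameter_bounded_bound[OF C(2) _ i, of x] d(2)[of x y] y C(3)[of i] \<delta> by simp
    qed
    thus "y \<in> (\<Union>i. CB i)" using i by (auto simp: CB_def intro!: exI[of _ i])
   qed
  qed (use C \<delta> in \<open>auto simp: CB_def\<close>)
  moreover have "(\<Sum>i. ball_gauge k (CA i)) + (\<Sum>i. ball_gauge k (CB i)) = (\<Sum>i. ball_gauge k (C i))"
   by (subst suminf_add) (use k in \<open>auto simp: CA_def CB_def intro!: suminf_cong\<close>)
  ultimately show "hausdorff_content \<delta> k A + hausdorff_content \<delta> k B <= (\<Sum>i. ball_gauge k (C i))"
   by (metis add_mono)
 qed
 \<comment> \<open>The two suprema run over independent scales; by monotonicity both are dominated
   at one common smaller scale below \<open>d\<close>.\<close>
 have 2: "hausdorff_content \<delta> k A + hausdorff_content \<delta>' k B <= hausdorff_outer k (A \<union> B)"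
  if "0 < \<delta>" "0 < \<delta>'" for \<delta> \<delta>'
 proof -
  define e where "e = min (min \<delta> \<delta>') (d/2)"
  have e: "0 < e" "e < d" "e <= \<delta>" "e <= \<delta>'" using that d by (auto simp: e_def)
  have "hausdorff_content \<delta> k A + hausdorff_content \<delta>' k B <= hausdorff_content e k A + hausdorff_content e k B"
   by (intro add_mono hausdorff_content_antimono e)
  also have "... <= hausdorff_content e k (A \<union> B)" by (rule 1[OF e(1,2)])
  also have "... <= hausdorff_outer k (A \<union> B)" by (rule hausdorff_content_le_outer[OF e(1)])
  finally show ?thesis .
 qed
 have ne: "{0::real<..} ~= {}" by (rule greaterThan_non_empty)
 have 3: "hausdorff_content \<delta> k A + hausdorff_outer k B <= hausdorff_outer k (A \<union> B)" if "0 < \<delta>" for \<delta>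
 proof -
  have "hausdorff_content \<delta> k A + hausdorff_outer k B = (SUP \<delta>'\<in>{0<..}. hausdorff_content \<delta> k A + hausdorff_content \<delta>' k B)"
   unfolding hausdorff_outer_def by (rule ennreal_SUP_add_right) auto
  also have "... <= hausdorff_outer k (A \<union> B)" by (intro SUP_least) (auto intro: 2 that)
  finally show ?thesis .
 qed
 have "hausdorff_outer k A + hausdorff_outer k B = (SUP \<delta>\<in>{0<..}. hausdorff_content \<delta> k A + hausdorff_outer k B)"
  unfolding hausdorff_outer_def[of k A] by (rule ennreal_SUP_add_left[symmetric]) auto
 also have "... <= hausdorff_outer k (A \<union> B)" by (intro SUP_least) (auto intro: 3)
 finally show ?thesis .
qed

text \<open>Caratheodory's criterion for a metric outer measure. The part \<open>P n\<close> of
  \<open>A\<close> at distance at least 1 / (n + 1) from \<open>F\<close> is separated from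
  \<open>A \<inter> F\<close>, so the two add up. What \<open>P n\<close> misses of
  \<open>A - F\<close> is a tail of the shells \<open>R j\<close>, and the shells have finite total
  measure because those of equal parity are separated from each other.\<close>

lemma hausdorff_outer_closed:
 fixes A F :: "'a::metric_space set"
 assumes k: "1 <= k" and F: "closed F"
 shows "hausdorff_outer k (A \<inter> F) + hausdorff_outer k (A - F) = hausdorff_outer k A"
proof (rule antisym)
 let ?H = "hausdorff_outer k :: 'a set => ennreal"
 show "?H A <= ?H (A \<inter> F) + ?H (A - F)"
  using hausdorff_outer_Un[OF k, of "A \<inter> F" "A - F"] by (simp add: Un_Diff_Int sup_commute)
 show "?H (A \<inter> F) + ?H (A - F) <= ?H A"
 proof (cases "F = {} \<or> ?H A = top")
  case True
  thus ?thesis using k by (auto simp: top_unique)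
 next
  case False
  hence Fne: "F ~= {}" and fin: "?H A < top" by (auto simp: less_top)
  define P where "P n = {x\<in>A. infdist x F \<ge> 1 / (real n + 1)}" for n
  define R where "R n = P (Suc n) - P n" for n
  have sep: "0 < d ==> (!!x y. x \<in> B ==> y \<in> C ==> infdist x F \<ge> d + e \<and> infdist y F <= e) ==>
    ?H B + ?H C <= ?H (B \<union> C)" for B C d e
  proof (rule hausdorff_outer_separated[OF k, of d])
   fix x y assume a: "!!x y. x \<in> B ==> y \<in> C ==> infdist x F \<ge> d + e \<and> infdist y F <= e" "x \<in> B" "y \<in> C"
   show "d <= dist x y" using a(1)[OF a(2,3)] infdist_triangle[of x F y] by linarith
  qed
  have PF: "?H (A \<inter> F) + ?H (P n) <= ?H A" for n
  proof -
   have "?H (P n) + ?H (A \<inter> F) <= ?H (P n \<union> (A \<inter> F))"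
    by (rule sep[of "1 / (real n + 1)" _ _ 0]) (auto simp: P_def)
   also have "... <= ?H A" by (rule hausdorff_outer_mono) (auto simp: P_def)
   finally show ?thesis by (simp add: add.commute)
  qed
  have Pmono: "P m \<subseteq> P n" if "m <= n" for m n
  proof -
   have "1 / (real n + 1) <= 1 / (real m + 1)" using that by (simp add: field_simps)
   thus ?thesis by (auto simp: P_def)
  qed
  have AF: "A - F \<subseteq> P n \<union> (\<Union>i. R (i + n))" for n
  proof
   fix x assume x: "x \<in> A - F"
   hence "infdist x F ~= 0" using in_closed_iff_infdist_zero[OF F Fne, of x] by simp
   hence "0 < infdist x F" using infdist_nonneg[of x F] by linarith
   then obtain m where "1 / real (Suc m) < infdist x F" by (rule nat_approx_posE)
   hence "1 / (real m + 1) < infdist x F" by (simp add: add.commute)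
   hence ex: "\<exists>m. x \<in> P m" using x by (auto simp: P_def intro!: exI[of _ m])
   show "x \<in> P n \<union> (\<Union>i. R (i + n))"
   proof (cases "x \<in> P n")
    case False
    define l where "l = (LEAST m. x \<in> P m)"
    have l: "x \<in> P l" unfolding l_def using ex by (rule LeastI_ex)
    have "\<not> l <= n" using False l Pmono[of l n] by blast
    hence j: "l = Suc ((l - Suc n) + n)" by simp
    define j where "j = l - Suc n"
    note j = j[folded j_def]
    have "x \<notin> P (j + n)" using not_less_Least[of "j + n" "%m. x \<in> P m"] j l_def by auto
    hence "x \<in> R (j + n)" using l j by (simp add: R_def)
    thus ?thesis by blast
   qed simp
  qed
  have Rsum: "(\<Sum>j<n. ?H (R (2 * j + p))) <= ?H (\<Union>j<n. R (2 * j + p))" for n p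
  proof (induction n)
   case (Suc n)
   show ?case
   \<comment> \<open>For n = p = 0 the separating distance would contain 1 / 0; the union is empty
     there.\<close>
   proof (cases "n = 0")
   case True thus ?thesis by (simp add: lessThan_Suc)
   next
   case False
   have "(\<Sum>j<Suc n. ?H (R (2 * j + p))) <= ?H (\<Union>j<n. R (2 * j + p)) + ?H (R (2 * n + p))"
    using Suc by (simp add: add_mono)
   also have "... <= ?H ((\<Union>j<n. R (2 * j + p)) \<union> R (2 * n + p))"
   proof (rule sep[of "1 / (real (2 * n + p)) - 1 / (real (2 * n + p) + 1)" _ _ "1 / (real (2 * n + p) + 1)"])
    fix x y assume x: "x \<in> (\<Union>j<n. R (2 * j + p))" and y: "y \<in> R (2 * n + p)"
    then obtain j where j: "j < n" "x \<in> P (Suc (2 * j + p))" by (auto simp: R_def)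
    have "Suc (2 * j + p) <= 2 * n + p - 1" using j(1) by linarith
    hence "x \<in> P (2 * n + p - 1)" using Pmono j(2) by blast
    hence "infdist x F \<ge> 1 / (real (2 * n + p - 1) + 1)" by (simp add: P_def)
    moreover have "real (2 * n + p - 1) + 1 = real (2 * n + p)" using j(1) by simp
    moreover have "infdist y F <= 1 / (real (2 * n + p) + 1)" using y by (auto simp: R_def P_def)
    ultimately show "1 / (real (2 * n + p)) - 1 / (real (2 * n + p) + 1) + 1 / (real (2 * n + p) + 1) <= infdist x F \<and>
     infdist y F <= 1 / (real (2 * n + p) + 1)" by simp
   next
    show "0 < 1 / (real (2 * n + p)) - 1 / (real (2 * n + p) + 1)"
    proof -
     have "0 < q ==> 0 < 1 / q - 1 / (q + 1)" for q :: real by (simp add: divide_strict_left_mono)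
     moreover have "0 < real (2 * n + p)" using False by simp
     ultimately show ?thesis by blast
    qed
   qed
   finally show ?thesis by (simp add: lessThan_Suc Un_commute)
   qed
  qed (use k in auto)
  have Rsum': "(\<Sum>j. ?H (R (2 * j + p))) <= ?H A" for p
  proof (rule suminf_le_const[OF summableI])
   fix n
   have "(\<Union>j<n. R (2 * j + p)) \<subseteq> A" by (auto simp: R_def P_def)
   thus "(\<Sum>j<n. ?H (R (2 * j + p))) <= ?H A"
    by (rule order_trans[OF Rsum hausdorff_outer_mono])
  qed
  have "(\<Sum>j<n. ?H (R j)) <= ?H A + ?H A" for n
  proof -
   have "(\<Sum>j<n. ?H (R j)) <= (\<Sum>j<2*n. ?H (R j))" by (rule sum_mono2) auto
   also have "... = (\<Sum>j<n. ?H (R (2 * j + 0))) + (\<Sum>j<n. ?H (R (2 * j + 1)))"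
    by (induction n) (auto simp: algebra_simps)
   also have "... <= (\<Sum>j. ?H (R (2 * j + 0))) + (\<Sum>j. ?H (R (2 * j + 1)))"
    by (intro add_mono sum_le_suminf) auto
   also have "... <= ?H A + ?H A" by (intro add_mono Rsum')
   finally show ?thesis .
  qed
  hence "(\<Sum>j. ?H (R j)) <= ?H A + ?H A" by (rule suminf_le_const[OF summableI])
  also have "... < top" using fin by simp
  finally have T: "(\<Sum>j. ?H (R j)) ~= top" by simp
  \<comment> \<open>The partial sums are added on both sides, since subtraction is unreliable in the
    extended reals; their finite limit is cancelled once at the end.\<close>
  have "(?H (A \<inter> F) + ?H (A - F)) + (\<Sum>j<n. ?H (R j)) <= ?H A + (\<Sum>j. ?H (R j))" for n
  proof -
   have "?H (A - F) <= ?H (P n) + (\<Sum>j. ?H (R (j + n)))"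
    by (rule order_trans[OF hausdorff_outer_mono[OF AF] order_trans[OF hausdorff_outer_Un[OF k] add_left_mono[OF hausdorff_outer_UN]]])
   hence "(?H (A \<inter> F) + ?H (A - F)) + (\<Sum>j<n. ?H (R j)) <= (?H (A \<inter> F) + ?H (P n)) + (\<Sum>j. ?H (R j))"
    unfolding suminf_offset[OF summableI, where i=n and f="%j. ?H (R j)"] by (simp add: add.assoc add_left_mono add_right_mono)
   thus ?thesis by (rule order_trans) (rule add_right_mono[OF PF])
  qed
  hence "(?H (A \<inter> F) + ?H (A - F)) + (\<Sum>j. ?H (R j)) <= ?H A + (\<Sum>j. ?H (R j))"
   by (intro LIMSEQ_le_const2[OF tendsto_add[OF tendsto_const summable_LIMSEQ[OF summableI]]]) auto
  thus ?thesis using T by (simp add: add.commute[of _ "suminf _"] ennreal_add_left_cancel_le)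
 qed
qed

text \<open>\<open>measure_of\<close> keeps the given set function only if it is a measure on the
  given sets, so without this fact \<open>hausdorff_measure\<close> would carry no information.
  Closed sets belong to the lambda system and generate the Borel sets.\<close>

lemma measure_space_hausdorff:
 assumes k: "1 <= k"
 shows "measure_space (UNIV :: 'a::metric_space set) (sets borel) (hausdorff_outer k)"
proof -
 have pos: "positive (Pow UNIV) (hausdorff_outer k :: 'a set => ennreal)"
  using k by (simp add: positive_def)
 have "outer_measure_space (Pow UNIV) (hausdorff_outer k :: 'a set => ennreal)"
  unfolding outer_measure_space_def using pos
  by (auto simp: increasing_def countably_subadditive_def intro: hausdorff_outer_mono hausdorff_outer_UN)
 hence ms: "measure_space (UNIV :: 'a set) (lambda_system UNIV (Pow UNIV) (hausdorff_outer k)) (hausdorff_outer k)"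
  using sigma_algebra.caratheodory_lemma[OF sigma_algebra_Pow] by blast
 hence sa: "sigma_algebra (UNIV :: 'a set) (lambda_system UNIV (Pow UNIV) (hausdorff_outer k))"
  and ca: "countably_additive (lambda_system (UNIV :: 'a set) (Pow UNIV) (hausdorff_outer k)) (hausdorff_outer k)"
  by (auto simp: measure_space_def)
 have "{S :: 'a set. closed S} \<subseteq> lambda_system UNIV (Pow UNIV) (hausdorff_outer k)"
  unfolding algebra.lambda_system_eq[OF algebra_Pow] using hausdorff_outer_closed[OF k] by auto
 hence "sigma_sets UNIV {S :: 'a set. closed S} \<subseteq> lambda_system UNIV (Pow UNIV) (hausdorff_outer k)"
  by (rule sigma_algebra.sigma_sets_subset[OF sa])
 moreover have "sets (borel :: 'a measure) = sigma_sets UNIV {S. closed S}"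
  by (simp add: borel_eq_closed)
 ultimately have "sets (borel :: 'a measure) \<subseteq> lambda_system UNIV (Pow UNIV) (hausdorff_outer k)" by simp
 hence "countably_additive (sets borel) (hausdorff_outer k :: 'a set => ennreal)"
 proof -
  assume sub: "sets (borel :: 'a measure) \<subseteq> lambda_system UNIV (Pow UNIV) (hausdorff_outer k)"
  show ?thesis
   unfolding countably_additive_def
  proof (intro allI impI)
   fix B :: "nat => 'a set"
   assume B: "range B \<subseteq> sets borel" "disjoint_family B" "(\<Union>i. B i) \<in> sets borel"
   show "(\<Sum>i. hausdorff_outer k (B i)) = hausdorff_outer k (\<Union>i. B i)"
    by (rule ca[unfolded countably_additive_def, rule_format, OF order_trans[OF B(1) sub] B(2) subsetD[OF sub B(3)]])
  qed
 qed
 moreover have "positive (sets borel) (hausdorff_outer k :: 'a set => ennreal)"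
  using k by (simp add: positive_def)
 moreover have "sigma_algebra (UNIV :: 'a set) (sets borel)"
  using sets.sigma_algebra_axioms[of "borel :: 'a measure"] by (simp only: space_borel)
 ultimately show ?thesis unfolding measure_space_def by (intro conjI)
qed

lemma sets_hausdorff_measure [simp, measurable_cong]: "sets (hausdorff_measure k :: 'a::metric_space measure) = sets borel"
 unfolding hausdorff_measure_def
 by (rule sets.sets_measure_of_eq[of "borel :: 'a measure", unfolded space_borel])

lemma space_hausdorff_measure [simp]: "space (hausdorff_measure k) = UNIV"
 unfolding hausdorff_measure_def by (simp only: space_measure_of_conv)

lemma emeasure_hausdorff_measure:
 fixes A :: "'a::metric_space set"
 assumes "1 <= k" "A \<in> sets borel"
 shows "emeasure (hausdorff_measure k) A = hausdorff_outer k A"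
proof -
 have ms: "measure_space (UNIV :: 'a set) (sets borel) (hausdorff_outer k)"
  by (rule measure_space_hausdorff[OF assms(1)])
 have "emeasure (measure_of UNIV (sets borel) (hausdorff_outer k)) A = hausdorff_outer k A"
  using emeasure_measure_of_sigma[of UNIV "sets borel" "hausdorff_outer k" A] ms assms(2)
  unfolding measure_space_def by simp
 thus ?thesis unfolding hausdorff_measure_def hausdorff_outer_def[abs_def] .
qed

section \<open>Lipschitz images and agreement with Lebesgue measure\<close>

lemma hausdorff_outer_lipschitz_image:
 fixes f :: "'a::metric_space => 'b::metric_space"
 assumes k: "1 <= k" and K: "0 < K" and f: "!!x y. x \<in> A ==> y \<in> A ==> dist (f x) (f y) <= K * dist x y"
 shows "hausdorff_outer k (f ` A) <= ennreal (K ^ k) * hausdorff_outer k A"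
 unfolding hausdorff_outer_def[of k "f ` A"]
proof (rule SUP_least)
 fix \<delta> :: real assume "\<delta> \<in> {0<..}"
 hence \<delta>: "0 < \<delta>" by simp
 have Kk: "ennreal (K ^ k) ~= 0" "ennreal (K ^ k) ~= top" using K by auto
 have "ennreal (1 / K ^ k) * hausdorff_content \<delta> k (f ` A) <= hausdorff_content (\<delta> / K) k A"
 proof (rule hausdorff_content_greatest)
  fix C :: "nat => 'a set"
  assume C: "A \<subseteq> (\<Union>i. C i)" "!!i. bounded (C i)" "!!i. diameter (C i) <= \<delta> / K"
  have d0: "0 <= diameter (C i)" for i using C(2) by (rule diameter_ge_0)
  have dd: "dist (f x) (f y) <= K * diameter (C i)" if "x \<in> C i \<inter> A" "y \<in> C i \<inter> A" for x y i
   using that f[of x y] diameter_bounded_bound[OF C(2)[of i], of x y] K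
   by (meson IntD1 IntD2 mult_left_mono order_trans less_imp_le)
  have bd: "bounded (f ` (C i \<inter> A))" for i
   unfolding bounded_two_points using dd by (intro exI[of _ "K * diameter (C i)"]) auto
  have diam: "diameter (f ` (C i \<inter> A)) <= K * diameter (C i)" for i
  proof (cases "C i \<inter> A = {}")
   case False
   thus ?thesis unfolding diameter_def[of "f ` (C i \<inter> A)"] using dd
    by (auto intro!: cSUP_least)
  qed (use d0 K in auto)
  have "hausdorff_content \<delta> k (f ` A) <= (\<Sum>i. ball_gauge k (f ` (C i \<inter> A)))"
  proof (rule hausdorff_content_le)
   show "f ` A \<subseteq> (\<Union>i. f ` (C i \<inter> A))" using C(1) by blast
   show "diameter (f ` (C i \<inter> A)) <= \<delta>" for i
    using diam[of i] C(3)[of i] K by (simp add: field_simps)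
  qed (rule bd)
  also have "... <= (\<Sum>i. ennreal (K ^ k) * ball_gauge k (C i))"
  proof (intro suminf_le summableI)
   fix i
   have "(diameter (f ` (C i \<inter> A)) / 2) ^ k <= (K * (diameter (C i) / 2)) ^ k"
    using diam[of i] diameter_ge_0[OF bd] by (intro power_mono) auto
   from mult_left_mono[OF this[unfolded power_mult_distrib], of "unit_ball_vol (real k)"]
   show "ball_gauge k (f ` (C i \<inter> A)) <= ennreal (K ^ k) * ball_gauge k (C i)"
    unfolding ball_gauge_def using K d0[of i] by (simp add: ennreal_mult[symmetric] ennreal_leI mult.left_commute)
  qed
  also have "... = ennreal (K ^ k) * (\<Sum>i. ball_gauge k (C i))" by simp
  finally have "ennreal (1 / K ^ k) * hausdorff_content \<delta> k (f ` A) <= ennreal (1 / K ^ k) * (ennreal (K ^ k) * (\<Sum>i. ball_gauge k (C i)))"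
   by (rule mult_left_mono) simp
  also have "... = (\<Sum>i. ball_gauge k (C i))" using K
   by (simp add: mult.assoc[symmetric] ennreal_mult[symmetric])
  finally show "ennreal (1 / K ^ k) * hausdorff_content \<delta> k (f ` A) <= (\<Sum>i. ball_gauge k (C i))" .
 qed
 also have "... <= hausdorff_outer k A" by (rule hausdorff_content_le_outer) (use \<delta> K in simp)
 finally have "ennreal (K ^ k) * (ennreal (1 / K ^ k) * hausdorff_content \<delta> k (f ` A)) <= ennreal (K ^ k) * hausdorff_outer k A"
  by (rule mult_left_mono) simp
 thus "hausdorff_content \<delta> k (f ` A) <= ennreal (K ^ k) * hausdorff_outer k A"
  using K by (simp add: mult.assoc[symmetric] ennreal_mult[symmetric])
qed

text \<open>The covering sets need not be measurable; the isodiametric inequality is applied to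
  their closures, which have the same diameters.\<close>

lemma lborel_le_hausdorff_content:
 fixes A :: "'a::euclidean_space set"
 assumes "A \<in> sets borel"
 shows "emeasure lborel A <= hausdorff_content \<delta> DIM('a) A"
proof (rule hausdorff_content_greatest)
 fix C :: "nat => 'a set"
 assume C: "A \<subseteq> (\<Union>i. C i)" "!!i. bounded (C i)" "!!i. diameter (C i) <= \<delta>"
 have "emeasure lborel A <= emeasure lborel (\<Union>i. closure (C i))"
 proof (rule emeasure_mono)
  show "A \<subseteq> (\<Union>i. closure (C i))" using C(1) closure_subset[of "C _"] by blast
 qed simp
 also have "... <= (\<Sum>i. emeasure lborel (closure (C i)))"
  by (rule emeasure_subadditive_countably) auto
 also have "... <= (\<Sum>i. ball_gauge DIM('a) (C i))"
 proof (intro suminf_le summableI)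
  fix i
  have "emeasure lborel (closure (C i)) <= ennreal (unit_ball_vol (real DIM('a)) * (diameter (closure (C i)) / 2) ^ DIM('a))"
   by (rule isodiametric) (use C in auto)
  thus "emeasure lborel (closure (C i)) <= ball_gauge DIM('a) (C i)"
   by (simp add: ball_gauge_def diameter_closure[OF C(2)])
 qed
 finally show "emeasure lborel A <= (\<Sum>i. ball_gauge DIM('a) (C i))" .
qed

lemma ball_gauge_cball:
 fixes c :: "'a::euclidean_space"
 assumes "0 <= r"
 shows "ball_gauge DIM('a) (cball c r) = emeasure lborel (cball c r)"
 using assms by (simp add: ball_gauge_def emeasure_cball)

text \<open>The Vitali theorems deliver countable families. They become sequences by padding with
  empty sets, whose gauge is 0 for k >= 1.\<close>

lemma hausdorff_content_le_countable:
 assumes k: "1 <= k" and \<delta>: "0 <= \<delta>" and J: "countable J"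
  and C: "A \<subseteq> (\<Union>j\<in>J. C j)" "!!j. j \<in> J ==> bounded (C j)" "!!j. j \<in> J ==> diameter (C j) <= \<delta>"
 shows "hausdorff_content \<delta> k A <= (\<integral>\<^sup>+j. ball_gauge k (C j) \<partial>count_space J)"
proof -
 let ?n = "to_nat_on J"
 define D where "D m = (if m \<in> ?n ` J then C (from_nat_into J m) else {})" for m
 have D: "D (?n j) = C j" if "j \<in> J" for j using J that by (simp add: D_def)
 have "hausdorff_content \<delta> k A <= (\<Sum>m. ball_gauge k (D m))"
 proof (rule hausdorff_content_le)
  show "A \<subseteq> (\<Union>m. D m)"
  proof
   fix x assume "x \<in> A"
   then obtain j where "j \<in> J" "x \<in> C j" using C(1) by blast
   thus "x \<in> (\<Union>m. D m)" using D by (intro UN_I[of "?n j"]) auto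
  qed
 qed (use C J \<delta> in \<open>auto simp: D_def\<close>)
 also have "... = (\<integral>\<^sup>+m. ball_gauge k (D m) \<partial>count_space (?n ` J))"
  unfolding nn_integral_count_space_nat[symmetric] by (rule nn_integral_count_space_eq) (use k in \<open>auto simp: D_def\<close>)
 also have "... = (\<integral>\<^sup>+j. ball_gauge k (D (?n j)) \<partial>count_space J)"
  by (rule nn_integral_bij_count_space[symmetric]) (use J in \<open>auto intro: inj_on_imp_bij_betw\<close>)
 also have "... = (\<integral>\<^sup>+j. ball_gauge k (C j) \<partial>count_space J)" by (rule nn_integral_cong) (simp add: D)
 finally show ?thesis .
qed

lemma disjoint_cballs_emeasure:
 fixes J :: "('a::euclidean_space \<times> real) set"
 assumes "countable J" "pairwise (%i j. disjnt (cball (fst i) (snd i)) (cball (fst j) (snd j))) J"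
  and G: "open G" "!!j. j \<in> J ==> cball (fst j) (snd j) \<subseteq> G"
 shows "(\<integral>\<^sup>+j. emeasure lborel (cball (fst j) (snd j)) \<partial>count_space J) <= emeasure lborel G"
proof -
 have "(\<integral>\<^sup>+j. emeasure lborel (cball (fst j) (snd j)) \<partial>count_space J) = emeasure lborel (\<Union>j\<in>J. cball (fst j) (snd j))"
  by (rule emeasure_UN_countable[symmetric]) (use assms in \<open>auto simp: disjoint_family_on_def pairwise_def disjnt_def\<close>)
 also have "... <= emeasure lborel G" by (rule emeasure_mono) (use G in auto)
 finally show ?thesis .
qed

text \<open>The 5r covering lemma inside an open set of measure at most e / 5^d: enlarging the
  disjoint balls five times multiplies the volume by 5^d, which the choice of the open set
  compensates.\<close>

lemma hausdorff_content_null: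
 fixes N :: "'a::euclidean_space set"
 assumes N: "N \<in> null_sets lebesgue" and \<delta>: "0 < \<delta>"
 shows "hausdorff_content \<delta> DIM('a) N = 0"
proof -
 obtain N' where N': "N' \<in> null_sets lborel" "N \<subseteq> N'"
  using N by (auto simp: null_sets_completion_iff2)
 have "hausdorff_content \<delta> DIM('a) N <= 0 + ennreal e" if e: "0 < e" for e
 proof -
  define e' where "e' = e / 5 ^ DIM('a)"
  have e': "0 < e'" using e by (simp add: e'_def)
  have "N' \<in> sets borel" using N'(1) by auto
  from outer_regular_lborel[OF this e'] obtain G where G: "open G" "N' \<subseteq> G" "emeasure lborel (G - N') < e'" by blast
  have "emeasure lborel (G - N') = emeasure lborel G" using N'(1) G by (intro emeasure_Diff_null_set) auto
  with G have Ge: "emeasure lborel G <= e'" by simp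
  \<comment> \<open>Radii at most \<delta> / 10 leave the balls with diameter at most \<delta> after
    enlargement by 5.\<close>
  define K where "K = {(x, r). x \<in> N' \<and> 0 < r \<and> r <= \<delta> / 10 \<and> cball x r \<subseteq> G}"
  have cov: "N' \<subseteq> (\<Union>i\<in>K. cball (fst i) (snd i))"
  proof
   fix x assume x: "x \<in> N'"
   then obtain r where "0 < r" "cball x r \<subseteq> G" using G open_contains_cball by blast
   hence "(x, min r (\<delta> / 10)) \<in> K" "x \<in> cball x (min r (\<delta> / 10))" using x \<delta> by (auto simp: K_def)
   thus "x \<in> (\<Union>i\<in>K. cball (fst i) (snd i))" by force
  qed
  obtain J where J: "countable J" "J \<subseteq> K"
   "pairwise (%i j. disjnt (cball (fst i) (snd i)) (cball (fst j) (snd j))) J"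
   "N' \<subseteq> (\<Union>i\<in>J. cball (fst i) (5 * snd i))"
  proof (rule Vitali_covering_lemma_cballs[OF cov])
   show "0 < snd i \<and> snd i <= \<delta> / 10" if "i \<in> K" for i using that by (auto simp: K_def)
  qed (rule that)
  have KG: "0 < snd j" "snd j <= \<delta> / 10" "cball (fst j) (snd j) \<subseteq> G" if "j \<in> J" for j
   using subsetD[OF J(2) that] by (cases j; simp add: K_def)+
  have "hausdorff_content \<delta> DIM('a) N <= hausdorff_content \<delta> DIM('a) N'" by (rule hausdorff_content_mono[OF N'(2)])
  also have "... <= (\<integral>\<^sup>+j. ball_gauge DIM('a) (cball (fst j) (5 * snd j)) \<partial>count_space J)"
   by (rule hausdorff_content_le_countable[OF _ _ J(1,4)]) (use KG(1,2) \<delta> in \<open>force simp: Suc_leI\<close>)+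
  also have "... = (\<integral>\<^sup>+j. ennreal (5 ^ DIM('a)) * emeasure lborel (cball (fst j) (snd j)) \<partial>count_space J)"
  proof (rule nn_integral_cong)
   fix j assume "j \<in> space (count_space J)"
   hence "0 < snd j" using KG by simp
   thus "ball_gauge DIM('a) (cball (fst j) (5 * snd j)) = ennreal (5 ^ DIM('a)) * emeasure lborel (cball (fst j) (snd j))"
    by (simp add: ball_gauge_cball emeasure_cball power_mult_distrib ennreal_mult[symmetric] mult.left_commute)
  qed
  also have "... = ennreal (5 ^ DIM('a)) * (\<integral>\<^sup>+j. emeasure lborel (cball (fst j) (snd j)) \<partial>count_space J)" by (rule nn_integral_cmult) simp
  also have "... <= ennreal (5 ^ DIM('a)) * ennreal e'"
   by (intro mult_left_mono order_trans[OF disjoint_cballs_emeasure[OF J(1,3) G(1) KG(3)] Ge]) auto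
  also have "... = ennreal e" using e' by (simp add: e'_def ennreal_mult[symmetric])
  finally show ?thesis by simp
 qed
 hence "hausdorff_content \<delta> DIM('a) N <= 0" by (rule ennreal_le_epsilon)
 thus ?thesis by simp
qed

text \<open>Disjoint small balls exhaust an open set up to a null set, and for a ball the gauge is
  exactly its volume. The null remainder costs nothing by
  \<open>hausdorff_content_null\<close>.\<close>

lemma hausdorff_content_open:
 fixes G :: "'a::euclidean_space set"
 assumes G: "open G" and \<delta>: "0 < \<delta>"
 shows "hausdorff_content \<delta> DIM('a) G <= emeasure lborel G"
proof -
 define K where "K = {(x, r). 0 < r \<and> r <= \<delta> / 2 \<and> cball x r \<subseteq> G}"
 have cov: "\<exists>i. i \<in> K \<and> x \<in> cball (fst i) (snd i) \<and> snd i < d" if xd: "x \<in> G" "0 < d" for x d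
 proof -
  obtain r where r: "0 < r" "cball x r \<subseteq> G" using G xd(1) unfolding open_contains_cball by blast
  have "cball x (min (d/2) (min r (\<delta> / 2))) \<subseteq> G" by (rule order_trans[OF subset_cball r(2)]) simp
  hence "(x, min (d/2) (min r (\<delta> / 2))) \<in> K" using xd \<delta> r(1) unfolding K_def by simp
  thus ?thesis using xd \<delta> r(1) by (intro exI[of _ "(x, min (d/2) (min r (\<delta> / 2)))"]) simp
 qed
 let ?B = "%i. cball (fst i) (snd i)"
 obtain J where J: "countable J" "J \<subseteq> K" "pairwise (%i j. disjnt (?B i) (?B j)) J" "negligible (G - (\<Union>i\<in>J. ?B i))"
 proof (rule Vitali_covering_theorem_cballs[of K snd G fst])
  show "0 < snd i" if "i \<in> K" for i using that by (auto simp: K_def)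
  show "\<exists>i. i \<in> K \<and> x \<in> ?B i \<and> snd i < d" if "x \<in> G" "0 < d" for x d using cov that .
 qed (rule that)
 have KG: "0 < snd j" "snd j <= \<delta> / 2" "?B j \<subseteq> G" if "j \<in> J" for j
  using subsetD[OF J(2) that] by (cases j; simp add: K_def)+
 have "hausdorff_content \<delta> DIM('a) G <= hausdorff_content \<delta> DIM('a) ((\<Union>j\<in>J. ?B j) \<union> (G - (\<Union>j\<in>J. ?B j)))"
  by (rule hausdorff_content_mono) auto
 also have "... <= hausdorff_content \<delta> DIM('a) (\<Union>j\<in>J. ?B j) + 0"
  using hausdorff_content_null[OF _ \<delta>, of "G - (\<Union>j\<in>J. ?B j)"] J(4) \<delta>
   hausdorff_content_Un[of "DIM('a)" \<delta> "\<Union>j\<in>J. ?B j" "G - (\<Union>j\<in>J. ?B j)"] by (simp add: negligible_iff_null_sets Suc_leI)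
 also have "... <= (\<integral>\<^sup>+j. ball_gauge DIM('a) (?B j) \<partial>count_space J)"
  unfolding add_0_right by (rule hausdorff_content_le_countable[OF _ _ J(1) order_refl]) (use KG(1,2) \<delta> in \<open>force simp: Suc_leI\<close>)+
 also have "... = (\<integral>\<^sup>+j. emeasure lborel (?B j) \<partial>count_space J)"
  by (rule nn_integral_cong) (use KG(1) in \<open>simp add: ball_gauge_cball less_imp_le\<close>)
 also have "... <= emeasure lborel G" by (rule disjoint_cballs_emeasure[OF J(1,3) G KG(3)])
 finally show ?thesis .
qed

lemma hausdorff_outer_eq_lborel:
 fixes A :: "'a::euclidean_space set"
 assumes A: "A \<in> sets borel"
 shows "hausdorff_outer DIM('a) A = emeasure lborel A"
proof (rule antisym)
 show "emeasure lborel A <= hausdorff_outer DIM('a) A"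
  using lborel_le_hausdorff_content[OF A, of 1] hausdorff_content_le_outer[of 1 "DIM('a)" A] by simp
 show "hausdorff_outer DIM('a) A <= emeasure lborel A"
 proof (rule ennreal_le_epsilon)
  fix e :: real assume e: "0 < e"
  obtain G where G: "open G" "A \<subseteq> G" "emeasure lborel (G - A) < e"
   using outer_regular_lborel[OF A e] by auto
  have "hausdorff_outer DIM('a) A <= emeasure lborel G"
   unfolding hausdorff_outer_def
  proof (rule SUP_least)
   fix \<delta> :: real assume "\<delta> \<in> {0<..}"
   hence "hausdorff_content \<delta> DIM('a) G <= emeasure lborel G" by (intro hausdorff_content_open G) simp
   thus "hausdorff_content \<delta> DIM('a) A <= emeasure lborel G"
    by (rule order_trans[OF hausdorff_content_mono[OF G(2)]])
  qed
  also have "emeasure lborel G = emeasure lborel (A \<union> (G - A))" using G(2) by (simp add: Un_absorb1)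
  also have "... <= emeasure lborel A + emeasure lborel (G - A)"
   using A G by (intro emeasure_subadditive) auto
  also have "... <= emeasure lborel A + ennreal e" using G by (intro add_left_mono) auto
  finally show "hausdorff_outer DIM('a) A <= emeasure lborel A + ennreal e" .
 qed
qed

section \<open>The Hilbert space structure of L2\<close>

lemma l2_rep_rel: "L2_rel (rep_l2 f) (rep_l2 f)"
 by (rule Quotient3_rep_reflp[OF Quotient3_l2])

lemma square_integrable_rep [simp]: "square_integrable lebesgue (rep_l2 f)"
 using l2_rep_rel by (auto simp: L2_rel_def)

lemma rep_l2_measurable [measurable]: "rep_l2 f \<in> borel_measurable lebesgue"
 using square_integrable_rep by (auto simp: square_integrable_def)

lemma rep_l2_integrable: "integrable lebesgue (%x. (cmod (rep_l2 f x))^2)"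
 using square_integrable_rep unfolding square_integrable_def by blast

lemma abs_rep_l2 [simp]: "abs_l2 (rep_l2 f) = f"
 by (rule Quotient3_abs_rep[OF Quotient3_l2])

lemma abs_l2_eqI:
 assumes "square_integrable lebesgue f" "square_integrable lebesgue g" "AE x in lebesgue. f x = g x"
 shows "abs_l2 f = abs_l2 g"
 using Quotient3_rel_abs[OF Quotient3_l2, of f g] assms by (simp add: L2_rel_def)

lemma rep_abs_l2:
 assumes "square_integrable lebesgue f"
 shows "AE x in lebesgue. rep_l2 (abs_l2 f) x = f x"
 using rep_abs_rsp_left[OF Quotient3_l2, of f f] assms by (simp add: L2_rel_def)

lemma plus_l2_abs:
 assumes "square_integrable lebesgue f" "square_integrable lebesgue g"
 shows "abs_l2 f + abs_l2 g = abs_l2 (%x. f x + g x)"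
 using assms by (intro plus_l2.abs_eq) (auto simp: L2_rel_def)

lemma scaleC_l2_abs:
 assumes "square_integrable lebesgue f"
 shows "scaleC_l2 c (abs_l2 f) = abs_l2 (%x. c * f x)"
 using assms by (intro scaleC_l2.abs_eq) (auto simp: L2_rel_def)

lemma uminus_l2_abs:
 assumes "square_integrable lebesgue f"
 shows "- abs_l2 f = abs_l2 (%x. - f x)"
 using assms by (intro uminus_l2.abs_eq) (auto simp: L2_rel_def)

lemma minus_l2_abs:
 assumes "square_integrable lebesgue f" "square_integrable lebesgue g"
 shows "abs_l2 f - abs_l2 g = abs_l2 (%x. f x - g x)"
 using plus_l2_abs[of f "%x. - g x"] assms
 by (simp add: minus_l2_def uminus_l2_abs square_integrable_uminus)

lemma cinner_l2_abs:
 assumes "square_integrable lebesgue f" "square_integrable lebesgue g"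
 shows "cinner_l2 (abs_l2 f) (abs_l2 g) = (LINT x|lebesgue. f x * cnj (g x))"
 using assms by (intro cinner_l2.abs_eq) (auto simp: L2_rel_def)

lemma rep_plus_l2: "AE x in lebesgue. rep_l2 (f + g) x = rep_l2 f x + rep_l2 g x"
 using rep_abs_l2[of "%x. rep_l2 f x + rep_l2 g x"] plus_l2_abs[of "rep_l2 f" "rep_l2 g"]
 by (simp add: square_integrable_add)

lemma rep_minus_l2: "AE x in lebesgue. rep_l2 (f - g) x = rep_l2 f x - rep_l2 g x"
 using rep_abs_l2[of "%x. rep_l2 f x + - rep_l2 g x"] minus_l2_abs[of "rep_l2 f" "rep_l2 g"]
 by (simp add: square_integrable_add square_integrable_uminus del: add_uminus_conv_diff) simp

lemma rep_scaleC_l2: "AE x in lebesgue. rep_l2 (scaleC_l2 c f) x = c * rep_l2 f x"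
 using rep_abs_l2[of "%x. c * rep_l2 f x"] scaleC_l2_abs[of "rep_l2 f"]
 by (simp add: square_integrable_scale)

lemma cinner_l2_rep: "cinner_l2 f g = (LINT x|lebesgue. rep_l2 f x * cnj (rep_l2 g x))"
 using cinner_l2_abs[of "rep_l2 f" "rep_l2 g"] by simp

lemma cinner_add_left: "cinner_l2 (f + g) h = cinner_l2 f h + cinner_l2 g h"
 by transfer (simp add: L2_rel_def distrib_right square_integrable_mult_cnj)

lemma cinner_scaleC_left: "cinner_l2 (scaleC_l2 c f) h = c * cinner_l2 f h"
 by transfer (simp add: mult.assoc)

lemma cinner_commute: "cinner_l2 f g = cnj (cinner_l2 g f)"
proof transfer
 fix f g :: "'a => complex"
 show "(LINT x|lebesgue. f x * cnj (g x)) = cnj (LINT x|lebesgue. g x * cnj (f x))"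
  using Bochner_Integration.integral_cnj[where M = lebesgue and f = "%x. g x * cnj (f x)"]
  by (simp only: complex_cnj_mult complex_cnj_cnj mult.commute)
qed

lemma cinner_add_right: "cinner_l2 h (f + g) = cinner_l2 h f + cinner_l2 h g"
 by (metis cinner_add_left cinner_commute complex_cnj_add)

lemma cinner_scaleC_right: "cinner_l2 h (scaleC_l2 c f) = cnj c * cinner_l2 h f"
 by (metis cinner_scaleC_left cinner_commute complex_cnj_mult)

lemma scaleC_minus1: "- f = scaleC_l2 (-1) f"
 by transfer (auto simp: L2_rel_def square_integrable_uminus)

lemma scaleC_scaleC: "scaleC_l2 a (scaleC_l2 b f) = scaleC_l2 (a * b) f"
 by transfer (auto simp: L2_rel_def square_integrable_scale mult.assoc)

lemma scaleC_one [simp]: "scaleC_l2 1 f = f"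
 by transfer (auto simp: L2_rel_def)

lemma scaleC_add_right: "scaleC_l2 a (f + g) = scaleC_l2 a f + scaleC_l2 a g"
 by transfer (auto simp: L2_rel_def square_integrable_scale square_integrable_add distrib_left)

lemma scaleC_add_left: "scaleC_l2 (a + b) f = scaleC_l2 a f + scaleC_l2 b f"
 by transfer (auto simp: L2_rel_def square_integrable_scale square_integrable_add distrib_right)

lemma scaleC_zero_left [simp]: "scaleC_l2 0 f = 0"
 by (metis add_cancel_right_left scaleC_add_left)

lemma scaleC_zero_right [simp]: "scaleC_l2 a 0 = 0"
 by (metis add_cancel_right_left scaleC_add_right)

lemma scaleC_uminus_right: "scaleC_l2 a (- f) = - scaleC_l2 a f"
 by (simp add: scaleC_minus1 scaleC_scaleC)

lemma scaleC_uminus_left: "scaleC_l2 (- a) f = - scaleC_l2 a f"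
 by (simp add: scaleC_minus1 scaleC_scaleC)

lemma scaleC_diff_right: "scaleC_l2 a (f - g) = scaleC_l2 a f - scaleC_l2 a g"
 using scaleC_add_right[of a f "- g"] by (simp add: scaleC_uminus_right)

lemma scaleC_diff_left: "scaleC_l2 (a - b) f = scaleC_l2 a f - scaleC_l2 b f"
 using scaleC_add_left[of a "- b" f] by (simp add: scaleC_uminus_left)

lemma scaleR_scaleC: "r *\<^sub>R f = scaleC_l2 (complex_of_real r) f" for f :: "'a::euclidean_space l2"
 by (rule scaleR_l2_def)

lemma cinner_uminus_left: "cinner_l2 (- f) g = - cinner_l2 f g"
 by (simp add: scaleC_minus1 cinner_scaleC_left)

lemma cinner_uminus_right: "cinner_l2 f (- g) = - cinner_l2 f g"
 by (simp add: scaleC_minus1 cinner_scaleC_right)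

lemma cinner_diff_left: "cinner_l2 (f - g) h = cinner_l2 f h - cinner_l2 g h"
 using cinner_add_left[of f "- g" h] by (simp add: cinner_uminus_left)

lemma cinner_diff_right: "cinner_l2 h (f - g) = cinner_l2 h f - cinner_l2 h g"
 using cinner_add_right[of h f "- g"] by (simp add: cinner_uminus_right)

lemma cinner_zero_left [simp]: "cinner_l2 0 g = 0"
 by (metis cinner_diff_left diff_self)

lemma cinner_zero_right [simp]: "cinner_l2 g 0 = 0"
 by (metis cinner_diff_right diff_self)

lemma norm_l2_sq: "(norm f)^2 = (LINT x|lebesgue. (cmod (rep_l2 f x))^2)"
proof -
 have "(norm f)^2 = Re (cinner_l2 f f)" by (simp add: power2_norm_eq_inner inner_l2_def)
 thus ?thesis by (simp add: cinner_l2_rep l2_self_inner)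
qed

lemma cinner_self: "cinner_l2 f f = complex_of_real ((norm f)^2)"
 by (simp add: cinner_l2_rep l2_self_inner norm_l2_sq)

lemma norm_l2_sq_abs:
 assumes "square_integrable lebesgue f"
 shows "(norm (abs_l2 f))^2 = (LINT x|lebesgue. (cmod (f x))^2)"
 using cinner_self[of "abs_l2 f"] assms
 by (simp add: cinner_l2_abs l2_self_inner del: of_real_power)

lemma norm_scaleC: "norm (scaleC_l2 c f) = cmod c * norm f"
proof -
 have "complex_of_real ((norm (scaleC_l2 c f))^2) = c * cnj c * complex_of_real ((norm f)^2)"
  by (simp add: cinner_self[symmetric] cinner_scaleC_left cinner_scaleC_right mult.assoc del: of_real_power)
 also have "... = complex_of_real ((cmod c * norm f)^2)"
  by (simp add: complex_norm_square[symmetric] power_mult_distrib del: of_real_power)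
 finally have "(norm (scaleC_l2 c f))^2 = (cmod c * norm f)^2"
  by (simp only: of_real_eq_iff)
 thus ?thesis by (rule power2_eq_imp_eq) auto
qed

lemma cinner_bound: "cmod (cinner_l2 f g) <= norm f * norm g"
proof (cases "cinner_l2 f g = 0")
 case False
 define c where "c = cnj (cinner_l2 f g) / cmod (cinner_l2 f g)"
 have c: "cmod c = 1" using False by (simp add: c_def norm_divide)
 have "c * cinner_l2 f g = complex_of_real (cmod (cinner_l2 f g))"
  using False by (simp add: c_def complex_norm_square[symmetric] power2_eq_square mult.commute)
 hence "cmod (cinner_l2 f g) = inner (scaleC_l2 c f) g"
  by (simp add: inner_l2_def cinner_scaleC_left)
 also have "... <= norm (scaleC_l2 c f) * norm g" by (rule norm_cauchy_schwarz)
 finally show ?thesis by (simp add: norm_scaleC c)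
qed simp

lemma l2_dist_sq_lebesgue:
 "(norm (f - g))^2 = (LINT x|lebesgue. (cmod (rep_l2 f x - rep_l2 g x))^2)"
 unfolding norm_l2_sq
 by (rule integral_cong_AE) (use rep_minus_l2[of f g] in auto)

lemma nn_integral_l2_diff:
 "(\<integral>\<^sup>+x. ennreal ((cmod (rep_l2 f x - rep_l2 g x))^2) \<partial>lebesgue) = ennreal ((norm (f - g))^2)"
proof -
 have "integrable lebesgue (%x. (cmod (rep_l2 f x - rep_l2 g x))^2)"
  using square_integrable_add[of lebesgue "rep_l2 f" "%x. - rep_l2 g x"]
  by (simp add: square_integrable_uminus) (simp add: square_integrable_def)
 thus ?thesis by (subst nn_integral_eq_integral) (auto simp: l2_dist_sq_lebesgue)
qed

section \<open>Square integrable functions on a general measure space\<close>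

definition sq_norm :: "'a measure => ('a => complex) => real" where
 "sq_norm M f = sqrt (LINT x|M. (cmod (f x))^2)"

lemma sq_norm_nonneg [simp]: "0 <= sq_norm M f"
 by (simp add: sq_norm_def)

lemma sq_norm_sq: "(sq_norm M f)^2 = (LINT x|M. (cmod (f x))^2)"
 by (simp add: sq_norm_def)

lemma sq_norm_cong_AE:
 assumes "f \<in> borel_measurable M" "g \<in> borel_measurable M" "AE x in M. f x = g x"
 shows "sq_norm M f = sq_norm M g"
 unfolding sq_norm_def by (rule arg_cong[where f=sqrt], rule integral_cong_AE) (use assms in auto)

lemma sq_norm_scale: "sq_norm M (%x. c * f x) = cmod c * sq_norm M f"
 by (simp add: sq_norm_def norm_mult power_mult_distrib real_sqrt_mult)

lemma nn_integral_sq_norm: "square_integrable M f ==> (\<integral>\<^sup>+x. ennreal ((cmod (f x))^2) \<partial>M) = ennreal ((sq_norm M f)^2)"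
 unfolding sq_norm_sq by (rule nn_integral_eq_integral) (auto simp: square_integrable_def)

lemma square_integrableI_nn:
 assumes "f \<in> borel_measurable M" "(\<integral>\<^sup>+x. ennreal ((cmod (f x))^2) \<partial>M) <= ennreal C" "0 <= C"
 shows "square_integrable M f" "(sq_norm M f)^2 <= C"
proof -
 have "integrable M (%x. (cmod (f x))^2)"
  by (rule integrableI_bounded) (use assms in \<open>auto simp: le_less_trans\<close>)
 thus s: "square_integrable M f" using assms(1) by (simp add: square_integrable_def)
 show "(sq_norm M f)^2 <= C" using nn_integral_sq_norm[OF s] assms(2,3) by simp
qed

text \<open>The hypothesis is Young's inequality with weight \<open>r\<close>; the best weight is b
  / a. Since \<open>a\<close> or \<open>b\<close> may vanish, the weight (b + d) / (a + d) is used
  and \<open>d\<close> tends to 0.\<close>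

lemma real_le_sqrt_mult:
 assumes "!!r. 0 < r ==> 2 * I <= r * a^2 + b^2 / r" "0 <= a" "0 <= (b::real)"
 shows "I <= a * b"
proof (rule field_le_epsilon)
 fix e :: real assume e: "0 < e"
 have "I <= (a + d) * (b + d)" if d: "0 < d" for d
 proof -
  have "2 * I <= (b + d) / (a + d) * a^2 + b^2 / ((b + d) / (a + d))"
   using assms(2,3) d by (intro assms(1)) auto
  also have "(b + d) / (a + d) * a^2 <= (b + d) / (a + d) * (a + d)^2"
   using assms(2,3) d by (intro mult_left_mono power_mono) auto
  also have "b^2 / ((b + d) / (a + d)) <= (b + d)^2 / ((b + d) / (a + d))"
   using assms(2,3) d by (intro divide_right_mono power_mono) auto
  also have "(b + d) / (a + d) * (a + d)^2 + (b + d)^2 / ((b + d) / (a + d)) = 2 * ((a + d) * (b + d))"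
   using assms(2,3) d by (simp add: power2_eq_square)
  finally show ?thesis by simp
 qed
 hence le: "\<forall>\<^sub>F d in at_right 0. I <= (a + d) * (b + d)"
  by (intro eventually_at_rightI[of 0 1]) auto
 have "((%d. (a + d) * (b + d)) \<longlongrightarrow> (a + 0) * (b + 0)) (at_right 0)" by (intro tendsto_intros)
 from tendsto_lowerbound[OF this le] show "I <= a * b + e" using e by simp
qed

lemma sq_norm_weighted_bound:
 assumes f: "square_integrable M f" and g: "square_integrable M g"
  and w: "w \<in> borel_measurable M" "AE x in M. \<bar>w x\<bar> <= C" "0 <= C"
 shows "integrable M (%x. complex_of_real (w x) * f x * cnj (g x))"
  "integrable M (%x. cmod (f x) * cmod (g x))"
  "(LINT x|M. cmod (f x) * cmod (g x)) <= sq_norm M f * sq_norm M g"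
  "cmod (LINT x|M. complex_of_real (w x) * f x * cnj (g x)) <= C * (sq_norm M f * sq_norm M g)"
proof -
 note m [measurable] = f[unfolded square_integrable_def, THEN conjunct1] g[unfolded square_integrable_def, THEN conjunct1] w(1)
 note i = f[unfolded square_integrable_def, THEN conjunct2] g[unfolded square_integrable_def, THEN conjunct2]
 have fg: "2 * (cmod (f x) * cmod (g x)) <= r * (cmod (f x))^2 + (cmod (g x))^2 / r" if "0 < r" for r x
 proof -
  have "0 <= (r * cmod (f x) - cmod (g x))^2 / r" using that by simp
  also have "... = r * (cmod (f x))^2 + (cmod (g x))^2 / r - 2 * (cmod (f x) * cmod (g x))"
   using that by (simp add: power2_eq_square field_simps)
  finally show ?thesis by simp
 qed
 show ifg: "integrable M (%x. cmod (f x) * cmod (g x))"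
 proof (rule Bochner_Integration.integrable_bound)
  show "integrable M (%x. (cmod (f x))^2 + (cmod (g x))^2)" using i by simp
  show "AE x in M. norm (cmod (f x) * cmod (g x)) <= norm ((cmod (f x))^2 + (cmod (g x))^2)"
   using fg[of 1] by (intro AE_I2) (smt (verit) norm_ge_zero mult_nonneg_nonneg real_norm_def zero_le_power2 mult_1 div_by_1)
 qed measurable
 show le: "(LINT x|M. cmod (f x) * cmod (g x)) <= sq_norm M f * sq_norm M g"
 proof (rule real_le_sqrt_mult)
  fix r :: real assume r: "0 < r"
  have "(LINT x|M. 2 * (cmod (f x) * cmod (g x))) <= (LINT x|M. r * (cmod (f x))^2 + (cmod (g x))^2 / r)"
   using ifg i fg[OF r] by (intro integral_mono) auto
  thus "2 * (LINT x|M. cmod (f x) * cmod (g x)) <= r * (sq_norm M f)^2 + (sq_norm M g)^2 / r"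
   using ifg i unfolding sq_norm_sq by (subst (asm) Bochner_Integration.integral_add) auto
 qed simp_all
 have bd: "AE x in M. norm (complex_of_real (w x) * f x * cnj (g x)) <= C * (cmod (f x) * cmod (g x))"
  using w(2) by eventually_elim (auto simp: norm_mult mult.assoc intro!: mult_right_mono)
 have mc: "(%x. complex_of_real (w x) * f x * cnj (g x)) \<in> borel_measurable M"
  by (intro borel_measurable_times m(1) borel_measurable_continuous_on[OF _ m(2), of cnj]
    borel_measurable_continuous_on[OF _ w(1), of complex_of_real] continuous_intros)
 show int: "integrable M (%x. complex_of_real (w x) * f x * cnj (g x))"
  by (rule Bochner_Integration.integrable_bound[OF integrable_mult_right[OF ifg, of C] mc])
   (use bd in eventually_elim, use w(3) in auto)
 have "cmod (LINT x|M. complex_of_real (w x) * f x * cnj (g x)) <= (LINT x|M. C * (cmod (f x) * cmod (g x)))"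
  by (rule order_trans[OF integral_norm_bound integral_mono_AE[OF integrable_norm[OF int] integrable_mult_right[OF ifg] bd]])
 also have "... <= C * (sq_norm M f * sq_norm M g)" using le w(3) by (simp add: mult_left_mono)
 finally show "cmod (LINT x|M. complex_of_real (w x) * f x * cnj (g x)) <= C * (sq_norm M f * sq_norm M g)" .
qed

lemma sq_norm_triangle:
 assumes f: "square_integrable M f" and g: "square_integrable M g"
 shows "sq_norm M (%x. f x + g x) <= sq_norm M f + sq_norm M g"
proof (rule power2_le_imp_le)
 note w = sq_norm_weighted_bound[OF f g, of "%_. 1" 1]
 have "(LINT x|M. (cmod (f x + g x))^2) <= (LINT x|M. (cmod (f x))^2 + (cmod (g x))^2 + 2 * (cmod (f x) * cmod (g x)))"
 proof (rule integral_mono)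
  show "(cmod (f x + g x))^2 <= (cmod (f x))^2 + (cmod (g x))^2 + 2 * (cmod (f x) * cmod (g x))" for x
   using power_mono[OF norm_triangle_ineq[of "f x" "g x"], of 2] by (simp add: power2_sum mult.assoc)
 qed (use f g w(2) square_integrable_add[OF f g] in \<open>auto simp: square_integrable_def\<close>)
 also have "... = (LINT x|M. (cmod (f x))^2) + (LINT x|M. (cmod (g x))^2) + 2 * (LINT x|M. cmod (f x) * cmod (g x))"
  using f g w(2) by (simp add: square_integrable_def)
 also have "... <= (sq_norm M f + sq_norm M g)^2"
  using w(3) by (simp add: sq_norm_sq power2_sum)
 finally show "(sq_norm M (%x. f x + g x))^2 <= (sq_norm M f + sq_norm M g)^2" by (simp add: sq_norm_sq)
qed simp

lemma square_integrable_diff: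
 "square_integrable M f ==> square_integrable M g ==> square_integrable M (%x. f x - g x)"
 using square_integrable_add[of M f "%x. - g x"] square_integrable_uminus[of M g] by simp

lemma sq_norm_minus: "sq_norm M (%x. f x - g x) = sq_norm M (%x. g x - f x)"
 by (simp add: sq_norm_def norm_minus_commute)

lemma sq_norm_triangle_diff:
 assumes f: "square_integrable M f" and g: "square_integrable M g"
 shows "sq_norm M f <= sq_norm M g + sq_norm M (%x. f x - g x)"
 using sq_norm_triangle[OF g square_integrable_diff[OF f g]] by simp

text \<open>Riesz--Fischer: along a subsequence with \<open>norm (X (r (n+1)) - X (r n)) <= (1/2)^n\<close> the weighted
 sum of \<open>2^n * |difference|^2\<close> has a finite integral, so the differences decay geometrically
 almost everywhere; Fatou identifies the pointwise limit as the limit in norm.\<close>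

lemma square_integrable_complete:
 fixes X :: "nat => 'a => complex"
 assumes X: "!!n. square_integrable M (X n)"
  and C: "!!e. 0 < e ==> \<exists>N. \<forall>m\<ge>N. \<forall>n\<ge>N. sq_norm M (%x. X m x - X n x) < e"
 shows "\<exists>f. square_integrable M f \<and> (%n. sq_norm M (%x. X n x - f x)) ----> 0"
proof -
 obtain N where N: "!!k m n. N k <= m ==> N k <= n ==> sq_norm M (%x. X m x - X n x) < (1/2)^k"
  using C[of "(1/2)^k" for k] by (metis half_gt_zero zero_less_one zero_less_power)
 define r where "r k = (\<Sum>j\<le>k. N j)" for k
 have r: "N k <= r k" for k unfolding r_def by (rule member_le_sum) auto
 have rmono: "r k <= r l" if "k <= l" for k l unfolding r_def using that by (intro sum_mono2) auto
 define Y where "Y k = X (r k)" for k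
 have Ys: "square_integrable M (Y k)" for k using X by (simp add: Y_def)
 have Ym[measurable]: "Y k \<in> borel_measurable M" for k using Ys by (simp add: square_integrable_def)
 have Yd: "(\<integral>\<^sup>+x. ennreal ((cmod (Y l x - Y k x))^2) \<partial>M) <= ennreal (((1/2)^k)^2)" if "k <= l" for k l
 proof -
  have "sq_norm M (%x. Y l x - Y k x) < (1/2)^k"
   unfolding Y_def using N[of k "r l" "r k"] r[of k] rmono[OF that] by simp
  hence "(sq_norm M (%x. Y l x - Y k x))^2 <= ((1/2)^k)^2" by (intro power_mono) auto
  thus ?thesis unfolding nn_integral_sq_norm[OF square_integrable_diff[OF Ys Ys]] by (rule ennreal_leI)
 qed
 define d where "d k x = Y (Suc k) x - Y k x" for k x
 have dm[measurable]: "d k \<in> borel_measurable M" for k unfolding d_def by measurable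
 have "(\<integral>\<^sup>+x. (\<Sum>k. ennreal (2^k * (cmod (d k x))^2)) \<partial>M) = (\<Sum>k. \<integral>\<^sup>+x. ennreal (2^k * (cmod (d k x))^2) \<partial>M)"
  by (rule nn_integral_suminf) measurable
 also have "... <= (\<Sum>k. ennreal ((1/2)^k))"
 proof (intro suminf_le summableI)
  fix k
  have "(\<integral>\<^sup>+x. ennreal (2^k * (cmod (d k x))^2) \<partial>M) = ennreal (2^k) * (\<integral>\<^sup>+x. ennreal ((cmod (d k x))^2) \<partial>M)"
   by (subst nn_integral_cmult[symmetric]) (auto simp: ennreal_mult[symmetric])
  also have "... <= ennreal (2^k) * ennreal (((1/2)^k)^2)"
   unfolding d_def by (intro mult_left_mono Yd) auto
  also have "... = ennreal ((1/2)^k)"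
   by (subst ennreal_mult[symmetric]) (auto simp: power_mult_distrib[symmetric] power2_eq_square mult.assoc[symmetric])
  finally show "(\<integral>\<^sup>+x. ennreal (2^k * (cmod (d k x))^2) \<partial>M) <= ennreal ((1/2)^k)" .
 qed
 also have "... = ennreal 2"
  by (rule suminf_ennreal_eq) (use geometric_sums[of "1/2::real"] in auto)
 finally have "(\<integral>\<^sup>+x. (\<Sum>k. ennreal (2^k * (cmod (d k x))^2)) \<partial>M) ~= \<infinity>"
  by (auto simp: top_unique)
 hence "AE x in M. (\<Sum>k. ennreal (2^k * (cmod (d k x))^2)) ~= \<infinity>"
  by (intro nn_integral_PInf_AE) measurable
 hence conv: "AE x in M. convergent (%k. Y k x)"
 proof eventually_elim
  case (elim x)
  define s where "s = (\<Sum>k. ennreal (2^k * (cmod (d k x))^2))"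
  have "s ~= top" using elim by (simp only: s_def infinity_ennreal_def not_False_eq_True)
  then obtain C where C: "s = ennreal C" "0 <= C" by (cases s) auto
  note C = C[unfolded s_def]
  have "2^k * (cmod (d k x))^2 <= C" for k
  proof -
   have "ennreal (2^k * (cmod (d k x))^2) <= (\<Sum>k. ennreal (2^k * (cmod (d k x))^2))"
   proof (rule ccontr)
    assume "\<not> ?thesis"
    hence "(\<Sum>k. ennreal (2^k * (cmod (d k x))^2)) < ennreal (2^k * (cmod (d k x))^2)" by (simp only: not_le)
    from ennreal_suminf_lessD[OF this, of k] show False by (simp only: less_irrefl)
   qed
   thus ?thesis unfolding C(1) using C(2) by (simp only: ennreal_le_iff)
  qed
  hence "(sqrt 2 ^ k * cmod (d k x))^2 <= C" for k
   by (simp add: power_mult_distrib power_mult[symmetric] mult.commute[of k]) (simp add: power_mult)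
  hence "sqrt 2 ^ k * cmod (d k x) <= sqrt C" for k by (simp add: real_le_rsqrt)
  hence le: "cmod (d k x) <= sqrt C * (1 / sqrt 2) ^ k" for k
   by (simp add: power_one_over field_simps)
  have "summable (%k. sqrt C * (1 / sqrt 2) ^ k)"
   by (intro summable_mult summable_geometric) (auto simp: real_less_lsqrt)
  hence "summable (%k. d k x)" by (rule summable_comparison_test') (use le in auto)
  hence "(%n. \<Sum>k<n. d k x) ----> (\<Sum>k. d k x)" by (rule summable_LIMSEQ)
  moreover have "(\<Sum>k<n. d k x) = Y n x - Y 0 x" for n unfolding d_def by (induction n) auto
  ultimately have "(%n. Y n x - Y 0 x) ----> (\<Sum>k. d k x)" by simp
  hence "(%n. Y n x - Y 0 x + Y 0 x) ----> (\<Sum>k. d k x) + Y 0 x" by (intro tendsto_intros)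
  thus "convergent (%k. Y k x)" by (auto simp: convergent_def)
 qed
 define f where "f x = lim (%k. Y k x)" for x
 have fm[measurable]: "f \<in> borel_measurable M"
  unfolding f_def by (rule borel_measurable_lim_metric) measurable
 have lim: "AE x in M. (%k. Y k x) ----> f x"
  using conv by eventually_elim (simp add: f_def convergent_LIMSEQ_iff)
 have fY: "(\<integral>\<^sup>+x. ennreal ((cmod (f x - Y k x))^2) \<partial>M) <= ennreal (((1/2)^k)^2)" for k
 proof -
  have "(\<integral>\<^sup>+x. ennreal ((cmod (f x - Y k x))^2) \<partial>M) = (\<integral>\<^sup>+x. liminf (%l. ennreal ((cmod (Y l x - Y k x))^2)) \<partial>M)"
  proof (rule nn_integral_cong_AE)
   show "AE x in M. ennreal ((cmod (f x - Y k x))^2) = liminf (%l. ennreal ((cmod (Y l x - Y k x))^2))"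
    using lim
   proof eventually_elim
    case (elim x)
    hence "(%l. ennreal ((cmod (Y l x - Y k x))^2)) ----> ennreal ((cmod (f x - Y k x))^2)"
     by (intro tendsto_intros tendsto_ennrealI)
    thus ?case by (intro lim_imp_Liminf[symmetric]) auto
   qed
  qed
  also have "... <= liminf (%l. \<integral>\<^sup>+x. ennreal ((cmod (Y l x - Y k x))^2) \<partial>M)"
   by (rule nn_integral_liminf) measurable
  also have "... <= ennreal (((1/2)^k)^2)"
  proof (rule Liminf_le)
   show "\<forall>\<^sub>F l in sequentially. (\<integral>\<^sup>+x. ennreal ((cmod (Y l x - Y k x))^2) \<partial>M) <= ennreal (((1/2)^k)^2)"
    using eventually_ge_at_top[of k] by eventually_elim (rule Yd)
  qed simp
  finally show ?thesis .
 qed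
 have "integrable M (%x. (cmod (f x - Y 0 x))^2)"
  by (rule integrableI_bounded) (use fY[of 0] in \<open>auto simp: le_less_trans\<close>)
 hence "square_integrable M (%x. f x - Y 0 x)" by (simp add: square_integrable_def)
 from square_integrable_add[OF this, of "Y 0"] have sf: "square_integrable M f"
  using Ys by simp
 have fYk: "sq_norm M (%x. f x - Y k x) <= (1/2)^k" for k
 proof -
  have "(sq_norm M (%x. f x - Y k x))^2 <= ((1/2)^k)^2"
   using fY[of k] unfolding nn_integral_sq_norm[OF square_integrable_diff[OF sf Ys]] by simp
  thus ?thesis by (rule power2_le_imp_le) simp
 qed
 have "(%n. sq_norm M (%x. X n x - f x)) ----> 0"
 proof (rule LIMSEQ_I)
  fix e :: real assume e: "0 < e"
  obtain k where k: "(1/2::real)^k < e/2" using real_arch_pow_inv[of "e/2" "1/2"] e by auto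
  show "\<exists>n0. \<forall>n\<ge>n0. norm (sq_norm M (%x. X n x - f x) - 0) < e"
  proof (intro exI allI impI)
   fix n assume "n \<ge> N k"
   hence "sq_norm M (%x. X n x - Y k x) < (1/2)^k" unfolding Y_def using N r by blast
   moreover have "sq_norm M (%x. X n x - f x) <= sq_norm M (%x. X n x - Y k x) + sq_norm M (%x. Y k x - f x)"
    using sq_norm_triangle[OF square_integrable_diff[OF X Ys] square_integrable_diff[OF Ys sf], of n k k] by simp
   ultimately show "norm (sq_norm M (%x. X n x - f x) - 0) < e"
    using fYk[of k] k sq_norm_minus[of M f "Y k"] by simp
  qed
 qed
 thus ?thesis using sf by blast
qed

lemma sq_norm_rep_diff: "sq_norm lebesgue (%x. rep_l2 f x - rep_l2 g x) = norm (f - g)"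
 unfolding sq_norm_def l2_dist_sq_lebesgue[symmetric] by simp

instance l2 :: (euclidean_space) complete_space
proof
 fix X :: "nat => 'a l2" assume X: "Cauchy X"
 have "\<exists>f. square_integrable lebesgue f \<and> (%n. sq_norm lebesgue (%x. rep_l2 (X n) x - f x)) ----> 0"
  by (rule square_integrable_complete) (use X in \<open>auto simp: sq_norm_rep_diff Cauchy_def dist_norm\<close>)
 then obtain f where f: "square_integrable lebesgue f" "(%n. sq_norm lebesgue (%x. rep_l2 (X n) x - f x)) ----> 0" by blast
 have "sq_norm lebesgue (%x. rep_l2 (X n) x - f x) = norm (X n - abs_l2 f)" for n
  unfolding sq_norm_rep_diff[symmetric]
  by (rule sq_norm_cong_AE) (use f(1) rep_abs_l2[OF f(1)] in \<open>auto simp: square_integrable_def\<close>)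
 hence "X ----> abs_l2 f" using f(2) by (simp add: LIM_zero_iff tendsto_norm_zero_iff)
 thus "convergent X" by (auto simp: convergent_def)
qed

section \<open>Coercive forms and their operators\<close>

text \<open>Completeness is demanded in the norm of the form itself, so the domain needs no topology
  of its own. Antilinearity in the second argument follows from symmetry.\<close>

locale coercive_form =
 fixes D :: "'a::euclidean_space l2 set" and t :: "'a l2 => 'a l2 => complex" and c :: real
 assumes D_add: "f \<in> D ==> g \<in> D ==> f + g \<in> D"
  and D_scale: "f \<in> D ==> scaleC_l2 a f \<in> D"
  and D_zero: "0 \<in> D"
  and t_add: "f \<in> D ==> g \<in> D ==> h \<in> D ==> t (f + g) h = t f h + t g h"
  and t_scale: "f \<in> D ==> h \<in> D ==> t (scaleC_l2 a f) h = a * t f h"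
  and t_sym: "f \<in> D ==> g \<in> D ==> t f g = cnj (t g f)"
  and c_pos: "0 < c"
  and coercive: "f \<in> D ==> c * (norm f)^2 <= Re (t f f)"
  and complete: "!!X. (!!n::nat. X n \<in> D) ==>
    (!!e. 0 < e ==> \<exists>N. \<forall>m\<ge>N. \<forall>n\<ge>N. Re (t (X m - X n) (X m - X n)) < e) ==>
    \<exists>u\<in>D. (%n. Re (t (X n - u) (X n - u))) ----> 0"
begin

abbreviation q where "q f \<equiv> Re (t f f)"

lemma D_uminus: "f \<in> D ==> - f \<in> D" unfolding scaleC_minus1 by (rule D_scale)

lemma D_diff: "f \<in> D ==> g \<in> D ==> f - g \<in> D"
 using D_add[of f "- g"] D_uminus by simp

lemma t_add_right: "f \<in> D ==> g \<in> D ==> h \<in> D ==> t h (f + g) = t h f + t h g"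
 using t_sym[of h "f + g"] t_sym[of h f] t_sym[of h g] by (simp add: D_add t_add)

lemma t_scale_right: "f \<in> D ==> h \<in> D ==> t h (scaleC_l2 a f) = cnj a * t h f"
 using t_sym[of h "scaleC_l2 a f"] t_sym[of h f] by (simp add: D_scale t_scale)

lemma t_diff: "f \<in> D ==> g \<in> D ==> h \<in> D ==> t (f - g) h = t f h - t g h"
 using t_add[of f "- g" h] t_scale[of g h "-1"] by (simp add: D_uminus scaleC_minus1[symmetric])

lemma q_nonneg: "f \<in> D ==> 0 <= q f"
 using coercive[of f] c_pos by (smt (verit) mult_nonneg_nonneg zero_le_power2)

lemma q_expand: "f \<in> D ==> g \<in> D ==> q (f + scaleC_l2 (of_real s) g) = q f + 2 * s * Re (t f g) + s^2 * q g"
 using t_sym[of g f] by (simp add: t_add t_add_right t_scale t_scale_right D_add D_scale power2_eq_square algebra_simps)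

lemma q_zeroD: "f \<in> D ==> q f = 0 ==> f = 0"
 using coercive[of f] c_pos by (simp add: mult_le_0_iff)

lemma cauchy_schwarz_q:
 assumes "f \<in> D" "g \<in> D" shows "(Re (t f g))^2 <= q f * q g"
proof (cases "q g = 0")
 case True
 hence "g = 0" using q_zeroD assms by blast
 hence "t f g = 0" using t_scale_right[OF assms(2,1), of 0] by simp
 thus ?thesis using True by simp
next
 case False
 hence g: "0 < q g" using q_nonneg[OF assms(2)] by simp
 have "0 <= q (f + scaleC_l2 (of_real (- Re (t f g) / q g)) g)"
  by (intro q_nonneg D_add D_scale assms)
 also have "... = q f - (Re (t f g))^2 / q g"
  unfolding q_expand[OF assms] using g by (simp add: power2_eq_square field_simps)
 finally show ?thesis using g by (simp add: field_simps)
qed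

text \<open>Variational proof: the solution minimises q g - 2 Re (l g). This functional is bounded
  below by Young's inequality, minimising sequences are Cauchy by the parallelogram law, and the
  first variation at the limit is the equation.\<close>

lemma riesz_form:
 assumes l_add: "!!g h. g \<in> D ==> h \<in> D ==> l (g + h) = l g + l h"
  and l_scale: "!!a g. g \<in> D ==> l (scaleC_l2 a g) = cnj a * l g"
  and l_bound: "!!g. g \<in> D ==> (cmod (l g))^2 <= K * q g"
 shows "\<exists>u\<in>D. \<forall>g\<in>D. t u g = l g"
proof -
 define F where "F g = q g - 2 * Re (l g)" for g
 have K: "0 <= max K 1" by simp
 have F_lower: "- (max K 1) <= F g" if "g \<in> D" for g
 proof -
  have "(Re (l g))^2 <= (cmod (l g))^2" using abs_Re_le_cmod[of "l g"] by (simp add: abs_le_square_iff[symmetric])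
  also have "... <= max K 1 * q g"
   using l_bound[OF that] mult_right_mono[OF max.cobounded1[of K 1] q_nonneg[OF that]] by linarith
  finally have "(Re (l g))^2 <= max K 1 * q g" .
  moreover have "2 * Re (l g) * max K 1 <= (Re (l g))^2 + (max K 1)^2"
   using sum_squares_bound[of "Re (l g)" "max K 1"] by simp
  ultimately have "2 * Re (l g) * max K 1 <= (q g + max K 1) * max K 1"
   by (simp add: power2_eq_square algebra_simps)
  hence "2 * Re (l g) <= q g + max K 1" by (rule mult_right_le_imp_le) simp
  thus ?thesis by (simp add: F_def)
 qed
 define m where "m = Inf (F ` D)"
 have bdd: "bdd_below (F ` D)" using F_lower by (auto intro!: bdd_belowI)
 have m: "m <= F g" if "g \<in> D" for g unfolding m_def using bdd that by (auto intro: cInf_lower)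
 have "\<exists>g\<in>D. F g < m + 1 / real (Suc n)" for n
 proof -
  have "Inf (F ` D) < m + 1 / real (Suc n)" by (simp add: m_def)
  thus ?thesis using D_zero bdd by (subst (asm) cInf_less_iff) auto
 qed
 then obtain X where X: "!!n. X n \<in> D" "!!n. F (X n) < m + 1 / real (Suc n)" by metis
 \<comment> \<open>Parallelogram law at the midpoint \<open>h\<close>: the linear parts cancel in 2
   F (X i) + 2 F (X j) - 4 F h, and F h is at least the infimum \<open>m\<close>.\<close>
 have dist: "q (X i - X j) <= 2 / real (Suc i) + 2 / real (Suc j)" for i j
 proof -
  define h where "h = scaleC_l2 (of_real (1/2)) (X i + X j)"
  have h: "h \<in> D" unfolding h_def by (intro D_scale D_add X)
  have 1: "q (X i + scaleC_l2 (of_real (-1)) (X j)) = q (X i) + 2 * (-1) * Re (t (X i) (X j)) + (-1)^2 * q (X j)"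
   by (rule q_expand) (rule X)+
  have 2: "q (X i + scaleC_l2 (of_real 1) (X j)) = q (X i) + 2 * 1 * Re (t (X i) (X j)) + 1^2 * q (X j)"
   by (rule q_expand) (rule X)+
  have 3: "q h = (1/4) * q (X i + X j)"
   unfolding h_def using X by (simp add: t_scale t_scale_right D_add D_scale)
  have 4: "Re (l h) = (1/2) * (Re (l (X i)) + Re (l (X j)))"
   unfolding h_def using X by (simp add: l_scale l_add D_add)
  have e: "X i + scaleC_l2 (of_real (-1)) (X j) = X i - X j" "X i + scaleC_l2 (of_real 1) (X j) = X i + X j"
   using scaleC_minus1[of "X j"] by simp_all
  have "q (X i - X j) = 2 * F (X i) + 2 * F (X j) - 4 * F h"
   using 1[unfolded e] 2[unfolded e] 3 4 unfolding F_def by simp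
  also have "... <= 2 * (m + 1 / real (Suc i)) + 2 * (m + 1 / real (Suc j)) - 4 * m"
  proof -
   have "2 * F (X i) <= 2 * (m + 1 / real (Suc i))" "2 * F (X j) <= 2 * (m + 1 / real (Suc j))"
    using X(2)[of i] X(2)[of j] by (simp_all only: mult_le_cancel_left_pos zero_less_numeral less_imp_le)
   moreover have "4 * m <= 4 * F h" using m[OF h] by simp
   ultimately show ?thesis by linarith
  qed
  finally show ?thesis by simp
 qed
 have "\<exists>u\<in>D. (%n. Re (t (X n - u) (X n - u))) ----> 0"
 proof (rule complete)
  fix e :: real assume e: "0 < e"
  obtain N where N: "1 / real (Suc N) < e / 4" using nat_approx_posE[of "e/4"] e by (metis zero_less_divide_iff zero_less_numeral)
  show "\<exists>N. \<forall>m\<ge>N. \<forall>n\<ge>N. q (X m - X n) < e"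
  proof (intro exI allI impI)
   fix i j assume ij: "N <= i" "N <= j"
   hence "1 / real (Suc i) <= 1 / real (Suc N)" "1 / real (Suc j) <= 1 / real (Suc N)"
    by (simp_all add: frac_le)
   thus "q (X i - X j) < e" using dist[of i j] N by simp
  qed
 qed (rule X)
 then obtain u where u: "u \<in> D" "(%n. q (X n - u)) ----> 0" by blast
 have re: "Re (t u g) = Re (l g)" if g: "g \<in> D" for g
 proof -
  have lim: "(%n. Re (t (X n) g)) ----> Re (t u g)"
  proof (rule LIM_zero_cancel, rule tendsto_rabs_zero_cancel, rule real_tendsto_sandwich[OF _ _ tendsto_const])
   have "(%n. sqrt (q (X n - u) * q g)) ----> sqrt (0 * q g)" by (intro tendsto_intros u)
   thus "(%n. sqrt (q (X n - u) * q g)) ----> 0" by simp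
   show "\<forall>\<^sub>F n in sequentially. \<bar>Re (t (X n) g) - Re (t u g)\<bar> <= sqrt (q (X n - u) * q g)"
    using cauchy_schwarz_q[OF D_diff[OF X(1) u(1)] g] t_diff[OF X(1) u(1) g] by (simp add: real_le_rsqrt)
  qed auto
  define A where "A = Re (t u g) - Re (l g)"
  have quad: "0 <= 2 * r * A + r^2 * q g" for r
  proof -
   have "0 <= 1 / real (Suc n) + 2 * r * (Re (t (X n) g) - Re (l g)) + r^2 * q g" for n
   proof -
    have "m <= F (X n + scaleC_l2 (of_real r) g)" by (intro m D_add D_scale X g)
    also have "... = F (X n) + 2 * r * (Re (t (X n) g) - Re (l g)) + r^2 * q g"
     unfolding F_def q_expand[OF X(1) g] using X g by (simp add: l_add l_scale D_scale algebra_simps)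
    finally show ?thesis using X(2)[of n] by simp
   qed
   hence "0 <= 0 + 2 * r * A + r^2 * q g" unfolding A_def
    by (intro LIMSEQ_le_const[OF tendsto_add[OF tendsto_add[OF lim_1_over_n[THEN LIMSEQ_Suc] tendsto_mult[OF tendsto_const tendsto_diff[OF lim tendsto_const]]] tendsto_const]]) auto
   thus ?thesis by simp
  qed
  \<comment> \<open>The 1 keeps \<open>B\<close> positive when q g = 0; the quadratic inequality is
    then tested at r = - A / B.\<close>
  define B where "B = q g + 1"
  have B: "0 < B" "q g < B" using q_nonneg[OF g] by (simp_all add: B_def)
  have "0 <= 2 * (- A / B) * A + (A / B)^2 * B"
   using quad[of "- A / B"] mult_left_mono[of "q g" B "(A / B)^2"] B by (simp add: power2_eq_square)
  also have "... = - (A^2 / B)" using B by (simp add: power2_eq_square field_simps)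
  finally have "A = 0" using B by (simp add: divide_le_0_iff)
  thus ?thesis by (simp add: A_def)
 qed
 have "t u g = l g" if g: "g \<in> D" for g
 proof (rule complex_eqI)
  show "Re (t u g) = Re (l g)" by (rule re[OF g])
  \<comment> \<open>Both sides are antilinear in \<open>g\<close>, so the real part at \<i> g is the
    imaginary part at \<open>g\<close>.\<close>
  have "Re (t u (scaleC_l2 \<i> g)) = Re (l (scaleC_l2 \<i> g))" by (rule re[OF D_scale[OF g]])
  thus "Im (t u g) = Im (l g)" using u g by (simp add: t_scale_right l_scale)
 qed
 thus ?thesis using u by blast
qed

lemma riesz_form_unique: "u \<in> D ==> v \<in> D ==> \<forall>g\<in>D. t u g = t v g ==> u = v"
 using q_zeroD[of "u - v"] D_diff[of u v] by (simp add: t_diff)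

text \<open>The solution operator of the weak problem with right-hand side \<open>h\<close>, that
  is, the inverse of the operator that the form represents.\<close>

definition Rop where "Rop h = (SOME u. u \<in> D \<and> (\<forall>g\<in>D. t u g = cinner_l2 h g))"

lemma Rop: "Rop h \<in> D" "g \<in> D ==> t (Rop h) g = cinner_l2 h g"
proof -
 have "\<exists>u\<in>D. \<forall>g\<in>D. t u g = cinner_l2 h g"
 proof (rule riesz_form)
  fix g assume g: "g \<in> D"
  have "(cmod (cinner_l2 h g))^2 <= (norm h * norm g)^2" by (intro power_mono cinner_bound) auto
  also have "... = ((norm h)^2 / c) * (c * (norm g)^2)" using c_pos by (simp add: power_mult_distrib)
  also have "... <= ((norm h)^2 / c) * q g" using c_pos by (intro mult_left_mono coercive g) auto
  finally show "(cmod (cinner_l2 h g))^2 <= ((norm h)^2 / c) * q g" .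
 qed (auto simp: cinner_add_right cinner_scaleC_right)
 hence "Rop h \<in> D \<and> (\<forall>g\<in>D. t (Rop h) g = cinner_l2 h g)"
  unfolding Rop_def Bex_def by (rule someI_ex)
 note * = this
 show "Rop h \<in> D" using * by (rule conjunct1)
 show "t (Rop h) g = cinner_l2 h g" if "g \<in> D" using conjunct2[OF *] that by (rule bspec)
qed

lemma Rop_eqI: "u \<in> D ==> (!!g. g \<in> D ==> t u g = cinner_l2 h g) ==> Rop h = u"
 by (rule riesz_form_unique) (auto simp: Rop)

lemma Rop_add: "Rop (f + g) = Rop f + Rop g"
 by (rule Rop_eqI) (auto simp: D_add t_add Rop cinner_add_left)

lemma Rop_scaleC: "Rop (scaleC_l2 a f) = scaleC_l2 a (Rop f)"
 by (rule Rop_eqI) (auto simp: D_scale t_scale Rop cinner_scaleC_left)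

lemma Rop_sym: "cinner_l2 (Rop f) g = cinner_l2 f (Rop g)"
proof -
 have "cinner_l2 (Rop f) g = cnj (t (Rop g) (Rop f))"
  using cinner_commute[of "Rop f" g] by (simp add: Rop)
 also have "... = t (Rop f) (Rop g)" using t_sym[of "Rop f" "Rop g"] by (simp add: Rop)
 finally show ?thesis by (simp add: Rop)
qed

lemma Rop_bound: "norm (Rop f) <= norm f / c"
proof -
 have "c * (norm (Rop f))^2 <= Re (cinner_l2 f (Rop f))"
  using coercive[OF Rop(1)[of f]] Rop(2)[OF Rop(1), of f f] by simp
 also have "... <= norm f * norm (Rop f)"
  using cinner_bound[of f "Rop f"] complex_Re_le_cmod order_trans by blast
 finally have "(c * norm (Rop f)) * norm (Rop f) <= norm f * norm (Rop f)" by (simp add: power2_eq_square)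
 hence "c * norm (Rop f) <= norm f \<or> norm (Rop f) = 0"
  by (cases "norm (Rop f) = 0") (auto dest: mult_right_le_imp_le)
 thus ?thesis using c_pos by (auto simp: field_simps)
qed

text \<open>If \<open>Rop f\<close> vanishes then \<open>f\<close> is orthogonal to the dense set
  \<open>D\<close>.\<close>

lemma Rop_inj:
 assumes dense: "closure D = UNIV" and "Rop f = 0"
 shows "f = 0"
proof -
 have "cinner_l2 f g = 0" if "g \<in> D" for g
  using Rop(2)[OF that, of f] assms(2) t_scale[OF D_zero that, of 0] by simp
 hence D: "D \<subseteq> {g. inner f g = 0}" by (auto simp: inner_l2_def)
 have "closed {g. inner f g = 0}" by (intro closed_Collect_eq continuous_intros)
 with D have "closure D \<subseteq> {g. inner f g = 0}" by (rule closure_minimal)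
 hence "f \<in> {g. inner f g = 0}" using dense by blast
 hence "inner f f = 0" by simp
 thus ?thesis by simp
qed

end

text \<open>Turns the Riesz argument into two standard facts: with \<open>T\<close> the identity on
  a closed subspace, \<open>Rop\<close> is the orthogonal projection; with \<open>T\<close> bounded
  below on the whole space, \<open>Rop\<close> inverts the product of the adjoint of
  \<open>T\<close> with \<open>T\<close>.\<close>

lemma coercive_form_image:
 assumes "!!f g. f \<in> M ==> g \<in> M ==> f + g \<in> M" "!!a f. f \<in> M ==> scaleC_l2 a f \<in> M" "0 \<in> M" "closed M"
  and T: "bounded_linear T" "!!a f. T (scaleC_l2 a f) = scaleC_l2 a (T f)" and c: "0 < c" "!!f. c * norm f <= norm (T f)"
 shows "coercive_form M (%f g. cinner_l2 (T f) (T g)) (c^2)"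
proof
 have q: "Re (cinner_l2 f f) = (norm f)^2" for f :: "'b l2" by (simp add: cinner_self del: of_real_power)
 show "c^2 * (norm f)^2 <= Re (cinner_l2 (T f) (T f))" for f
  using power_mono[OF c(2)[of f], of 2] c(1) by (simp add: q power_mult_distrib)
 show "cinner_l2 (T f) (T g) = cnj (cinner_l2 (T g) (T f))" for f g by (rule cinner_commute)
 fix X :: "nat => 'a l2" assume X: "!!n. X n \<in> M"
  and C: "!!e. 0 < e ==> \<exists>N. \<forall>m\<ge>N. \<forall>n\<ge>N. Re (cinner_l2 (T (X m - X n)) (T (X m - X n))) < e"
 have "Cauchy X"
 proof (rule CauchyI)
  fix e :: real assume e: "0 < e"
  obtain N where N: "\<forall>m\<ge>N. \<forall>n\<ge>N. (norm (T (X m - X n)))^2 < (c * e)^2" using C[of "(c * e)^2"] e c by (auto simp: q)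
  have "norm (X m - X n) < e" if "m \<ge> N" "n \<ge> N" for m n
  proof -
   have "norm (T (X m - X n)) < c * e" using N that c e by (intro power2_less_imp_less[of _ "c * e"]) auto
   hence "c * norm (X m - X n) < c * e" using c(2)[of "X m - X n"] by linarith
   thus ?thesis using c by simp
  qed
  thus "\<exists>N. \<forall>m\<ge>N. \<forall>n\<ge>N. norm (X m - X n) < e" by blast
 qed
 then obtain u where u: "X ----> u" using Cauchy_convergent_iff convergent_def by blast
 hence "u \<in> M" using assms(4) X closed_sequentially by blast
 moreover have "(%n. (norm (T (X n - u)))^2) ----> (norm (T 0))^2"
  by (intro tendsto_power tendsto_norm bounded_linear.tendsto[OF T(1)] LIM_zero u)
 ultimately show "\<exists>u\<in>M. (%n. Re (cinner_l2 (T (X n - u)) (T (X n - u)))) ----> 0"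
  using linear_0[OF bounded_linear.linear[OF T(1)]] by (auto simp: q)
qed (use assms(1-3) c in \<open>auto simp: cinner_add_left cinner_scaleC_left linear_add[OF bounded_linear.linear[OF T(1)]] T(2)\<close>)

lemma bounded_linear_scaleC: "bounded_linear (scaleC_l2 a)"
 by (rule bounded_linear_intro[of _ "cmod a"])
  (auto simp: scaleC_add_right scaleR_scaleC scaleC_scaleC norm_scaleC mult.commute)

text \<open>The graph of the operator \<open>B\<close> with \<open>(B - \<mu>)\<inverse> = R\<close>.\<close>

definition op_of_inv :: "('a::euclidean_space l2 => 'a l2) => real => 'a l2_op" where
 "op_of_inv R \<mu> = {(R h, h + scaleC_l2 (of_real \<mu>) (R h)) | h. True}"

text \<open>A bounded symmetric injective operator is the inverse of a self-adjoint one. Working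
  with \<open>R\<close> in place of the unbounded operator keeps every argument free of
  domains.\<close>

locale sym_inv =
 fixes R :: "'a::euclidean_space l2 => 'a l2" and C :: real
 assumes R_add: "R (f + g) = R f + R g"
  and R_scale: "R (scaleC_l2 a f) = scaleC_l2 a (R f)"
  and R_sym: "cinner_l2 (R f) g = cinner_l2 f (R g)"
  and R_bound: "norm (R f) <= C * norm f"
  and R_inj: "R f = 0 ==> f = 0"
begin

lemma R_diff: "R (f - g) = R f - R g"
 using R_add[of f "- g"] R_scale[of "-1" g] by (simp add: scaleC_minus1[symmetric])

lemma res_diff: "(k - k') - scaleC_l2 w (R (k - k')) = (k - scaleC_l2 w (R k)) - (k' - scaleC_l2 w (R k'))"
 by (simp add: R_diff scaleC_diff_right algebra_simps)

lemma R_eqD: "R f = R g ==> f = g"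
 using R_inj[of "f - g"] by (simp add: R_diff)

lemma R_zero: "R 0 = 0" using R_diff[of 0 0] by simp

lemma R_bl: "bounded_linear R"
proof (rule bounded_linear_intro)
 show "norm (R f) <= norm f * C" for f using R_bound[of f] by (simp add: mult.commute)
qed (auto simp: R_add R_scale scaleR_scaleC)

text \<open>The part of \<open>f\<close> orthogonal to the closed range is annihilated by
  \<open>R\<close>, because \<open>R\<close> is symmetric, and therefore vanishes by
  injectivity.\<close>

lemma range_dense: "closure (range R) = UNIV"
proof -
 define M where "M = closure (range R)"
 have RM: "R g \<in> M" for g unfolding M_def by (rule subsetD[OF closure_subset rangeI])
 have "subspace (range R)" by (rule linear_subspace_image[OF bounded_linear.linear[OF R_bl] subspace_UNIV])
 hence cM: "convex M" unfolding M_def by (intro convex_closure subspace_imp_convex)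
 have Msc: "scaleC_l2 a f \<in> M" if f: "f \<in> M" for a f
 proof -
  have "scaleC_l2 a ` closure (range R) \<subseteq> closure (scaleC_l2 a ` range R)"
   by (intro image_closure_subset[OF _ closed_closure] closure_subset linear_continuous_on bounded_linear_scaleC)
  also have "... \<subseteq> closure (range R)" by (intro closure_mono) (auto simp: R_scale[symmetric])
  finally show ?thesis using f by (auto simp: M_def)
 qed
 have Madd: "f + g \<in> M" if "f \<in> M" "g \<in> M" for f g
  using Msc[OF convexD[OF cM that, of "1/2" "1/2"], of 2] by (simp add: scaleR_scaleC scaleC_add_right scaleC_scaleC)
 \<comment> \<open>For the inner product restricted to the closed subspace \<open>M\<close>,
   \<open>M.Rop f\<close> is the orthogonal projection of \<open>f\<close> onto
   \<open>M\<close>.\<close>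
 interpret M: coercive_form M cinner_l2 "1^2"
  by (rule coercive_form_image[where T="%f. f", OF Madd Msc]) (use RM[of 0] in \<open>auto simp: M_def bounded_linear_ident R_zero\<close>)
 have "f \<in> M" for f
 proof -
  have "cinner_l2 (R (f - M.Rop f)) g = 0" for g
   unfolding R_sym cinner_diff_left using M.Rop(2)[OF RM, of f g] by simp
  from this[of "R (f - M.Rop f)"] have "R (f - M.Rop f) = 0" by (simp add: cinner_self)
  hence "f = M.Rop f" using R_inj by force
  thus ?thesis using M.Rop(1)[of f] by simp
 qed
 thus ?thesis by (auto simp: M_def)
qed

lemma Domain_op: "Domain (op_of_inv R \<mu>) = range R"
 by (auto simp: op_of_inv_def)

lemma mem_op_iff: "(R h, g) \<in> op_of_inv R \<mu> \<longleftrightarrow> g = h + scaleC_l2 (of_real \<mu>) (R h)"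
 by (auto simp: op_of_inv_def dest: R_eqD)

lemma self_adjoint_op: "self_adjoint (op_of_inv R \<mu>)"
 unfolding self_adjoint_def Domain_op
proof (intro conjI range_dense set_eqI iffI)
 fix p assume "p \<in> adjoint_op (op_of_inv R \<mu>)"
 then obtain f g where p: "p = (f, g)" and *: "!!h. cinner_l2 (h + scaleC_l2 (of_real \<mu>) (R h)) f = cinner_l2 (R h) g"
  unfolding adjoint_op_def op_of_inv_def by blast
 define k where "k = g - scaleC_l2 (of_real \<mu>) f"
 have "cinner_l2 h (f - R k) = 0" for h
  using *[of h] by (simp add: k_def cinner_add_left cinner_scaleC_left cinner_diff_right R_sym[symmetric] cinner_scaleC_right algebra_simps)
 from this[of "f - R k"] have "f = R k" by (simp add: cinner_self)
 moreover have "g = k + scaleC_l2 (of_real \<mu>) f" by (simp add: k_def)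
 ultimately show "p \<in> op_of_inv R \<mu>" using mem_op_iff[of k g] unfolding p by metis
next
 fix p assume "p \<in> op_of_inv R \<mu>"
 then obtain h where p: "p = (R h, h + scaleC_l2 (of_real \<mu>) (R h))" by (auto simp: op_of_inv_def)
 show "p \<in> adjoint_op (op_of_inv R \<mu>)"
  unfolding adjoint_op_def p op_of_inv_def
  by (auto simp: cinner_add_left cinner_add_right cinner_scaleC_left cinner_scaleC_right R_sym)
qed

text \<open>Every element of the domain is \<open>R k\<close>; substituting it turns the resolvent
  equation at \<open>z\<close> into k - (z - \<mu>) R k = f, an equation for the bounded operator
  \<open>R\<close>.\<close>

lemma resolvent_eqI:
 assumes "!!f. h f - scaleC_l2 (z - of_real \<mu>) (R (h f)) = f"
  and "!!k. k - scaleC_l2 (z - of_real \<mu>) (R k) = 0 ==> k = 0"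
 shows "\<exists>!u. (u, f + scaleC_l2 z u) \<in> op_of_inv R \<mu>" "resolvent (op_of_inv R \<mu>) z f = R (h f)"
proof -
 have 1: "(R k, f + scaleC_l2 z (R k)) \<in> op_of_inv R \<mu> \<longleftrightarrow> k = h f" for k
 proof -
  have "(R k, f + scaleC_l2 z (R k)) \<in> op_of_inv R \<mu> \<longleftrightarrow> f + scaleC_l2 z (R k) = k + scaleC_l2 (of_real \<mu>) (R k)"
   by (rule mem_op_iff)
  also have "... \<longleftrightarrow> k - scaleC_l2 (z - of_real \<mu>) (R k) = f"
   by (auto simp: scaleC_diff_left algebra_simps)
  also have "... \<longleftrightarrow> k = h f"
  proof
   assume "k - scaleC_l2 (z - of_real \<mu>) (R k) = f"
   hence "(k - h f) - scaleC_l2 (z - of_real \<mu>) (R (k - h f)) = 0"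
    unfolding res_diff using assms(1)[of f] by simp
   thus "k = h f" using assms(2)[of "k - h f"] by simp
  qed (simp add: assms)
  finally show ?thesis .
 qed
 have 2: "(u, f + scaleC_l2 z u) \<in> op_of_inv R \<mu> \<longleftrightarrow> u = R (h f)" for u
 proof
  assume a: "(u, f + scaleC_l2 z u) \<in> op_of_inv R \<mu>"
  then obtain k where "u = R k" by (auto simp: op_of_inv_def)
  thus "u = R (h f)" using a 1 by simp
 qed (simp add: 1)
 thus "\<exists>!u. (u, f + scaleC_l2 z u) \<in> op_of_inv R \<mu>" by auto
 show "resolvent (op_of_inv R \<mu>) z f = R (h f)" unfolding resolvent_def 2 by simp
qed

lemma resolvent_base:
 "of_real \<mu> \<in> resolvent_set (op_of_inv R \<mu>)" "resolvent (op_of_inv R \<mu>) (of_real \<mu>) = R"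
proof -
 have 1: "\<exists>!u. (u, f + scaleC_l2 (of_real \<mu>) u) \<in> op_of_inv R \<mu>" and 2: "resolvent (op_of_inv R \<mu>) (of_real \<mu>) f = R f" for f
  using resolvent_eqI[of "%f. f" "of_real \<mu>" \<mu> f] by auto
 from 2 show e: "resolvent (op_of_inv R \<mu>) (of_real \<mu>) = R" by auto
 show "of_real \<mu> \<in> resolvent_set (op_of_inv R \<mu>)" unfolding resolvent_set_def using 1 R_bl e by simp
qed

text \<open>The number <R h, h> is real, so pairing h - w R h with w h leaves the imaginary part Im
  (cnj w) |h|^2.\<close>

lemma lower_bound:
 assumes "Im w ~= 0"
 shows "(\<bar>Im w\<bar> / cmod w) * norm h <= norm (h - scaleC_l2 w (R h))"
proof -
 have w: "w ~= 0" using assms by auto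
 have "Im (cinner_l2 (R h) h) = 0" using R_sym[of h h] cinner_commute[of h "R h"] by (metis cnj.simps(2) equal_neg_zero)
 moreover have "cinner_l2 (h - scaleC_l2 w (R h)) (scaleC_l2 w h) = cnj w * of_real ((norm h)^2) - of_real ((cmod w)^2) * cinner_l2 (R h) h"
  by (simp add: cinner_diff_left cinner_scaleC_left cinner_scaleC_right cinner_self complex_norm_square algebra_simps del: of_real_power)
 ultimately have "\<bar>Im w\<bar> * (norm h)^2 = \<bar>Im (cinner_l2 (h - scaleC_l2 w (R h)) (scaleC_l2 w h))\<bar>"
  by (simp add: abs_mult)
 also have "... <= norm (h - scaleC_l2 w (R h)) * norm (scaleC_l2 w h)"
  using abs_Im_le_cmod cinner_bound order_trans by blast
 finally have "(\<bar>Im w\<bar> * norm h) * norm h <= (cmod w * norm (h - scaleC_l2 w (R h))) * norm h"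
  by (simp add: norm_scaleC power2_eq_square mult_ac)
 hence "\<bar>Im w\<bar> * norm h <= cmod w * norm (h - scaleC_l2 w (R h)) \<or> norm h = 0"
  by (cases "norm h = 0") (auto dest: mult_right_le_imp_le)
 thus ?thesis using w by (auto simp: field_simps)
qed

text \<open>The adjoint of 1 - w R is 1 - cnj w R, which is bounded below by
  \<open>lower_bound\<close>. Hence the product of 1 - w R with its adjoint can be inverted, and 1 -
  w R is onto.\<close>

lemma nonreal_surj:
 assumes w: "Im w ~= 0"
 shows "\<exists>h. h - scaleC_l2 w (R h) = f"
proof -
 define T where "T v h = h - scaleC_l2 v (R h)" for v h
 have T_scale: "T v (scaleC_l2 a f) = scaleC_l2 a (T v f)" for v a f
  by (simp add: T_def R_scale scaleC_diff_right scaleC_scaleC mult.commute)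
 have T_adj: "cinner_l2 (T w f) g = cinner_l2 f (T (cnj w) g)" for f g
  by (simp add: T_def cinner_diff_left cinner_diff_right cinner_scaleC_left cinner_scaleC_right R_sym)
 have blT: "bounded_linear (T v)" for v
  unfolding T_def by (rule bounded_linear_sub[OF bounded_linear_ident bounded_linear_compose[OF bounded_linear_scaleC R_bl]])
 interpret S: coercive_form UNIV "%f g. cinner_l2 (T (cnj w) f) (T (cnj w) g)" "(\<bar>Im w\<bar> / cmod w)^2"
  by (rule coercive_form_image[OF _ _ _ _ blT T_scale])
   (use w lower_bound[of "cnj w"] in \<open>auto simp: T_def intro!: divide_pos_pos\<close>)
 have "cinner_l2 (T w (T (cnj w) (S.Rop f)) - f) g = 0" for g
  using S.Rop(2)[of g f] by (simp add: cinner_diff_left T_adj)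
 from this[of "T w (T (cnj w) (S.Rop f)) - f"] have "T w (T (cnj w) (S.Rop f)) = f" by (simp add: cinner_self)
 thus ?thesis unfolding T_def[of w] by blast
qed

lemma nonreal_resolvent:
 assumes z: "Im z ~= 0"
 shows "\<exists>h. (\<forall>f. h f - scaleC_l2 (z - of_real \<mu>) (R (h f)) = f) \<and>
  z \<in> resolvent_set (op_of_inv R \<mu>) \<and> (\<forall>f. resolvent (op_of_inv R \<mu>) z f = R (h f)) \<and>
  (\<forall>f. norm (h f) <= (cmod (z - of_real \<mu>) / \<bar>Im z\<bar>) * norm f)"
proof -
 define w where "w = z - of_real \<mu>"
 have w: "Im w ~= 0" "Im w = Im z" using z by (simp_all add: w_def)
 hence w0: "0 < cmod w" by auto
 obtain h where h: "!!f. h f - scaleC_l2 w (R (h f)) = f" using nonreal_surj[OF w(1)] by metis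
 have inj: "k = 0" if "k - scaleC_l2 w (R k) = 0" for k
 proof -
  have "(\<bar>Im w\<bar> / cmod w) * norm k <= 0" using lower_bound[OF w(1), of k] that by simp
  moreover have "0 < \<bar>Im w\<bar> / cmod w" using w w0 by simp
  ultimately have "norm k <= 0" unfolding mult_le_0_iff by linarith
  thus ?thesis by simp
 qed
 note r = resolvent_eqI[of h z \<mu>, folded w_def, OF h inj]
 have hb: "norm (h f) <= (cmod w / \<bar>Im z\<bar>) * norm f" for f
  using lower_bound[OF w(1), of "h f"] h[of f] w w0 by (simp add: field_simps)
 have heq: "h f = k" if "k - scaleC_l2 w (R k) = f" for f k
  using inj[of "h f - k", unfolded res_diff] h[of f] that by simp
 have "bounded_linear h"
 proof (rule bounded_linear_intro)
  show "h (f + g) = h f + h g" for f g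
  proof (rule heq)
   have "h f + h g - scaleC_l2 w (R (h f + h g)) = (h f - scaleC_l2 w (R (h f))) + (h g - scaleC_l2 w (R (h g)))"
    by (simp add: R_add scaleC_add_right algebra_simps)
   thus "h f + h g - scaleC_l2 w (R (h f + h g)) = f + g" by (simp only: h)
  qed
  show "h (r *\<^sub>R f) = r *\<^sub>R h f" for r f
  proof (rule heq)
   have "r *\<^sub>R h f - scaleC_l2 w (R (r *\<^sub>R h f)) = r *\<^sub>R (h f - scaleC_l2 w (R (h f)))"
    by (simp add: scaleR_scaleC R_scale scaleC_diff_right scaleC_scaleC mult.commute)
   thus "r *\<^sub>R h f - scaleC_l2 w (R (r *\<^sub>R h f)) = r *\<^sub>R f" by (simp add: h)
  qed
  show "norm (h f) <= norm f * (cmod w / \<bar>Im z\<bar>)" for f using hb[of f] by (simp add: mult.commute)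
 qed
 hence "bounded_linear (%f. R (h f))" by (rule bounded_linear_compose[OF R_bl])
 moreover have "resolvent (op_of_inv R \<mu>) z = (%f. R (h f))" using r by auto
 ultimately have "z \<in> resolvent_set (op_of_inv R \<mu>)" unfolding resolvent_set_def using r by auto
 thus ?thesis using h r hb by (intro exI[of _ h]) (simp add: w_def)
qed

end

text \<open>Closeness of the resolvents at the one real point \<mu> transfers to every nonreal
  \<open>z\<close>; both resolvents at \<open>z\<close> are expressed through \<open>R\<close> and
  \<open>Rs e\<close> as in \<open>resolvent_eqI\<close>.\<close>

lemma norm_resolvent_convergentI:
 fixes Rs :: "real => 'a::euclidean_space l2 => 'a l2" and C :: "real => real"
 assumes R: "sym_inv R C0" and Rs: "\<forall>\<^sub>F e in F. sym_inv (Rs e) (C e)"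
  and d: "\<forall>\<^sub>F e in F. 0 <= d e \<and> (\<forall>f. norm (Rs e f - R f) <= d e * norm f)" and d0: "(d \<longlongrightarrow> 0) F"
  and A: "A = op_of_inv R \<mu>" and H: "\<forall>\<^sub>F e in F. H e = op_of_inv (Rs e) \<mu>"
 shows "norm_resolvent_convergent H A F"
 unfolding norm_resolvent_convergent_def
proof (intro allI impI conjI)
 fix z :: complex assume z: "Im z ~= 0"
 interpret R: sym_inv R C0 by (rule R)
 define w where "w = z - complex_of_real \<mu>"
 have w0: "w ~= 0" using z by (auto simp: w_def)
 obtain h where h: "!!f. h f - scaleC_l2 w (R (h f)) = f"
  "z \<in> resolvent_set A" "!!f. resolvent A z f = R (h f)"
  "!!f. norm (h f) <= (cmod w / \<bar>Im z\<bar>) * norm f"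
  using R.nonreal_resolvent[OF z, where \<mu>=\<mu>] unfolding A w_def by blast
 show "z \<in> resolvent_set A" by (rule h)
 show "\<forall>\<^sub>F e in F. z \<in> resolvent_set (H e)"
  using Rs H
 proof eventually_elim
  case (elim e)
  show ?case unfolding elim(2) using sym_inv.nonreal_resolvent[OF elim(1) z, where \<mu>=\<mu>] by blast
 qed
 define K where "K = cmod w / \<bar>Im z\<bar>"
 have K: "0 <= K" by (simp add: K_def)
 have "\<forall>\<^sub>F e in F. onorm (%f. resolvent (H e) z f - resolvent A z f) <= K * K * d e \<and>
   0 <= onorm (%f. resolvent (H e) z f - resolvent A z f)"
  using Rs H d
 proof eventually_elim
  case (elim e)
  interpret S: sym_inv "Rs e" "C e" by (rule elim)
  obtain h' where h': "!!f. h' f - scaleC_l2 w (Rs e (h' f)) = f"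
   "z \<in> resolvent_set (H e)" "!!f. resolvent (H e) z f = Rs e (h' f)"
   "!!f. norm (h' f) <= (cmod w / \<bar>Im z\<bar>) * norm f"
   using S.nonreal_resolvent[OF z, where \<mu>=\<mu>] unfolding elim(2) w_def by blast
  have est: "norm (Rs e (h' f) - R (h f)) <= K * K * d e * norm f" for f
  proof -
   have e: "scaleC_l2 w (Rs e (h' f)) = h' f - f" "scaleC_l2 w (R (h f)) = h f - f"
    using h'(1)[of f] h(1)[of f] by (simp_all add: algebra_simps)
   hence 1: "scaleC_l2 w (Rs e (h' f) - R (h f)) = h' f - h f" by (simp add: scaleC_diff_right)
   \<comment> \<open>Second resolvent identity: the difference h' f - h f solves the equation of
     \<open>Rs e\<close> with right-hand side w (Rs e - R) (h f). Solving it costs one factor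
     \<open>K\<close>, the bound of h f the other.\<close>
   have 2: "(h' f - h f) - scaleC_l2 w (Rs e (h' f - h f)) = scaleC_l2 w (Rs e (h f) - R (h f))"
    unfolding S.res_diff by (simp add: scaleC_diff_right e)
   have "(\<bar>Im w\<bar> / cmod w) * norm (h' f - h f) <= cmod w * norm (Rs e (h f) - R (h f))"
    using S.lower_bound[of w "h' f - h f"] z unfolding 2 by (simp add: w_def norm_scaleC)
   moreover have "Im w = Im z" by (simp add: w_def)
   ultimately have "norm (h' f - h f) <= K * (cmod w * norm (Rs e (h f) - R (h f)))"
    using w0 z by (simp add: K_def field_simps)
   hence "cmod w * norm (Rs e (h' f) - R (h f)) <= cmod w * (K * norm (Rs e (h f) - R (h f)))"
    unfolding 1[symmetric] norm_scaleC by (simp add: mult_ac)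
   hence "norm (Rs e (h' f) - R (h f)) <= K * norm (Rs e (h f) - R (h f))"
    using w0 by simp
   also have "... <= K * (d e * norm (h f))" using elim(3) K by (intro mult_left_mono) auto
   also have "... <= K * (d e * (K * norm f))"
    using h(4)[of f] K elim(3) by (intro mult_left_mono) (auto simp: K_def)
   finally show ?thesis by (simp add: mult_ac)
  qed
  have "bounded_linear (resolvent (H e) z)"
   using h'(2) unfolding resolvent_set_def mem_Collect_eq by (rule conjunct2)
  moreover have "bounded_linear (resolvent A z)"
   using h(2) unfolding resolvent_set_def mem_Collect_eq by (rule conjunct2)
  ultimately have bl: "bounded_linear (%f. resolvent (H e) z f - resolvent A z f)" by (rule bounded_linear_sub)
  have "0 <= onorm (%f. resolvent (H e) z f - resolvent A z f)" by (rule onorm_pos_le[OF bl])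
  moreover have "onorm (%f. resolvent (H e) z f - resolvent A z f) <= K * K * d e"
  proof (rule onorm_bound)
   show "norm (resolvent (H e) z f - resolvent A z f) <= K * K * d e * norm f" for f
    unfolding h h' by (rule est)
  qed (use elim(3) K in simp)
  ultimately show ?case by simp
 qed
 note ev = this
 have "((%e. K * K * d e) \<longlongrightarrow> K * K * 0) F" by (intro tendsto_intros d0)
 hence lim: "((%e. K * K * d e) \<longlongrightarrow> 0) F" by simp
 show "((%e. onorm (%f. resolvent (H e) z f - resolvent A z f)) \<longlongrightarrow> 0) F"
 proof (rule real_tendsto_sandwich[OF _ _ tendsto_const lim])
  show "\<forall>\<^sub>F e in F. 0 <= onorm (%f. resolvent (H e) z f - resolvent A z f)"
   using ev by eventually_elim (rule conjunct2)
  show "\<forall>\<^sub>F e in F. onorm (%f. resolvent (H e) z f - resolvent A z f) <= K * K * d e"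
   using ev by eventually_elim (rule conjunct1)
 qed
qed

text \<open>The operator of a form written down directly; \<open>form_operator\<close> is described
  only through its uniqueness and is identified with this graph.\<close>

definition form_graph where
 "form_graph D a = {(f, h). f \<in> D \<and> (\<forall>g\<in>D. a f g = cinner_l2 h g)}"

context coercive_form
begin

lemma sym_inv_Rop:
 assumes "closure D = UNIV" shows "sym_inv Rop (1 / c)"
proof
 show "norm (Rop f) <= 1 / c * norm f" for f using Rop_bound[of f] by simp
 show "Rop f = 0 ==> f = 0" for f by (rule Rop_inj[OF assms])
qed (auto simp: Rop_add Rop_scaleC Rop_sym)

lemma form_graph_eq:
 assumes a: "!!f g. f \<in> D ==> g \<in> D ==> a f g = t f g + of_real \<mu> * cinner_l2 f g"
 shows "form_graph D a = op_of_inv Rop \<mu>"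
proof (intro set_eqI iffI)
 fix p assume "p \<in> form_graph D a"
 then obtain f h where p: "p = (f, h)" "f \<in> D" "!!g. g \<in> D ==> a f g = cinner_l2 h g"
  by (auto simp: form_graph_def)
 have "Rop (h - scaleC_l2 (of_real \<mu>) f) = f"
  by (rule Rop_eqI[OF p(2)]) (use p(2,3) a in \<open>force simp: cinner_diff_left cinner_scaleC_left algebra_simps\<close>)
 thus "p \<in> op_of_inv Rop \<mu>" unfolding op_of_inv_def p(1)
  by (auto intro!: exI[of _ "h - scaleC_l2 (of_real \<mu>) f"])
next
 fix p assume "p \<in> op_of_inv Rop \<mu>"
 then obtain h where "p = (Rop h, h + scaleC_l2 (of_real \<mu>) (Rop h))" by (auto simp: op_of_inv_def)
 thus "p \<in> form_graph D a"
  by (auto simp: form_graph_def Rop a cinner_add_left cinner_scaleC_left)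
qed

text \<open>Any competitor \<open>A\<close> is contained in the form graph, which is self-adjoint.
  Taking adjoints reverses the inclusion, so the two coincide.\<close>

lemma form_operator_eq:
 assumes dense: "closure D = UNIV" and a: "!!f g. f \<in> D ==> g \<in> D ==> a f g = t f g + of_real \<mu> * cinner_l2 f g"
 shows "form_operator D a = form_graph D a"
proof -
 have sa: "self_adjoint (form_graph D a)"
 proof -
  have fg: "form_graph D a = op_of_inv Rop \<mu>" by (rule form_graph_eq) (rule a)
  show ?thesis unfolding fg by (rule sym_inv.self_adjoint_op[OF sym_inv_Rop[OF dense]])
 qed
 show ?thesis
  unfolding form_operator_def
 proof (rule the_equality)
  show "self_adjoint (form_graph D a) \<and> Domain (form_graph D a) \<subseteq> D \<and>
    (\<forall>(f, h)\<in>form_graph D a. \<forall>g\<in>D. a f g = cinner_l2 h g)"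
   using sa by (auto simp: form_graph_def)
  fix A assume A: "self_adjoint A \<and> Domain A \<subseteq> D \<and> (\<forall>(f, h)\<in>A. \<forall>g\<in>D. a f g = cinner_l2 h g)"
  hence sub: "A \<subseteq> form_graph D a" by (auto simp: form_graph_def)
  have "form_graph D a = adjoint_op (form_graph D a)" using sa by (simp add: self_adjoint_def)
  also have "... \<subseteq> adjoint_op A" unfolding adjoint_op_def using sub by blast
  also have "... = A" using A by (simp add: self_adjoint_def)
  finally show "A = form_graph D a" using sub by blast
 qed
qed

end

lemma perturb_form_graph:
 assumes "!!f g. cinner_l2 (mult_l2 q f) g = b f g"
 shows "perturb (form_graph D a) q = form_graph D (%f g. a f g + b f g)"
proof (intro set_eqI iffI)
 fix p assume "p \<in> perturb (form_graph D a) q"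
 then obtain f h where "p = (f, h + mult_l2 q f)" "f \<in> D" "!!g. g \<in> D ==> a f g = cinner_l2 h g"
  unfolding perturb_def form_graph_def by blast
 thus "p \<in> form_graph D (%f g. a f g + b f g)"
  by (simp add: form_graph_def cinner_add_left assms)
next
 fix p assume "p \<in> form_graph D (%f g. a f g + b f g)"
 then obtain f h where p: "p = (f, h)" "f \<in> D" "!!g. g \<in> D ==> a f g + b f g = cinner_l2 h g"
  by (auto simp: form_graph_def)
 have "(f, h - mult_l2 q f) \<in> form_graph D a"
  unfolding form_graph_def using p(2) p(3)[symmetric] by (simp add: cinner_diff_left assms)
 thus "p \<in> perturb (form_graph D a) q"
  unfolding perturb_def p(1)
  by (intro CollectI exI[of _ f] exI[of _ "h - mult_l2 q f"]) simp
qed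

section \<open>Smooth functions and test functions\<close>

lemma partial_deriv_eq:
 "(f has_derivative f') (at x) ==> pD j f x = f' (axis j 1)"
 by (simp add: partial_deriv_def frechet_derivative_at[symmetric])

lemma smooth_coinduct:
 assumes "f \<in> F" "!!g x. g \<in> F ==> g differentiable (at x)" "!!g j. g \<in> F ==> pD j g \<in> F"
 shows "smooth f"
proof -
 have "foldr pD js f \<in> F" for js by (induction js) (auto simp: assms)
 thus ?thesis by (auto simp: smooth_def assms)
qed

lemma smooth_partial_deriv: "smooth f ==> smooth (pD j f)"
 unfolding smooth_def
proof (intro allI)
 fix js x assume "\<forall>js x. foldr pD js f differentiable at x"
 hence "foldr pD (js @ [j]) f differentiable at x" by blast
 thus "foldr pD js (pD j f) differentiable at x" by simp
qed

lemma smooth_differentiable: "smooth f ==> f differentiable (at x)"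
 unfolding smooth_def by (metis foldr_Nil id_apply)

lemma has_derivative_partial_deriv:
 fixes f :: "real^'n::finite => 'b::real_normed_vector"
 assumes "f differentiable (at x)"
 shows "(f has_derivative (%h. \<Sum>j\<in>UNIV. h $ j *\<^sub>R pD j f x)) (at x)"
proof -
 have d: "(f has_derivative frechet_derivative f (at x)) (at x)"
  using assms by (simp add: frechet_derivative_works)
 hence l: "linear (frechet_derivative f (at x))" by (rule has_derivative_linear)
 have "frechet_derivative f (at x) h = (\<Sum>j\<in>UNIV. h $ j *\<^sub>R pD j f x)" for h
 proof -
  have "frechet_derivative f (at x) h = frechet_derivative f (at x) (\<Sum>j\<in>UNIV. h $ j *\<^sub>R axis j 1)"
   by (simp add: basis_expansion scalar_mult_eq_scaleR[symmetric])
  also have "... = (\<Sum>j\<in>UNIV. h $ j *\<^sub>R frechet_derivative f (at x) (axis j 1))"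
   using l by (simp add: linear_sum linear_cmul)
  finally show ?thesis by (simp add: partial_deriv_def)
 qed
 hence "frechet_derivative f (at x) = (%h. \<Sum>j\<in>UNIV. h $ j *\<^sub>R pD j f x)" by (rule ext)
 thus ?thesis using d by simp
qed

text \<open>The polynomial parameter makes the family closed under differentiation: p (1/t) exp (-
  1/t) has a derivative of the same kind, with X^2 (p - p') in place of \<open>p\<close>. At 0 the
  right difference quotient again has this form, with X p.\<close>

definition exp_bump :: "real poly => real => real" where
 "exp_bump p t = (if 0 < t then poly p (1 / t) * exp (- (1 / t)) else 0)"

lemma poly_div_exp_tendsto_0: "((%x. poly p x * exp (- x)) \<longlongrightarrow> (0::real)) at_top"
proof -
 have "((%x. \<Sum>i\<le>degree p. coeff p i * (x ^ i / exp x)) \<longlongrightarrow> (\<Sum>i\<le>degree p. coeff p i * 0)) at_top"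
  by (intro tendsto_intros tendsto_power_div_exp_0)
 moreover have "poly p x * exp (- x) = (\<Sum>i\<le>degree p. coeff p i * (x ^ i / exp x))" for x
  by (simp add: poly_altdef sum_distrib_right exp_minus divide_inverse mult.assoc)
 ultimately show ?thesis by simp
qed

lemma exp_bump_deriv:
 "(exp_bump p has_real_derivative exp_bump (monom 1 2 * (p - pderiv p)) t) (at t)"
proof -
 consider "0 < t" | "t < 0" | "t = 0" by linarith
 thus ?thesis
 proof cases
  case 1
  have "((%t. poly p (1 / t) * exp (- (1 / t))) has_real_derivative exp_bump (monom 1 2 * (p - pderiv p)) t) (at t)"
   using 1 unfolding exp_bump_def
   by (auto intro!: derivative_eq_intros simp: poly_monom power2_eq_square field_simps)
  thus ?thesis
   by (rule has_field_derivative_transform_within_open[where S="{0<..}"]) (use 1 in \<open>auto simp: exp_bump_def\<close>)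
 next
  case 2
  have "((%t. 0) has_real_derivative exp_bump (monom 1 2 * (p - pderiv p)) t) (at t)"
   using 2 by (simp add: exp_bump_def)
  thus ?thesis
   by (rule has_field_derivative_transform_within_open[where S="{..<0}"]) (use 2 in \<open>auto simp: exp_bump_def\<close>)
 next
  case 3
  have "((%h. exp_bump p h / h) \<longlongrightarrow> 0) (at 0)"
  proof (rule filterlim_split_at)
   have "((%h. 0) \<longlongrightarrow> (0::real)) (at_left 0)" by simp
   thus "((%h. exp_bump p h / h) \<longlongrightarrow> 0) (at_left 0)"
    by (rule Lim_transform_eventually) (auto simp: eventually_at_filter exp_bump_def)
   have "((%h. poly (pCons 0 p) (inverse h) * exp (- (inverse h))) \<longlongrightarrow> 0) (at_right 0)"
    by (rule filterlim_compose[OF poly_div_exp_tendsto_0 filterlim_inverse_at_top_right])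
   thus "((%h. exp_bump p h / h) \<longlongrightarrow> 0) (at_right 0)"
    by (rule Lim_transform_eventually) (auto simp: eventually_at_filter exp_bump_def field_simps)
  qed
  thus ?thesis using 3 by (simp add: DERIV_def exp_bump_def)
 qed
qed

lemma exp_bump_nonneg: "0 <= exp_bump 1 t" and exp_bump_pos: "0 < t ==> 0 < exp_bump 1 t"
 by (auto simp: exp_bump_def)

text \<open>An algebra of functions that is closed under partial derivatives; by coinduction it consists
 of smooth functions.\<close>

inductive_set smooth_alg :: "(real^'n::finite => complex) set" where
 base: "smooth f ==> f \<in> smooth_alg"
| const: "(%_. c) \<in> smooth_alg"
| coord: "(%x. complex_of_real (x $ j)) \<in> smooth_alg"
| bump: "(%x. complex_of_real (exp_bump p (1 - x \<bullet> x))) \<in> smooth_alg"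
| add: "f \<in> smooth_alg ==> g \<in> smooth_alg ==> (%x. f x + g x) \<in> smooth_alg"
| mult: "f \<in> smooth_alg ==> g \<in> smooth_alg ==> (%x. f x * g x) \<in> smooth_alg"

lemma partial_deriv_add:
 assumes "f differentiable (at x)" "g differentiable (at x)"
 shows "pD j (%x. f x + g x) x = pD j f x + pD j g x"
proof -
 have "((%x. f x + g x) has_derivative (%h. frechet_derivative f (at x) h + frechet_derivative g (at x) h)) (at x)"
  using assms by (intro has_derivative_add) (simp_all add: frechet_derivative_works)
 from partial_deriv_eq[OF this, of j] show ?thesis by (simp add: partial_deriv_def)
qed

lemma partial_deriv_mult:
 fixes f g :: "real^'n::finite => complex"
 assumes "f differentiable (at x)" "g differentiable (at x)"
 shows "pD j (%x. f x * g x) x = pD j f x * g x + f x * pD j g x"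
proof -
 have "((%x. f x * g x) has_derivative (%h. f x * frechet_derivative g (at x) h + frechet_derivative f (at x) h * g x)) (at x)"
  using assms by (intro has_derivative_mult) (simp_all add: frechet_derivative_works)
 from partial_deriv_eq[OF this, of j] show ?thesis by (simp add: partial_deriv_def)
qed

lemma has_derivative_bump:
 "((%x::real^'n::finite. complex_of_real (exp_bump p (1 - x \<bullet> x))) has_derivative
   (%h. of_real (exp_bump (monom 1 2 * (p - pderiv p)) (1 - x \<bullet> x) * (- 2 * (x \<bullet> h))))) (at x)"
proof -
 have "((%x::real^'n. 1 - x \<bullet> x) has_derivative (%h. - 2 * (x \<bullet> h))) (at x)"
  by (auto intro!: derivative_eq_intros simp: inner_commute)
 from has_derivative_compose[OF this has_field_derivative_imp_has_derivative[OF exp_bump_deriv]]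
 show ?thesis by (rule bounded_linear.has_derivative[OF bounded_linear_of_real])
qed

lemma smooth_alg_step:
 fixes f :: "real^'n::finite => complex"
 assumes "f \<in> smooth_alg"
 shows "(\<forall>x. f differentiable (at x)) \<and> (\<forall>j. pD j f \<in> smooth_alg)"
 using assms
proof (induction rule: smooth_alg.induct)
 case (base f)
 thus ?case by (simp add: smooth_differentiable smooth_partial_deriv smooth_alg.base)
next
 case (const c)
 have "pD j (%_::real^'n. c) = (%_. 0)" for j by (rule ext, subst partial_deriv_eq[OF has_derivative_const]) simp
 thus ?case by (simp add: smooth_alg.const)
next
 case (coord j)
 have d: "((%x. complex_of_real (x $ j)) has_derivative (%h. complex_of_real (h $ j))) (at x)" for x
  by (intro bounded_linear_imp_has_derivative bounded_linear_compose[OF bounded_linear_of_real bounded_linear_vec_nth])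
 hence "pD i (%x. complex_of_real (x $ j)) = (%_. complex_of_real (axis i 1 $ j))" for i by (intro ext partial_deriv_eq)
 thus ?case using d by (auto simp: smooth_alg.const differentiable_def)
next
 case (bump p)
 have "pD j (%x::real^'n. complex_of_real (exp_bump p (1 - x \<bullet> x))) =
   (%x. complex_of_real (exp_bump (monom 1 2 * (p - pderiv p)) (1 - x \<bullet> x)) * (- 2 * of_real (x $ j)))" for j
  by (rule ext) (simp add: partial_deriv_eq[OF has_derivative_bump] inner_axis)
 moreover have "... j \<in> smooth_alg" for j :: 'n by (intro smooth_alg.mult smooth_alg.bump smooth_alg.const smooth_alg.coord)
 moreover have "(%x::real^'n. complex_of_real (exp_bump p (1 - x \<bullet> x))) differentiable (at x)" for x
  unfolding differentiable_def by (rule exI, rule has_derivative_bump)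
 ultimately show ?case by simp
next
 case (add f g)
 hence "pD j (%x. f x + g x) = (%x. pD j f x + pD j g x)" for j by (intro ext partial_deriv_add) auto
 thus ?case using add by (auto intro!: smooth_alg.add differentiable_add)
next
 case (mult f g)
 hence "pD j (%x. f x * g x) = (%x. pD j f x * g x + f x * pD j g x)" for j
  by (intro ext partial_deriv_mult) auto
 thus ?case using mult by (auto intro!: smooth_alg.add smooth_alg.mult differentiable_mult)
qed

lemma smooth_algD: "f \<in> smooth_alg ==> smooth f"
 by (rule smooth_coinduct[of f smooth_alg]) (auto dest: smooth_alg_step)

lemma smooth_add: "smooth f ==> smooth g ==> smooth (%x. f x + g x)"
 and smooth_mult: "smooth f ==> smooth g ==> smooth (%x. f x * g x)"
 and smooth_cmult: "smooth f ==> smooth (%x. c * f x)"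
 and smooth_bump: "smooth (%x. complex_of_real (exp_bump p (1 - x \<bullet> x)))"
 by (rule smooth_algD, intro smooth_alg.intros(1,2,4-6); assumption)+

lemma partial_deriv_cnj:
 assumes "f differentiable (at x)"
 shows "pD j (%x. cnj (f x)) x = cnj (pD j f x)" "(%x. cnj (f x)) differentiable (at x)"
proof -
 have d: "((%x. cnj (f x)) has_derivative (%h. cnj (frechet_derivative f (at x) h))) (at x)"
  using assms by (intro bounded_linear.has_derivative[OF bounded_linear_cnj]) (simp add: frechet_derivative_works)
 show "pD j (%x. cnj (f x)) x = cnj (pD j f x)" using partial_deriv_eq[OF d, of j] by (simp add: partial_deriv_def)
 show "(%x. cnj (f x)) differentiable (at x)" using d by (auto simp: differentiable_def)
qed

lemma smooth_cnj:
 assumes "smooth f" shows "smooth (%x. cnj (f x))"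
proof (rule smooth_coinduct[of _ "{%x. cnj (g x) | g. smooth g}"])
 fix h j assume "h \<in> {%x. cnj (g x) | g. smooth g}"
 then obtain g where g: "h = (%x. cnj (g x))" "smooth g" by blast
 have "pD j h = (%x. cnj (pD j g x))"
  unfolding g by (rule ext, rule partial_deriv_cnj(1)) (rule smooth_differentiable[OF g(2)])
 thus "pD j h \<in> {%x. cnj (g x) | g. smooth g}" using smooth_partial_deriv[OF g(2)] by blast
qed (use assms smooth_differentiable partial_deriv_cnj(2) in blast)+

lemma partial_deriv_affine:
 fixes f :: "real^'n::finite => complex"
 assumes "!!x. f differentiable (at x)"
 shows "pD j (%y. f (a + s *\<^sub>R y)) y = of_real s * pD j f (a + s *\<^sub>R y)" "(%y. f (a + s *\<^sub>R y)) differentiable (at y)"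
proof -
 have 1: "((%y. a + s *\<^sub>R y) has_derivative (%h. s *\<^sub>R h)) (at y)" by (auto intro!: derivative_eq_intros)
 have 2: "(f has_derivative frechet_derivative f (at (a + s *\<^sub>R y))) (at (a + s *\<^sub>R y))" using assms by (simp add: frechet_derivative_works)
 note d = has_derivative_compose[OF 1 2]
 show "pD j (%y. f (a + s *\<^sub>R y)) y = of_real s * pD j f (a + s *\<^sub>R y)"
  using partial_deriv_eq[OF d, of j] linear_cmul[OF has_derivative_linear[OF 2]] by (simp add: partial_deriv_def scaleR_conv_of_real)
 show "(%y. f (a + s *\<^sub>R y)) differentiable (at y)" using d by (auto simp: differentiable_def)
qed

lemma partial_deriv_cmult:
 fixes f :: "real^'n::finite => complex"
 assumes "f differentiable (at x)"
 shows "pD j (%x. c * f x) x = c * pD j f x"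
 using partial_deriv_mult[of "%_. c" x f j] assms partial_deriv_eq[OF has_derivative_const, of j c x] by simp

lemma smooth_affine:
 assumes "smooth f" shows "smooth (%y. f (a + s *\<^sub>R y))"
proof (rule smooth_coinduct[of _ "{%y. c * g (a + s *\<^sub>R y) | c g. smooth g}"])
 show "(%y. f (a + s *\<^sub>R y)) \<in> {%y. c * g (a + s *\<^sub>R y) | c g. smooth g}" using assms by (auto intro!: exI[of _ 1] exI[of _ f])
next
 fix h x assume "h \<in> {%y. c * g (a + s *\<^sub>R y) | c g. smooth g}"
 then obtain c g where g: "h = (%y. c * g (a + s *\<^sub>R y))" "smooth g" by blast
 note d = partial_deriv_affine[OF smooth_differentiable[OF g(2)]]
 show "h differentiable (at x)" unfolding g(1) by (intro differentiable_mult differentiable_const d)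
 have "pD j h = (%y. (c * of_real s) * pD j g (a + s *\<^sub>R y))" for j
  unfolding g(1) by (rule ext) (simp add: partial_deriv_cmult[OF d(2)] d(1))
 thus "pD j h \<in> {%y. c * g (a + s *\<^sub>R y) | c g. smooth g}" for j using smooth_partial_deriv[OF g(2)] by blast
qed

lemma smooth_continuous: "smooth f ==> continuous_on A f"
 by (rule continuous_at_imp_continuous_on) (auto intro: differentiable_imp_continuous_within smooth_differentiable)

section \<open>Test functions\<close>

lemma test_iff: "test_function (f :: real^'n::finite => complex) \<longleftrightarrow> smooth f \<and> (\<exists>R. \<forall>x. R < norm x --> f x = 0)"
proof -
 have "bounded {x. f x ~= 0} \<longleftrightarrow> (\<exists>R. \<forall>x. R < norm x --> f x = 0)" unfolding bounded_iff by (metis (mono_tags) mem_Collect_eq not_le)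
 thus ?thesis by (simp add: test_function_def)
qed

lemma test_smooth: "test_function f ==> smooth f"
 by (simp add: test_function_def)

lemma test_differentiable: "test_function f ==> f differentiable (at x)"
 by (intro smooth_differentiable test_smooth)

lemma test_support:
 assumes "test_function f" shows "\<exists>R>0. \<forall>x. R < norm x --> f x = 0 \<and> (\<forall>j. pD j f x = 0)"
proof -
 obtain R where R: "!!x. R < norm x ==> f x = 0" using assms unfolding test_iff by blast
 have "pD j f x = 0" if x: "R < norm x" for x j
 proof -
  have o: "open {x::real^'a. R < norm x}" by (intro open_Collect_less continuous_intros)
  have "(f has_derivative (%_. 0)) (at x)"
   by (rule has_derivative_transform_within_open[OF has_derivative_const[of 0] o]) (use x R in auto)
  thus ?thesis by (rule partial_deriv_eq)
 qed
 thus ?thesis using R by (intro exI[of _ "max R 1"]) auto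
qed

lemma test_partial_deriv: "test_function f ==> test_function (pD j f)"
 using test_support[of f] unfolding test_iff by (blast intro: smooth_partial_deriv)

lemma test_mult: "smooth f ==> test_function g ==> test_function (%x. f x * g x)"
 unfolding test_iff by (force intro: smooth_mult)

lemma test_cmult: "test_function g ==> test_function (%x. c * g x)"
 unfolding test_iff by (force intro: smooth_cmult)

lemma test_add:
 assumes "test_function f" "test_function g" shows "test_function (%x. f x + g x)"
proof -
 obtain R R' where "!!x. R < norm x ==> f x = 0" "!!x. R' < norm x ==> g x = 0" using assms unfolding test_iff by blast
 hence "\<forall>x. max R R' < norm x --> f x + g x = 0" by simp
 thus ?thesis using assms unfolding test_iff by (blast intro: smooth_add)
qed

lemma test_diff: "test_function f ==> test_function g ==> test_function (%x. f x - g x)"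
 using test_add[of f "%x. (-1) * g x"] test_cmult[of g "-1"] by simp

lemma test_cnj: "test_function f ==> test_function (%x. cnj (f x))"
 unfolding test_iff by (auto intro: smooth_cnj)

lemma test_affine:
 assumes f: "test_function f" and s: "s ~= 0" shows "test_function (%y. f (a + s *\<^sub>R y))"
proof -
 obtain R where R: "!!x. R < norm x ==> f x = 0" using test_support[OF f] by blast
 have "f (a + s *\<^sub>R y) = 0" if "(R + norm a) / \<bar>s\<bar> < norm y" for y
  using that s norm_triangle_ineq4[of "a + s *\<^sub>R y" a] by (intro R) (simp add: pos_divide_less_eq mult.commute)
 thus ?thesis using f unfolding test_iff by (blast intro: smooth_affine)
qed

lemma test_reflect: "test_function f ==> test_function (%y. f (a - y))"
 using test_affine[of f "-1" a] by simp

lemma test_bounded: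
 assumes "test_function f"
 shows "\<exists>B>0. \<forall>x. cmod (f x) <= B"
proof -
 obtain R where R: "!!x. R < norm x ==> f x = 0" using test_support[OF assms] by blast
 have "bounded (f ` cball 0 R)"
  by (intro compact_imp_bounded compact_continuous_image smooth_continuous test_smooth assms) simp
 then obtain B where B: "!!x. x \<in> cball 0 R ==> cmod (f x) <= B" unfolding bounded_iff by blast
 have "cmod (f x) <= max B 1" for x using B[of x] R[of x] by (cases "norm x <= R") (auto simp: le_max_iff_disj)
 thus ?thesis by (intro exI[of _ "max B 1"]) simp
qed

lemma test_borel: "test_function f ==> f \<in> borel_measurable borel"
 by (intro borel_measurable_continuous_onI smooth_continuous test_smooth)

lemma integrable_bounded_support:
 fixes f :: "'a::euclidean_space => 'b::{banach, second_countable_topology}"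
 assumes "f \<in> borel_measurable borel" "!!x. norm (f x) <= B" "!!x. R < dist c x ==> f x = 0"
 shows "integrable lborel f" "(LINT x|lborel. norm (f x)) <= B * measure lborel (cball c R)"
proof -
 have i: "integrable lborel (%x. indicat_real (cball c R) x * B)"
  using emeasure_lborel_cball_finite by (intro integrable_mult_left integrable_real_indicator) auto
 have le: "norm (f x) <= indicat_real (cball c R) x * B" for x
  using assms(2)[of x] assms(3)[of x] by (cases "dist c x <= R") (auto simp: indicator_def)
 show f: "integrable lborel f"
  by (rule Bochner_Integration.integrable_bound[OF i]) (use assms(1) order_trans[OF le] in auto)
 show "(LINT x|lborel. norm (f x)) <= B * measure lborel (cball c R)"
  using integral_mono[OF integrable_norm[OF f] i le] by (simp add: mult.commute)
qed

lemma test_integrable: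
 assumes "test_function f" shows "integrable lborel f" "integrable lborel (%x. (cmod (f x))^2)"
proof -
 obtain B where B: "!!x. cmod (f x) <= B" using test_bounded[OF assms] by blast
 obtain R where R: "!!x. R < dist 0 x ==> f x = 0" using test_support[OF assms] by auto
 show "integrable lborel f" by (rule integrable_bounded_support(1)[OF test_borel[OF assms] B R])
 show "integrable lborel (%x. (cmod (f x))^2)"
  by (rule integrable_bounded_support(1)[of _ "B^2" R 0]) (use B R test_borel[OF assms] in \<open>auto simp: power_mono\<close>)
qed

lemma test_square_integrable:
 "test_function f ==> square_integrable lborel f" "test_function f ==> square_integrable lebesgue f"
 using test_borel[of f] test_integrable(2)[of f]
 by (auto simp: square_integrable_def integrable_completion intro!: measurable_completion)

lemma uniformly_continuous_bounded_support:
 fixes k :: "'a::euclidean_space => 'b::real_normed_vector"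
 assumes k: "continuous_on UNIV k" "!!x. R < norm x ==> k x = 0" and e: "0 < e"
 shows "\<exists>d>0. \<forall>x y. dist x y < d --> norm (k x - k y) < e"
proof -
 have "uniformly_continuous_on (cball 0 (R + 1)) k" by (intro compact_uniformly_continuous continuous_on_subset[OF k(1)]) auto
 from uniformly_continuous_onE[OF this e] obtain d where d: "0 < d"
  "!!x y. x \<in> cball 0 (R + 1) ==> y \<in> cball 0 (R + 1) ==> dist y x < d ==> dist (k y) (k x) < e" by metis
 have "norm (k x - k y) < e" if xy: "dist x y < min d 1" for x y
 proof (cases "x \<in> cball 0 (R + 1) \<and> y \<in> cball 0 (R + 1)")
  case True
  thus ?thesis using d(2)[of y x] xy by (simp add: dist_norm)
 next
  case False
  have "R < norm x \<and> R < norm y"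
   using False xy norm_triangle_sub[of x y] norm_triangle_sub[of y x] by (auto simp: dist_norm norm_minus_commute)
  thus ?thesis using k(2) e by simp
 qed
 thus ?thesis using d(1) by (intro exI[of _ "min d 1"]) simp
qed

text \<open>First-order expansion with a remainder uniform in \<open>x\<close>: the partial
  derivatives are uniformly continuous because they have bounded support. The tolerance is divided
  by the dimension since the components of the differential are estimated one by one.\<close>

lemma test_taylor:
 fixes f :: "real^'n::finite => complex"
 assumes f: "test_function f" and e: "0 < e"
 shows "\<exists>d>0. \<forall>x h. norm h < d --> cmod (f (x + h) - f x - (\<Sum>j\<in>UNIV. h $ j *\<^sub>R pD j f x)) <= e * norm h"
proof -
 let ?D = "%x h. \<Sum>j\<in>UNIV. h $ j *\<^sub>R pD j f x"
 define e' where "e' = e / real CARD('n)"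
 have e': "0 < e'" using e by (simp add: e'_def)
 obtain R where R: "!!x j. R < norm x ==> pD j f x = 0" using test_support[OF f] by blast
 have "\<forall>j. \<exists>d>0. \<forall>x y. dist x y < d --> cmod (pD j f x - pD j f y) < e'"
  using uniformly_continuous_bounded_support[OF smooth_continuous[OF test_smooth[OF test_partial_deriv[OF f]]] R e'] by blast
 then obtain d where d: "!!j. 0 < d j" "!!j x y. dist x y < d j ==> cmod (pD j f x - pD j f y) < e'" by metis
 have "cmod (f (x + h) - f x - ?D x h) <= e * norm h" if h: "norm h < Min (range d)" for x h
 proof -
  have "norm (f (x + h) - f x - ?D x ((x + h) - x)) <= norm ((x + h) - x) * e"
  proof (rule differentiable_bound_linearization[of x "x + h" "cball x (norm h)" f ?D x e])
   show "x + t *\<^sub>R (x + h - x) \<in> cball x (norm h)" if "t \<in> {0..1}" for t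
    using that mult_right_mono[of t 1 "norm h"] by (simp add: dist_norm)
   show "(f has_derivative ?D y) (at y within cball x (norm h))" for y
    by (rule has_derivative_at_withinI, rule has_derivative_partial_deriv, rule test_differentiable[OF f])
   fix y assume y: "y \<in> cball x (norm h)"
   show "onorm (?D y - ?D x) <= e"
   proof (rule onorm_bound)
    fix k :: "real^'n"
    have "norm (k $ j *\<^sub>R (pD j f y - pD j f x)) <= norm k * e'" for j
     unfolding norm_scaleR using y h component_le_norm_cart[of k j] d(2)[of y x j] le_less_trans[of "dist y x" "norm h" "d j"]
     by (intro mult_mono) (auto simp: Min_gr_iff dist_commute less_imp_le)
    hence "norm (\<Sum>j\<in>UNIV. k $ j *\<^sub>R (pD j f y - pD j f x)) <= CARD('n) * (norm k * e')"
     by (rule order_trans[OF norm_sum sum_bounded_above])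
    thus "norm ((?D y - ?D x) k) <= e * norm k" by (simp add: sum_subtractf scaleR_diff_right e'_def mult.commute)
   qed (use e in simp)
  qed simp
  thus ?thesis by (simp add: mult.commute)
 qed
 thus ?thesis using d(1) by (intro exI[of _ "Min (range d)"]) simp
qed

lemma integral_lborel_shift:
 fixes h :: "'a::euclidean_space => 'b::{banach, second_countable_topology}"
 assumes [measurable]: "h \<in> borel_measurable borel"
 shows "(LINT y|lborel. h (y + a)) = (LINT y|lborel. h y)" "(LINT y|lborel. h (a - y)) = (LINT y|lborel. h y)"
 using integral_distr[of "(+) a" lborel borel h] integral_distr[of "%y. a + (-1) *\<^sub>R y" lborel borel h] lborel_affine[of "-1" a]
 by (simp_all add: lborel_distr_plus density_1 add.commute)

lemma nn_integral_lborel_shift: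
 assumes [measurable]: "h \<in> borel_measurable borel"
 shows "(\<integral>\<^sup>+y. h (y + a) \<partial>lborel) = (\<integral>\<^sup>+y. h y \<partial>(lborel :: 'a::euclidean_space measure))" "(\<integral>\<^sup>+y. h (a - y) \<partial>lborel) = (\<integral>\<^sup>+y. h y \<partial>lborel)"
 using nn_integral_distr[of "(+) a" lborel borel h] nn_integral_distr[of "%y. a + (-1) *\<^sub>R y" lborel borel h] lborel_affine[of "-1" a]
 by (simp_all add: lborel_distr_plus density_1 add.commute)

text \<open>The integral of f (x + t e_j) - f x is 0 by translation invariance, and by the uniform
  expansion it equals t times the integral of the derivative up to e t times a fixed volume.
  Dividing by \<open>t\<close> and letting \<open>e\<close> tend to 0 gives the claim.\<close>

lemma integral_partial_deriv_test:
 fixes f :: "real^'n::finite => complex"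
 assumes f: "test_function f" shows "(LINT x|lborel. pD j f x) = 0"
proof -
 obtain R where R: "0 < R" "!!x. R < norm x ==> f x = 0 \<and> pD j f x = 0" using test_support[OF f] by blast
 note i = test_integrable(1)[OF f] test_integrable(1)[OF test_partial_deriv[OF f, of j]]
 have *: "cmod (LINT x|lborel. pD j f x) <= e * measure lborel (cball (0::real^'n) (R + 1))" if e: "0 < e" for e
 proof -
  obtain d where d: "0 < d" "!!x h. norm h < d ==> cmod (f (x + h) - f x - (\<Sum>j\<in>UNIV. h $ j *\<^sub>R pD j f x)) <= e * norm h"
   using test_taylor[OF f e] by blast
  define t where "t = min d 1 / 2"
  have t: "0 < t" "t < d" "t < 1" using d(1) by (auto simp: t_def)
  define a :: "real^'n" where "a = t *\<^sub>R axis j 1"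
  have a: "norm a = t" using t by (simp add: a_def)
  define g where "g x = f (x + a) - f x - t *\<^sub>R pD j f x" for x
  have "(\<Sum>i\<in>UNIV. a $ i *\<^sub>R pD i f x) = t *\<^sub>R pD j f x" for x
   by (simp add: a_def axis_def if_distrib[where f="%c. c *\<^sub>R _"] if_distrib[where f="%c. _ * c"] cong: if_cong)
  hence le: "cmod (g x) <= e * t" for x using d(2)[of a x] t by (simp add: g_def a)
  have z: "g x = 0" if "R + 1 < dist 0 x" for x
   using R(2)[of x] R(2)[of "x + a"] that t norm_triangle_ineq4[of "x + a" a] by (simp add: g_def a)
  have m: "g \<in> borel_measurable borel"
   unfolding g_def using test_borel[OF f] test_borel[OF test_partial_deriv[OF f]] by measurable
  have fa: "integrable lborel (%x. f (x + a))"
   using test_integrable(1)[OF test_affine[OF f, of 1 "a"]] by (simp add: add.commute)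
  have "(LINT x|lborel. g x) = - (t *\<^sub>R (LINT x|lborel. pD j f x))"
   unfolding g_def using i fa integral_lborel_shift(1)[OF test_borel[OF f]] by simp
  hence "t * cmod (LINT x|lborel. pD j f x) = cmod (LINT x|lborel. g x)" using t by simp
  also have "... <= e * t * measure lborel (cball (0::real^'n) (R + 1))"
   using integrable_bounded_support(2)[OF m le z] by (rule order_trans[OF integral_norm_bound])
  finally show ?thesis using t by (simp add: mult_ac)
 qed
 have V: "0 < measure lborel (cball (0::real^'n) (R + 1))" using R(1) by (simp add: content_cball_pos)
 show ?thesis
 proof (rule ccontr)
  assume "(LINT x|lborel. pD j f x) ~= 0"
  with *[of "cmod (LINT x|lborel. pD j f x) / (2 * measure lborel (cball (0::real^'n) (R + 1)))"] V show False by simp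
 qed
qed

section \<open>Mollification\<close>

lemma completion_ex_borel_measurable_complex:
 fixes g :: "'a => complex"
 assumes g: "g \<in> borel_measurable (completion M)"
 shows "\<exists>g'\<in>borel_measurable M. (AE x in M. g x = g' x)"
proof -
 have "(%x. Re (g x)) \<in> borel_measurable (completion M)" "(%x. Im (g x)) \<in> borel_measurable (completion M)"
  using g by simp_all
 from this[THEN completion_ex_borel_measurable_real]
 obtain a b where ab: "a \<in> borel_measurable M" "b \<in> borel_measurable M"
  "AE x in M. Re (g x) = a x" "AE x in M. Im (g x) = b x" by blast
 show ?thesis
 proof (intro bexI[of _ "%x. Complex (a x) (b x)"])
  show "AE x in M. g x = Complex (a x) (b x)"
   using ab(3,4) by eventually_elim (simp add: complex_eq_iff)
  have "(%x. Complex (a x) (b x)) = (%x. of_real (a x) + \<i> * of_real (b x))" by (simp add: complex_eq_iff fun_eq_iff)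
  thus "(%x. Complex (a x) (b x)) \<in> borel_measurable M" using ab(1,2) by simp
 qed
qed

lemma borel_measurable_cnj [measurable (raw)]:
 "f \<in> borel_measurable M ==> (%x. cnj (f x)) \<in> borel_measurable M"
 by (rule borel_measurable_continuous_on[of cnj]) (auto intro: continuous_intros)

lemma square_integrable_lborel_lebesgue:
 "square_integrable lborel f ==> square_integrable lebesgue f"
 by (auto simp: square_integrable_def integrable_completion intro!: measurable_completion)

lemma square_integrable_cong_AE:
 assumes "square_integrable M f" "AE x in M. f x = g x" "g \<in> borel_measurable M"
 shows "square_integrable M g"
proof -
 have [measurable]: "f \<in> borel_measurable M" "g \<in> borel_measurable M" using assms by (auto simp: square_integrable_def)
 have "integrable M (%x. (cmod (g x))^2) \<longleftrightarrow> integrable M (%x. (cmod (f x))^2)"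
  by (rule integrable_cong_AE) (use assms(2) in auto)
 thus ?thesis using assms by (simp add: square_integrable_def)
qed

text \<open>Fubini for products of Borel measures and composition with Borel maps need Borel
  functions, whereas \<open>rep_l2\<close> is only Lebesgue measurable.\<close>

lemma l2_borel_rep:
 fixes f :: "'a::euclidean_space l2"
 obtains f0 where "f0 \<in> borel_measurable borel" "AE x in lebesgue. rep_l2 f x = f0 x"
  "square_integrable lborel f0" "f = abs_l2 f0"
proof -
 obtain f0 where f0: "f0 \<in> borel_measurable lborel" "AE x in lborel. rep_l2 f x = f0 x"
  using completion_ex_borel_measurable_complex[OF rep_l2_measurable[of f]] by blast
 have m: "f0 \<in> borel_measurable lebesgue" using f0(1) by (rule measurable_completion)
 have ae: "AE x in lebesgue. rep_l2 f x = f0 x" using f0(2) by (rule AE_completion)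
 have sl: "square_integrable lebesgue f0"
  by (rule square_integrable_cong_AE[OF square_integrable_rep ae m])
 hence "square_integrable lborel f0" using f0(1) by (simp add: square_integrable_def integrable_completion)
 moreover have "f = abs_l2 f0" using abs_l2_eqI[OF square_integrable_rep sl ae] by simp
 ultimately show ?thesis using that[of f0] f0(1) ae by simp
qed

lemma norm_abs_l2_lborel: "square_integrable lborel g ==> norm (abs_l2 g) = sq_norm lborel g"
 unfolding sq_norm_def norm_l2_sq_abs[OF square_integrable_lborel_lebesgue, symmetric]
 by (subst integral_completion[symmetric]) (auto simp: square_integrable_def norm_l2_sq_abs[OF square_integrable_lborel_lebesgue, unfolded square_integrable_def, symmetric])

lemma bounded_support_l2:
 fixes g :: "'a::euclidean_space => complex"
 assumes g: "g \<in> borel_measurable borel" and B: "0 <= B" "!!x. cmod (g x) <= B" and R: "!!x. R < dist c x ==> g x = 0"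
 shows "square_integrable lborel g" "norm (abs_l2 g) <= B * sqrt (measure lborel (cball c R))"
proof -
 note i = integrable_bounded_support[of "%x. (cmod (g x))^2" "B^2" R c]
 show sq: "square_integrable lborel g" unfolding square_integrable_def using i(1) g B R by (simp add: power_mono)
 have "(norm (abs_l2 g))^2 <= (B * sqrt (measure lborel (cball c R)))^2"
  using i(2) g B R by (simp add: norm_abs_l2_lborel[OF sq] sq_norm_sq power_mono power_mult_distrib)
 thus "norm (abs_l2 g) <= B * sqrt (measure lborel (cball c R))" by (rule power2_le_imp_le) (use B in simp)
qed

definition refl_l2 :: "(real^'n::finite => complex) => real^'n => (real^'n) l2" where
 "refl_l2 \<rho> x = abs_l2 (%y. cnj (\<rho> (x - y)))"

text \<open>The convolution of \<open>f\<close> and \<rho>. Written as an inner product with a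
  translated kernel, it inherits differentiability from the map that sends \<open>x\<close> to this
  kernel in L2, with no differentiation under the integral.\<close>

definition conv :: "(real^'n::finite) l2 => (real^'n => complex) => real^'n => complex" where
 "conv f \<rho> x = cinner_l2 f (refl_l2 \<rho> x)"

lemma refl_sq: "test_function \<rho> ==> square_integrable lebesgue (%y. cnj (\<rho> (x - y)))"
 by (intro test_square_integrable test_cnj test_reflect)

lemma scaleR_abs_l2:
 "square_integrable lebesgue f ==> r *\<^sub>R abs_l2 f = abs_l2 (%x. of_real r * f x)"
 by (simp add: scaleR_scaleC scaleC_l2_abs)

lemma sum_abs_l2:
 assumes "finite J" "!!j. j \<in> J ==> square_integrable lebesgue (g j)"
 shows "square_integrable lebesgue (%x. \<Sum>j\<in>J. g j x) \<and> (\<Sum>j\<in>J. abs_l2 (g j)) = abs_l2 (%x. \<Sum>j\<in>J. g j x)"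
 using assms
proof (induction J)
 case empty
 thus ?case by (simp add: zero_l2_def square_integrable_def)
next
 case (insert i J)
 thus ?case by (simp add: square_integrable_add plus_l2_abs)
qed

text \<open>The remainder of the expansion is uniformly small and lives in a fixed ball, hence is
  small in L2.\<close>

lemma refl_l2_has_derivative:
 fixes \<rho> :: "real^'n::finite => complex"
 assumes \<rho>: "test_function \<rho>"
 shows "(refl_l2 \<rho> has_derivative (%h. \<Sum>j\<in>UNIV. h $ j *\<^sub>R refl_l2 (pD j \<rho>) x)) (at x)"
 unfolding has_derivative_at_alt
proof (intro conjI allI impI)
 show "bounded_linear (%h. \<Sum>j\<in>UNIV. h $ j *\<^sub>R refl_l2 (pD j \<rho>) x)"
  by (intro bounded_linear_sum bounded_linear_scaleR_const bounded_linear_vec_nth)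
 fix e :: real assume e: "0 < e"
 obtain R where R: "0 < R" "!!x j. R < norm x ==> \<rho> x = 0 \<and> pD j \<rho> x = 0" using test_support[OF \<rho>] by blast
 \<comment> \<open>The ball of radius R + 1 around \<open>x\<close> contains the supports of both
   translates as long as |y - x| < 1.\<close>
 define K where "K = sqrt (measure lborel (cball x (R + 1)))"
 have K: "0 < K" using R(1) by (simp add: K_def content_cball_pos)
 obtain d where d: "0 < d" "!!x h. norm h < d ==> cmod (\<rho> (x + h) - \<rho> x - (\<Sum>j\<in>UNIV. h $ j *\<^sub>R pD j \<rho> x)) <= e / K * norm h"
  using test_taylor[OF \<rho>, of "e / K"] e K by auto
 have "norm (refl_l2 \<rho> y - refl_l2 \<rho> x - (\<Sum>j\<in>UNIV. (y - x) $ j *\<^sub>R refl_l2 (pD j \<rho>) x)) <= e * norm (y - x)"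
  if y: "norm (y - x) < min d 1" for y
 proof -
  define h where "h = y - x"
  define g where "g z = cnj (\<rho> (y - z)) - cnj (\<rho> (x - z)) - (\<Sum>j\<in>UNIV. of_real (h $ j) * cnj (pD j \<rho> (x - z)))" for z
  note sq = refl_sq[OF \<rho>] refl_sq[OF test_partial_deriv[OF \<rho>]]
  note sm = sum_abs_l2[of UNIV "%j z. of_real (h $ j) * cnj (pD j \<rho> (x - z))", OF finite_class.finite_UNIV square_integrable_scale[OF sq(2)]]
  have g: "g z = cnj (\<rho> ((x - z) + h) - \<rho> (x - z) - (\<Sum>j\<in>UNIV. h $ j *\<^sub>R pD j \<rho> (x - z)))" for z
   by (simp add: g_def h_def scaleR_conv_of_real algebra_simps)
  have le: "cmod (g z) <= e / K * norm h" for z unfolding g complex_mod_cnj by (rule d(2)) (use y in \<open>simp add: h_def\<close>)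
  have z: "g z = 0" if "R + 1 < dist x z" for z
  proof -
   have "R < norm (x - z)" "R < norm (y - z)" using that y norm_triangle_ineq4[of "y - z" "y - x"] by (auto simp: dist_norm)
   thus ?thesis by (simp add: g_def R(2))
  qed
  have m: "g \<in> borel_measurable borel"
   unfolding g_def using test_borel[OF test_reflect[OF \<rho>]] test_borel[OF test_reflect[OF test_partial_deriv[OF \<rho>]]]
   by measurable
  have "refl_l2 \<rho> y - refl_l2 \<rho> x - (\<Sum>j\<in>UNIV. h $ j *\<^sub>R refl_l2 (pD j \<rho>) x) = abs_l2 g"
   unfolding refl_l2_def g_def using sm by (simp add: scaleR_abs_l2 sq minus_l2_abs square_integrable_diff)
  moreover have "norm (abs_l2 g) <= e / K * norm h * K" using bounded_support_l2(2)[where R="R + 1" and c=x, OF m _ le z] e K unfolding K_def[symmetric] by simp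
  ultimately show ?thesis using K by (simp add: h_def)
 qed
 thus "\<exists>d>0. \<forall>y. norm (y - x) < d -->
   norm (refl_l2 \<rho> y - refl_l2 \<rho> x - (\<Sum>j\<in>UNIV. (y - x) $ j *\<^sub>R refl_l2 (pD j \<rho>) x)) <= e * norm (y - x)"
  using d(1) by (intro exI[of _ "min d 1"]) simp
qed

lemma bounded_linear_cinner_right: "bounded_linear (%g. cinner_l2 f g)"
proof (rule bounded_linear_intro)
 show "norm (cinner_l2 f g) <= norm g * norm f" for g using cinner_bound[of f g] by (simp add: mult.commute)
qed (simp_all add: cinner_add_right scaleR_scaleC cinner_scaleC_right scaleR_conv_of_real)

lemma bounded_linear_cinner_left: "bounded_linear (%f. cinner_l2 f g)"
proof (rule bounded_linear_intro)
 show "norm (cinner_l2 f g) <= norm f * norm g" for f by (rule cinner_bound)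
qed (simp_all add: cinner_add_left scaleR_scaleC cinner_scaleC_left scaleR_conv_of_real)

lemma conv_has_derivative:
 assumes \<rho>: "test_function \<rho>"
 shows "(conv f \<rho> has_derivative (%h. \<Sum>j\<in>UNIV. h $ j *\<^sub>R conv f (pD j \<rho>) x)) (at x)"
proof -
 have "((%x. cinner_l2 f (refl_l2 \<rho> x)) has_derivative (%h. cinner_l2 f (\<Sum>j\<in>UNIV. h $ j *\<^sub>R refl_l2 (pD j \<rho>) x))) (at x)"
  by (rule bounded_linear.has_derivative[OF bounded_linear_cinner_right refl_l2_has_derivative[OF \<rho>]])
 moreover have "cinner_l2 f (\<Sum>j\<in>UNIV. h $ j *\<^sub>R refl_l2 (pD j \<rho>) x) = (\<Sum>j\<in>UNIV. h $ j *\<^sub>R conv f (pD j \<rho>) x)" for h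
  using bounded_linear_cinner_right[of f] by (simp add: bounded_linear.linear linear_sum linear_cmul conv_def)
 ultimately show ?thesis unfolding conv_def[abs_def] by simp
qed

lemma partial_deriv_conv:
 assumes \<rho>: "test_function \<rho>"
 shows "pD j (conv f \<rho>) = conv f (pD j \<rho>)"
proof
 fix x
 have "pD j (conv f \<rho>) x = (\<Sum>i\<in>UNIV. axis j 1 $ i *\<^sub>R conv f (pD i \<rho>) x)"
  by (rule partial_deriv_eq[OF conv_has_derivative[OF \<rho>]])
 also have "... = (\<Sum>i\<in>UNIV. if i = j then conv f (pD i \<rho>) x else 0)"
  by (rule sum.cong) (auto simp: axis_def)
 finally show "pD j (conv f \<rho>) x = conv f (pD j \<rho>) x" by simp
qed

lemma smooth_conv:
 assumes \<rho>: "test_function \<rho>" shows "smooth (conv f \<rho>)"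
proof (rule smooth_coinduct[of _ "{conv f \<rho> | \<rho>. test_function \<rho>}"])
 show "conv f \<rho> \<in> {conv f \<rho> | \<rho>. test_function \<rho>}" using \<rho> by blast
 show "g differentiable (at x)" if "g \<in> {conv f \<rho> | \<rho>. test_function \<rho>}" for g x
  using that conv_has_derivative[of _ f x] by (auto simp: differentiable_def)
 show "pD j g \<in> {conv f \<rho> | \<rho>. test_function \<rho>}" if "g \<in> {conv f \<rho> | \<rho>. test_function \<rho>}" for g j
 proof -
  obtain \<rho> where "g = conv f \<rho>" "test_function \<rho>" using \<open>g \<in> _\<close> by blast
  hence "pD j g = conv f (pD j \<rho>)" "test_function (pD j \<rho>)"
   by (simp_all add: partial_deriv_conv test_partial_deriv)
  thus ?thesis by blast
 qed
qed

lemma conv_integral: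
 assumes \<rho>: "test_function \<rho>" and f0: "f0 \<in> borel_measurable borel" "square_integrable lborel f0" "f = abs_l2 f0"
 shows "conv f \<rho> x = (LINT y|lborel. f0 y * \<rho> (x - y))" "integrable lborel (%y. f0 y * \<rho> (x - y))"
proof -
 have [measurable]: "(%y. \<rho> (x - y)) \<in> borel_measurable borel" by (intro test_borel test_reflect \<rho>)
 note [measurable] = f0(1)
 have "conv f \<rho> x = (LINT y|lebesgue. f0 y * cnj (cnj (\<rho> (x - y))))"
  unfolding conv_def refl_l2_def f0(3) by (rule cinner_l2_abs[OF square_integrable_lborel_lebesgue[OF f0(2)] refl_sq[OF \<rho>]])
 thus "conv f \<rho> x = (LINT y|lborel. f0 y * \<rho> (x - y))" by (simp add: integral_completion)
 have "square_integrable lborel (%y. cnj (\<rho> (x - y)))"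
  by (intro test_square_integrable test_cnj test_reflect \<rho>)
 from square_integrable_mult_cnj[OF f0(2) this] show "integrable lborel (%y. f0 y * \<rho> (x - y))" by simp
qed

text \<open>Young's inequality: |\<rho>| is split into two square roots, Cauchy-Schwarz is applied
  at each point and Fubini to the result.\<close>

lemma conv_young:
 fixes \<rho> :: "real^'n::finite => complex"
 assumes \<rho>: "test_function \<rho>"
 shows "square_integrable lborel (conv f \<rho>)" "square_integrable lebesgue (conv f \<rho>)"
  "norm (abs_l2 (conv f \<rho>)) <= (LINT y|lborel. cmod (\<rho> y)) * norm f"
proof -
 obtain f0 where f0: "f0 \<in> borel_measurable borel" "square_integrable lborel f0" "f = abs_l2 f0" using l2_borel_rep[of f] by metis
 define N where "N = (LINT y|lborel. cmod (\<rho> y))"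
 have N0: "0 <= N" by (simp add: N_def)
 note [measurable] = f0(1) test_borel[OF \<rho>]
 have meas: "conv f \<rho> \<in> borel_measurable borel" by (intro borel_measurable_continuous_onI smooth_continuous smooth_conv \<rho>)
 have N: "(\<integral>\<^sup>+y. ennreal (cmod (\<rho> y)) \<partial>lborel) = ennreal N"
  unfolding N_def using test_integrable(1)[OF \<rho>] by (intro nn_integral_eq_integral) auto
 have pw: "ennreal ((cmod (conv f \<rho> x))^2) <= (\<integral>\<^sup>+y. ennreal ((cmod (f0 y))^2) * ennreal (cmod (\<rho> (x - y))) \<partial>lborel) * ennreal N" for x
 proof -
  let ?r = "%y. ennreal (sqrt (cmod (\<rho> (x - y))))"
  have r: "?r y * ?r y = ennreal (cmod (\<rho> (x - y)))" for y by (simp add: ennreal_mult[symmetric])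
  have "ennreal (cmod (conv f \<rho> x)) <= (\<integral>\<^sup>+y. ennreal (cmod (f0 y * \<rho> (x - y))) \<partial>lborel)"
   unfolding conv_integral(1)[OF \<rho> f0] by (rule integral_norm_bound_ennreal[OF conv_integral(2)[OF \<rho> f0]])
  also have "... = (\<integral>\<^sup>+y. (ennreal (cmod (f0 y)) * ?r y) * ?r y \<partial>lborel)" by (simp add: norm_mult ennreal_mult' r mult.assoc)
  finally have "(ennreal (cmod (conv f \<rho> x)))^2 <= (\<integral>\<^sup>+y. (ennreal (cmod (f0 y)) * ?r y)^2 \<partial>lborel) * (\<integral>\<^sup>+y. (?r y)^2 \<partial>lborel)"
   by (rule order_trans[OF power_mono Cauchy_Schwarz_nn_integral]) auto
  thus ?thesis
   using nn_integral_lborel_shift(2)[of "%y. ennreal (cmod (\<rho> y))" x] N by (simp add: power_mult_distrib power2_eq_square[of "?r _"] r ennreal_power)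
 qed
 have "(\<integral>\<^sup>+x. ennreal ((cmod (conv f \<rho> x))^2) \<partial>lborel) <= (\<integral>\<^sup>+x. \<integral>\<^sup>+y. ennreal ((cmod (f0 y))^2) * ennreal (cmod (\<rho> (x - y))) \<partial>lborel \<partial>lborel) * ennreal N"
  by (subst nn_integral_multc[symmetric]) (auto intro!: nn_integral_mono pw)
 also have "(\<integral>\<^sup>+x. \<integral>\<^sup>+y. ennreal ((cmod (f0 y))^2) * ennreal (cmod (\<rho> (x - y))) \<partial>lborel \<partial>lborel)
   = (\<integral>\<^sup>+y. \<integral>\<^sup>+x. ennreal ((cmod (f0 y))^2) * ennreal (cmod (\<rho> (x - y))) \<partial>lborel \<partial>lborel)"
  by (rule lborel_pair.Fubini') measurable
 also have "... = ennreal ((norm f)^2) * ennreal N"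
  using nn_integral_lborel_shift(1)[of "%y. ennreal (cmod (\<rho> y))" "- _"] nn_integral_sq_norm[OF f0(2)]
  by (simp add: nn_integral_cmult nn_integral_multc N f0(3) norm_abs_l2_lborel[OF f0(2)])
 also have "... * ennreal N = ennreal ((N * norm f)^2)" using N0 by (simp add: ennreal_mult[symmetric] power2_eq_square mult_ac)
 finally have nn: "(\<integral>\<^sup>+x. ennreal ((cmod (conv f \<rho> x))^2) \<partial>lborel) <= ennreal ((N * norm f)^2)" .
 have mL: "conv f \<rho> \<in> borel_measurable lborel" using meas by simp
 show s: "square_integrable lborel (conv f \<rho>)" by (rule square_integrableI_nn(1)[OF mL nn]) simp
 thus "square_integrable lebesgue (conv f \<rho>)" by (rule square_integrable_lborel_lebesgue)
 have "(norm (abs_l2 (conv f \<rho>)))^2 <= (N * norm f)^2"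
  unfolding norm_abs_l2_lborel[OF s] by (rule square_integrableI_nn(2)[OF mL nn]) simp
 thus "norm (abs_l2 (conv f \<rho>)) <= N * norm f" by (rule power2_le_imp_le) (use N0 in simp)
qed

lemma l2_dominated_convergence:
 fixes f :: "'a::euclidean_space => complex"
 assumes X: "!!n. square_integrable lebesgue (X n)" and f: "square_integrable lebesgue f"
  and lim: "AE x in lebesgue. (%n. X n x) ----> f x"
  and w: "integrable lebesgue (%x. (w x)^2)" "!!n x. cmod (X n x - f x) <= w x"
 shows "(%n. abs_l2 (X n)) ----> abs_l2 f"
proof -
 note d = square_integrable_diff[OF X f]
 have "(%n. LINT x|lebesgue. (cmod (X n x - f x))^2) ----> (LINT x|(lebesgue :: 'a measure). 0)"
 proof (rule integral_dominated_convergence[OF _ _ w(1)])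
  show "AE x in lebesgue. (%n. (cmod (X n x - f x))^2) ----> 0"
   using lim by eventually_elim (use tendsto_power[OF tendsto_norm_zero[OF LIM_zero], of _ _ _ 2] in simp)
  show "AE x in lebesgue. norm ((cmod (X n x - f x))^2) <= (w x)^2" for n using w(2) by (intro AE_I2) (simp add: power_mono)
 qed (use d in \<open>auto simp: square_integrable_def\<close>)
 hence "(%n. (norm (abs_l2 (X n) - abs_l2 f))^2) ----> 0" by (simp add: minus_l2_abs X f norm_l2_sq_abs d)
 from tendsto_real_sqrt[OF this] show ?thesis by (simp add: tendsto_norm_zero_iff LIM_zero_iff)
qed

text \<open>Truncate \<open>f\<close> in argument and value, approximate the truncation almost
  everywhere by continuous functions, and truncate these continuously as well, so that dominated
  convergence gives convergence in L2.\<close>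

lemma continuous_bounded_support_dense:
 fixes f :: "'a::euclidean_space l2"
 assumes e: "0 < e"
 shows "\<exists>k R. continuous_on UNIV k \<and> (\<forall>x. R < norm x --> k x = 0) \<and> square_integrable lborel k \<and> norm (f - abs_l2 k) < e"
proof -
 define F where "F m x = (if norm x <= real m \<and> cmod (rep_l2 f x) <= real m then rep_l2 f x else 0)" for m x
 have [measurable]: "norm \<in> borel_measurable (lebesgue :: 'a measure)" by (intro measurable_completion) simp
 have Fm: "F m \<in> borel_measurable lebesgue" for m unfolding F_def by measurable
 have Fsq: "square_integrable lebesgue (F m)" for m
  unfolding square_integrable_def using Fm
  by (auto intro!: Bochner_Integration.integrable_bound[OF rep_l2_integrable[of f]] power_mono simp: F_def)
 have "(%m. abs_l2 (F m)) ----> abs_l2 (rep_l2 f)"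
 proof (rule l2_dominated_convergence[OF Fsq square_integrable_rep _ rep_l2_integrable[of f]])
  show "AE x in lebesgue. (%m. F m x) ----> rep_l2 f x"
  proof (intro AE_I2 tendsto_eventually)
   fix x
   obtain m0 where m0: "max (norm x) (cmod (rep_l2 f x)) <= real m0" using real_arch_simple by blast
   show "\<forall>\<^sub>F m in sequentially. F m x = rep_l2 f x"
    using eventually_ge_at_top[of m0] by eventually_elim (use m0 in \<open>simp add: F_def\<close>)
  qed
 qed (simp add: F_def)
 from tendstoD[OF this, of "e / 2"] e obtain m where m: "norm (f - abs_l2 (F m)) < e / 2"
  by (auto simp: eventually_sequentially dist_norm norm_minus_commute)
 obtain N g where N: "negligible N" and gc: "!!n. continuous_on UNIV (g n)" and glim: "!!x. x \<notin> N ==> (%n. g n x) ----> F m x"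
  using lebesgue_measurable_imp_measurable_on[OF Fm[of m], of UNIV] unfolding measurable_on_def by auto
 define M where "M = real m + 1"
 have M: "0 < M" by (simp add: M_def)
 \<comment> \<open>A continuous truncation in both the point and the value that leaves
   \<open>F m\<close> unchanged, because \<open>F m\<close> vanishes outside radius \<open>m\<close>
   and has modulus at most \<open>m\<close>, one less than \<open>M\<close>.\<close>
 define c where "c x z = of_real (max 0 (min 1 (M - norm x))) * (z * of_real (M / max M (cmod z)))" for x :: 'a and z
 have cF: "c x (F m x) = F m x" for x by (auto simp: c_def F_def M_def max_absorb1)
 have cM: "cmod (c x z) <= M" for x z
 proof -
  have "cmod z * (M / max M (cmod z)) <= M" using M by (simp add: field_simps max_def)
  moreover have "cmod (c x z) = max 0 (min 1 (M - norm x)) * (cmod z * (M / max M (cmod z)))" using M by (simp add: c_def norm_mult norm_divide)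
  ultimately have "cmod (c x z) <= 1 * M" using M by (simp only:) (rule mult_mono, auto)
  thus ?thesis by simp
 qed
 have c0: "c x z = 0" if "M < norm x" for x z using that by (simp add: c_def)
 define G where "G n x = c x (g n x)" for n x
 have Gc: "continuous_on UNIV (G n)" for n unfolding G_def c_def using M by (intro continuous_intros gc) auto
 have Gsq: "square_integrable lborel (G n)" for n
  by (rule bounded_support_l2(1)[where B=M and R=M and c=0, OF borel_measurable_continuous_onI[OF Gc]]) (use M cM c0 in \<open>auto simp: G_def\<close>)
 have "(%n. abs_l2 (G n)) ----> abs_l2 (F m)"
 proof (rule l2_dominated_convergence[where w="%x. indicat_real (cball 0 M) x * (2 * M)", OF square_integrable_lborel_lebesgue[OF Gsq] Fsq])
  have "AE x in lebesgue. x \<notin> N" using N by (simp add: negligible_iff_null_sets AE_not_in)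
  thus "AE x in lebesgue. (%n. G n x) ----> F m x"
  proof eventually_elim
   case (elim x)
   have "(%n. G n x) ----> c x (F m x)" unfolding G_def c_def using M by (intro tendsto_intros glim[OF elim]) auto
   thus ?case by (simp only: cF)
  qed
  have "integrable lborel (%x::'a. (indicat_real (cball 0 M) x * (2 * M))^2)"
   by (rule integrable_bounded_support(1)[of _ "(2 * M)^2" M 0]) (use M in \<open>auto simp: indicator_def\<close>)
  thus "integrable lebesgue (%x::'a. (indicat_real (cball 0 M) x * (2 * M))^2)"
   by (subst integrable_completion[OF borel_measurable_integrable])
  show "cmod (G n x - F m x) <= indicat_real (cball 0 M) x * (2 * M)" for n x
   using norm_triangle_ineq4[of "G n x" "F m x"] cM[of x "g n x"] cM[of x "F m x"] c0[of x "g n x"] c0[of x "F m x"]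
   by (cases "norm x <= M") (auto simp: G_def cF)
 qed
 from tendstoD[OF this, of "e / 2"] e obtain n where "norm (abs_l2 (F m) - abs_l2 (G n)) < e / 2"
  by (auto simp: eventually_sequentially dist_norm norm_minus_commute)
 hence "norm (f - abs_l2 (G n)) < e" using m norm_triangle_ineq[of "f - abs_l2 (F m)" "abs_l2 (F m) - abs_l2 (G n)"] by simp
 thus ?thesis using Gc Gsq c0 by (intro exI[of _ "G n"] exI[of _ M]) (auto simp: G_def)
qed

lemma conv_diff: "conv (f - g) \<rho> x = conv f \<rho> x - conv g \<rho> x"
 by (simp add: conv_def cinner_diff_left)

abbreviation bump :: "real^'n::finite => complex" where
 "bump x \<equiv> complex_of_real (exp_bump 1 (1 - x \<bullet> x))"

lemma test_bump: "test_function bump"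
 unfolding test_iff using smooth_bump
 by (intro conjI exI[of _ 1]) (auto simp: exp_bump_def dot_square_norm dest: one_less_power[of _ 2])

text \<open>The constant divides by the integral of the scaled bump itself, which avoids a change of
  variables.\<close>

definition mollifier :: "nat => real^'n::finite => complex" where
 "mollifier n x = complex_of_real (1 / (LINT y|lborel. exp_bump 1 (1 - (real (Suc n) *\<^sub>R (y::real^'n)) \<bullet> (real (Suc n) *\<^sub>R y)))) * bump (real (Suc n) *\<^sub>R x)"

lemma mollifier:
 fixes n :: nat
 defines "\<rho> \<equiv> (mollifier n :: real^'n::finite => complex)"
 shows "test_function \<rho>" "!!x. 1 / real (Suc n) < norm x ==> \<rho> x = 0" "(LINT y|lborel. cmod (\<rho> y)) = 1" "(LINT y|lborel. \<rho> y) = 1"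
proof -
 define s where "s = real (Suc n)"
 have s: "0 < s" by (simp add: s_def)
 define b where "b x = exp_bump 1 (1 - (s *\<^sub>R x) \<bullet> (s *\<^sub>R x))" for x :: "real^'n"
 have tb: "test_function (%x. complex_of_real (b x))" using test_affine[OF test_bump, of s 0] s by (simp add: b_def)
 have ib: "integrable lborel b" using test_integrable(1)[OF tb] by (simp add: complex_of_real_integrable_eq)
 define c where "c = (LINT y|lborel. b y)"
 have b0: "0 <= b x" for x by (simp add: b_def exp_bump_nonneg)
 have "c ~= 0"
 proof
  assume "c = 0"
  hence "AE x in lborel. b x = 0" unfolding c_def using integral_nonneg_eq_0_iff_AE[OF ib] b0 by auto
  moreover have "0 < b x" if "x \<in> ball 0 (1 / s)" for x
  proof -
   have "norm (s *\<^sub>R x) < 1" using that s by (simp add: field_simps)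
   hence "(norm (s *\<^sub>R x))^2 < 1" by (simp add: power_less_one_iff)
   thus ?thesis unfolding b_def power2_norm_eq_inner by (intro exp_bump_pos) simp
  qed
  ultimately have "AE x in lborel. x \<notin> ball (0::real^'n) (1 / s)" by (force elim: eventually_mono)
  hence "measure lborel (ball (0::real^'n) (1 / s)) = 0" by (simp add: measure_eq_AE[of "ball _ _" "{}"])
  thus False using content_ball_pos[of "1 / s" "0::real^'n"] s by simp
 qed
 moreover have "0 <= c" unfolding c_def using b0 by simp
 ultimately have c: "0 < c" by simp
 have \<rho>: "\<rho> = (%x. complex_of_real (1 / c) * complex_of_real (b x))" by (simp add: \<rho>_def mollifier_def c_def b_def[abs_def] s_def fun_eq_iff)
 show "test_function \<rho>" unfolding \<rho> by (rule test_cmult[OF tb])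
 show "\<rho> x = 0" if "1 / real (Suc n) < norm x" for x
 proof -
  have "1 < norm (s *\<^sub>R x)" using that s unfolding s_def[symmetric] by (simp add: field_simps)
  hence "1 < (norm (s *\<^sub>R x))^2" by (rule one_less_power) simp
  thus ?thesis unfolding \<rho> b_def exp_bump_def power2_norm_eq_inner by simp
 qed
 have "cmod (\<rho> x) = (1 / c) * b x" for x unfolding \<rho> norm_mult norm_of_real using c b0 by simp
 thus "(LINT y|lborel. cmod (\<rho> y)) = 1" using c ib by (simp add: c_def)
 have "(LINT y|lborel. \<rho> y) = complex_of_real (1 / c) * complex_of_real c" unfolding \<rho> c_def using ib by (simp add: integral_complex_of_real)
 thus "(LINT y|lborel. \<rho> y) = 1" using c by (simp flip: of_real_mult)
qed

definition moll :: "nat => (real^'n::finite) l2 => (real^'n) l2" where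
 "moll n f = abs_l2 (conv f (mollifier n))"

lemma moll_norm: "norm (moll n f) <= norm f"
 using conv_young(3)[OF mollifier(1), of f n] by (simp add: moll_def mollifier(3))

lemma moll_diff: "moll n (f - g) = moll n f - moll n g"
 unfolding moll_def by (simp add: minus_l2_abs conv_young(2) mollifier(1) conv_diff[abs_def])

lemma conv_mollifier_bound:
 fixes k :: "real^'n::finite => complex"
 assumes k: "k \<in> borel_measurable borel" "square_integrable lborel k" and le: "!!y. norm (x - y) <= 1 / real (Suc n) ==> cmod (k y - k x) <= B"
 shows "cmod (conv (abs_l2 k) (mollifier n) x - k x) <= B"
proof -
 define \<rho> where "\<rho> = (mollifier n :: real^'n => complex)"
 note mol = mollifier[where n=n and 'n='n, folded \<rho>_def]
 note i = test_integrable(1)[OF test_reflect[OF mol(1)], of x]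
 have [measurable]: "\<rho> \<in> borel_measurable borel" by (rule test_borel[OF mol(1)])
 note ci = conv_integral[OF mol(1) k refl, of x]
 have n: "(LINT y|lborel. cmod (\<rho> (x - y))) = 1" "(LINT y|lborel. \<rho> (x - y)) = 1"
  using integral_lborel_shift(2)[of "%y. cmod (\<rho> y)" x] integral_lborel_shift(2)[of \<rho> x] mol by simp_all
 have "conv (abs_l2 k) \<rho> x - k x = (LINT y|lborel. (k y - k x) * \<rho> (x - y))" using ci i n(2) by (simp add: left_diff_distrib)
 also have "cmod ... <= (LINT y|lborel. cmod ((k y - k x) * \<rho> (x - y)))" by (rule integral_norm_bound)
 also have "... <= (LINT y|lborel. B * cmod (\<rho> (x - y)))"
 proof (rule integral_mono)
  show "cmod ((k y - k x) * \<rho> (x - y)) <= B * cmod (\<rho> (x - y))" for y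
   using le[of y] mol(2)[of "x - y"] by (cases "norm (x - y) <= 1 / real (Suc n)") (auto simp: norm_mult mult_right_mono)
 qed (use ci(2) i in \<open>auto simp: left_diff_distrib\<close>)
 finally show ?thesis using n(1) by (simp add: \<rho>_def)
qed

text \<open>Mollification is contractive, so it suffices to treat a continuous function of bounded
  support close to \<open>f\<close>, for which convergence is uniform on a fixed ball.\<close>

lemma moll_tendsto: "(%n. moll n f) ----> f"
proof (rule LIMSEQ_I)
 fix e :: real assume e: "0 < e"
 obtain k R where k: "continuous_on UNIV k" "!!x. R < norm x ==> k x = 0" "square_integrable lborel k" "norm (f - abs_l2 k) < e / 3"
  using continuous_bounded_support_dense[of "e/3" f] e by auto
 have km: "k \<in> borel_measurable borel" by (rule borel_measurable_continuous_onI[OF k(1)])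
 have ks: "square_integrable lebesgue k" by (rule square_integrable_lborel_lebesgue[OF k(3)])
 define K where "K = sqrt (measure lborel (cball (0::real^'a) (max R 0 + 1)))"
 have K: "0 < K" by (simp add: K_def content_cball_pos)
 obtain d where d: "0 < d" "!!x y. dist x y < d ==> cmod (k x - k y) < e / (3 * K)"
  by (rule uniformly_continuous_bounded_support[OF k(1,2), where e="e / (3 * K)", THEN exE]) (use e K in auto)
 obtain n0 where n0: "1 / real (Suc n0) < min d 1" using nat_approx_posE[of "min d 1"] d by auto
 have "norm (moll n f - f) < e" if n: "n0 <= n" for n
 proof -
  have "1 / real (Suc n) <= 1 / real (Suc n0)" using n by (simp add: frac_le)
  hence nd: "1 / real (Suc n) < d" "1 / real (Suc n) < 1" using n0 unfolding min_less_iff_conj by linarith+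
  note cs = conv_young(1,2)[OF mollifier(1), of "abs_l2 k" n]
  have "norm (abs_l2 (%x. conv (abs_l2 k) (mollifier n) x - k x)) <= e / (3 * K) * sqrt (measure lborel (cball (0::real^'a) (max R 0 + 1)))"
  proof (rule bounded_support_l2(2))
   show "(%x. conv (abs_l2 k) (mollifier n) x - k x) \<in> borel_measurable borel" using cs(1) km by (intro borel_measurable_diff) (auto simp: square_integrable_def)
   show "cmod (conv (abs_l2 k) (mollifier n) x - k x) <= e / (3 * K)" for x
    using d(2)[of _ x] nd by (intro conv_mollifier_bound km k(3)) (auto simp: dist_norm norm_minus_commute less_imp_le)
   show "conv (abs_l2 k) (mollifier n) x - k x = 0" if z: "max R 0 + 1 < dist 0 x" for x
   proof -
    have "k y = 0" if y: "norm (x - y) <= 1 / real (Suc n)" for y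
     using y nd(2) z[unfolded dist_0_norm] norm_triangle_sub[of x y] max.cobounded1[of R 0] by (intro k(2)) linarith
    hence "cmod (conv (abs_l2 k) (mollifier n) x - k x) <= 0" using k(2)[of x] z by (intro conv_mollifier_bound km k(3)) auto
    thus ?thesis by simp
   qed
  qed (use e K in simp)
  hence "norm (moll n (abs_l2 k) - abs_l2 k) <= e / 3" unfolding K_def[symmetric] using K by (simp add: moll_def minus_l2_abs cs ks)
  moreover have "norm (moll n f - moll n (abs_l2 k)) < e / 3" using moll_norm[of n "f - abs_l2 k"] k(4) by (simp add: moll_diff)
  ultimately show ?thesis using k(4) norm_diff_triangle_ineq[of "moll n f" f "moll n (abs_l2 k)" "abs_l2 k"]
   norm_triangle_ineq[of "moll n f - moll n (abs_l2 k)" "moll n (abs_l2 k) - abs_l2 k"] norm_triangle_ineq4[of "moll n f - abs_l2 k" "f - abs_l2 k"]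
   by simp
 qed
 thus "\<exists>n0. \<forall>n\<ge>n0. norm (moll n f - f) < e" by blast
qed

section \<open>Weak derivatives\<close>

text \<open>The definition pairs bilinearly while L2 has a sesquilinear product; the two agree
  because test functions are closed under conjugation.\<close>

lemma has_weak_partial_iff:
 "has_weak_partial j f g \<longleftrightarrow>
   (\<forall>\<phi>. test_function \<phi> --> cinner_l2 f (abs_l2 (pD j \<phi>)) = - cinner_l2 g (abs_l2 \<phi>))"
proof -
 have c: "cinner_l2 f (abs_l2 \<phi>) = (LINT x|lebesgue. rep_l2 f x * cnj (\<phi> x))" if "test_function \<phi>" for f \<phi>
  using cinner_l2_abs[OF square_integrable_rep[of f] test_square_integrable(2)[OF that]] by simp
 have e: "cinner_l2 f (abs_l2 (pD j \<phi>)) = - cinner_l2 g (abs_l2 \<phi>) \<longleftrightarrow>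
   (LINT x|lebesgue. rep_l2 f x * pD j (%x. cnj (\<phi> x)) x) = - (LINT x|lebesgue. rep_l2 g x * cnj (\<phi> x))"
  if "test_function \<phi>" for \<phi>
  using that by (simp add: c test_partial_deriv partial_deriv_cnj(1) test_differentiable)
 show ?thesis unfolding has_weak_partial_def using e e[OF test_cnj] test_cnj by auto
qed

lemma has_weak_partial_add:
 "has_weak_partial j f g ==> has_weak_partial j f' g' ==> has_weak_partial j (f + f') (g + g')"
 unfolding has_weak_partial_iff by (simp add: cinner_add_left)

lemma has_weak_partial_scaleC:
 "has_weak_partial j f g ==> has_weak_partial j (scaleC_l2 c f) (scaleC_l2 c g)"
 unfolding has_weak_partial_iff by (simp add: cinner_scaleC_left)

lemma has_weak_partial_diff:
 "has_weak_partial j f g ==> has_weak_partial j f' g' ==> has_weak_partial j (f - f') (g - g')"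
 unfolding has_weak_partial_iff by (simp add: cinner_diff_left)

lemma has_weak_partial_limit:
 assumes h: "!!n. has_weak_partial j (f n) (g n)" and l: "f ----> F" "g ----> G"
 shows "has_weak_partial j F G"
 unfolding has_weak_partial_iff
proof (intro allI impI)
 fix \<phi> :: "real^'a => complex" assume t: "test_function \<phi>"
 note b = bounded_linear.tendsto[OF bounded_linear_cinner_left]
 have "(%n. cinner_l2 (f n) (abs_l2 (pD j \<phi>))) ----> - cinner_l2 G (abs_l2 \<phi>)"
  using tendsto_minus[OF b[OF l(2)], of "abs_l2 \<phi>"] h t unfolding has_weak_partial_iff by simp
 with b[OF l(1)] show "cinner_l2 F (abs_l2 (pD j \<phi>)) = - cinner_l2 G (abs_l2 \<phi>)" by (rule LIMSEQ_unique)
qed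

text \<open>The product of \<open>w\<close> with a conjugated test function is a test function, and
  the integral of its derivative vanishes.\<close>

lemma smooth_has_weak_partial:
 assumes w: "smooth w" "square_integrable lebesgue w" "square_integrable lebesgue (pD j w)"
 shows "has_weak_partial j (abs_l2 w) (abs_l2 (pD j w))"
 unfolding has_weak_partial_iff
proof (intro allI impI)
 fix \<phi> :: "real^'a => complex" assume t: "test_function \<phi>"
 note p = partial_deriv_cnj[OF test_differentiable[OF t]]
 note sq = test_square_integrable(2)[OF t] test_square_integrable(2)[OF test_partial_deriv[OF t, of j]]
 have tw: "test_function (%x. w x * cnj (\<phi> x))" by (rule test_mult[OF w(1) test_cnj[OF t]])
 have "0 = (LINT x|lebesgue. pD j (%x. w x * cnj (\<phi> x)) x)"
  using integral_partial_deriv_test[OF tw, of j] by (simp add: integral_completion test_borel test_partial_deriv tw)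
 also have "... = (LINT x|lebesgue. pD j w x * cnj (\<phi> x)) + (LINT x|lebesgue. w x * cnj (pD j \<phi> x))"
  unfolding partial_deriv_mult[OF smooth_differentiable[OF w(1)] p(2)] p(1)
  by (rule Bochner_Integration.integral_add[OF square_integrable_mult_cnj[OF w(3) sq(1)] square_integrable_mult_cnj[OF w(2) sq(2)]])
 finally show "cinner_l2 (abs_l2 w) (abs_l2 (pD j \<phi>)) = - cinner_l2 (abs_l2 (pD j w)) (abs_l2 \<phi>)"
  by (simp add: cinner_l2_abs w sq eq_neg_iff_add_eq_0 add.commute)
qed

lemma test_has_weak_partial: "test_function \<phi> ==> has_weak_partial j (abs_l2 \<phi>) (abs_l2 (pD j \<phi>))"
 by (intro smooth_has_weak_partial test_smooth test_square_integrable test_partial_deriv)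

lemma partial_deriv_refl:
 assumes "test_function \<rho>"
 shows "abs_l2 (pD j (%y. cnj (\<rho> (x - y)))) = - refl_l2 (pD j \<rho>) x"
proof -
 note d = partial_deriv_affine[OF test_differentiable[OF assms], where s="-1" and a=x, simplified]
 have "pD j (%y. cnj (\<rho> (x - y))) = (%y. - cnj (pD j \<rho> (x - y)))"
  by (rule ext) (simp add: partial_deriv_cnj(1)[OF d(2)] d(1))
 thus ?thesis unfolding refl_l2_def by (simp add: uminus_l2_abs refl_sq test_partial_deriv assms)
qed

text \<open>The reflected kernel is an admissible test function, so a derivative on the kernel may
  be moved to \<open>f\<close>.\<close>

lemma conv_weak_partial:
 assumes "has_weak_partial j f g" and \<rho>: "test_function \<rho>"
 shows "conv f (pD j \<rho>) = conv g \<rho>"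
proof
 fix x
 have "cinner_l2 f (abs_l2 (pD j (%y. cnj (\<rho> (x - y))))) = - cinner_l2 g (refl_l2 \<rho> x)"
  using assms(1) test_cnj[OF test_reflect[OF \<rho>]] unfolding has_weak_partial_iff refl_l2_def by blast
 thus "conv f (pD j \<rho>) x = conv g \<rho> x"
  by (simp add: conv_def cinner_uminus_right partial_deriv_refl[OF \<rho>])
qed

lemma conv_has_weak_partial:
 assumes \<rho>: "test_function \<rho>"
 shows "has_weak_partial j (abs_l2 (conv f \<rho>)) (abs_l2 (conv f (pD j \<rho>)))"
 using smooth_has_weak_partial[OF smooth_conv[OF \<rho>, of f] conv_young(2)[OF \<rho>], of j]
 by (simp add: partial_deriv_conv \<rho> conv_young test_partial_deriv)

lemma moll_has_weak_partial:
 "has_weak_partial j f g ==> has_weak_partial j (moll n f) (moll n g)"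
 unfolding moll_def using conv_has_weak_partial[OF mollifier(1)[of n], where f=f and j=j] by (simp add: conv_weak_partial mollifier)

text \<open>The factor exp 1 normalises the value at the origin to 1; the derivatives are O(1 /
  m).\<close>

definition cutoff :: "nat => real^'n::finite => complex" where
 "cutoff m x = complex_of_real (exp 1) * bump (0 + (1 / real (Suc m)) *\<^sub>R x)"

lemma cutoff:
 fixes x :: "real^'n::finite" and j :: 'n
 shows "test_function (cutoff m :: real^'n => complex)" "cmod (cutoff m x) <= 1" "cmod (cutoff m x - 1) <= 1"
  "\<exists>B>0. \<forall>m x. cmod (pD j (cutoff m) x) <= B / real (Suc m)"
proof -
 have t: "test_function (%x::real^'n. bump (0 + (1 / real (Suc m)) *\<^sub>R x))" for m by (rule test_affine[OF test_bump]) simp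
 show "test_function (cutoff m :: real^'n => complex)" unfolding cutoff_def[abs_def] by (rule test_cmult[OF t])
 have r: "0 <= exp 1 * exp_bump 1 s \<and> exp 1 * exp_bump 1 s <= 1" if "s <= 1" for s
 proof (cases "0 < s")
  case True
  hence "exp (1 + - (1 / s)) <= exp (0::real)" using that by (subst exp_le_cancel_iff) simp
  thus ?thesis using True by (simp add: exp_bump_def exp_add[symmetric])
 qed (simp add: exp_bump_def)
 have "cmod (cutoff m x) <= 1 \<and> cmod (cutoff m x - 1) <= 1"
 proof -
  define b where "b = exp 1 * exp_bump 1 (1 - (0 + (1 / real (Suc m)) *\<^sub>R x) \<bullet> (0 + (1 / real (Suc m)) *\<^sub>R x))"
  have "cutoff m x = complex_of_real b" "cutoff m x - 1 = complex_of_real (b - 1)" by (simp_all add: cutoff_def b_def)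
  moreover have "0 <= b" "b <= 1" unfolding b_def using r by simp_all
  ultimately show ?thesis by (simp only: norm_of_real) simp
 qed
 thus "cmod (cutoff m x) <= 1" "cmod (cutoff m x - 1) <= 1" by auto
 obtain B where B: "0 < B" "!!x::real^'n. cmod (pD j bump x) <= B"
  using test_bounded[OF test_partial_deriv[OF test_bump]] by blast
 note d = partial_deriv_affine[OF test_differentiable[OF test_bump], where a=0]
 have "cmod (pD j (cutoff m) x) <= exp 1 * B / real (Suc m)" for m x
  unfolding cutoff_def[abs_def] partial_deriv_cmult[OF d(2)] d(1) norm_mult norm_of_real using B(2) by (simp add: divide_right_mono)
 thus "\<exists>B>0. \<forall>m x. cmod (pD j (cutoff m) x) <= B / real (Suc m)" using B(1) by (intro exI[of _ "exp 1 * B"]) simp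
qed

lemma cutoff_tendsto_1: "(%m. cutoff m x) ----> 1"
proof -
 have "(%m. bump (0 + (1 / real (Suc m)) *\<^sub>R x)) ----> bump (0 + 0 *\<^sub>R x)"
  by (rule isCont_tendsto_compose[OF differentiable_imp_continuous_within[OF test_differentiable[OF test_bump]]])
   (intro tendsto_intros lim_1_over_n[THEN LIMSEQ_Suc])
 from tendsto_mult_left[OF this, of "complex_of_real (exp 1)"] show ?thesis
  by (simp add: cutoff_def exp_bump_def exp_minus flip: of_real_mult)
qed

lemma mult_bounded_square_integrable:
 assumes v: "square_integrable M v" and ch: "ch \<in> borel_measurable M" "AE x in M. cmod (ch x) <= C" "0 <= C"
 shows "square_integrable M (%x. ch x * v x)" "AE x in M. (cmod (ch x * v x))^2 <= C^2 * (cmod (v x))^2"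
proof -
 show le: "AE x in M. (cmod (ch x * v x))^2 <= C^2 * (cmod (v x))^2"
  using ch(2) by eventually_elim (simp add: norm_mult power_mult_distrib mult_right_mono power_mono)
 have "integrable M (%x. (cmod (ch x * v x))^2)"
  by (rule Bochner_Integration.integrable_bound[of _ "%x. C^2 * (cmod (v x))^2"]) (use v ch le in \<open>auto simp: square_integrable_def\<close>)
 thus "square_integrable M (%x. ch x * v x)" using v ch by (auto simp: square_integrable_def)
qed

lemma norm_mult_bounded:
 assumes v: "square_integrable lebesgue v" and ch: "ch \<in> borel_measurable lebesgue" "AE x in lebesgue. cmod (ch x) <= C" "0 <= C"
 shows "norm (abs_l2 (%x. ch x * v x)) <= C * norm (abs_l2 v)"
proof -
 note s = mult_bounded_square_integrable[OF v ch]
 have "(norm (abs_l2 (%x. ch x * v x)))^2 <= (LINT x|lebesgue. C^2 * (cmod (v x))^2)"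
  unfolding norm_l2_sq_abs[OF s(1)] using s v by (intro integral_mono_AE) (auto simp: square_integrable_def)
 also have "... = (C * norm (abs_l2 v))^2" by (simp add: norm_l2_sq_abs[OF v] power_mult_distrib)
 finally show ?thesis by (rule power2_le_imp_le) (use ch in simp)
qed

lemma cutoff_borel: "cutoff m \<in> borel_measurable lebesgue" "pD j (cutoff m) \<in> borel_measurable lebesgue"
 by (auto intro!: measurable_completion simp: test_borel test_partial_deriv cutoff(1))

lemma cutoff_mult_tendsto:
 assumes v: "square_integrable lebesgue v"
 shows "(%m. abs_l2 (%x. cutoff m x * v x)) ----> abs_l2 v"
proof (rule l2_dominated_convergence[OF mult_bounded_square_integrable(1)[OF v cutoff_borel(1) AE_I2[OF cutoff(2)]] v])
 show "AE x in lebesgue. (%m. cutoff m x * v x) ----> v x"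
  using tendsto_mult_right[OF cutoff_tendsto_1] by (intro AE_I2) simp
 show "integrable lebesgue (%x. (cmod (v x))^2)" using v by (simp add: square_integrable_def)
 show "cmod (cutoff m x * v x - v x) <= cmod (v x)" for m x
  using mult_right_mono[OF cutoff(3)[of m x], of "cmod (v x)"] by (simp add: left_diff_distrib flip: norm_mult)
qed simp

text \<open>Function and gradient as one point of a product space: density in H1 becomes membership
  in a closure, and two successive approximations need no diagonal sequence.\<close>

definition h1_pair :: "(real^'n::finite => complex) => (real^'n) l2 \<times> (((real^'n) l2)^'n)" where
 "h1_pair \<phi> = (abs_l2 \<phi>, \<chi> j. abs_l2 (pD j \<phi>))"

lemma smooth_in_closure_test:
 assumes w: "smooth w" "square_integrable lebesgue w" "!!j. square_integrable lebesgue (pD j w)"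
 shows "h1_pair w \<in> closure (h1_pair ` Collect test_function)"
proof -
 have "(%m. abs_l2 (pD j (%x. w x * cutoff m x))) ----> abs_l2 (pD j w)" for j
 proof -
  obtain B where B: "0 < B" "!!m x. cmod (pD j (cutoff m) x) <= B / real (Suc m)" using cutoff(4) by blast
  have le: "norm (abs_l2 (%x. pD j (cutoff m) x * w x)) <= B * (1 / real (Suc m)) * norm (abs_l2 w)" for m
   using norm_mult_bounded[OF w(2) cutoff_borel(2) AE_I2[OF B(2)]] B(1) by simp
  have "(%m. B * (1 / real (Suc m)) * norm (abs_l2 w)) ----> B * 0 * norm (abs_l2 w)"
   by (intro tendsto_intros lim_1_over_n[THEN LIMSEQ_Suc])
  hence "(%m. abs_l2 (%x. pD j (cutoff m) x * w x)) ----> 0"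
   by (intro Lim_null_comparison[OF always_eventually[OF allI[OF le]]]) simp
  from tendsto_add[OF cutoff_mult_tendsto[OF w(3)] this] show ?thesis
   using mult_bounded_square_integrable(1)[OF w(3) cutoff_borel(1) AE_I2[OF cutoff(2)]] mult_bounded_square_integrable(1)[OF w(2) cutoff_borel(2) AE_I2[OF B(2)]] B(1)
   by (simp add: plus_l2_abs partial_deriv_mult[OF smooth_differentiable[OF w(1)] test_differentiable[OF cutoff(1)], abs_def] mult.commute)
 qed
 moreover have "(%m. abs_l2 (%x. w x * cutoff m x)) ----> abs_l2 w" using cutoff_mult_tendsto[OF w(2)] by (simp add: mult.commute)
 ultimately have "(%m. h1_pair (%x. w x * cutoff m x)) ----> h1_pair w"
  unfolding h1_pair_def by (rule tendsto_Pair[OF _ tendsto_vec_lambda, rotated])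
 thus ?thesis
  by (rule closed_sequentially[OF closed_closure, rotated]) (intro subsetD[OF closure_subset] imageI CollectI test_mult[OF w(1) cutoff(1)])
qed

text \<open>Mollifying gives smooth functions with square integrable gradient; multiplying by
  cut-offs makes the support bounded. The limits compose because the closure is closed.\<close>

theorem test_functions_dense_H1:
 assumes g: "!!j. has_weak_partial j f (g j)"
 shows "\<exists>\<phi>. (\<forall>k. test_function (\<phi> k)) \<and> (%k. abs_l2 (\<phi> k)) ----> f \<and>
   (\<forall>j. (%k. abs_l2 (pD j (\<phi> k))) ----> g j)"
proof -
 have "h1_pair (conv f (mollifier n)) \<in> closure (h1_pair ` Collect test_function)" for n
  by (intro smooth_in_closure_test) (simp_all add: partial_deriv_conv conv_weak_partial[OF g] mollifier(1) smooth_conv conv_young(2))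
 moreover have "(%n. h1_pair (conv f (mollifier n))) ----> (f, \<chi> j. g j)"
  unfolding h1_pair_def partial_deriv_conv[OF mollifier(1)] conv_weak_partial[OF g mollifier(1)] moll_def[symmetric]
  by (rule tendsto_Pair[OF moll_tendsto tendsto_vec_lambda[OF moll_tendsto]])
 ultimately have "(f, \<chi> j. g j) \<in> closure (h1_pair ` Collect test_function)" by (rule closed_sequentially[OF closed_closure])
 then obtain X where X: "\<forall>k. X k \<in> h1_pair ` Collect test_function" "X ----> (f, \<chi> j. g j)" unfolding closure_sequential by blast
 then obtain \<phi> where \<phi>: "!!k. test_function (\<phi> k)" "!!k. X k = h1_pair (\<phi> k)" unfolding image_iff Bex_def mem_Collect_eq by metis
 show ?thesis using \<phi>(1) tendsto_fst[OF X(2)] tendsto_vec_nth[OF tendsto_snd[OF X(2)]] by (intro exI[of _ \<phi>]) (simp add: \<phi>(2) h1_pair_def)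
qed

section \<open>The Sobolev space H1 and elliptic regularity\<close>

text \<open>Mollifications of \<open>h\<close> are inner products with reflected kernels, which are
  test functions. They all vanish and converge to \<open>h\<close>.\<close>

lemma orthogonal_test_functions:
 assumes "!!\<phi>. test_function \<phi> ==> cinner_l2 h (abs_l2 \<phi>) = 0"
 shows "h = 0"
proof -
 have "conv h \<rho> x = 0" if "test_function \<rho>" for \<rho> x
  unfolding conv_def refl_l2_def by (rule assms) (intro test_cnj test_reflect that)
 hence c: "conv h (mollifier n) = (%x. 0)" for n using mollifier(1) by blast
 have "moll n h = 0" for n unfolding moll_def c zero_l2_def ..
 thus ?thesis using moll_tendsto[of h] by (simp add: LIMSEQ_const_iff)
qed

lemma has_weak_partial_unique:
 assumes "has_weak_partial j f g" "has_weak_partial j f g'"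
 shows "g = g'"
proof -
 have "has_weak_partial j (f - f) (g - g')" by (rule has_weak_partial_diff[OF assms])
 hence "g - g' = 0"
  unfolding has_weak_partial_iff by (intro orthogonal_test_functions) simp
 thus ?thesis by simp
qed

lemma weak_partial_eqI: "has_weak_partial j f g ==> wD j f = g"
 unfolding weak_partial_def by (rule the_equality) (auto intro: has_weak_partial_unique)

definition H1 :: "(real^'n::finite) l2 set" where
 "H1 = sobolev 1"

lemma sobolev_1_iff: "f \<in> H1 \<longleftrightarrow> (\<forall>j. \<exists>g. has_weak_partial j f g)"
 by (simp add: H1_def)

lemma sobolev_2_iff: "f \<in> sobolev 2 \<longleftrightarrow> (\<forall>j. \<exists>g\<in>H1. has_weak_partial j f g)"
 by (simp add: H1_def numeral_2_eq_2)

lemma has_weak_partial_weak_partial: "f \<in> H1 ==> has_weak_partial j f (wD j f)"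
 unfolding sobolev_1_iff using weak_partial_eqI by metis

lemma sobolev_1I: "(!!j. has_weak_partial j f (g j)) ==> f \<in> H1"
 unfolding sobolev_1_iff by blast

lemma sobolev_2I: "f \<in> H1 ==> (!!j. wD j f \<in> H1) ==> f \<in> sobolev 2"
 unfolding sobolev_2_iff using has_weak_partial_weak_partial by blast

lemma sobolev_2D:
 assumes "f \<in> sobolev 2" shows "f \<in> H1" "wD j f \<in> H1"
proof -
 show 1: "f \<in> H1" using assms unfolding sobolev_2_iff sobolev_1_iff by blast
 obtain g where "g \<in> H1" "has_weak_partial j f g" using assms unfolding sobolev_2_iff by blast
 thus "wD j f \<in> H1" using weak_partial_eqI by metis
qed

lemmas weak_partial_rules =
 has_weak_partial_add[OF has_weak_partial_weak_partial has_weak_partial_weak_partial]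
 has_weak_partial_diff[OF has_weak_partial_weak_partial has_weak_partial_weak_partial]
 has_weak_partial_scaleC[OF has_weak_partial_weak_partial]

lemma sobolev_1_add: "f \<in> H1 ==> g \<in> H1 ==> f + g \<in> H1"
 by (rule sobolev_1I, rule weak_partial_rules(1))

lemma sobolev_1_diff: "f \<in> H1 ==> g \<in> H1 ==> f - g \<in> H1"
 by (rule sobolev_1I, rule weak_partial_rules(2))

lemma sobolev_1_scaleC: "f \<in> H1 ==> scaleC_l2 c f \<in> H1"
 by (rule sobolev_1I, rule weak_partial_rules(3))

lemmas weak_partial_add = weak_partial_eqI[OF weak_partial_rules(1)]
 and weak_partial_diff = weak_partial_eqI[OF weak_partial_rules(2)]
 and weak_partial_scaleC = weak_partial_eqI[OF weak_partial_rules(3)]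

lemma zero_sobolev_1: "0 \<in> H1"
proof -
 have "has_weak_partial j 0 0" for j by (simp add: has_weak_partial_iff)
 thus ?thesis by (rule sobolev_1I)
qed

lemma test_sobolev_1: "test_function \<phi> ==> abs_l2 \<phi> \<in> H1"
 and weak_partial_test: "test_function \<phi> ==> wD j (abs_l2 \<phi>) = abs_l2 (pD j \<phi>)"
 by (rule sobolev_1I, erule test_has_weak_partial) (rule weak_partial_eqI, erule test_has_weak_partial)

lemma sobolev_1_dense: "closure (H1 :: (real^'n::finite) l2 set) = UNIV"
proof -
 have "moll n f \<in> H1" for n and f :: "(real^'n) l2"
  unfolding moll_def by (rule sobolev_1I, rule conv_has_weak_partial[OF mollifier(1)])
 hence "f \<in> closure H1" for f :: "(real^'n) l2"
  unfolding closure_sequential using moll_tendsto[of f] by (intro exI[of _ "%n. moll n f"]) simp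
 thus ?thesis by blast
qed

definition grad_form :: "(real^'n::finite) l2 => (real^'n) l2 => complex" where
 "grad_form f g = (\<Sum>j\<in>UNIV. cinner_l2 (wD j f) (wD j g))"

definition h1_sq :: "(real^'n::finite) l2 => real" where
 "h1_sq f = (norm f)^2 + (\<Sum>j\<in>UNIV. (norm (wD j f))^2)"

lemma grad_form_self: "grad_form f f = of_real (h1_sq f - (norm f)^2)"
 unfolding grad_form_def h1_sq_def by (simp add: cinner_self)

lemma h1_sq_nonneg: "0 <= h1_sq f" and norm_le_h1: "(norm f)^2 <= h1_sq f"
 and weak_partial_le_h1: "(norm (wD j f))^2 <= h1_sq f"
proof -
 have "(norm (wD j f))^2 <= (\<Sum>j\<in>UNIV. (norm (wD j f))^2)" by (rule member_le_sum) auto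
 moreover have "0 <= (norm (wD j f))^2" "0 <= (norm f)^2" by simp_all
 ultimately show "0 <= h1_sq f" "(norm f)^2 <= h1_sq f" "(norm (wD j f))^2 <= h1_sq f"
  unfolding h1_sq_def by linarith+
qed

lemma grad_form_add: "f \<in> H1 ==> g \<in> H1 ==> grad_form (f + g) h = grad_form f h + grad_form g h"
 by (simp add: grad_form_def weak_partial_add cinner_add_left sum.distrib)

lemma grad_form_diff: "f \<in> H1 ==> g \<in> H1 ==> grad_form (f - g) h = grad_form f h - grad_form g h"
 by (simp add: grad_form_def weak_partial_diff cinner_diff_left sum_subtractf)

lemma grad_form_scale: "f \<in> H1 ==> grad_form (scaleC_l2 c f) h = c * grad_form f h"
 by (simp add: grad_form_def weak_partial_scaleC cinner_scaleC_left sum_distrib_left)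

lemma grad_form_sym: "grad_form f g = cnj (grad_form g f)"
 unfolding grad_form_def cnj_sum by (rule sum.cong) (auto simp: cinner_commute[symmetric])

lemma h1_complete:
 assumes X: "!!n. X n \<in> H1"
  and c: "!!e. 0 < e ==> \<exists>N. \<forall>m\<ge>N. \<forall>n\<ge>N. h1_sq (X m - X n) < e"
 shows "\<exists>u\<in>H1. (%n. h1_sq (X n - u)) ----> 0"
proof -
 have C: "convergent Y" if Y: "!!m n. (norm (Y m - Y n))^2 <= h1_sq (X m - X n)" for Y :: "nat => (real^'a) l2"
  unfolding Cauchy_convergent_iff[symmetric]
 proof (rule CauchyI)
  fix e :: real assume e: "0 < e"
  obtain N where N: "\<forall>m\<ge>N. \<forall>n\<ge>N. h1_sq (X m - X n) < e^2" using c[of "e^2"] e by auto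
  have "norm (Y m - Y n) < e" if "m \<ge> N" "n \<ge> N" for m n
   using le_less_trans[OF Y] N that e by (intro power2_less_imp_less[of _ e]) auto
  thus "\<exists>N. \<forall>m\<ge>N. \<forall>n\<ge>N. norm (Y m - Y n) < e" by blast
 qed
 obtain u where u: "X ----> u" using C[of X] norm_le_h1 unfolding convergent_def by blast
 have "\<exists>v. (%n. wD j (X n)) ----> v" for j
  using C[of "%n. wD j (X n)"] weak_partial_le_h1[of j] unfolding convergent_def by (simp add: weak_partial_diff[symmetric] X)
 then obtain v where v: "!!j. (%n. wD j (X n)) ----> v j" by metis
 have uv: "has_weak_partial j u (v j)" for j
  by (rule has_weak_partial_limit[OF _ u v]) (rule has_weak_partial_weak_partial[OF X])
 have us: "u \<in> H1" using uv by (rule sobolev_1I)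
 have "(%n. h1_sq (X n - u)) ----> (norm (0::(real^'a) l2))^2 + (\<Sum>j\<in>(UNIV::'a set). (norm (0::(real^'a) l2))^2)"
  unfolding h1_sq_def weak_partial_diff[OF X us] weak_partial_eqI[OF uv]
  using u v by (intro tendsto_intros) (auto simp: LIM_zero_iff)
 thus ?thesis using us by (intro bexI[of _ u]) simp_all
qed

text \<open>Two-sided bounds by \<open>h1_sq\<close> identify the norm of the form with that of H1,
  which is complete because weak derivatives are closed under limits.\<close>

lemma h1_coercive_form:
 fixes t :: "(real^'n::finite) l2 => (real^'n) l2 => complex"
 assumes "!!f g h. f \<in> H1 ==> g \<in> H1 ==> h \<in> H1 ==> t (f + g) h = t f h + t g h"
  and "!!f h a. f \<in> H1 ==> h \<in> H1 ==> t (scaleC_l2 a f) h = a * t f h"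
  and "!!f g. f \<in> H1 ==> g \<in> H1 ==> t f g = cnj (t g f)"
  and c: "0 < c" and lower: "!!f. f \<in> H1 ==> c * h1_sq f <= Re (t f f)"
  and upper: "!!f. f \<in> H1 ==> Re (t f f) <= C * h1_sq f"
 shows "coercive_form (H1) t c"
proof
 show "c * (norm f)^2 <= Re (t f f)" if "f \<in> H1" for f
  using lower[OF that] mult_left_mono[OF norm_le_h1[of f], of c] c by linarith
 show "t f g = cnj (t g f)" if "f \<in> H1" "g \<in> H1" for f g by (rule assms(3)[OF that])
 fix X :: "nat => (real^'n) l2" assume X: "!!n. X n \<in> H1"
  and ca: "!!e. 0 < e ==> \<exists>N. \<forall>m\<ge>N. \<forall>n\<ge>N. Re (t (X m - X n) (X m - X n)) < e"
 have "\<exists>u\<in>H1. (%n. h1_sq (X n - u)) ----> 0"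
 proof (rule h1_complete[OF X])
  fix e :: real assume e: "0 < e"
  obtain N where N: "\<forall>m\<ge>N. \<forall>n\<ge>N. Re (t (X m - X n) (X m - X n)) < c * e" using ca[of "c * e"] c e by auto
  have "h1_sq (X m - X n) < e" if "m \<ge> N" "n \<ge> N" for m n
  proof -
   have "c * h1_sq (X m - X n) < c * e" using le_less_trans[OF lower[OF sobolev_1_diff[OF X X]]] N that by blast
   thus ?thesis using c by simp
  qed
  thus "\<exists>N. \<forall>m\<ge>N. \<forall>n\<ge>N. h1_sq (X m - X n) < e" by blast
 qed
 then obtain u where u: "u \<in> H1" "(%n. h1_sq (X n - u)) ----> 0" by blast
 have "(%n. Re (t (X n - u) (X n - u))) ----> 0"
 proof (rule real_tendsto_sandwich)
  show "\<forall>\<^sub>F n in sequentially. c * h1_sq (X n - u) <= Re (t (X n - u) (X n - u))"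
   by (intro always_eventually allI lower sobolev_1_diff X u)
  show "\<forall>\<^sub>F n in sequentially. Re (t (X n - u) (X n - u)) <= C * h1_sq (X n - u)"
   by (intro always_eventually allI upper sobolev_1_diff X u)
  show "(%n. c * h1_sq (X n - u)) ----> 0" "(%n. C * h1_sq (X n - u)) ----> 0"
   using tendsto_mult[OF tendsto_const u(2)] by simp_all
 qed
 thus "\<exists>u\<in>H1. (%n. Re (t (X n - u) (X n - u))) ----> 0" using u(1) by blast
qed (simp_all add: sobolev_1_add sobolev_1_scaleC zero_sobolev_1 assms(1,2) c)

text \<open>For test functions \<open>g\<close> this is the definition of the weak derivative; both
  sides are continuous in \<open>g\<close> with respect to H1.\<close>

lemma integration_by_parts:
 assumes f: "f \<in> H1" and g: "g \<in> H1"
 shows "cinner_l2 (wD j f) g = - cinner_l2 f (wD j g)"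
proof -
 obtain \<phi> where \<phi>: "!!k. test_function (\<phi> k)" "(%k. abs_l2 (\<phi> k)) ----> g"
  "!!j. (%k. abs_l2 (pD j (\<phi> k))) ----> wD j g"
  using test_functions_dense_H1[of g "%j. wD j g"] has_weak_partial_weak_partial[OF g] by blast
 note b = bounded_linear.tendsto[OF bounded_linear_cinner_right]
 have "(%k. cinner_l2 (wD j f) (abs_l2 (\<phi> k))) ----> - cinner_l2 f (wD j g)"
  using tendsto_minus[OF b[OF \<phi>(3)[of j]], of f] has_weak_partial_weak_partial[OF f, of j] \<phi>(1) unfolding has_weak_partial_iff by simp
 with b[OF \<phi>(2)] show ?thesis by (rule LIMSEQ_unique)
qed

lemma laplacian_grad_form:
 assumes u: "u \<in> sobolev 2" and g: "g \<in> H1"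
 shows "grad_form u g = cinner_l2 (- laplacian u) g"
proof -
 have "grad_form u g = (\<Sum>j\<in>UNIV. - cinner_l2 (wD j (wD j u)) g)"
  unfolding grad_form_def using integration_by_parts[OF sobolev_2D(2)[OF u] g] by (intro sum.cong) auto
 also have "... = - (\<Sum>j\<in>UNIV. cinner_l2 (wD j (wD j u)) g)" by (rule sum_negf)
 also have "(\<Sum>j\<in>UNIV. cinner_l2 (wD j (wD j u)) g) = cinner_l2 (laplacian u) g"
  unfolding laplacian_def by (rule linear_sum[OF bounded_linear.linear[OF bounded_linear_cinner_left], symmetric])
 finally show ?thesis by (simp add: cinner_uminus_left)
qed

lemma weak_partial_conv:
 assumes "test_function \<rho>"
 shows "abs_l2 (conv f \<rho>) \<in> H1" "wD j (abs_l2 (conv f \<rho>)) = abs_l2 (conv f (pD j \<rho>))"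
 by (rule sobolev_1I, rule conv_has_weak_partial[OF assms]) (rule weak_partial_eqI, rule conv_has_weak_partial[OF assms])

text \<open>Integrating by parts twice moves \<open>\<partial>\<^sub>i \<partial>\<^sub>j w \<cdot> \<partial>\<^sub>i \<partial>\<^sub>j w\<close> to \<open>\<partial>\<^sub>j \<partial>\<^sub>j w \<cdot> \<partial>\<^sub>i \<partial>\<^sub>i w\<close>.\<close>

lemma hessian_conv:
 assumes u: "u \<in> H1" and \<rho>: "test_function \<rho>"
 defines "w \<equiv> abs_l2 (conv u \<rho>)"
 shows "(\<Sum>i\<in>UNIV. \<Sum>j\<in>UNIV. (norm (wD i (wD j w)))^2) = (norm (laplacian w))^2"
proof -
 note t = test_partial_deriv
 note W = weak_partial_conv
 \<comment> \<open>One derivative is moved to \<open>u\<close> and the other stays on the kernel.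
   Doing so in either order shows that the two derivatives commute, without Schwarz's theorem for
   the kernel.\<close>
 have com: "wD i (wD j (abs_l2 (conv u \<sigma>))) = wD j (wD i (abs_l2 (conv u \<sigma>)))"
  if "test_function \<sigma>" for i j \<sigma>
 proof -
  have c: "conv u (pD k \<tau>) = conv (wD k u) \<tau>" if "test_function \<tau>" for k \<tau>
   by (rule conv_weak_partial[OF has_weak_partial_weak_partial[OF u] that])
  have "wD i (wD j (abs_l2 (conv u \<sigma>))) = abs_l2 (conv u (pD j (pD i \<sigma>)))"
   using W[OF that] W(2)[OF t[OF that]] W(2)[OF that, of i "wD j u"] c[OF that] c[OF t[OF that]] by metis
  thus ?thesis by (simp add: W t that)
 qed
 have s: "wD j w \<in> H1" "wD i (wD j w) \<in> H1" for i j unfolding w_def by (simp_all add: W t \<rho>)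
 have sw: "wD i (wD i (wD j w)) = wD j (wD i (wD i w))" for i j
  unfolding w_def com[OF \<rho>, of i j] using com[OF t[OF \<rho>], of i j i] by (simp add: W \<rho>)
 have "(\<Sum>i\<in>UNIV. \<Sum>j\<in>UNIV. cinner_l2 (wD i (wD j w)) (wD i (wD j w))) =
   (\<Sum>i\<in>UNIV. \<Sum>j\<in>UNIV. cinner_l2 (wD j (wD j w)) (wD i (wD i w)))"
  using sw by (intro sum.cong refl) (metis integration_by_parts s)
 also have "... = cinner_l2 (laplacian w) (laplacian w)"
  unfolding laplacian_def by (simp add: linear_sum[OF bounded_linear.linear[OF bounded_linear_cinner_left]]
   linear_sum[OF bounded_linear.linear[OF bounded_linear_cinner_right]])
 finally have "complex_of_real (\<Sum>i\<in>UNIV. \<Sum>j\<in>UNIV. (norm (wD i (wD j w)))^2) = complex_of_real ((norm (laplacian w))^2)"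
  by (simp add: cinner_self)
 thus ?thesis by (simp only: of_real_eq_iff)
qed

text \<open>The weak equation is tested with the reflected kernel, which lies in H1; the pairing of
  gradients becomes the Laplacian of the convolution.\<close>

lemma laplacian_conv:
 assumes u: "u \<in> H1" and h: "!!g. g \<in> H1 ==> grad_form u g = cinner_l2 h g" and \<rho>: "test_function \<rho>"
 shows "laplacian (abs_l2 (conv u \<rho>)) = - abs_l2 (conv h \<rho>)"
proof -
 note t = test_partial_deriv[OF \<rho>]
 have R: "refl_l2 \<rho> x \<in> H1" "wD j (refl_l2 \<rho> x) = - refl_l2 (pD j \<rho>) x" for x j
  using test_cnj[OF test_reflect[OF \<rho>], of x]
  by (simp_all add: partial_deriv_refl[OF \<rho>, symmetric] weak_partial_test) (simp_all add: refl_l2_def test_sobolev_1 weak_partial_test)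
 have "laplacian (abs_l2 (conv u \<rho>)) = (\<Sum>j\<in>UNIV. abs_l2 (conv (wD j u) (pD j \<rho>)))"
  by (simp add: laplacian_def weak_partial_conv \<rho> t conv_weak_partial[OF has_weak_partial_weak_partial[OF u]])
 also have "... = abs_l2 (%x. \<Sum>j\<in>UNIV. conv (wD j u) (pD j \<rho>) x)"
  using sum_abs_l2[of UNIV "%j. conv (wD j u) (pD j \<rho>)"] conv_young(2)[OF t] by simp
 also have "(%x. \<Sum>j\<in>UNIV. conv (wD j u) (pD j \<rho>) x) = (%x. - conv h \<rho> x)"
  using h[OF R(1)] by (simp add: grad_form_def R(2) conv_def cinner_uminus_right sum_negf fun_eq_iff minus_equation_iff)
 also have "abs_l2 ... = - abs_l2 (conv h \<rho>)" by (rule uminus_l2_abs[symmetric], rule conv_young(2)[OF \<rho>])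
 finally show ?thesis .
qed

lemma conv_diff_kernel:
 assumes "test_function \<rho>" "test_function \<sigma>"
 shows "abs_l2 (conv f \<rho>) - abs_l2 (conv f \<sigma>) = abs_l2 (conv f (%x. \<rho> x - \<sigma> x))"
proof -
 have "refl_l2 (%x. \<rho> x - \<sigma> x) x = refl_l2 \<rho> x - refl_l2 \<sigma> x" for x
  unfolding refl_l2_def by (simp add: minus_l2_abs refl_sq assms)
 hence "conv f (%x. \<rho> x - \<sigma> x) = (%x. conv f \<rho> x - conv f \<sigma> x)" by (simp add: conv_def fun_eq_iff cinner_diff_right)
 thus ?thesis by (simp add: minus_l2_abs conv_young assms)
qed

text \<open>For mollified solutions the Hessian and the Laplacian have equal L2 norms. Applied to
  differences of mollifications, this makes the second derivatives Cauchy, and weak derivatives are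
  closed.\<close>

theorem elliptic_regularity:
 assumes u: "u \<in> H1" and h: "!!g. g \<in> H1 ==> grad_form u g = cinner_l2 h g"
 shows "u \<in> sobolev 2" "- laplacian u = h"
  "(\<Sum>i\<in>UNIV. \<Sum>j\<in>UNIV. (norm (wD i (wD j u)))^2) = (norm h)^2"
proof -
 define w where "w n = moll n u" for n
 have w: "w n = abs_l2 (conv u (mollifier n))" for n by (simp add: w_def moll_def)
 have ws: "w n \<in> H1" "wD j (w n) \<in> H1" for n j
  unfolding w by (simp_all add: weak_partial_conv test_partial_deriv mollifier)
 have wj: "wD j (w n) = moll n (wD j u)" for n j
  unfolding w_def by (rule weak_partial_eqI, rule moll_has_weak_partial, rule has_weak_partial_weak_partial[OF u])
 have lap: "laplacian (w n) = - moll n h" for n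
  unfolding w moll_def by (rule laplacian_conv[OF u h mollifier(1)])
 have ij_le: "norm (wD i (wD j (w m)) - wD i (wD j (w n))) <= norm (moll m h - moll n h)" for i j m n
 proof (rule power2_le_imp_le)
  \<comment> \<open>The difference of two mollifications is the convolution with the difference of
    the kernels, again a test function, so the Hessian identity applies to it directly.\<close>
  define \<rho> where "\<rho> = (%x::real^'a. mollifier m x - mollifier n x)"
  have \<rho>: "test_function \<rho>" unfolding \<rho>_def by (intro test_diff mollifier)
  have d: "w m - w n = abs_l2 (conv u \<rho>)" "moll m h - moll n h = abs_l2 (conv h \<rho>)"
   unfolding w moll_def \<rho>_def by (intro conv_diff_kernel mollifier)+
  let ?W = "%i j. (norm (wD i (wD j (w m - w n))))^2"
  have "?W i j <= (\<Sum>i\<in>UNIV. \<Sum>j\<in>UNIV. ?W i j)"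
   by (rule order_trans[OF member_le_sum[of j UNIV] member_le_sum[of i UNIV]]) (auto intro: sum_nonneg)
  also have "... = (norm (moll m h - moll n h))^2" using laplacian_conv[OF u h \<rho>] by (simp add: d hessian_conv[OF u \<rho>])
  finally show "(norm (wD i (wD j (w m)) - wD i (wD j (w n))))^2 <= (norm (moll m h - moll n h))^2"
   by (simp add: weak_partial_diff ws)
 qed simp
 have "convergent (%n. wD i (wD j (w n)))" for i j
  unfolding Cauchy_convergent_iff[symmetric]
 proof (rule CauchyI)
  fix e :: real assume e: "0 < e"
  obtain N where N: "\<forall>m\<ge>N. \<forall>n\<ge>N. norm (moll m h - moll n h) < e" using CauchyD[OF LIMSEQ_imp_Cauchy[OF moll_tendsto[of h]] e] by blast
  hence "norm (wD i (wD j (w m)) - wD i (wD j (w n))) < e" if "m \<ge> N" "n \<ge> N" for m n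
   using le_less_trans[OF ij_le] that by simp
  thus "\<exists>N. \<forall>m\<ge>N. \<forall>n\<ge>N. norm (wD i (wD j (w m)) - wD i (wD j (w n))) < e" by blast
 qed
 then obtain v where v: "!!i j. (%n. wD i (wD j (w n))) ----> v i j" unfolding convergent_def by metis
 have hv: "has_weak_partial i (wD j u) (v i j)" for i j
  by (rule has_weak_partial_limit[OF has_weak_partial_weak_partial[OF ws(2)] _ v]) (simp add: wj moll_tendsto)
 hence vij: "wD i (wD j u) = v i j" for i j by (rule weak_partial_eqI)
 show "u \<in> sobolev 2" by (rule sobolev_2I[OF u], rule sobolev_1I, rule hv)
 have "(%n. laplacian (w n)) ----> laplacian u"
  unfolding laplacian_def vij by (intro tendsto_sum v)
 moreover have "(%n. laplacian (w n)) ----> - h" unfolding lap by (intro tendsto_minus moll_tendsto)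
 ultimately have "laplacian u = - h" by (rule LIMSEQ_unique)
 thus "- laplacian u = h" by simp
 have "(%n. \<Sum>i\<in>UNIV. \<Sum>j\<in>UNIV. (norm (wD i (wD j (w n))))^2) ----> (\<Sum>i\<in>UNIV. \<Sum>j\<in>UNIV. (norm (v i j))^2)"
  by (intro tendsto_intros v)
 hence "(%n. (norm (moll n h))^2) ----> (\<Sum>i\<in>UNIV. \<Sum>j\<in>UNIV. (norm (v i j))^2)"
  unfolding w hessian_conv[OF u mollifier(1)] unfolding w[symmetric] lap by simp
 from LIMSEQ_unique[OF this tendsto_power[OF tendsto_norm[OF moll_tendsto]]]
 show "(\<Sum>i\<in>UNIV. \<Sum>j\<in>UNIV. (norm (wD i (wD j u)))^2) = (norm h)^2" by (simp add: vij)
qed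

section \<open>Bounded potentials\<close>

lemma L_infinity_bound:
 assumes "L_infinity M q"
 obtains C where "0 <= C" "AE x in M. \<bar>q x\<bar> <= C" "q \<in> borel_measurable M"
proof -
 obtain C where C: "AE x in M. \<bar>q x\<bar> <= C" "q \<in> borel_measurable M" using assms by (auto simp: L_infinity_def)
 have "AE x in M. \<bar>q x\<bar> <= max C 0" using C(1) by eventually_elim simp
 thus ?thesis using that[of "max C 0"] C(2) by simp
qed

lemma mult_square_integrable:
 assumes q: "L_infinity M q" and f: "square_integrable M f"
 shows "square_integrable M (%x. complex_of_real (q x) * f x)"
proof -
 obtain C where "0 <= C" "AE x in M. \<bar>q x\<bar> <= C" "q \<in> borel_measurable M" by (rule L_infinity_bound[OF q])
 thus ?thesis by (intro mult_bounded_square_integrable[OF f, of _ C]) auto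
qed

lemma cinner_mult_l2:
 assumes q: "L_infinity lebesgue q"
 shows "cinner_l2 (mult_l2 q f) g = (LINT x|lebesgue. complex_of_real (q x) * rep_l2 f x * cnj (rep_l2 g x))"
 unfolding mult_l2_def
 using cinner_l2_abs[OF mult_square_integrable[OF q square_integrable_rep[of f]] square_integrable_rep[of g]] by simp

lemma mult_l2_add:
 assumes q: "L_infinity lebesgue q" shows "mult_l2 q (f + g) = mult_l2 q f + mult_l2 q g"
proof -
 note m = mult_square_integrable[OF q square_integrable_rep]
 show ?thesis unfolding mult_l2_def plus_l2_abs[OF m m]
  by (rule abs_l2_eqI[OF m square_integrable_add[OF m m]]) (use rep_plus_l2[of f g] in eventually_elim, simp add: distrib_left)
qed

lemma mult_l2_scaleC:
 assumes q: "L_infinity lebesgue q" shows "mult_l2 q (scaleC_l2 c f) = scaleC_l2 c (mult_l2 q f)"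
proof -
 note m = mult_square_integrable[OF q square_integrable_rep]
 show ?thesis unfolding mult_l2_def scaleC_l2_abs[OF m]
  by (rule abs_l2_eqI[OF m square_integrable_scale[OF m]]) (use rep_scaleC_l2[of c f] in eventually_elim, simp add: mult.left_commute)
qed

lemma mult_l2_sym:
 assumes "L_infinity lebesgue q"
 shows "cinner_l2 (mult_l2 q f) g = cnj (cinner_l2 (mult_l2 q g) f)"
proof -
 have "cnj (cinner_l2 (mult_l2 q g) f) = (LINT x|lebesgue. cnj (complex_of_real (q x) * rep_l2 g x * cnj (rep_l2 f x)))"
  unfolding cinner_mult_l2[OF assms] by (rule Bochner_Integration.integral_cnj[symmetric])
 thus ?thesis unfolding cinner_mult_l2[OF assms] by (simp add: mult_ac)
qed

lemma norm_mult_l2: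
 assumes q: "L_infinity lebesgue q"
 obtains C where "0 <= C" "!!f. norm (mult_l2 q f) <= C * norm f"
proof -
 obtain C where C: "0 <= C" "AE x in lebesgue. \<bar>q x\<bar> <= C" "q \<in> borel_measurable lebesgue" by (rule L_infinity_bound[OF q])
 have "norm (mult_l2 q f) <= C * norm (abs_l2 (rep_l2 f))" for f
  unfolding mult_l2_def by (rule norm_mult_bounded[OF square_integrable_rep]) (use C in auto)
 thus ?thesis using that C(1) by simp
qed

text \<open>A form solution satisfies a Poisson equation with right-hand side h + V f in L2, so
  elliptic regularity places it in H2 and the form domain H1 gives nothing more than the operator
  domain.\<close>

lemma schroedinger_form_graph:
 "schroedinger V = form_graph (H1) (%f g. grad_form f g - cinner_l2 (mult_l2 V f) g)"
proof (intro set_eqI iffI)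
 fix p assume "p \<in> schroedinger V"
 then obtain f where p: "p = (f, - laplacian f - mult_l2 V f)" "f \<in> sobolev 2" by (auto simp: schroedinger_def)
 show "p \<in> form_graph (H1) (%f g. grad_form f g - cinner_l2 (mult_l2 V f) g)"
  unfolding p(1) form_graph_def using sobolev_2D(1)[OF p(2)] laplacian_grad_form[OF p(2)] by (simp add: cinner_diff_left)
next
 fix p assume "p \<in> form_graph (H1) (%f g. grad_form f g - cinner_l2 (mult_l2 V f) g)"
 then obtain f h where p: "p = (f, h)" "f \<in> H1" "!!g. g \<in> H1 ==> grad_form f g - cinner_l2 (mult_l2 V f) g = cinner_l2 h g"
  unfolding form_graph_def by blast
 have "grad_form f g = cinner_l2 (h + mult_l2 V f) g" if "g \<in> H1" for g
  using p(3)[OF that] by (simp add: cinner_add_left diff_eq_eq)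
 note e = elliptic_regularity[OF p(2) this]
 have "h = - laplacian f - mult_l2 V f" using e(2) by simp
 thus "p \<in> schroedinger V" using e(1) p(1) by (auto simp: schroedinger_def)
qed

section \<open>Strict differentiability\<close>

text \<open>Strict differentiability compares increments between two variable points near
  \<open>u0\<close>, which is what two-sided distance estimates for a chart require.\<close>

lemma C1_strict_derivative:
 fixes f :: "'a::real_normed_vector => 'b::real_normed_vector" and f' :: "'a => 'a \<Rightarrow>\<^sub>L 'b"
 assumes U: "open U" "u0 \<in> U" and d: "!!u. u \<in> U ==> (f has_derivative blinfun_apply (f' u)) (at u)"
  and c: "isCont f' u0" and e: "0 < e"
 shows "\<exists>r>0. ball u0 r \<subseteq> U \<and> (\<forall>u\<in>ball u0 r. \<forall>v\<in>ball u0 r. norm (f u - f v - f' u0 (u - v)) <= e * norm (u - v))"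
proof -
 obtain r1 where r1: "0 < r1" "ball u0 r1 \<subseteq> U" using U open_contains_ball by blast
 obtain r2 where r2: "0 < r2" "!!u. dist u u0 < r2 ==> dist (f' u) (f' u0) < e"
  using c e unfolding continuous_at_eps_delta by blast
 define r where "r = min r1 r2"
 have r: "0 < r" "ball u0 r \<subseteq> U" using r1 r2 by (auto simp: r_def subset_iff)
 show ?thesis
 proof (intro exI[of _ r] conjI ballI)
  fix u v assume uv: "u \<in> ball u0 r" "v \<in> ball u0 r"
  have "norm (f u - f v - blinfun_apply (f' u0) (u - v)) <= norm (u - v) * e"
  proof (rule differentiable_bound_linearization[where S="ball u0 r" and f'="%u. blinfun_apply (f' u)"])
   show "v + t *\<^sub>R (u - v) \<in> ball u0 r" if "t \<in> {0..1}" for t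
   proof -
    have "v + t *\<^sub>R (u - v) = (1 - t) *\<^sub>R v + t *\<^sub>R u" by (simp add: algebra_simps)
    thus ?thesis using convexD_alt[OF convex_ball uv(2,1), of t] that by simp
   qed
   show "(f has_derivative blinfun_apply (f' x)) (at x within ball u0 r)" if "x \<in> ball u0 r" for x
    by (rule has_derivative_at_withinI[OF d[OF subsetD[OF r(2) that]]])
   show "onorm (blinfun_apply (f' x) - blinfun_apply (f' u0)) <= e" if "x \<in> ball u0 r" for x
   proof -
    have "blinfun_apply (f' x) - blinfun_apply (f' u0) = blinfun_apply (f' x - f' u0)"
     by (simp add: fun_eq_iff blinfun.diff_left)
    moreover have "norm (f' x - f' u0) < e" using r2(2)[of x] that by (simp add: r_def dist_norm norm_minus_commute)
    ultimately show ?thesis by (simp add: norm_blinfun.rep_eq)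
   qed
  qed (use r in simp)
  thus "norm (f u - f v - f' u0 (u - v)) <= e * norm (u - v)" by (simp add: mult.commute)
 qed (use r in auto)
qed

text \<open>The second difference of \<open>f\<close> along h v and h w is symmetric in
  \<open>v\<close> and \<open>w\<close>, and it equals h^2 B w v as well as h^2 B v w up to e h^2 /
  2.\<close>

lemma symmetric_second_derivative:
 fixes f :: "'a::real_normed_vector => 'b::real_normed_vector" and f' :: "'a => 'a \<Rightarrow>\<^sub>L 'b" and B :: "'a \<Rightarrow>\<^sub>L 'a \<Rightarrow>\<^sub>L 'b"
 assumes U: "open U" "u0 \<in> U" and d: "!!u. u \<in> U ==> (f has_derivative blinfun_apply (f' u)) (at u)"
  and s: "!!e. 0 < e ==> \<exists>r>0. ball u0 r \<subseteq> U \<and> (\<forall>u\<in>ball u0 r. \<forall>v\<in>ball u0 r. norm (f' u - f' v - B (u - v)) <= e * norm (u - v))"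
 shows "B v w = B w v"
proof -
 have "norm (B v w - B w v) <= e" if e: "0 < e" for e
 proof -
  define K where "K = norm v * norm w + 1"
  have K: "0 < K" by (simp add: K_def add_nonneg_pos)
  obtain r where r: "0 < r" "ball u0 r \<subseteq> U"
   "!!u v. u \<in> ball u0 r ==> v \<in> ball u0 r ==> norm (f' u - f' v - B (u - v)) <= e / (2 * K) * norm (u - v)"
   using s[of "e / (2 * K)"] e K by auto
  define h where "h = r / (2 * (norm v + norm w + 1))"
  have h: "0 < h" "h * (norm v + norm w) < r"
   using r add_nonneg_pos[of "norm v + norm w" 1] by (simp_all add: h_def pos_divide_less_eq algebra_simps add_strict_increasing)
  \<comment> \<open>Mean value inequality along the segment in direction \<open>a\<close> for the
    first difference in direction \<open>b\<close> minus its linear model.\<close>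
  have Q: "norm (f (u0 + h *\<^sub>R a + h *\<^sub>R b) - f (u0 + h *\<^sub>R a) - f (u0 + h *\<^sub>R b) + f u0 - (h * h) *\<^sub>R B b a) <= (h * h) * (e / 2)"
   if ab: "h * (norm a + norm b) < r" "norm a * norm b < K" for a b
  proof -
   let ?g = "%u. f (u + h *\<^sub>R b) - f u - B (h *\<^sub>R b) u"
   let ?S = "closed_segment u0 (u0 + h *\<^sub>R a)"
   have "norm (?g (u0 + h *\<^sub>R a) - ?g u0) <= (e / (2 * K) * norm (h *\<^sub>R b)) * norm (u0 + h *\<^sub>R a - u0)"
   proof (rule differentiable_bound[OF convex_closed_segment])
    fix u assume "u \<in> ?S"
    then obtain t where t: "0 <= t" "t <= 1" "u = u0 + t *\<^sub>R (h *\<^sub>R a)" by (auto simp: closed_segment_def algebra_simps)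
    have "norm (t *\<^sub>R (h *\<^sub>R a)) <= h * norm a" using t h by (simp add: mult_left_le_one_le)
    moreover have "h * norm a < r" by (rule le_less_trans[OF _ ab(1)]) (use h in simp)
    ultimately have u: "u \<in> ball u0 r" "u + h *\<^sub>R b \<in> ball u0 r"
     using ab(1) h norm_triangle_ineq[of "t *\<^sub>R (h *\<^sub>R a)" "h *\<^sub>R b"] norm_minus_cancel[of "t *\<^sub>R (h *\<^sub>R a) + h *\<^sub>R b"]
     by (simp_all add: t(3) dist_norm distrib_left diff_diff_eq[symmetric])
    let ?D = "f' (u + h *\<^sub>R b) - f' u - B (h *\<^sub>R b)"
    have uU: "u \<in> U" "u + h *\<^sub>R b \<in> U" using u r(2) by auto
    have "((%u. u + h *\<^sub>R b) has_derivative (%k. k)) (at u)" by (auto intro!: derivative_eq_intros)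
    note has_derivative_diff[OF has_derivative_diff[OF has_derivative_compose[OF this d[OF uU(2)]] d[OF uU(1)]]
     bounded_linear_imp_has_derivative[OF blinfun.bounded_linear_right[of "B (h *\<^sub>R b)"]]]
    thus "(?g has_derivative blinfun_apply ?D) (at u within ?S)" unfolding minus_blinfun.rep_eq by (rule has_derivative_at_withinI)
    show "onorm (blinfun_apply ?D) <= e / (2 * K) * norm (h *\<^sub>R b)"
     using r(3)[OF u(2,1)] by (simp add: norm_blinfun.rep_eq)
   qed auto
   also have "... = (h * h * e / (2 * K)) * (norm a * norm b)" using h by simp
   also have "... <= (h * h * e / (2 * K)) * K" using ab(2) h e K by (intro mult_left_mono) auto
   finally show ?thesis using K by (simp add: blinfun.add_right blinfun.scaleR_right blinfun.scaleR_left algebra_simps)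
  qed
  define q where "q = f (u0 + h *\<^sub>R v + h *\<^sub>R w) - f (u0 + h *\<^sub>R v) - f (u0 + h *\<^sub>R w) + f u0"
  have q: "norm (q - (h * h) *\<^sub>R B w v) <= (h * h) * (e / 2)" "norm (q - (h * h) *\<^sub>R B v w) <= (h * h) * (e / 2)"
   using Q[of v w] Q[of w v] h(2) by (simp_all add: q_def K_def algebra_simps)
  have "(h * h) * norm (B v w - B w v) = norm ((q - (h * h) *\<^sub>R B w v) - (q - (h * h) *\<^sub>R B v w))"
   using h by (simp flip: scaleR_diff_right)
  also have "... <= (h * h) * e" using norm_triangle_ineq4[of "q - (h * h) *\<^sub>R B w v" "q - (h * h) *\<^sub>R B v w"] q by (simp add: field_simps)
  finally show ?thesis using h by simp
 qed
 hence "norm (B v w - B w v) <= 0" by (meson dense_ge)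
 thus ?thesis by simp
qed

text \<open>At a maximiser \<open>y\<close> of \<open>norm (W y)\<close> on the unit sphere \<open>W (W y) = k^2 y\<close>, so one of
 \<open>\<plusminus>k\<close> is an eigenvalue.\<close>

lemma self_adjoint_norm_bound:
 fixes W :: "'a::euclidean_space => 'a"
 assumes W: "linear W" and sym: "!!x y. W x \<bullet> y = x \<bullet> W y"
  and inj: "!!t y. \<bar>t\<bar> < b ==> y + t *\<^sub>R W y = 0 ==> y = 0" and b: "0 < b"
 shows "norm (W x) <= norm x / b"
proof -
 have cont: "continuous_on A W" for A using W by (simp add: linear_continuous_on linear_linear)
 obtain e :: 'a where e: "e \<in> Basis" using nonempty_Basis by blast
 have "compact (sphere (0::'a) 1)" "sphere (0::'a) 1 ~= {}" using e by (auto intro!: exI[of _ e])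
 from continuous_attains_sup[OF this, of "%x. norm (W x)"]
  continuous_on_norm[OF cont]
 obtain y where "y \<in> sphere 0 1" "!!x. x \<in> sphere 0 1 ==> norm (W x) <= norm (W y)"
  by blast
 hence y: "norm y = 1" "!!x. norm x = 1 ==> norm (W x) <= norm (W y)" by simp_all
 define k where "k = norm (W y)"
 have k: "norm (W x) <= k * norm x" for x
 proof (cases "x = 0")
  case False
  hence "norm (W ((1 / norm x) *\<^sub>R x)) <= k" unfolding k_def by (intro y(2)) simp
  thus ?thesis using False by (simp add: linear_cmul[OF W] field_simps)
 qed (simp add: linear_0[OF W])
 have "k <= 1 / b"
 proof (rule ccontr)
  assume "\<not> k <= 1 / b"
  hence kb1: "1 / b < k" by simp
  have kb2: "0 < k" using less_trans[OF _ kb1, of 0] b by simp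
  have kb: "1 / k < b" "0 < k" using kb1 kb2 b by (simp_all add: field_simps)
  have yy: "y \<bullet> y = 1" using y(1) by (simp add: norm_eq_1)
  have wy: "W (W y) \<bullet> y = k^2" using sym[of "W y" y] by (simp add: k_def power2_norm_eq_inner)
  have n2: "(norm (W (W y)))^2 <= (k * k)^2" using k[of "W y"] by (intro power_mono) (auto simp: k_def)
  have "(norm (W (W y) - k^2 *\<^sub>R y))^2 = (norm (W (W y)))^2 - 2 * k^2 * (W (W y) \<bullet> y) + k^2 * k^2 * (y \<bullet> y)"
   unfolding power2_norm_eq_inner by (simp add: inner_diff_left inner_diff_right inner_commute algebra_simps)
  also have "... <= 0" using n2 unfolding wy yy by (simp add: power2_eq_square algebra_simps)
  finally have WW: "W (W y) = k^2 *\<^sub>R y" by simp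
  define z where "z = W y + k *\<^sub>R y"
  show False
  proof (cases "z = 0")
   case True
   hence "W y = - k *\<^sub>R y" by (simp add: z_def eq_neg_iff_add_eq_0)
   hence "y + (1 / k) *\<^sub>R W y = 0" using kb by simp
   hence "y = 0" using inj[of "1 / k" y] kb by simp
   thus False using y(1) by simp
  next
   case False
   have "W z = k *\<^sub>R z" unfolding z_def by (simp add: linear_add[OF W] linear_cmul[OF W] WW power2_eq_square scaleR_add_right)
   hence "z + (- (1 / k)) *\<^sub>R W z = 0" using kb by simp
   hence "z = 0" using inj[of "- (1 / k)" z] kb by simp
   thus False using False by simp
  qed
 qed
 hence "k * norm x <= 1 / b * norm x" by (rule mult_right_mono) simp
 thus ?thesis using k[of x] by simp
qed

text \<open>An open set is a countable union of compact sets, so relatively closed sets have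
  countable unions of compact sets as images; injectivity lets complements pass through the
  image.\<close>

lemma borel_injective_image:
 fixes f :: "'a::euclidean_space => 'b::euclidean_space"
 assumes U: "open U" and f: "continuous_on U f" "inj_on f U" and E: "E \<in> sets borel" "E \<subseteq> U"
 shows "f ` E \<in> sets borel"
proof -
 obtain K where K: "!!n::nat. compact (K n)" "!!n. K n \<subseteq> U" "(\<Union>n. K n) = U"
  using open_Union_compact_subsets[OF U] by metis
 have cl: "f ` (F \<inter> U) \<in> sets borel" if "closed F" for F
 proof -
  have "f ` (F \<inter> U) = (\<Union>n. f ` (F \<inter> K n))" using K(3) by blast
  moreover have "compact (f ` (F \<inter> K n))" for n
   using K that by (intro compact_continuous_image continuous_on_subset[OF f(1)] closed_Int_compact) auto
  moreover have "(\<Union>n. f ` (F \<inter> K n)) \<in> sets borel"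
   by (rule sets.countable_UN[of "%n. f ` (F \<inter> K n)"]) (auto intro: borel_compact[OF \<open>!!n. compact (f ` (F \<inter> K n))\<close>])
  ultimately show ?thesis by simp
 qed
 have "E \<in> sigma_sets UNIV {F. closed F}" using E(1) by (simp add: borel_eq_closed)
 hence "f ` (E \<inter> U) \<in> sets borel"
 proof (induction rule: sigma_sets.induct)
  case (Basic F)
  thus ?case using cl by simp
 next
  case Empty
  thus ?case by simp
 next
  case (Compl F)
  have "f ` ((UNIV - F) \<inter> U) = f ` (UNIV \<inter> U) - f ` (F \<inter> U)" using f(2) by (auto simp: inj_on_def)
  moreover have "f ` (UNIV \<inter> U) \<in> sets borel" by (rule cl) simp
  ultimately show ?case using Compl by (metis sets.Diff)
 next
  case (Union F)
  have "f ` ((\<Union>i. F i) \<inter> U) = (\<Union>i. f ` (F i \<inter> U))" by blast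
  thus ?case using Union by auto
 qed
 thus ?thesis using E(2) by (simp add: Int_absorb2)
qed

section \<open>The unit normal and an almost isometric model of the layer\<close>

lemma isometry_add_normal_norm:
 fixes L :: "'a::euclidean_space => 'b::euclidean_space" and n :: 'b
 assumes iso: "!!w. norm (L w) = norm w" and n: "norm n = 1" "!!w. n \<bullet> L w = 0"
 shows "norm (L w + t *\<^sub>R n) = norm (w, t)"
proof -
 have "(norm (L w + t *\<^sub>R n))^2 = (norm (L w))^2 + t^2"
  using n(2)[of w] n(1) unfolding power2_norm_eq_inner
  by (simp add: inner_add_left inner_add_right inner_commute[of "L w" n] norm_eq_1 power2_eq_square)
 also have "... = (norm (w, t))^2" by (simp add: iso norm_Pair)
 finally show ?thesis by simp
qed

text \<open>The sum of the isometry and the normal direction preserves norms, hence is injective,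
  and the dimensions agree.\<close>

lemma hyperplane_decomposition:
 fixes L :: "'a::euclidean_space => 'b::euclidean_space"
 assumes L: "linear L" and iso: "!!w. norm (L w) = norm w" and n: "norm n = 1" "!!w. n \<bullet> L w = 0"
  and dim: "DIM('b) = DIM('a) + 1"
 shows "\<exists>a s. y = L a + s *\<^sub>R n"
proof -
 let ?F = "%p. L (fst p) + snd p *\<^sub>R n"
 have lin: "linear ?F" by (rule linearI) (simp_all add: linear_add[OF L] linear_cmul[OF L] algebra_simps)
 have nF: "norm (?F p) = norm p" for p using isometry_add_normal_norm[OF iso n, of "fst p" "snd p"] by simp
 hence "p = 0" if "?F p = 0" for p using nF[of p, unfolded that] by simp
 hence "inj ?F" unfolding linear_injective_0[OF lin] by blast
 hence "span (range ?F) = UNIV" using dim_image_eq[OF lin, of UNIV] dim by (simp add: dim_eq_full[symmetric])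
 hence "y \<in> range ?F" using span_eq_iff[of "range ?F"] linear_subspace_image[OF lin subspace_UNIV] by simp
 thus ?thesis by (auto simp del: prod.collapse)
qed

text \<open>The normal is only known to be continuous; its derivative comes from the relations it
  satisfies. The error \<open>y\<close> is split into a tangential and a normal part at
  \<open>u0\<close>: orthogonality to the tangent spaces at \<open>u\<close> and \<open>v\<close>
  controls the first, and constancy of the length of \<open>n\<close> the second.\<close>

lemma normal_strict_derivative:
 fixes f' :: "'a::euclidean_space => 'a \<Rightarrow>\<^sub>L 'b::euclidean_space" and B :: "'a \<Rightarrow>\<^sub>L 'a \<Rightarrow>\<^sub>L 'b"
 assumes U: "open U" "u0 \<in> U" and cf': "isCont f' u0"
  and s: "!!e. 0 < e ==> \<exists>r>0. ball u0 r \<subseteq> U \<and> (\<forall>u\<in>ball u0 r. \<forall>v\<in>ball u0 r. norm (f' u - f' v - B (u - v)) <= e * norm (u - v))"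
  and n: "!!u. u \<in> U ==> norm (n u) = 1" "!!u w. u \<in> U ==> n u \<bullet> f' u w = 0" and cn: "isCont n u0"
  and iso: "!!w. norm (f' u0 w) = norm w" and dim: "DIM('b) = DIM('a) + 1"
  and W: "!!w a. W w \<bullet> a = - (n u0 \<bullet> B w a)" and e: "0 < e"
 shows "\<exists>r>0. ball u0 r \<subseteq> U \<and> (\<forall>u\<in>ball u0 r. \<forall>v\<in>ball u0 r. norm (n u - n v - f' u0 (W (u - v))) <= e * norm (u - v))"
proof -
 define L where "L = blinfun_apply (f' u0)"
 define n0 where "n0 = n u0"
 have n0: "norm n0 = 1" "!!w. n0 \<bullet> L w = 0" unfolding n0_def L_def using n U by auto
 have linL: "linear L" unfolding L_def by (rule bounded_linear.linear[OF blinfun.bounded_linear_right])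
 have isoL: "norm (L w) = norm w" for w by (simp add: L_def iso)
 have LL: "L v \<bullet> L w = v \<bullet> w" for v w
  unfolding dot_norm[of "L v" "L w"] dot_norm[of v w] by (simp add: isoL linear_add[OF linL, symmetric])
 have CS: "\<bar>x \<bullet> v\<bar> <= p * q" if "norm x <= p" "norm v <= q" for x v :: 'b and p q
  using Cauchy_Schwarz_ineq2[of x v] mult_mono[OF that] norm_ge_zero[of x] norm_ge_zero[of v] that by linarith
 define K where "K = norm B + 1"
 have K: "1 <= K" by (simp add: K_def)
 \<comment> \<open>With d <= 1/4 the term 2 d |z| is absorbed and |z| <= 3 K |w|. Then |y| <= 2 d (3
   K |w|) + d K |w|, which is the 7 d K |w| required to be at most e |w|.\<close>
 define d where "d = min (1 / 4) (e / (7 * K))"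
 have d: "0 < d" "d <= 1 / 4" "7 * d * K <= e" using e K by (auto simp: d_def min_def field_simps)
 obtain r1 where r1: "0 < r1" "ball u0 r1 \<subseteq> U"
  "!!u v. u \<in> ball u0 r1 ==> v \<in> ball u0 r1 ==> norm (f' u - f' v - B (u - v)) <= d * norm (u - v)" using s[OF d(1)] by blast
 obtain r2 where r2: "0 < r2" "!!u. dist u u0 < r2 ==> dist (f' u) (f' u0) < d"
  using cf' d(1) unfolding continuous_at_eps_delta by blast
 obtain r3 where r3: "0 < r3" "!!u. dist u u0 < r3 ==> dist (n u) (n u0) < d"
  using cn d(1) unfolding continuous_at_eps_delta by blast
 define r where "r = min r1 (min r2 r3)"
 have r: "0 < r" "ball u0 r \<subseteq> U" using r1 r2 r3 by (auto simp: r_def subset_iff)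
 show ?thesis
 proof (intro exI[of _ r] conjI ballI)
  fix u v assume uv: "u \<in> ball u0 r" "v \<in> ball u0 r"
  hence inU: "u \<in> U" "v \<in> U" using r(2) by auto
  define w where "w = u - v"
  define z where "z = n u - n v"
  define y where "y = z - L (W w)"
  have near: "norm (f' u - f' u0) <= d" "norm (n u - n0) <= d" "norm (n v - n0) <= d"
   using r2(2)[of u] r3(2)[of u] r3(2)[of v] uv by (auto simp: r_def dist_norm norm_minus_commute n0_def)
  have Bd: "norm (f' u - f' v - B w) <= d * norm w" unfolding w_def using uv by (intro r1(3)) (auto simp: r_def)
  obtain a s where a: "y = L a + s *\<^sub>R n0" using hyperplane_decomposition[OF linL isoL n0 dim] by blast
  have as: "norm a <= norm y" "\<bar>s\<bar> <= norm y"
   unfolding a isometry_add_normal_norm[OF isoL n0] using norm_fst_le[of a s] norm_snd_le[of s a] by simp_all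
  have app: "norm (X a) <= p * norm y" if "norm X <= p" for X :: "'a \<Rightarrow>\<^sub>L 'b" and p
   by (rule order_trans[OF norm_blinfun mult_mono[OF that as(1)]]) (use order_trans[OF norm_ge_zero that] in auto)
  have "n u \<bullet> n u = 1" "n v \<bullet> n v = 1" using n(1) inU by (simp_all add: norm_eq_1[symmetric])
  \<comment> \<open>Both normals have length 1, so \<open>z\<close> is orthogonal to their sum, and
    \<open>n0\<close> is close to half of this sum.\<close>
  hence "2 * (z \<bullet> n0) = - (z \<bullet> (n u - n0)) - (z \<bullet> (n v - n0))"
   unfolding z_def by (simp add: inner_diff_left inner_diff_right inner_commute)
  hence "\<bar>z \<bullet> n0\<bar> <= norm z * d" using CS[OF order_refl near(2), of z] CS[OF order_refl near(3), of z] by linarith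
  hence sz: "\<bar>s * (z \<bullet> n0)\<bar> <= norm y * (norm z * d)" unfolding abs_mult using as(2) by (intro mult_mono) auto
  have "L (W w) \<bullet> n0 = 0" using n0(2)[of "W w"] by (simp add: inner_commute)
  hence "y \<bullet> y = y \<bullet> L a + s * (z \<bullet> n0)" by (subst (2) a) (simp add: inner_add_right y_def inner_diff_left)
  \<comment> \<open>Subtract the orthogonality relations at \<open>u\<close> and at \<open>v\<close>
    in direction \<open>a\<close>; what remains of the linear term is cancelled by the definition of
    \<open>W\<close>.\<close>
  moreover have "y \<bullet> L a = - (z \<bullet> (f' u - f' u0) a) - (n v \<bullet> (f' u - f' v - B w) a) - (n v - n0) \<bullet> B w a"
   unfolding y_def inner_diff_left LL W n0_def[symmetric] unfolding z_def L_def using n(2)[OF inU(1), of a] n(2)[OF inU(2), of a]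
   by (simp add: inner_diff_left inner_diff_right blinfun.diff_left)
  moreover have "\<bar>z \<bullet> (f' u - f' u0) a\<bar> <= norm z * (d * norm y)" by (rule CS[OF order_refl app[OF near(1)]])
  moreover have "\<bar>n v \<bullet> (f' u - f' v - B w) a\<bar> <= 1 * (d * norm w * norm y)"
   by (rule CS[OF _ app[OF Bd]]) (simp add: n(1) inU)
  moreover have "\<bar>(n v - n0) \<bullet> B w a\<bar> <= d * (norm B * norm w * norm y)" by (rule CS[OF near(3) app[OF norm_blinfun]])
  moreover have "(2 * (d * norm z) + d * (K * norm w)) * norm y =
    norm y * (norm z * d) + norm z * (d * norm y) + 1 * (d * norm w * norm y) + d * (norm B * norm w * norm y)"
   by (simp add: K_def algebra_simps)
  ultimately have "norm y * norm y <= (2 * (d * norm z) + d * (K * norm w)) * norm y"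
   using sz by (simp only: power2_norm_eq_inner[symmetric] power2_eq_square[symmetric])
  hence diff: "norm y <= 2 * (d * norm z) + d * (K * norm w)"
   using d(1) K by (cases "y = 0") (auto intro!: add_nonneg_nonneg mult_nonneg_nonneg)
  have "norm (W w) * norm (W w) = - (n0 \<bullet> B w (W w))" unfolding power2_eq_square[symmetric] power2_norm_eq_inner n0_def by (rule W)
  also have "... <= 1 * (norm B * norm w * norm (W w))"
   using CS[of n0 1 "B w (W w)", OF _ order_trans[OF norm_blinfun mult_right_mono[OF norm_blinfun]]] n0 by (simp add: abs_le_iff)
  finally have "norm (W w) <= norm B * norm w" by (cases "W w = 0") auto
  hence Ww: "norm (W w) <= K * norm w" by (simp add: K_def distrib_right add_increasing2)
  have "norm z <= norm y + norm (W w)" using norm_triangle_ineq[of y "L (W w)"] isoL by (simp add: y_def)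
  moreover have "d * norm z <= 1 / 4 * norm z" "d * (K * norm w) <= 1 / 4 * (K * norm w)"
   using d K by (intro mult_right_mono; simp)+
  moreover have "0 <= K * norm w" using K by simp
  ultimately have "norm z <= 3 * (K * norm w)" using diff Ww by linarith
  hence "norm y <= (7 * d * K) * norm w" using diff mult_left_mono[of "norm z" "3 * (K * norm w)" d] d(1) by linarith
  also have "... <= e * norm w" using d(3) by (rule mult_right_mono) simp
  finally show "norm (n u - n v - f' u0 (W (u - v))) <= e * norm (u - v)" by (simp add: y_def z_def L_def w_def)
 qed (use r in auto)
qed

text \<open>With parameters that are isometric at \<open>u0\<close>, the map from (u, t) to f u + t
  n u differs from the isometry (w, t) -> L w + t n0 in increments by a relative error O(e) for |t|
  < e. The factor comes from t W, and |W| <= 1 / b because points at height below \<open>b\<close>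
  stay separated.\<close>

lemma normal_flat_model:
 fixes f' :: "'a::euclidean_space => 'a \<Rightarrow>\<^sub>L 'b::euclidean_space" and B :: "'a \<Rightarrow>\<^sub>L 'a \<Rightarrow>\<^sub>L 'b"
 assumes U: "open U" "u0 \<in> U" and df: "!!u. u \<in> U ==> (f has_derivative blinfun_apply (f' u)) (at u)"
  and cf': "isCont f' u0"
  and s: "!!e. 0 < e ==> \<exists>r>0. ball u0 r \<subseteq> U \<and> (\<forall>u\<in>ball u0 r. \<forall>v\<in>ball u0 r. norm (f' u - f' v - B (u - v)) <= e * norm (u - v))"
  and n: "!!u. u \<in> U ==> norm (n u) = 1" "!!u w. u \<in> U ==> n u \<bullet> f' u w = 0" and cn: "isCont n u0"
  and iso: "!!w. norm (f' u0 w) = norm w" and dim: "DIM('b) = DIM('a) + 1"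
  and c: "0 < c" "!!u v t. u \<in> U ==> v \<in> U ==> \<bar>t\<bar> < b ==> c * norm (u - v) <= norm (f u + t *\<^sub>R n u - (f v + t *\<^sub>R n v))"
  and b: "0 < b" and e: "0 < e"
 shows "\<exists>r>0. ball u0 r \<subseteq> U \<and> (\<forall>u\<in>ball u0 r. \<forall>v\<in>ball u0 r.
   \<bar>norm (f u - f v) - norm (u - v)\<bar> <= 2 * e / b * norm (u - v) \<and>
   (\<forall>t t'. \<bar>t\<bar> < e --> \<bar>norm (f u + t *\<^sub>R n u - (f v + t' *\<^sub>R n v)) - norm (u - v, t - t')\<bar> <= 2 * e / b * norm (u - v, t - t')))"
proof -
 define L where "L = blinfun_apply (f' u0)"
 define n0 where "n0 = n u0"
 \<comment> \<open>The Weingarten map transported to the parameter space, whose inner product is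
   that of the tangent space at \<open>u0\<close> since f' u0 is isometric.\<close>
 define W where "W w = (\<Sum>b\<in>Basis. (- (n u0 \<bullet> B w b)) *\<^sub>R b)" for w
 have linL: "linear L" unfolding L_def by (rule bounded_linear.linear[OF blinfun.bounded_linear_right])
 have n0: "norm n0 = 1" "!!w. n0 \<bullet> L w = 0" unfolding n0_def L_def using n U by auto
 have linW: "linear W" unfolding W_def
  by (rule linearI) (simp_all add: blinfun.add_right blinfun.add_left blinfun.scaleR_right blinfun.scaleR_left inner_add_right sum.distrib[symmetric] algebra_simps scaleR_sum_right)
 have Wb: "W w \<bullet> b = - (n u0 \<bullet> B w b)" if "b \<in> Basis" for w b
  unfolding W_def using that by (simp add: inner_sum_left inner_Basis if_distrib cong: if_cong)
 have symB: "B v w = B w v" for v w by (rule symmetric_second_derivative[OF U df s])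
 have Wv: "W w \<bullet> v = - (n u0 \<bullet> B w v)" for w v
 proof -
  have "W w \<bullet> v = (\<Sum>b\<in>Basis. (W w \<bullet> b) * (v \<bullet> b))" by (rule euclidean_inner)
  also have "... = (\<Sum>b\<in>Basis. - (n u0 \<bullet> B w ((v \<bullet> b) *\<^sub>R b)))" by (rule sum.cong) (simp_all add: Wb blinfun.scaleR_right)
  also have "... = - (n u0 \<bullet> B w (\<Sum>b\<in>Basis. (v \<bullet> b) *\<^sub>R b))" by (simp add: sum_negf inner_sum_right blinfun.sum_right)
  finally show ?thesis by (simp add: euclidean_representation)
 qed
 have symW: "W x \<bullet> y = x \<bullet> W y" for x y using Wv[of x y] Wv[of y x] symB[of x y] by (simp add: inner_commute)
 have sn: "\<exists>r>0. ball u0 r \<subseteq> U \<and> (\<forall>u\<in>ball u0 r. \<forall>v\<in>ball u0 r. norm (n u - n v - L (W (u - v))) <= d * norm (u - v))" if d: "0 < d" for d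
  unfolding L_def by (rule normal_strict_derivative[OF U cf' s n cn iso dim Wv d])
 have sf: "\<exists>r>0. ball u0 r \<subseteq> U \<and> (\<forall>u\<in>ball u0 r. \<forall>v\<in>ball u0 r. norm (f u - f v - L (u - v)) <= d * norm (u - v))" if d: "0 < d" for d
  unfolding L_def by (rule C1_strict_derivative[OF U df cf' d])
 have both: "\<exists>r>0. ball u0 r \<subseteq> U \<and> (\<forall>u\<in>ball u0 r. \<forall>v\<in>ball u0 r. norm (f u - f v - L (u - v)) <= d * norm (u - v)
   \<and> norm (n u - n v - L (W (u - v))) <= d * norm (u - v) \<and> norm (n v - n0) <= d)" if d: "0 < d" for d
 proof -
  obtain r1 where r1: "0 < r1" "ball u0 r1 \<subseteq> U" "\<forall>u\<in>ball u0 r1. \<forall>v\<in>ball u0 r1. norm (f u - f v - L (u - v)) <= d * norm (u - v)" using sf[OF d] by blast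
  obtain r2 where r2: "0 < r2" "ball u0 r2 \<subseteq> U" "\<forall>u\<in>ball u0 r2. \<forall>v\<in>ball u0 r2. norm (n u - n v - L (W (u - v))) <= d * norm (u - v)" using sn[OF d] by blast
  obtain r3 where r3: "0 < r3" "!!u. dist u u0 < r3 ==> dist (n u) (n u0) < d"
   using cn d unfolding continuous_at_eps_delta by blast
  have "norm (n v - n0) <= d" if "v \<in> ball u0 r3" for v using r3(2)[of v] that by (simp add: dist_norm n0_def norm_minus_commute)
  thus ?thesis using r1 r2 r3(1) by (intro exI[of _ "min r1 (min r2 r3)"]) auto
 qed
 \<comment> \<open>A vector \<open>y\<close> in the kernel of 1 + t W with |t| < b would bring the
   shifted points of \<open>u0\<close> and u0 + h y closer than the lower bound \<open>c\<close>
   allows; d is chosen so that the errors reach only c / 2. The bound then follows from symmetry of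
   \<open>W\<close>.\<close>
 have Wbd: "norm (W w) <= norm w / b" for w
 proof (rule self_adjoint_norm_bound[OF linW symW _ b])
  fix t y assume t: "\<bar>t\<bar> < b" and y: "y + t *\<^sub>R W y = 0"
  define d where "d = c / (2 * (1 + \<bar>t\<bar>))"
  have d: "0 < d" using c(1) by (simp add: d_def)
  obtain r where r: "0 < r" "ball u0 r \<subseteq> U" "!!u v. u \<in> ball u0 r ==> v \<in> ball u0 r ==> norm (f u - f v - L (u - v)) <= d * norm (u - v)
   \<and> norm (n u - n v - L (W (u - v))) <= d * norm (u - v) \<and> norm (n v - n0) <= d" using both[OF d] by blast
  show "y = 0"
  proof (rule ccontr)
   assume "y ~= 0"
   define h where "h = r / (2 * norm y)"
   have h: "0 < h" "h * norm y < r" using \<open>y ~= 0\<close> r(1) by (simp_all add: h_def)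
   define u where "u = u0 + h *\<^sub>R y"
   have u: "u \<in> ball u0 r" "u0 \<in> ball u0 r" "u - u0 = h *\<^sub>R y" using h r(1) by (simp_all add: u_def dist_norm)
   have "c * norm (u - u0) <= norm (f u + t *\<^sub>R n u - (f u0 + t *\<^sub>R n u0))" using u r(2) t by (intro c(2)) auto
   also have "f u + t *\<^sub>R n u - (f u0 + t *\<^sub>R n u0) =
     (f u - f u0 - L (u - u0)) + t *\<^sub>R (n u - n u0 - L (W (u - u0))) + h *\<^sub>R L (y + t *\<^sub>R W y)"
    unfolding u(3) by (simp add: linear_add[OF linL] linear_cmul[OF linL] linear_cmul[OF linW] algebra_simps)
   also have "... = (f u - f u0 - L (u - u0)) + t *\<^sub>R (n u - n u0 - L (W (u - u0)))" unfolding y by (simp add: linear_0[OF linL])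
   also have "norm ... <= d * norm (u - u0) + \<bar>t\<bar> * (d * norm (u - u0))"
    using r(3)[OF u(1,2)] by (intro norm_triangle_le add_mono) (auto intro: mult_left_mono)
   also have "... = (d * (1 + \<bar>t\<bar>)) * norm (u - u0)" by (simp add: algebra_simps)
   also have "d * (1 + \<bar>t\<bar>) = c / 2" unfolding d_def by (simp add: field_simps)
   finally show False using c(1) \<open>y ~= 0\<close> h(1) by (simp add: u(3))
  qed
 qed
 \<comment> \<open>The three error terms are at most e / (2 b), e / b and e / (2 b) times the
   distance, together 2 e / b.\<close>
 define d where "d = e / (2 * b) / (1 + e)"
 have "0 < d" "1 + e ~= 0" using b e by (simp_all add: d_def)
 hence d: "0 < d" "d * (1 + e) <= e / (2 * b)" "d <= e / (2 * b)"
  using mult_left_mono[of 1 "1 + e" d] e by (simp_all add: d_def)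
 obtain r where r: "0 < r" "ball u0 r \<subseteq> U" "!!u v. u \<in> ball u0 r ==> v \<in> ball u0 r ==> norm (f u - f v - L (u - v)) <= d * norm (u - v)
   \<and> norm (n u - n v - L (W (u - v))) <= d * norm (u - v) \<and> norm (n v - n0) <= d" using both[OF d(1)] by blast
 show ?thesis
 proof (intro exI[of _ r] conjI ballI allI impI)
  fix u v assume uv: "u \<in> ball u0 r" "v \<in> ball u0 r"
  have Lw: "norm (L (u - v)) = norm (u - v)" by (simp add: L_def iso)
  have "d * norm (u - v) <= 2 * e / b * norm (u - v)" using d(3) e b by (intro mult_right_mono) (auto simp: field_simps)
  thus "\<bar>norm (f u - f v) - norm (u - v)\<bar> <= 2 * e / b * norm (u - v)"
   using norm_triangle_ineq3[of "f u - f v" "L (u - v)"] r(3)[OF uv] Lw by linarith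
  \<comment> \<open>Only \<open>t\<close> has to be small: t' enters solely through t - t',
    multiplied by the small n v - n0.\<close>
  fix t t' :: real assume t: "\<bar>t\<bar> < e"
  define w where "w = u - v"
  have A1: "f u + t *\<^sub>R n u - (f v + t' *\<^sub>R n v) - (L w + (t - t') *\<^sub>R n0) =
   (f u - f v - L w) + t *\<^sub>R (n u - n v - L (W w)) + t *\<^sub>R L (W w) + (t - t') *\<^sub>R (n v - n0)" by (simp add: algebra_simps)
  have A2: "norm ((f u - f v - L w) + t *\<^sub>R (n u - n v - L (W w)) + t *\<^sub>R L (W w) + (t - t') *\<^sub>R (n v - n0))
   <= d * norm w + e * (d * norm w) + e * (norm w / b) + \<bar>t - t'\<bar> * d"
  proof (intro norm_triangle_le add_mono)
   show "norm (f u - f v - L w) <= d * norm w" using r(3)[OF uv] by (simp add: w_def)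
   show "norm (t *\<^sub>R (n u - n v - L (W w))) <= e * (d * norm w)"
    using r(3)[OF uv] t by (auto simp: w_def intro!: mult_mono)
   show "norm (t *\<^sub>R L (W w)) <= e * (norm w / b)" using mult_mono[OF less_imp_le[OF t] Wbd[of w]] e iso[of "W w"] by (simp add: L_def)
   show "norm ((t - t') *\<^sub>R (n v - n0)) <= \<bar>t - t'\<bar> * d" using r(3)[OF uv] by (auto intro: mult_left_mono)
  qed
  have A3: "d * norm w + e * (d * norm w) + e * (norm w / b) + \<bar>t - t'\<bar> * d <= 2 * e / b * norm (w, t - t')"
  proof -
   have nw: "norm w <= norm (w, t - t')" "\<bar>t - t'\<bar> <= norm (w, t - t')"
    using norm_fst_le[of w "t - t'"] norm_snd_le[of "t - t'" w] by simp_all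
   have "d * norm w + e * (d * norm w) = (d * (1 + e)) * norm w" by (simp add: algebra_simps)
   also have "... <= e / (2 * b) * norm (w, t - t')" using d(2) nw(1) e b by (intro mult_mono) auto
   finally have 1: "d * norm w + e * (d * norm w) <= e / (2 * b) * norm (w, t - t')" .
   have 2: "e * (norm w / b) <= e / b * norm (w, t - t')" using nw(1) e b by (simp add: divide_right_mono mult_left_mono)
   have 3: "\<bar>t - t'\<bar> * d <= e / (2 * b) * norm (w, t - t')"
    using mult_mono[OF d(3) nw(2)] e b by (simp add: mult.commute)
   have "e / (2 * b) * norm (w, t - t') + e / b * norm (w, t - t') + e / (2 * b) * norm (w, t - t') = 2 * e / b * norm (w, t - t')"
    using b by (simp add: field_simps)
   thus ?thesis using add_mono[OF add_mono[OF 1 2] 3] by (simp only:)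
  qed
  have A4: "norm (L w + (t - t') *\<^sub>R n0) = norm (w, t - t')"
   by (rule isometry_add_normal_norm[OF _ n0]) (simp add: L_def iso)
  have "\<bar>norm (f u + t *\<^sub>R n u - (f v + t' *\<^sub>R n v)) - norm (L w + (t - t') *\<^sub>R n0)\<bar> <= 2 * e / b * norm (w, t - t')"
   by (rule order_trans[OF norm_triangle_ineq3]) (unfold A1, rule order_trans[OF A2 A3])
  thus "\<bar>norm (f u + t *\<^sub>R n u - (f v + t' *\<^sub>R n v)) - norm (u - v, t - t')\<bar> <= 2 * e / b * norm (u - v, t - t')"
   unfolding A4 unfolding w_def .
 qed (use r in auto)
qed

section \<open>Tools for comparing measures\<close>

lemma hausdorff_outer_expanding:
 fixes f :: "'a::metric_space => 'b::metric_space"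
 assumes "1 <= k" "0 < K" and f: "!!x y. x \<in> A ==> y \<in> A ==> dist x y <= K * dist (f x) (f y)"
 shows "hausdorff_outer k A <= ennreal (K ^ k) * hausdorff_outer k (f ` A)"
proof -
 have inj: "inj_on f A" using f by (force intro!: inj_onI)
 have "hausdorff_outer k (inv_into A f ` (f ` A)) <= ennreal (K ^ k) * hausdorff_outer k (f ` A)"
  by (rule hausdorff_outer_lipschitz_image[OF assms(1,2)]) (auto simp: inv_into_f_f[OF inj] f)
 thus ?thesis by (simp add: inv_into_image_cancel[OF inj])
qed

lemma emeasure_le_of_countable_cover:
 fixes X :: "nat => 'a set"
 assumes s: "sets M = sets N" and X: "!!k. X k \<in> sets M"
  and le: "!!k D. D \<in> sets M ==> D \<subseteq> X k ==> emeasure M D <= K * emeasure N D"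
  and D: "D \<in> sets M" "D \<subseteq> (\<Union>k. X k)"
 shows "emeasure M D <= K * emeasure N D"
proof -
 define Y where "Y k = D \<inter> disjointed X k" for k
 have Y: "Y k \<in> sets M" "Y k \<subseteq> X k" for k
  using D X sets.range_disjointed_sets[of X M] disjointed_subset[of X k] by (auto simp: Y_def)
 have dY: "disjoint_family Y" using disjoint_family_disjointed[of X] by (auto simp: Y_def disjoint_family_on_def)
 have UY: "(\<Union>k. Y k) = D" using D(2) UN_disjointed_eq[of X] by (auto simp: Y_def)
 have "emeasure M D = (\<Sum>k. emeasure M (Y k))" using suminf_emeasure[of Y M, OF _ dY] Y(1) UY by (simp add: image_subset_iff)
 also have "... <= (\<Sum>k. K * emeasure N (Y k))" by (rule suminf_le[OF le[OF Y(1) Y(2)]]) auto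
 also have "... = K * (\<Sum>k. emeasure N (Y k))" by simp
 also have "(\<Sum>k. emeasure N (Y k)) = emeasure N D" using suminf_emeasure[of Y N, OF _ dY] Y(1) s UY by (simp add: image_subset_iff)
 finally show ?thesis .
qed

text \<open>On [0, 1] a convex function lies below its chord, here from 1 to 2^p.\<close>

lemma one_plus_power_le: "0 <= x ==> x <= 1 ==> (1 + x) ^ p <= 1 + (2 ^ p - 1) * (x::real)"
proof (induction p)
 case (Suc p)
 have p: "0 <= (2 ^ p - 1 :: real)" by simp
 have "(1 + x) ^ Suc p <= (1 + x) * (1 + (2 ^ p - 1) * x)" using Suc by (simp add: mult_left_mono)
 also have "... = 1 + x + (2 ^ p - 1) * x + ((2 ^ p - 1) * x) * x" by (simp add: algebra_simps)
 also have "... <= 1 + x + (2 ^ p - 1) * x + ((2 ^ p - 1) * x) * 1" using Suc.prems p by (intro add_left_mono mult_left_mono) auto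
 also have "... = 1 + (2 ^ Suc p - 1) * x" by (simp add: algebra_simps)
 finally show ?case .
qed simp

section \<open>Admissible hypersurfaces\<close>

locale admissible_hypersurface =
 fixes I :: "'i set"
  and \<phi> :: "'i => real^'m::finite => real^'n::finite"
  and U :: "'i => (real^'m) set"
  and V' :: "'i => (real^'n) set"
  and S :: "(real^'n) set"
  and \<nu> :: "real^'n => real^'n"
  and \<beta> :: real
 assumes dim: "2 <= CARD('n)"
  and adm: "admissible I \<phi> U V' S \<nu> \<beta>"
begin

abbreviation "\<iota> \<equiv> normal_shift \<nu>"
abbreviation "\<sigma> \<equiv> surface_measure S"
abbreviation "\<sigma>t \<equiv> surface_measure S \<Otimes>\<^sub>M (lborel :: real measure)"

lemma beta: "0 < \<beta>"
 and hyp: "C2_hypersurface I \<phi> U V' S" and normal: "unit_normal_field I \<phi> U S \<nu>"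
 and iota_inj: "inj_on \<iota> (S \<times> {-\<beta><..<\<beta>})"
 using adm by (auto simp: admissible_def)

lemma card_n: "CARD('n) = CARD('m) + 1"
 and finite_I: "finite I"
 and open_U: "i \<in> I ==> open (U i)" and open_V: "i \<in> I ==> open (V' i)"
 and C2: "i \<in> I ==> C2_on (\<phi> i) (U i)"
 and homeo: "i \<in> I ==> \<exists>\<psi>. homeomorphism (U i) (V' i \<inter> S) (\<phi> i) \<psi>"
 and S_cover: "S \<subseteq> (\<Union>i\<in>I. V' i)"
 and full_rank: "i \<in> I ==> u \<in> U i ==> rank (matrix (frechet_derivative (\<phi> i) (at u))) = CARD('m)"
 and phi_lipschitz: "\<exists>C>0. \<forall>i\<in>I. \<forall>u\<in>U i. \<forall>v\<in>U i. norm (\<phi> i u - \<phi> i v) <= C * norm (u - v)"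
 using hyp dim by (auto simp: C2_hypersurface_def)

lemma nu_cont: "continuous_on S \<nu>" and nu_norm: "x \<in> S ==> norm (\<nu> x) = 1"
 and nu_tangent: "i \<in> I ==> u \<in> U i ==> y \<in> tangent_space (\<phi> i) u ==> \<nu> (\<phi> i u) \<bullet> y = 0"
 using normal by (auto simp: unit_normal_field_def)

lemma iota_lower: "\<exists>c>0. \<forall>i\<in>I. \<forall>u\<in>U i. \<forall>v\<in>U i. \<forall>s t. \<bar>s\<bar> < \<beta> --> \<bar>t\<bar> < \<beta> -->
  c * norm (u - v, t - s) <= norm (\<iota> (\<phi> i u, t) - \<iota> (\<phi> i v, s))"
proof -
 obtain c where c: "c > 0" "!!i u v s t. i \<in> I ==> u \<in> U i ==> v \<in> U i ==> s \<in> {-\<beta><..<\<beta>} ==> t \<in> {-\<beta><..<\<beta>} ==>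
   (norm (\<iota> (\<phi> i u, t) - \<iota> (\<phi> i v, s)))^2 \<ge> c^2 * ((norm (u - v))^2 + \<bar>s - t\<bar>^2)"
  using adm unfolding admissible_def by blast
 show ?thesis
 proof (intro exI[of _ c] conjI ballI allI impI c(1))
  fix i u v s t assume a: "i \<in> I" "u \<in> U i" "v \<in> U i" "\<bar>s\<bar> < \<beta>" "\<bar>t\<bar> < \<beta>"
  have "(c * norm (u - v, t - s))^2 = c^2 * ((norm (u - v))^2 + \<bar>s - t\<bar>^2)"
   by (simp add: power_mult_distrib norm_Pair power2_commute)
  also have "... <= (norm (\<iota> (\<phi> i u, t) - \<iota> (\<phi> i v, s)))^2" using a by (intro c(2)) auto
  finally show "c * norm (u - v, t - s) <= norm (\<iota> (\<phi> i u, t) - \<iota> (\<phi> i v, s))" by (rule power2_le_imp_le) simp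
 qed
qed

lemma phi_image: "i \<in> I ==> \<phi> i ` U i = V' i \<inter> S"
 and phi_cont: "i \<in> I ==> continuous_on (U i) (\<phi> i)"
 and phi_inj: "i \<in> I ==> inj_on (\<phi> i) (U i)"
 using homeo[of i] by (auto simp: homeomorphism_def intro: inj_on_inverseI)

lemma phi_in_S: "i \<in> I ==> u \<in> U i ==> \<phi> i u \<in> S"
 using phi_image by blast

lemma S_eq: "S = (\<Union>i\<in>I. \<phi> i ` U i)"
 using S_cover phi_image by auto

lemma S_borel [measurable]: "S \<in> sets borel"
proof -
 have "\<phi> i ` U i \<in> sets borel" if "i \<in> I" for i
  by (rule borel_injective_image[OF open_U phi_cont phi_inj]) (auto intro: borel_open open_U that)
 thus ?thesis using finite_I by (subst S_eq) (intro sets.finite_UN, auto)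
qed

lemma space_sigma [simp]: "space \<sigma> = S"
 by (simp add: surface_measure_def space_restrict_space space_hausdorff_measure)

lemma sets_sigma: "A \<in> sets \<sigma> \<longleftrightarrow> A \<in> sets borel \<and> A \<subseteq> S"
 by (auto simp: surface_measure_def sets_restrict_space_iff sets_hausdorff_measure space_hausdorff_measure)

lemma measurable_into_sigma: "f \<in> measurable M \<sigma> \<longleftrightarrow> f \<in> measurable M borel \<and> f \<in> space M \<rightarrow> S"
proof -
 have "measurable M (hausdorff_measure (CARD('n) - 1) :: (real^'n) measure) = measurable M borel"
  by (rule measurable_cong_sets) (simp_all add: sets_hausdorff_measure)
 thus ?thesis unfolding surface_measure_def
  by (subst measurable_restrict_space2_iff) (auto simp: space_hausdorff_measure)
qed

lemma id_sigma [measurable]: "(%x. x) \<in> measurable \<sigma> borel"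
 using measurable_into_sigma[of "%x. x" \<sigma>] by simp

lemma measurable_sigma_continuous:
 fixes f :: "real^'n => 'b::topological_space"
 assumes "continuous_on S f"
 shows "f \<in> measurable \<sigma> borel"
proof -
 have "measurable \<sigma> borel = (measurable (restrict_space borel S) borel :: (real^'n => 'b) set)"
  by (rule measurable_cong_sets) (simp_all add: surface_measure_def sets_restrict_space sets_hausdorff_measure)
 thus ?thesis using borel_measurable_continuous_on_restrict[OF assms] by simp
qed

lemma nu_measurable [measurable]: "\<nu> \<in> measurable \<sigma> borel"
 by (rule measurable_sigma_continuous[OF nu_cont])

lemma iota_measurable [measurable]: "\<iota> \<in> measurable \<sigma>t borel"
 unfolding normal_shift_def by measurable

lemma emeasure_sigma: "A \<in> sets \<sigma> ==> emeasure \<sigma> A = hausdorff_outer CARD('m) A"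
proof -
 assume A: "A \<in> sets \<sigma>"
 have m: "CARD('n) - 1 = CARD('m)" "1 <= CARD('m)" using card_n dim by auto
 have "emeasure \<sigma> A = emeasure (hausdorff_measure (CARD('n) - 1)) A"
  unfolding surface_measure_def using A
  by (intro emeasure_restrict_space) (auto simp: sets_sigma sets_hausdorff_measure space_hausdorff_measure)
 also have "... = hausdorff_outer CARD('m) A" using A m by (simp add: emeasure_hausdorff_measure sets_sigma)
 finally show ?thesis .
qed

lemma chart_image_sets: "i \<in> I ==> X \<in> sets borel ==> X \<subseteq> U i ==> \<phi> i ` X \<in> sets \<sigma>"
 using borel_injective_image[OF open_U phi_cont phi_inj] phi_in_S by (auto simp: sets_sigma)

lemma sigma_finite_sigma: "sigma_finite_measure \<sigma>"
proof
 define X where "X = (%(i, k). \<phi> i ` (U i \<inter> ball 0 (real k)))"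
 show "\<exists>A. countable A \<and> A \<subseteq> sets \<sigma> \<and> \<Union> A = space \<sigma> \<and> (\<forall>a\<in>A. emeasure \<sigma> a ~= \<infinity>)"
 proof (intro exI[of _ "X ` (I \<times> (UNIV :: nat set))"] conjI ballI)
  show "countable (X ` (I \<times> (UNIV :: nat set)))" using finite_I by (auto intro: countable_finite)
  have UB: "U i \<inter> ball 0 (real k) \<in> sets borel" if "i \<in> I" for i k using open_U[OF that] by (intro borel_open) auto
  have Xs: "X (i, k) \<in> sets \<sigma>" if "i \<in> I" for i k
   using chart_image_sets[OF that UB[OF that]] by (auto simp: X_def)
  thus "X ` (I \<times> UNIV) \<subseteq> sets \<sigma>" by auto
  show "\<Union> (X ` (I \<times> UNIV)) = space \<sigma>"
   unfolding space_sigma using reals_Archimedean2 by (subst S_eq) (fastforce simp: X_def)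
  obtain C where C: "C > 0" "\<forall>i\<in>I. \<forall>u\<in>U i. \<forall>v\<in>U i. norm (\<phi> i u - \<phi> i v) <= C * norm (u - v)"
   using phi_lipschitz by blast
  fix a assume "a \<in> X ` (I \<times> UNIV)"
  then obtain i and k :: nat where a: "i \<in> I" "a = X (i, k)" by auto
  have "emeasure \<sigma> a = hausdorff_outer CARD('m) (\<phi> i ` (U i \<inter> ball 0 (real k)))"
   using emeasure_sigma[OF Xs[OF a(1)]] a by (simp add: X_def)
  also have "... <= ennreal (C ^ CARD('m)) * hausdorff_outer CARD('m) (U i \<inter> ball 0 (real k))"
   using C a(1) card_n dim by (intro hausdorff_outer_lipschitz_image) (auto simp: dist_norm)
  also have "... < \<infinity>"
   using emeasure_bounded_finite[OF bounded_Int[OF disjI2[OF bounded_ball]], of "U i" 0 "real k"] hausdorff_outer_eq_lborel[OF UB[OF a(1)]] by (simp add: ennreal_mult_less_top)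
  finally show "emeasure \<sigma> a ~= \<infinity>" by simp
 qed
qed

sublocale sigma: sigma_finite_measure \<sigma>
 by (rule sigma_finite_sigma)

sublocale sigmat: pair_sigma_finite \<sigma> "lborel :: real measure"
 by (simp add: pair_sigma_finite_def sigma_finite_sigma lborel.sigma_finite_measure_axioms)

lemma chart_preimage_borel:
 fixes W :: "(real^'m) set"
 assumes W: "open W" and p: "continuous_on W p" "p ` W \<subseteq> S" and B: "B \<in> sets \<sigma>t"
 shows "{(a, t). a \<in> W \<and> (p a, t) \<in> B} \<in> sets borel"
proof -
 let ?M = "restrict_space borel (W \<times> (UNIV :: real set))"
 have WU: "W \<times> (UNIV :: real set) \<in> sets borel" using W by (intro borel_open open_Times) auto
 have "continuous_on (W \<times> UNIV) (%z. p (fst z))" by (intro continuous_on_compose2[OF p(1)] continuous_intros) auto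
 hence "(%z. p (fst z)) \<in> measurable ?M \<sigma>"
  unfolding measurable_into_sigma using p(2) borel_measurable_continuous_on_restrict by (auto simp: space_restrict_space)
 moreover have "snd \<in> measurable ?M lborel" using borel_measurable_continuous_on_restrict[OF continuous_on_snd[OF continuous_on_id]] by simp
 ultimately have "(%z. (p (fst z), snd z)) \<in> measurable ?M \<sigma>t" by (rule measurable_Pair)
 from measurable_sets[OF this B] have "(%z. (p (fst z), snd z)) -` B \<inter> (W \<times> UNIV) \<in> sets borel"
  using WU by (simp add: space_restrict_space sets_restrict_space_iff)
 moreover have "(%z. (p (fst z), snd z)) -` B \<inter> (W \<times> UNIV) = {(a, t). a \<in> W \<and> (p a, t) \<in> B}" by auto
 ultimately show ?thesis by simp
qed

text \<open>Images are needed to see that layers are Borel and that the inverse of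
  \<open>\<iota>\<close> is measurable. In each chart \<open>\<iota>\<close> is continuous and
  injective on an open set.\<close>

lemma iota_image_borel:
 assumes B: "B \<in> sets \<sigma>t" "B \<subseteq> S \<times> {-\<beta><..<\<beta>}"
 shows "\<iota> ` B \<in> sets borel"
proof -
 obtain c where c: "c > 0" "!!i u v s t. i \<in> I ==> u \<in> U i ==> v \<in> U i ==> \<bar>s\<bar> < \<beta> ==> \<bar>t\<bar> < \<beta> ==>
   c * norm (u - v, t - s) <= norm (\<iota> (\<phi> i u, t) - \<iota> (\<phi> i v, s))" using iota_lower by blast
 define B' where "B' i = {(u, t). u \<in> U i \<and> (\<phi> i u, t) \<in> B}" for i
 define F where "F i = (%(u, t). \<iota> (\<phi> i u, t))" for i
 have eq: "\<iota> ` B = (\<Union>i\<in>I. F i ` B' i)"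
 proof
  show "\<iota> ` B \<subseteq> (\<Union>i\<in>I. F i ` B' i)"
  proof (clarify)
   fix x t assume xt: "(x, t) \<in> B"
   hence "x \<in> S" using B(2) by auto
   then obtain i u where "i \<in> I" "u \<in> U i" "x = \<phi> i u" using S_eq by blast
   thus "\<iota> (x, t) \<in> (\<Union>i\<in>I. F i ` B' i)" using xt by (force simp: F_def B'_def)
  qed
 qed (auto simp: F_def B'_def)
 have "F i ` B' i \<in> sets borel" if i: "i \<in> I" for i
 proof (rule borel_injective_image[where U="U i \<times> {-\<beta><..<\<beta>}"])
  show "open (U i \<times> {-\<beta><..<\<beta>})" using open_U[OF i] by (intro open_Times) auto
  have "continuous_on (U i \<times> {-\<beta><..<\<beta>}) (%z. \<nu> (\<phi> i (fst z)))" "continuous_on (U i \<times> {-\<beta><..<\<beta>}) (%z. \<phi> i (fst z))"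
   using phi_in_S[OF i] by (auto intro!: continuous_on_compose2[OF nu_cont] continuous_on_compose2[OF phi_cont[OF i]] continuous_intros)
  thus "continuous_on (U i \<times> {-\<beta><..<\<beta>}) (F i)"
   unfolding F_def normal_shift_def case_prod_beta by (auto intro!: continuous_intros)
  show "inj_on (F i) (U i \<times> {-\<beta><..<\<beta>})"
  proof (rule inj_onI, clarify)
   fix u t v s assume a: "u \<in> U i" "v \<in> U i" "t \<in> {-\<beta><..<\<beta>}" "s \<in> {-\<beta><..<\<beta>}" "F i (u, t) = F i (v, s)"
   have "c * norm (u - v, t - s) <= 0" using c(2)[OF i a(1,2), of s t] a(3-) by (auto simp: F_def)
   hence "norm (u - v, t - s) = 0" using c(1) by (simp add: mult_le_0_iff)
   thus "u = v \<and> t = s" by (simp only: norm_eq_zero) (simp add: zero_prod_def)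
  qed
  show "B' i \<in> sets borel" unfolding B'_def using phi_in_S[OF i]
   by (intro chart_preimage_borel[OF open_U[OF i] phi_cont[OF i] _ B(1)]) auto
  show "B' i \<subseteq> U i \<times> {-\<beta><..<\<beta>}" using B(2) by (auto simp: B'_def)
 qed
 thus ?thesis unfolding eq using finite_I by (intro sets.finite_UN) auto
qed

section \<open>Surface measure times length against volume in one chart\<close>

context
 fixes W :: "(real^'m) set" and p :: "real^'m => real^'n" and e :: real and B
 assumes W: "open W" and p: "continuous_on W p" "p ` W \<subseteq> S" and e: "e <= \<beta>"
  and B: "B \<in> sets \<sigma>t" "B \<subseteq> p ` W \<times> {-e<..<e}"
begin

private definition "B' = {(a, t). a \<in> W \<and> (p a, t) \<in> B}"

private definition "F = (%(a, t). \<iota> (p a, t))"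

private lemma B': "B' \<in> sets borel" "B' \<subseteq> W \<times> {-e<..<e}" "\<iota> ` B = F ` B'"
proof -
 show "B' \<in> sets borel" unfolding B'_def by (rule chart_preimage_borel[OF W p B(1)])
 show "B' \<subseteq> W \<times> {-e<..<e}" using B(2) by (auto simp: B'_def)
 show "\<iota> ` B = F ` B'" using B(2) by (force simp: F_def B'_def image_iff)
qed

private lemma slice: "(%x. (x, t)) -` B = p ` ((%a. (a, t)) -` B')"
 using B(2) by (force simp: B'_def)

private lemma slice_sigma: "hausdorff_outer CARD('m) (p ` ((%a. (a, t)) -` B')) = emeasure \<sigma> ((%x. (x, t)) -` B)"
 by (rule trans[OF _ emeasure_sigma[OF sets_Pair2[OF B(1)], symmetric]]) (simp only: slice)

private lemma B'_slice: "hausdorff_outer CARD('m) ((%a. (a, t)) -` B') = emeasure lborel ((%a. (a, t)) -` B')"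
 and B'_pair: "B' \<in> sets (lborel \<Otimes>\<^sub>M lborel)"
proof -
 show p: "B' \<in> sets (lborel \<Otimes>\<^sub>M lborel)" using B'(1) by (simp only: lborel_prod sets_lborel)
 show "hausdorff_outer CARD('m) ((%a. (a, t)) -` B') = emeasure lborel ((%a. (a, t)) -` B')"
  using hausdorff_outer_eq_lborel[of "(%a. (a, t)) -` B'"] sets_Pair2[OF p, of t] by simp
qed

private lemma lborel_slices: "emeasure lborel B' = (\<integral>\<^sup>+t. hausdorff_outer CARD('m) ((%a. (a, t)) -` B') \<partial>lborel)"
 unfolding lborel_prod[symmetric] B'_slice by (rule lborel_pair.emeasure_pair_measure_alt2[OF B'_pair])

private lemma sigmat_slices: "emeasure \<sigma>t B = (\<integral>\<^sup>+t. hausdorff_outer CARD('m) (p ` ((%a. (a, t)) -` B')) \<partial>lborel)"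
 unfolding sigmat.emeasure_pair_measure_alt2[OF B(1)]
 by (intro nn_integral_cong) (simp only: slice_sigma)

private lemma lborel_image: "emeasure lborel (\<iota> ` B) = hausdorff_outer CARD('n) (F ` B')"
proof -
 have "B \<subseteq> S \<times> {-\<beta><..<\<beta>}" using B(2) p(2) e by force
 hence "\<iota> ` B \<in> sets borel" by (rule iota_image_borel[OF B(1)])
 thus ?thesis using hausdorff_outer_eq_lborel[of "\<iota> ` B"] by (simp add: B'(3))
qed

private lemma lborel_B': "emeasure lborel B' = hausdorff_outer CARD('n) B'"
 using hausdorff_outer_eq_lborel[OF B'(1)] card_n by simp

text \<open>The slices at fixed height are compared in dimension d - 1 through \<open>p\<close>, and
  the resulting Lebesgue measure of the parameter set in dimension d through the inverse of the
  normal coordinates. Both steps see only Lipschitz constants.\<close>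

lemma chart_upper:
 assumes k1: "0 < k1" "!!a b. a \<in> W ==> b \<in> W ==> norm (p a - p b) <= k1 * norm (a - b)"
  and k2: "0 < k2" "!!a b t s. a \<in> W ==> b \<in> W ==> \<bar>t\<bar> < e ==> \<bar>s\<bar> < e ==> norm (a - b, t - s) <= k2 * norm (\<iota> (p a, t) - \<iota> (p b, s))"
 shows "emeasure \<sigma>t B <= ennreal (k1 ^ CARD('m) * k2 ^ CARD('n)) * emeasure lborel (\<iota> ` B)"
proof -
 have "emeasure \<sigma>t B <= (\<integral>\<^sup>+t. ennreal (k1 ^ CARD('m)) * hausdorff_outer CARD('m) ((%a. (a, t)) -` B') \<partial>lborel)"
  unfolding sigmat_slices using card_n dim k1
  by (intro nn_integral_mono hausdorff_outer_lipschitz_image) (auto simp: B'_def dist_norm)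
 also have "... = ennreal (k1 ^ CARD('m)) * emeasure lborel B'"
  unfolding lborel_slices
  by (rule nn_integral_cmult) (unfold B'_slice, rule lborel_pair.measurable_emeasure_Pair2[OF B'_pair])
 also have "... <= ennreal (k1 ^ CARD('m)) * (ennreal (k2 ^ CARD('n)) * emeasure lborel (\<iota> ` B))"
 proof (rule mult_left_mono)
  show "emeasure lborel B' <= ennreal (k2 ^ CARD('n)) * emeasure lborel (\<iota> ` B)"
   unfolding lborel_image lborel_B'
  proof (rule hausdorff_outer_expanding[OF _ k2(1)])
   fix x y assume xy: "x \<in> B'" "y \<in> B'"
   obtain a t b s where "x = (a, t)" "y = (b, s)" by (cases x, cases y)
   moreover from this have "a \<in> W" "b \<in> W" "\<bar>t\<bar> < e" "\<bar>s\<bar> < e" using subsetD[OF B'(2) xy(1)] subsetD[OF B'(2) xy(2)] by auto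
   ultimately show "dist x y <= k2 * dist (F x) (F y)" using k2(2)[of a b t s] by (simp add: dist_norm F_def)
  qed (use dim in simp)
 qed simp
 finally show ?thesis using k1(1) k2(1) by (simp add: ennreal_mult mult.assoc)
qed

lemma chart_lower:
 assumes k3: "0 < k3" "!!a b. a \<in> W ==> b \<in> W ==> norm (a - b) <= k3 * norm (p a - p b)"
  and k4: "0 < k4" "!!a b t s. a \<in> W ==> b \<in> W ==> \<bar>t\<bar> < e ==> \<bar>s\<bar> < e ==> norm (\<iota> (p a, t) - \<iota> (p b, s)) <= k4 * norm (a - b, t - s)"
 shows "emeasure lborel (\<iota> ` B) <= ennreal (k3 ^ CARD('m) * k4 ^ CARD('n)) * emeasure \<sigma>t B"
proof -
 have step: "emeasure lborel (\<iota> ` B) <= ennreal (k4 ^ CARD('n)) * emeasure lborel B'"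
  unfolding lborel_image lborel_B'
 proof (rule hausdorff_outer_lipschitz_image[OF _ k4(1)])
  fix x y assume xy: "x \<in> B'" "y \<in> B'"
  obtain a t b s where "x = (a, t)" "y = (b, s)" by (cases x, cases y)
  moreover from this have "a \<in> W" "b \<in> W" "\<bar>t\<bar> < e" "\<bar>s\<bar> < e" using subsetD[OF B'(2) xy(1)] subsetD[OF B'(2) xy(2)] by auto
  ultimately show "dist (F x) (F y) <= k4 * dist x y" using k4(2)[of a b t s] by (simp add: dist_norm F_def)
 qed (use dim in simp)
 have "emeasure lborel B' <= (\<integral>\<^sup>+t. ennreal (k3 ^ CARD('m)) * hausdorff_outer CARD('m) (p ` ((%a. (a, t)) -` B')) \<partial>lborel)"
  unfolding lborel_slices using card_n dim k3
  by (intro nn_integral_mono hausdorff_outer_expanding) (auto simp: B'_def dist_norm)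
 also have "... = ennreal (k3 ^ CARD('m)) * emeasure \<sigma>t B"
  unfolding sigmat_slices
  by (rule nn_integral_cmult) (unfold slice_sigma, rule sigmat.measurable_emeasure_Pair2[OF B(1)])
 finally have le: "emeasure lborel B' <= ennreal (k3 ^ CARD('m)) * emeasure \<sigma>t B" .
 show ?thesis using order_trans[OF step mult_left_mono[OF le, of "ennreal (k4 ^ CARD('n))"]] k3(1) k4(1)
  by (simp add: ennreal_mult mult_ac)
qed

end

end

text \<open>The range of an injective linear map is isometric to the parameter space; composing this
  isometry with a left inverse of \<open>L\<close> gives the change of parameters.\<close>

lemma isometric_parametrisation:
 fixes L :: "real^'m::finite => 'b::euclidean_space"
 assumes L: "linear L" "inj L"
 shows "\<exists>T :: real^'m => real^'m. linear T \<and> bij T \<and> (\<forall>a. norm (L (T a)) = norm a)"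
proof -
 have d: "dim (UNIV :: (real^'m) set) = dim (range L)" using dim_image_eq[OF L(1), of UNIV] L(2) by simp
 obtain O' :: "real^'m => 'b" and g where O0: "linear O'" "linear g" "O' ` UNIV = range L" "g ` range L = UNIV"
   "!!x. x \<in> UNIV ==> norm (O' x) = norm x" "!!x. x \<in> range L ==> norm (g x) = norm x"
   "!!x. x \<in> UNIV ==> g (O' x) = x" "!!x. x \<in> range L ==> O' (g x) = x"
  by (rule isometries_subspaces[OF subspace_UNIV linear_subspace_image[OF L(1) subspace_UNIV] d]) (rule that, assumption+)
 note O' = O0(1,3) O0(5)[OF UNIV_I]
 obtain h where h: "linear h" "h \<circ> L = id" using linear_injective_left_inverse[OF L] by blast
 define T where "T = h \<circ> O'"
 have LT: "L (T a) = O' a" for a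
 proof -
  obtain w where w: "O' a = L w" using O'(2) by blast
  have "h (L w) = w" using h(2) by (metis comp_apply id_apply)
  thus ?thesis by (simp add: T_def w)
 qed
 have lin: "linear T" unfolding T_def by (rule linear_compose[OF O'(1) h(1)])
 have "inj T"
 proof (rule injI)
  fix a b assume "T a = T b"
  hence "L (T (a - b)) = 0" by (simp add: linear_diff[OF lin] linear_0[OF L(1)])
  hence "norm (a - b) = 0" using LT O'(3) by (metis norm_zero)
  thus "a = b" by simp
 qed
 hence "bij T" using linear_injective_imp_surjective[OF lin] by (simp add: bij_def)
 thus ?thesis using lin LT O'(3) by metis
qed

section \<open>Flat charts and the layer measure\<close>

context admissible_hypersurface
begin

text \<open>A linear change of parameters makes the differential of the chart isometric at the
  chosen point, and \<open>normal_flat_model\<close> applies near it.\<close>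

lemma flat_chart:
 assumes i: "i \<in> I" and u0: "u0 \<in> U i" and e: "0 < e"
 shows "\<exists>(W :: (real^'m) set) p G. open W \<and> continuous_on W p \<and> p ` W = S \<inter> G \<and> open G \<and> \<phi> i u0 \<in> G \<and>
   (\<forall>a\<in>W. \<forall>b\<in>W. \<bar>norm (p a - p b) - norm (a - b)\<bar> <= 2 * e / \<beta> * norm (a - b) \<and>
    (\<forall>t s. \<bar>t\<bar> < e --> \<bar>norm (\<iota> (p a, t) - \<iota> (p b, s)) - norm (a - b, t - s)\<bar> <= 2 * e / \<beta> * norm (a - b, t - s)))"
proof -
 define f where "f = \<phi> i"
 define X where "X = U i"
 have X: "open X" "u0 \<in> X" unfolding X_def using open_U[OF i] u0 by auto
 obtain f' :: "real^'m => (real^'m) \<Rightarrow>\<^sub>L (real^'n)" and f'' :: "real^'m => (real^'m) \<Rightarrow>\<^sub>L (real^'m) \<Rightarrow>\<^sub>L (real^'n)"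
  where f: "\<forall>u\<in>X. (f has_derivative blinfun_apply (f' u)) (at u)" "\<forall>u\<in>X. (f' has_derivative blinfun_apply (f'' u)) (at u)"
   "continuous_on X f''"
  using C2[OF i] unfolding C2_on_def f_def X_def by blast
 obtain c where c: "c > 0" "!!u v s t. u \<in> X ==> v \<in> X ==> \<bar>s\<bar> < \<beta> ==> \<bar>t\<bar> < \<beta> ==>
   c * norm (u - v, t - s) <= norm (\<iota> (f u, t) - \<iota> (f v, s))" using iota_lower i unfolding f_def X_def by blast
 have inS: "f u \<in> S" if "u \<in> X" for u using phi_in_S[OF i] that by (simp add: f_def X_def)
 define L where "L = blinfun_apply (f' u0)"
 have linL: "linear L" unfolding L_def by (rule bounded_linear.linear[OF blinfun.bounded_linear_right])
 have "L = frechet_derivative (\<phi> i) (at u0)" unfolding L_def f_def[symmetric] using f(1) X(2) by (intro frechet_derivative_at) blast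
 moreover have "(*v) (matrix L) = L" using linL by (intro ext) simp
 ultimately have "inj L" using full_rank[OF i u0] full_rank_injective[of "matrix L"] by simp
 then obtain T :: "real^'m => real^'m" where T: "linear T" "bij T" "!!a. norm (L (T a)) = norm a" using isometric_parametrisation[OF linL] by blast
 define Tb where "Tb = Blinfun T"
 have Tb: "blinfun_apply Tb = T" unfolding Tb_def by (rule bounded_linear_Blinfun_apply) (rule linear_conv_bounded_linear[THEN iffD1, OF T(1)])
 define Y where "Y = T -` X"
 have contT: "continuous_on A T" for A using T(1) by (simp add: linear_continuous_on linear_conv_bounded_linear)
 obtain a0 where a0: "T a0 = u0" using T(2) by (metis bij_pointE)
 have Y: "open Y" "a0 \<in> Y" unfolding Y_def using open_vimage[OF X(1) contT] X(2) a0 by auto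
 have Tc: "blinfun_apply (A o\<^sub>L Tb) = (%a. A (T a))" for A :: "(real^'m) \<Rightarrow>\<^sub>L 'c::real_normed_vector" by (simp add: fun_eq_iff Tb)
 define R where "R = Blinfun (%A :: (real^'m) \<Rightarrow>\<^sub>L (real^'n). A o\<^sub>L Tb)"
 have R: "blinfun_apply R A = A o\<^sub>L Tb" for A unfolding R_def
  by (simp add: bounded_linear_Blinfun_apply bounded_bilinear.bounded_linear_left[OF bounded_bilinear_blinfun_compose])
 define p where "p = f \<circ> T"
 define p' where "p' a = f' (T a) o\<^sub>L Tb" for a
 define p'' where "p'' a = (R o\<^sub>L f'' (T a)) o\<^sub>L Tb" for a
 define n where "n a = \<nu> (p a)" for a
 have dT: "(T has_derivative T) (at a)" for a using T(1) by (simp add: bounded_linear_imp_has_derivative linear_conv_bounded_linear)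
 have dp: "(p has_derivative blinfun_apply (p' a)) (at a)" if "a \<in> Y" for a
  using has_derivative_compose[OF dT bspec[OF f(1)], of a] that by (simp add: p_def p'_def Y_def comp_def Tc)
 have dp': "(p' has_derivative blinfun_apply (p'' a)) (at a)" if "a \<in> Y" for a
  using bounded_linear.has_derivative[OF blinfun.bounded_linear_right[of R] has_derivative_compose[OF dT bspec[OF f(2)], of a]] that
  by (simp add: p'_def[abs_def] p''_def Y_def Tc R)
 have cp': "isCont p' a0" by (rule has_derivative_continuous[OF dp'[OF Y(2)]])
 have "isCont (%a. f'' (T a)) a0"
  using isCont_o2[OF has_derivative_continuous[OF dT], of a0 f''] f(3) X by (simp add: continuous_on_eq_continuous_at a0)
 hence cp'': "isCont p'' a0" unfolding p''_def[abs_def] by (intro continuous_intros)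
 have sB: "\<exists>r>0. ball a0 r \<subseteq> Y \<and> (\<forall>u\<in>ball a0 r. \<forall>v\<in>ball a0 r. norm (p' u - p' v - p'' a0 (u - v)) <= d * norm (u - v))" if d: "0 < d" for d
  by (rule C1_strict_derivative[OF Y dp' cp'' d])
 have pS: "p a \<in> S" if "a \<in> Y" for a using inS that by (simp add: p_def Y_def)
 have contp: "continuous_on A p" if "A \<subseteq> Y" for A
  using dp that by (intro continuous_at_imp_continuous_on) (meson has_derivative_continuous subsetD)
 have n1: "norm (n a) = 1" if "a \<in> Y" for a unfolding n_def using nu_norm pS[OF that] by simp
 have n2: "n a \<bullet> p' a w = 0" if a: "a \<in> Y" for a w
 proof -
  have Ta: "T a \<in> U i" using a by (simp add: Y_def X_def)
  have "f' (T a) v \<in> tangent_space (\<phi> i) (T a)" for v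
  proof -
   have "frechet_derivative (\<phi> i) (at (T a)) = blinfun_apply (f' (T a))"
    using f(1) Ta unfolding f_def X_def by (metis frechet_derivative_at)
   hence pd: "pD j (\<phi> i) (T a) = f' (T a) (axis j 1)" for j by (simp add: partial_deriv_def)
   have "v = (\<Sum>j\<in>UNIV. (v $ j) *\<^sub>R axis j 1)" using basis_expansion[of v] by (simp add: scalar_mult_eq_scaleR)
   hence "f' (T a) v = (\<Sum>j\<in>UNIV. (v $ j) *\<^sub>R f' (T a) (axis j 1))"
    by (metis (no_types, lifting) blinfun.scaleR_right blinfun.sum_right sum.cong)
   also have "... \<in> tangent_space (\<phi> i) (T a)" unfolding tangent_space_def
    by (intro span_sum span_scale) (auto simp: pd[symmetric] intro: span_base)
   finally show ?thesis .
  qed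
  thus ?thesis using nu_tangent[OF i Ta] by (simp add: n_def p_def f_def p'_def Tb)
 qed
 have cn: "isCont n a0"
 proof -
  have "continuous_on Y n" unfolding n_def[abs_def]
   by (rule continuous_on_compose2[OF nu_cont contp]) (use pS in auto)
  thus ?thesis using Y by (simp add: continuous_on_eq_continuous_at)
 qed
 have iso: "norm (p' a0 w) = norm w" for w using T(3)[of w] by (simp add: p'_def Tb a0 L_def)
 have DIM: "DIM(real^'n) = DIM(real^'m) + 1" using card_n by simp
 define k where "k = norm (f' u0) + 1"
 have k: "0 < k" by (simp add: k_def add_nonneg_pos)
 have low: "c / k * norm (a - b) <= norm (p a + t *\<^sub>R n a - (p b + t *\<^sub>R n b))" if "a \<in> Y" "b \<in> Y" "\<bar>t\<bar> < \<beta>" for a b t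
 proof -
  have "norm (a - b) = norm (f' u0 (T (a - b)))" using T(3) by (simp add: L_def)
  also have "... <= norm (f' u0) * norm (T (a - b))" by (rule norm_blinfun)
  also have "... <= k * norm (T a - T b)" by (simp add: k_def linear_diff[OF T(1)] mult_right_mono)
  finally have "c / k * norm (a - b) <= c * norm (T a - T b)" using c(1) k by (simp add: field_simps)
  also have "... <= norm (\<iota> (f (T a), t) - \<iota> (f (T b), t))" using c(2)[of "T a" "T b" t t] that by (simp add: Y_def norm_Pair)
  finally show ?thesis by (simp add: normal_shift_def p_def n_def)
 qed
 have "\<exists>r>0. ball a0 r \<subseteq> Y \<and> (\<forall>u\<in>ball a0 r. \<forall>v\<in>ball a0 r.
   \<bar>norm (p u - p v) - norm (u - v)\<bar> <= 2 * e / \<beta> * norm (u - v) \<and>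
   (\<forall>t t'. \<bar>t\<bar> < e --> \<bar>norm (p u + t *\<^sub>R n u - (p v + t' *\<^sub>R n v)) - norm (u - v, t - t')\<bar> <= 2 * e / \<beta> * norm (u - v, t - t')))"
  by (rule normal_flat_model[OF Y dp cp' sB n1 n2 cn iso DIM divide_pos_pos[OF c(1) k] low beta e]) assumption+
 then obtain r where r: "r > 0" "ball a0 r \<subseteq> Y" "\<forall>u\<in>ball a0 r. \<forall>v\<in>ball a0 r.
   \<bar>norm (p u - p v) - norm (u - v)\<bar> <= 2 * e / \<beta> * norm (u - v) \<and>
   (\<forall>t t'. \<bar>t\<bar> < e --> \<bar>norm (p u + t *\<^sub>R n u - (p v + t' *\<^sub>R n v)) - norm (u - v, t - t')\<bar> <= 2 * e / \<beta> * norm (u - v, t - t'))"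
  by (elim exE conjE) (rule that; assumption)
 define W where "W = ball a0 r"
 have TW: "T ` W \<subseteq> X" using r(2) by (auto simp: W_def Y_def)
 have "open (T ` W)" unfolding W_def by (rule open_surjective_linear_image[OF open_ball T(1) bij_is_surj[OF T(2)]])
 hence op: "openin (top_of_set X) (T ` W)" using TW by (intro open_subset)
 obtain g where g: "homeomorphism X (V' i \<inter> S) f g" using homeo[OF i] by (auto simp: f_def X_def)
 \<comment> \<open>Charts are homeomorphisms onto relatively open pieces of the surface, so the
   image of a small ball is cut out of \<open>S\<close> by an open set.\<close>
 have "openin (top_of_set (V' i \<inter> S)) (f ` (T ` W))" by (rule homeomorphism_imp_open_map[OF g op])
 then obtain G where G: "open G" "f ` (T ` W) = (V' i \<inter> S) \<inter> G" unfolding openin_open by blast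
 have pW: "p ` W = S \<inter> (V' i \<inter> G)" using G(2) by (auto simp: p_def image_comp)
 moreover have "p a0 \<in> p ` W" using r(1) by (simp add: W_def)
 hence "\<phi> i u0 \<in> V' i \<inter> G" unfolding pW by (simp add: p_def a0 f_def)
 moreover have "open (V' i \<inter> G)" using G(1) open_V[OF i] by auto
 moreover have "open W" "continuous_on W p" using contp r(2) by (auto simp: W_def)
 moreover have "\<forall>a\<in>W. \<forall>b\<in>W. \<bar>norm (p a - p b) - norm (a - b)\<bar> <= 2 * e / \<beta> * norm (a - b) \<and>
    (\<forall>t s. \<bar>t\<bar> < e --> \<bar>norm (\<iota> (p a, t) - \<iota> (p b, s)) - norm (a - b, t - s)\<bar> <= 2 * e / \<beta> * norm (a - b, t - s))"
  using r(3) unfolding W_def normal_shift_def n_def by simp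
 ultimately show ?thesis by blast
qed

text \<open>Surface measure times length, carried to the ambient space by the normal coordinates:
  the volume of the layer with the Jacobian left out.\<close>

definition "layer_measure e = distr (restrict_space \<sigma>t (S \<times> {-e<..<e})) borel \<iota>"

lemma strip_sets [measurable]: "S \<times> {-e<..<e} \<in> sets \<sigma>t"
 using sets.top[of \<sigma>] by (intro pair_measureI) auto

lemma sets_layer_measure [simp, measurable_cong]: "sets (layer_measure e) = sets borel"
 and space_layer_measure [simp]: "space (layer_measure e) = UNIV"
 by (simp_all add: layer_measure_def)

lemma iota_vimage_sets: "D \<in> sets borel ==> \<iota> -` D \<inter> S \<times> {-e<..<e} \<in> sets \<sigma>t"
proof -
 assume "D \<in> sets borel"
 hence "\<iota> -` D \<inter> space \<sigma>t \<in> sets \<sigma>t" by (rule measurable_sets[OF iota_measurable])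
 hence "(\<iota> -` D \<inter> space \<sigma>t) \<inter> S \<times> {-e<..<e} \<in> sets \<sigma>t" by (rule sets.Int[OF _ strip_sets])
 moreover have "(\<iota> -` D \<inter> space \<sigma>t) \<inter> S \<times> {-e<..<e} = \<iota> -` D \<inter> S \<times> {-e<..<e}" by (auto simp: space_pair_measure)
 ultimately show ?thesis by simp
qed

lemma nn_integral_layer_measure:
 assumes f: "f \<in> borel_measurable borel"
 shows "(\<integral>\<^sup>+x. f x \<partial>layer_measure e) = (\<integral>\<^sup>+x. \<integral>\<^sup>+t. f (x + t *\<^sub>R \<nu> x) * indicator {-e<..<e} t \<partial>lborel \<partial>\<sigma>)"
proof -
 have [measurable]: "\<iota> \<in> measurable (restrict_space \<sigma>t (S \<times> {-e<..<e})) borel" by (rule measurable_restrict_space1[OF iota_measurable])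
 have m: "(%z. f (\<iota> z) * indicator (S \<times> {-e<..<e}) z) \<in> borel_measurable \<sigma>t"
  using measurable_compose[OF iota_measurable f] by measurable
 have "(\<integral>\<^sup>+x. f x \<partial>layer_measure e) = (\<integral>\<^sup>+z. f (\<iota> z) \<partial>restrict_space \<sigma>t (S \<times> {-e<..<e}))"
  unfolding layer_measure_def using f by (subst nn_integral_distr) auto
 also have "... = (\<integral>\<^sup>+z. f (\<iota> z) * indicator (S \<times> {-e<..<e}) z \<partial>\<sigma>t)"
  using strip_sets by (subst nn_integral_restrict_space) (auto intro: sets.Int)
 also have "... = (\<integral>\<^sup>+x. \<integral>\<^sup>+t. f (\<iota> (x, t)) * indicator (S \<times> {-e<..<e}) (x, t) \<partial>lborel \<partial>\<sigma>)"
  using lborel.nn_integral_fst[OF m] by simp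
 also have "... = (\<integral>\<^sup>+x. \<integral>\<^sup>+t. f (x + t *\<^sub>R \<nu> x) * indicator {-e<..<e} t \<partial>lborel \<partial>\<sigma>)"
  by (intro nn_integral_cong) (auto simp: normal_shift_def indicator_def)
 finally show ?thesis .
qed

lemma emeasure_layer_measure:
 assumes D: "D \<in> sets borel"
 shows "emeasure (layer_measure e) D = emeasure \<sigma>t (\<iota> -` D \<inter> S \<times> {-e<..<e})"
proof -
 have m: "\<iota> \<in> measurable (restrict_space \<sigma>t (S \<times> {-e<..<e})) borel" by (rule measurable_restrict_space1[OF iota_measurable])
 have sub: "S \<times> {-e<..<e} \<subseteq> space \<sigma>t" by (auto simp: space_pair_measure)
 have "emeasure (layer_measure e) D = emeasure (restrict_space \<sigma>t (S \<times> {-e<..<e})) (\<iota> -` D \<inter> S \<times> {-e<..<e})"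
  unfolding layer_measure_def emeasure_distr[OF m D] using sub by (simp add: space_restrict_space Int_absorb2)
 also have "... = emeasure \<sigma>t (\<iota> -` D \<inter> S \<times> {-e<..<e})"
  using strip_sets sub by (subst emeasure_restrict_space) (auto simp: Int_absorb2)
 finally show ?thesis .
qed

lemma layer_borel: "e <= \<beta> ==> layer S \<nu> e \<in> sets borel"
 unfolding layer_def by (rule iota_image_borel[OF strip_sets]) auto

lemma layer_vimage:
 assumes e: "e <= \<beta>" and D: "D \<in> sets borel" "D \<subseteq> \<iota> ` ((S \<inter> G) \<times> {-e<..<e})"
 shows "\<exists>B\<in>sets \<sigma>t. B \<subseteq> (S \<inter> G) \<times> {-e<..<e} \<and> \<iota> ` B = D \<and> emeasure (layer_measure e) D = emeasure \<sigma>t B"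
proof (intro bexI conjI subsetI)
 let ?B = "\<iota> -` D \<inter> S \<times> {-e<..<e}"
 show "emeasure (layer_measure e) D = emeasure \<sigma>t ?B" by (rule emeasure_layer_measure[OF D(1)])
 show "?B \<in> sets \<sigma>t" by (rule iota_vimage_sets[OF D(1)])
 show "\<iota> ` ?B = D" using D(2) by blast
 fix z assume z: "z \<in> ?B"
 then obtain z' where z': "z' \<in> (S \<inter> G) \<times> {-e<..<e}" "\<iota> z = \<iota> z'" using D(2) by auto
 hence "z = z'" using z e by (intro inj_onD[OF iota_inj]) auto
 thus "z \<in> (S \<inter> G) \<times> {-e<..<e}" using z'(1) by simp
qed

text \<open>By Lindelof countably many of the neighbourhoods suffice; made disjoint, they let the
  local inequality be summed without loss in the constant.\<close>

lemma local_layer_le: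
 assumes e: "e <= \<beta>" and MN: "sets M = sets borel" "sets N = sets borel"
  and loc: "!!x. x \<in> S ==> \<exists>G. open G \<and> x \<in> G \<and> (\<forall>D\<in>sets borel. D \<subseteq> \<iota> ` ((S \<inter> G) \<times> {-e<..<e}) --> emeasure M D <= K * emeasure N D)"
  and D: "D \<in> sets borel" "D \<subseteq> layer S \<nu> e"
 shows "emeasure M D <= K * emeasure N D"
proof -
 define R where "R G \<longleftrightarrow> open G \<and> (\<forall>D\<in>sets borel. D \<subseteq> \<iota> ` ((S \<inter> G) \<times> {-e<..<e}) --> emeasure M D <= K * emeasure N D)" for G
 obtain F where F: "F \<subseteq> Collect R" "countable F" "\<Union>F = \<Union>(Collect R)" using Lindelof[of "Collect R"] by (auto simp: R_def)
 define G where "G = from_nat_into (insert {} F)"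
 have rG: "range G = insert {} F" unfolding G_def using F(2) by (intro range_from_nat_into) auto
 have "R {}" by (simp add: R_def)
 hence R: "R (G k)" for k using F(1) rG by (metis insert_iff mem_Collect_eq rangeI subsetD)
 have SG: "x \<in> (\<Union>k. G k)" if x: "x \<in> S" for x
 proof -
  obtain H where "H \<in> Collect R" "x \<in> H" using loc[OF x] unfolding R_def by blast
  thus ?thesis using F(3) unfolding rG by blast
 qed
 have Xs: "\<iota> ` ((S \<inter> G k) \<times> {-e<..<e}) \<in> sets borel" for k
 proof (rule iota_image_borel)
  have "S \<inter> G k \<in> sets \<sigma>" using R[of k] by (auto simp: R_def sets_sigma borel_open)
  thus "(S \<inter> G k) \<times> {-e<..<e} \<in> sets \<sigma>t" by (intro pair_measureI) auto
 qed (use e in auto)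
 show ?thesis
 proof (rule emeasure_le_of_countable_cover[where X="%k. \<iota> ` ((S \<inter> G k) \<times> {-e<..<e})"])
  show "D \<subseteq> (\<Union>k. \<iota> ` ((S \<inter> G k) \<times> {-e<..<e}))"
  proof
   fix y assume "y \<in> D"
   then obtain x t where "x \<in> S" "t \<in> {-e<..<e}" "y = \<iota> (x, t)" using D(2) unfolding layer_def by blast
   moreover obtain k where "x \<in> G k" using SG[OF \<open>x \<in> S\<close>] by blast
   ultimately show "y \<in> (\<Union>k. \<iota> ` ((S \<inter> G k) \<times> {-e<..<e}))" by blast
  qed
  show "emeasure M D' <= K * emeasure N D'" if "D' \<in> sets M" "D' \<subseteq> \<iota> ` ((S \<inter> G k) \<times> {-e<..<e})" for D' k
   using R[of k] that MN(1) unfolding R_def by simp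
 qed (use Xs MN D in auto)
qed

lemma layer_measure_le_lborel:
 assumes e: "e <= \<beta>"
  and loc: "!!x. x \<in> S ==> \<exists>G. open G \<and> x \<in> G \<and>
   (\<forall>D\<in>sets borel. D \<subseteq> \<iota> ` ((S \<inter> G) \<times> {-e<..<e}) --> emeasure (layer_measure e) D <= K * emeasure lborel D)"
  and D: "D \<in> sets borel"
 shows "emeasure (layer_measure e) D <= K * emeasure lborel D"
proof -
 let ?D = "D \<inter> layer S \<nu> e"
 have D': "?D \<in> sets borel" using D layer_borel[OF e] by (simp add: sets.Int)
 have "\<iota> -` D \<inter> S \<times> {-e<..<e} = \<iota> -` ?D \<inter> S \<times> {-e<..<e}" by (auto simp: layer_def)
 hence "emeasure (layer_measure e) D = emeasure (layer_measure e) ?D" using D D' by (simp add: emeasure_layer_measure)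
 also have "... <= K * emeasure lborel ?D" by (rule local_layer_le[OF e _ _ loc D']) auto
 also have "... <= K * emeasure lborel D" using D by (intro mult_left_mono emeasure_mono) auto
 finally show ?thesis .
qed

text \<open>The global Lipschitz bounds of the given charts, uniform over the finite family, already
  compare the two measures up to a fixed factor.\<close>

lemma layer_measure_bounded: "\<exists>K>0. \<forall>D\<in>sets borel. emeasure (layer_measure \<beta>) D <= ennreal K * emeasure lborel D"
proof -
 obtain C where C: "C > 0" "\<forall>i\<in>I. \<forall>u\<in>U i. \<forall>v\<in>U i. norm (\<phi> i u - \<phi> i v) <= C * norm (u - v)" using phi_lipschitz by blast
 obtain c where c: "c > 0" "\<forall>i\<in>I. \<forall>u\<in>U i. \<forall>v\<in>U i. \<forall>s t. \<bar>s\<bar> < \<beta> --> \<bar>t\<bar> < \<beta> -->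
  c * norm (u - v, t - s) <= norm (\<iota> (\<phi> i u, t) - \<iota> (\<phi> i v, s))" using iota_lower by blast
 define K where "K = C ^ CARD('m) * (1 / c) ^ CARD('n)"
 have "emeasure (layer_measure \<beta>) D <= ennreal K * emeasure lborel D" if "D \<in> sets borel" for D
 proof (rule layer_measure_le_lborel[OF order_refl _ that])
  fix x assume "x \<in> S"
  then obtain i where i: "i \<in> I" "x \<in> V' i" using S_cover by blast
  have c': "norm (u - v, t - s) <= 1 / c * norm (\<iota> (\<phi> i u, t) - \<iota> (\<phi> i v, s))" if "u \<in> U i" "v \<in> U i" "\<bar>t\<bar> < \<beta>" "\<bar>s\<bar> < \<beta>" for u v t s
  proof -
   have "c * norm (u - v, t - s) <= norm (\<iota> (\<phi> i u, t) - \<iota> (\<phi> i v, s))" using c(2) i that by blast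
   thus ?thesis using c(1) by (simp add: field_simps)
  qed
  have "emeasure \<sigma>t B <= ennreal K * emeasure lborel (\<iota> ` B)" if "B \<in> sets \<sigma>t" "B \<subseteq> (S \<inter> V' i) \<times> {- \<beta><..<\<beta>}" for B
   unfolding K_def by (rule chart_upper[OF open_U[OF i(1)] phi_cont[OF i(1)] _ order_refl that(1)])
    (use that C c c' i phi_in_S phi_image[OF i(1)] in \<open>auto simp: Int_commute\<close>)
  thus "\<exists>G. open G \<and> x \<in> G \<and> (\<forall>D\<in>sets borel. D \<subseteq> \<iota> ` ((S \<inter> G) \<times> {-\<beta><..<\<beta>}) --> emeasure (layer_measure \<beta>) D <= ennreal K * emeasure lborel D)"
   using layer_vimage[OF order_refl] by (intro exI[of _ "V' i"] conjI ballI impI open_V i) metis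
 qed
 moreover have "0 < K" unfolding K_def using C c by simp
 ultimately show ?thesis by blast
qed

text \<open>Flat charts distort distances by a factor 1 + O(e), with constants independent of the
  base point, and measures by its power m + n. Smallness of the charts does no harm, since the local
  inequality globalises with the same constant.\<close>

lemma layer_measure_almost_lborel:
 "\<exists>C>0. \<forall>e. 0 < e --> e <= \<beta> / 4 --> (\<forall>D\<in>sets borel.
   emeasure (layer_measure e) D <= ennreal (1 + C * e) * emeasure lborel D \<and>
   (D \<subseteq> layer S \<nu> e --> emeasure lborel D <= ennreal (1 + C * e) * emeasure (layer_measure e) D))"
proof -
 define N where "N = CARD('m) + CARD('n)"
 define C where "C = 2 ^ N * (4 / \<beta>)"
 have "0 < C" using beta by (simp add: C_def)
 moreover have "emeasure (layer_measure e) D <= ennreal (1 + C * e) * emeasure lborel D \<and>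
   (D \<subseteq> layer S \<nu> e --> emeasure lborel D <= ennreal (1 + C * e) * emeasure (layer_measure e) D)"
  if e: "0 < e" "e <= \<beta> / 4" and D: "D \<in> sets borel" for e D
 proof -
  define q where "q = 2 * e / \<beta>"
  have q: "0 < q" "q <= 1 / 2" using e beta by (auto simp: q_def field_simps)
  define k where "k = 1 + 2 * q"
  have k: "0 < k" "1 + q <= k" using q by (auto simp: k_def)
  have kN: "k ^ CARD('m) * k ^ CARD('n) <= 1 + C * e"
  proof -
   have "k ^ CARD('m) * k ^ CARD('n) = k ^ N" by (simp add: N_def power_add)
   also have "... <= 1 + (2 ^ N - 1) * (2 * q)" unfolding k_def using q by (intro one_plus_power_le) auto
   also have "... <= 1 + 2 ^ N * (2 * q)" using q by simp
   also have "... = 1 + C * e" by (simp add: C_def q_def)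
   finally show ?thesis .
  qed
  \<comment> \<open>For q <= 1/2 one has 1 <= (1 + 2 q) (1 - q), so the single constant
    \<open>k\<close> serves both directions; e <= \<beta> / 4 is what gives q <= 1/2.\<close>
  have inv: "y <= k * z" and dir: "z <= k * y" if "\<bar>z - y\<bar> <= q * y" "0 <= y" for y z
  proof -
   have z: "(1 - q) * y <= z" "z <= (1 + q) * y" using that(1) by (simp_all add: algebra_simps abs_le_iff)
   thus "z <= k * y" using mult_right_mono[OF k(2) that(2)] by linarith
   have "0 <= q * (1 - 2 * q)" using q by simp
   hence "1 * y <= (k * (1 - q)) * y" by (intro mult_right_mono that) (simp add: k_def algebra_simps)
   moreover have "(k * (1 - q)) * y <= k * z" using mult_left_mono[OF z(1) less_imp_le[OF k(1)]] by (simp only: mult.assoc)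
   ultimately show "y <= k * z" by simp
  qed
  have eb: "e <= \<beta>" using e beta by simp
  have loc: "\<exists>G. open G \<and> x \<in> G \<and> (\<forall>D\<in>sets borel. D \<subseteq> \<iota> ` ((S \<inter> G) \<times> {-e<..<e}) -->
    emeasure (layer_measure e) D <= ennreal (1 + C * e) * emeasure lborel D \<and>
    emeasure lborel D <= ennreal (1 + C * e) * emeasure (layer_measure e) D)" if x: "x \<in> S" for x
  proof -
   obtain i u0 where i: "i \<in> I" "u0 \<in> U i" "x = \<phi> i u0" using x S_eq by blast
   obtain W :: "(real^'m) set" and p G where W: "open W" "continuous_on W p" "p ` W = S \<inter> G" "open G" "\<phi> i u0 \<in> G"
    and fl0: "\<forall>a\<in>W. \<forall>b\<in>W. \<bar>norm (p a - p b) - norm (a - b)\<bar> <= q * norm (a - b) \<and>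
     (\<forall>t s. \<bar>t\<bar> < e --> \<bar>norm (\<iota> (p a, t) - \<iota> (p b, s)) - norm (a - b, t - s)\<bar> <= q * norm (a - b, t - s))"
    using flat_chart[OF i(1,2) e(1)] unfolding q_def[symmetric] by (elim exE conjE) (rule that; assumption)
   have fl: "\<bar>norm (p a - p b) - norm (a - b)\<bar> <= q * norm (a - b)" if "a \<in> W" "b \<in> W" for a b
    using bspec[OF bspec[OF fl0 that(1)] that(2)] by (rule conjunct1)
   have fl': "\<bar>norm (\<iota> (p a, t) - \<iota> (p b, s)) - norm (a - b, t - s)\<bar> <= q * norm (a - b, t - s)" if "a \<in> W" "b \<in> W" "\<bar>t\<bar> < e" for a b t s
    using conjunct2[OF bspec[OF bspec[OF fl0 that(1)] that(2)]] that(3) by simp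
   have cmp: "norm (p a - p b) <= k * norm (a - b)" "norm (a - b) <= k * norm (p a - p b)" if "a \<in> W" "b \<in> W" for a b
    using dir[OF fl[OF that] norm_ge_zero] inv[OF fl[OF that] norm_ge_zero] by blast+
   have cmp': "norm (\<iota> (p a, t) - \<iota> (p b, s)) <= k * norm (a - b, t - s)" "norm (a - b, t - s) <= k * norm (\<iota> (p a, t) - \<iota> (p b, s))"
    if "a \<in> W" "b \<in> W" "\<bar>t\<bar> < e" for a b t s
    using dir[OF fl'[OF that] norm_ge_zero] inv[OF fl'[OF that] norm_ge_zero] by blast+
   show ?thesis
   proof (intro exI[of _ G] conjI ballI impI)
    fix D assume "D \<in> sets borel" "D \<subseteq> \<iota> ` ((S \<inter> G) \<times> {-e<..<e})"
    from layer_vimage[OF eb this] obtain B where B: "B \<in> sets \<sigma>t" "B \<subseteq> (S \<inter> G) \<times> {-e<..<e}"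
     and BD: "\<iota> ` B = D" "emeasure (layer_measure e) D = emeasure \<sigma>t B" by blast
    have pW: "p ` W \<subseteq> S" "B \<subseteq> p ` W \<times> {-e<..<e}" using W(3) B(2) by auto
    have "emeasure \<sigma>t B <= ennreal (k ^ CARD('m) * k ^ CARD('n)) * emeasure lborel (\<iota> ` B)"
     by (rule chart_upper[OF W(1,2) pW(1) eb B(1) pW(2)]) (intro k(1) cmp cmp'; assumption)+
    thus "emeasure (layer_measure e) D <= ennreal (1 + C * e) * emeasure lborel D"
     unfolding BD by (rule order_trans) (intro mult_right_mono ennreal_leI kN, simp)
    have "emeasure lborel (\<iota> ` B) <= ennreal (k ^ CARD('m) * k ^ CARD('n)) * emeasure \<sigma>t B"
     by (rule chart_lower[OF W(1,2) pW(1) eb B(1) pW(2)]) (intro k(1) cmp cmp'; assumption)+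
    thus "emeasure lborel D <= ennreal (1 + C * e) * emeasure (layer_measure e) D"
     unfolding BD by (rule order_trans) (intro mult_right_mono ennreal_leI kN, simp)
   qed (use W i in auto)
  qed
  show ?thesis
  proof (intro conjI impI)
   show "emeasure (layer_measure e) D <= ennreal (1 + C * e) * emeasure lborel D"
    by (rule layer_measure_le_lborel[OF eb _ D]) (use loc in meson)
   show "emeasure lborel D <= ennreal (1 + C * e) * emeasure (layer_measure e) D" if "D \<subseteq> layer S \<nu> e"
    by (rule local_layer_le[OF eb _ _ _ D that]) (simp, simp, use loc in meson)
  qed
 qed
 ultimately show ?thesis by blast
qed

end

section \<open>Test functions along normal lines\<close>

lemma nn_integral_open_interval:
 fixes F :: "real => real"
 assumes F: "continuous_on UNIV F" "!!t. 0 <= F t"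
 shows "(\<integral>\<^sup>+t. ennreal (F t) * indicator {a<..<b} t \<partial>lborel) = ennreal (integral {a..b} F)"
 using nn_integral_has_integral_lebesgue[of "{a<..<b}" F, OF F(2)] integrable_continuous_interval[OF continuous_on_subset[OF F(1)], of a b]
 by (simp add: has_integral_Icc_iff_Ioo[symmetric] has_integral_integral ennreal_mult' ennreal_indicator F(2) mult.commute)

lemma norm_diff_le_integral:
 fixes g :: "real => 'b::euclidean_space"
 assumes d: "!!t. (g has_vector_derivative g' t) (at t)" and F: "continuous_on UNIV F" "!!t. norm (g' t) <= F t"
  and st: "s \<in> {a..b}" "t \<in> {a..b}"
 shows "norm (g t - g s) <= integral {a..b} F"
proof -
 have le: "norm (g t - g s) <= integral {a..b} F" if "s \<in> {a..b}" "t \<in> {a..b}" "s <= t" for s t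
 proof -
  have gi: "(g' has_integral g t - g s) {s..t}"
   by (rule fundamental_theorem_of_calculus[OF that(3)]) (rule has_vector_derivative_at_within[OF d])
  have Fi: "F integrable_on {c..d}" for c d by (intro integrable_continuous_interval continuous_on_subset[OF F(1)]) auto
  have "norm (g t - g s) <= integral {s..t} F"
   using integral_norm_bound_integral[of g' "{s..t}" F] gi Fi F(2) by (auto simp: integrable_on_def integral_unique)
  also have "... <= integral {a..b} F"
   using that order_trans[OF norm_ge_zero F(2)] by (intro integral_subset_le Fi) auto
  finally show ?thesis .
 qed
 show ?thesis using le[of s t] le[of t s] st by (cases "s <= t") (auto simp: norm_minus_commute)
qed

text \<open>The square of |g| varies by at most the integral of 2 |g| |g'|, so its value at
  \<open>t\<close> exceeds its mean over the interval by no more than this.\<close>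

lemma line_sup_bound:
 fixes g :: "real => complex"
 assumes d: "!!t. (g has_vector_derivative g' t) (at t)" and c: "continuous_on UNIV g'" and b: "0 < b" and t: "\<bar>t\<bar> < b"
 shows "(cmod (g t))^2 <= integral {-b..b} (%s. (cmod (g s))^2) / (2 * b) + integral {-b..b} (%s. 2 * (cmod (g s) * cmod (g' s)))"
proof -
 have cg: "continuous_on UNIV g"
  using d by (intro continuous_at_imp_continuous_on) (auto dest: has_vector_derivative_continuous)
 define h where "h s = (cmod (g s))^2" for s
 define D where "D = integral {-b..b} (%s. 2 * (cmod (g s) * cmod (g' s)))"
 have dh: "(h has_vector_derivative 2 * (g s \<bullet> g' s)) (at s)" for s
  unfolding h_def[abs_def] power2_norm_eq_inner
  using bounded_bilinear.has_vector_derivative[OF bounded_bilinear_inner d[of s] d[of s]] by (simp add: inner_commute)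
 have le: "h t - D <= h s" if "s \<in> {-b..b}" for s
 proof -
  have "norm (h t - h s) <= D"
   unfolding D_def
  proof (rule norm_diff_le_integral[OF dh])
   show "continuous_on UNIV (%s. 2 * (cmod (g s) * cmod (g' s)))" by (intro continuous_intros cg c)
   show "norm (2 * (g s \<bullet> g' s)) <= 2 * (cmod (g s) * cmod (g' s))" for s
    using Cauchy_Schwarz_ineq2[of "g s" "g' s"] by simp
  qed (use that t in auto)
  thus ?thesis by simp
 qed
 have "integral {-b..b} (%_. h t - D) <= integral {-b..b} h"
 proof (rule integral_le)
  show "h integrable_on {-b..b}"
   unfolding h_def[abs_def] by (intro integrable_continuous_interval continuous_intros continuous_on_subset[OF cg]) auto
 qed (use le in auto)
 hence "2 * b * (h t - D) <= integral {-b..b} h" using b by simp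
 hence "h t - D <= integral {-b..b} h / (2 * b)" using b by (simp add: field_simps)
 thus ?thesis unfolding h_def[abs_def] D_def by simp
qed

text \<open>Cauchy-Schwarz for the integral of g' over an interval of length |t| < e, obtained from
  the weighted Young inequality at every weight.\<close>

lemma line_difference_bound:
 fixes g :: "real => complex"
 assumes d: "!!t. (g has_vector_derivative g' t) (at t)" and c: "continuous_on UNIV g'" and t: "\<bar>t\<bar> < e"
 shows "(cmod (g t - g 0))^2 <= e * integral {-e..e} (%s. (cmod (g' s))^2)"
proof -
 define P where "P = integral {-e..e} (%s. (cmod (g' s))^2)"
 have ci: "(%s. (cmod (g' s))^2) integrable_on {a..b}" for a b
  by (intro integrable_continuous_interval continuous_intros continuous_on_subset[OF c]) auto
 have P0: "0 <= P" unfolding P_def by (rule integral_nonneg[OF ci]) simp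
 have "cmod (g t - g 0) <= sqrt \<bar>t\<bar> * sqrt P"
 proof (rule real_le_sqrt_mult)
  fix r :: real assume r: "0 < r"
  define a b where "a = min t 0" and "b = max t 0"
  have ab: "a <= b" "b - a = \<bar>t\<bar>" "-e <= a" "b <= e" using t by (auto simp: a_def b_def)
  define F where "F s = r / 2 + (cmod (g' s))^2 / (2 * r)" for s
  have "norm (g t - g 0) <= integral {a..b} F"
  proof (rule norm_diff_le_integral[OF d])
   show "continuous_on UNIV F" unfolding F_def using r by (intro continuous_intros c) auto
   show "norm (g' s) <= F s" for s
   proof -
    have "0 <= (r - cmod (g' s))^2 / (2 * r)" using r by simp
    also have "... = F s - cmod (g' s)" unfolding F_def using r by (simp add: power2_eq_square field_simps)
    finally show ?thesis by simp
   qed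
  qed (auto simp: a_def b_def)
  also have "integral {a..b} F = r / 2 * \<bar>t\<bar> + integral {a..b} (%s. (cmod (g' s))^2) / (2 * r)"
   unfolding F_def using ab ci by (subst Henstock_Kurzweil_Integration.integral_add) (auto intro!: integrable_on_divide simp: mult.commute)
  also have "... <= r / 2 * \<bar>t\<bar> + P / (2 * r)"
  proof -
   have "integral {a..b} (%s. (cmod (g' s))^2) <= P" unfolding P_def by (rule integral_subset_le) (use ab ci in auto)
   thus ?thesis using r by (simp add: divide_right_mono)
  qed
  finally show "2 * cmod (g t - g 0) <= r * (sqrt \<bar>t\<bar>)^2 + (sqrt P)^2 / r" using P0 r by simp
 qed (use P0 in auto)
 hence "(cmod (g t - g 0))^2 <= (sqrt \<bar>t\<bar> * sqrt P)^2" by (intro power_mono) auto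
 also have "... = \<bar>t\<bar> * P" using P0 by (simp add: power_mult_distrib)
 also have "... <= e * P" using t P0 by (intro mult_right_mono) auto
 finally show ?thesis by (simp add: P_def)
qed

definition grad_norm :: "(real^'n::finite => complex) => real^'n => real" where
 "grad_norm \<phi> x = sqrt (\<Sum>j\<in>UNIV. (cmod (pD j \<phi> x))^2)"

lemma grad_norm_sq: "(grad_norm \<phi> x)^2 = (\<Sum>j\<in>UNIV. (cmod (pD j \<phi> x))^2)"
 by (simp add: grad_norm_def sum_nonneg)

lemma grad_norm_nonneg [simp]: "0 <= grad_norm \<phi> x"
 by (simp add: grad_norm_def sum_nonneg)

definition line_deriv :: "(real^'n::finite => complex) => real^'n => real^'n => real => complex" where
 "line_deriv \<phi> x v t = (\<Sum>j\<in>UNIV. v $ j *\<^sub>R pD j \<phi> (x + t *\<^sub>R v))"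

lemma test_line_derivative:
 fixes \<phi> :: "real^'n::finite => complex" and x v :: "real^'n"
 assumes t: "test_function \<phi>" and v: "norm v = 1"
 defines "g' \<equiv> line_deriv \<phi> x v"
 shows "((%t. \<phi> (x + t *\<^sub>R v)) has_vector_derivative g' t) (at t)" "continuous_on UNIV g'"
  "cmod (g' t) <= grad_norm \<phi> (x + t *\<^sub>R v)"
proof -
 have dl: "((%t. x + t *\<^sub>R v) has_derivative (%h. h *\<^sub>R v)) (at t)" by (auto intro!: derivative_eq_intros)
 have "((%t. \<phi> (x + t *\<^sub>R v)) has_derivative (%h. \<Sum>j\<in>UNIV. (h *\<^sub>R v) $ j *\<^sub>R pD j \<phi> (x + t *\<^sub>R v))) (at t)"
  by (rule has_derivative_compose[OF dl has_derivative_partial_deriv[OF test_differentiable[OF t]]])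
 moreover have "(%h. \<Sum>j\<in>UNIV. (h *\<^sub>R v) $ j *\<^sub>R pD j \<phi> (x + t *\<^sub>R v)) = (%h. h *\<^sub>R g' t)"
  by (simp add: g'_def line_deriv_def scaleR_sum_right)
 ultimately show "((%t. \<phi> (x + t *\<^sub>R v)) has_vector_derivative g' t) (at t)" by (simp add: has_vector_derivative_def)
 have cp: "continuous_on UNIV (pD j \<phi>)" for j
  by (intro smooth_continuous test_smooth test_partial_deriv t)
 show "continuous_on UNIV g'" unfolding g'_def line_deriv_def
  by (intro continuous_intros continuous_on_compose2[OF cp]) auto
 have "cmod (g' t) <= (\<Sum>j\<in>UNIV. \<bar>v $ j\<bar> * \<bar>cmod (pD j \<phi> (x + t *\<^sub>R v))\<bar>)"
  unfolding g'_def line_deriv_def by (rule sum_norm_le) simp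
 also have "... <= L2_set (%j. v $ j) UNIV * L2_set (%j. cmod (pD j \<phi> (x + t *\<^sub>R v))) UNIV"
  by (rule L2_set_mult_ineq)
 also have "L2_set (%j. v $ j) UNIV = 1" using v by (simp add: norm_vec_def L2_set_def)
 finally show "cmod (g' t) <= grad_norm \<phi> (x + t *\<^sub>R v)" by (simp add: grad_norm_def L2_set_def)
qed

lemma grad_norm_continuous: "test_function \<phi> ==> continuous_on A (grad_norm \<phi>)"
 unfolding grad_norm_def by (intro continuous_intros smooth_continuous test_smooth test_partial_deriv)

lemma norm_l2_test: "test_function \<phi> ==> norm (abs_l2 \<phi>) = sq_norm lborel \<phi>"
 by (intro norm_abs_l2_lborel test_square_integrable)

lemma sq_norm_grad_norm:
 assumes t: "test_function \<phi>"
 shows "square_integrable lborel (%x. complex_of_real (grad_norm \<phi> x))"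
  "(sq_norm lborel (%x. complex_of_real (grad_norm \<phi> x)))^2 = (\<Sum>j\<in>UNIV. (norm (abs_l2 (pD j \<phi>)))^2)"
proof -
 note tp = test_partial_deriv[OF t]
 have i: "integrable lborel (%x. (cmod (pD j \<phi> x))^2)" for j
  using test_square_integrable(1)[OF tp] by (simp add: square_integrable_def)
 have "(%x. complex_of_real (grad_norm \<phi> x)) \<in> borel_measurable lborel"
  using grad_norm_continuous[OF t, of UNIV] by (auto intro!: borel_measurable_continuous_onI continuous_intros)
 thus "square_integrable lborel (%x. complex_of_real (grad_norm \<phi> x))"
  using i by (simp add: square_integrable_def grad_norm_sq)
 show "(sq_norm lborel (%x. complex_of_real (grad_norm \<phi> x)))^2 = (\<Sum>j\<in>UNIV. (norm (abs_l2 (pD j \<phi>)))^2)"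
  using i by (simp add: sq_norm_sq grad_norm_sq norm_l2_test[OF tp])
qed

section \<open>Trace and difference bounds for test functions\<close>

context admissible_hypersurface
begin

lemma layer_measure_mono: "e <= \<beta> ==> D \<in> sets borel ==> emeasure (layer_measure e) D <= emeasure (layer_measure \<beta>) D"
 by (auto simp: emeasure_layer_measure intro!: emeasure_mono iota_vimage_sets)

definition "K\<beta> = (SOME K. 0 < K \<and> (\<forall>D\<in>sets borel. emeasure (layer_measure \<beta>) D <= ennreal K * emeasure lborel D))"

lemma K\<beta>: "0 < K\<beta>" "D \<in> sets borel ==> emeasure (layer_measure \<beta>) D <= ennreal K\<beta> * emeasure lborel D"
 using someI_ex[OF layer_measure_bounded, folded K\<beta>_def] by auto

lemma nn_integral_layer_measure_le:
 assumes e: "e <= \<beta>" and h: "h \<in> borel_measurable borel"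
 shows "(\<integral>\<^sup>+x. h x \<partial>layer_measure e) <= ennreal K\<beta> * (\<integral>\<^sup>+x. h x \<partial>lborel)"
proof -
 have "(\<integral>\<^sup>+x. h x \<partial>layer_measure e) <= (\<integral>\<^sup>+x. h x \<partial>scale_measure (ennreal K\<beta>) lborel)"
 proof (rule nn_integral_mono_measure)
  show "layer_measure e <= scale_measure (ennreal K\<beta>) lborel"
   by (subst le_measure) (auto intro: order_trans[OF layer_measure_mono[OF e] K\<beta>(2)])
 qed simp
 also have "... = ennreal K\<beta> * (\<integral>\<^sup>+x. h x \<partial>lborel)" using h by (intro nn_integral_scale_measure) simp
 finally show ?thesis .
qed

text \<open>\<open>line_sup_bound\<close> on every normal segment bounds the value at height
  \<open>t\<close> by an integral over the layer; passing to Lebesgue measure costs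
  \<open>K\<beta>\<close>, and Cauchy-Schwarz leaves the product of the L2 and H1 norms. The bound
  is uniform over all parallel surfaces, not only the one at height 0.\<close>

lemma trace_test:
 "\<exists>C>0. \<forall>\<psi> t. test_function \<psi> --> \<bar>t\<bar> < \<beta> -->
   (\<integral>\<^sup>+x. ennreal ((cmod (\<psi> (x + t *\<^sub>R \<nu> x)))^2) \<partial>\<sigma>) <= ennreal (C * (norm (abs_l2 \<psi>) * sqrt (h1_sq (abs_l2 \<psi>))))"
proof -
 define C where "C = K\<beta> * (1 / (2 * \<beta>) + 2)"
 have C: "0 < C" using K\<beta>(1) beta by (simp add: C_def add_pos_pos)
 have "(\<integral>\<^sup>+x. ennreal ((cmod (\<psi> (x + t *\<^sub>R \<nu> x)))^2) \<partial>\<sigma>) <= ennreal (C * (norm (abs_l2 \<psi>) * sqrt (h1_sq (abs_l2 \<psi>))))"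
  if t: "test_function \<psi>" "\<bar>t\<bar> < \<beta>" for \<psi> t
 proof -
  let ?N = "norm (abs_l2 \<psi>) * sqrt (h1_sq (abs_l2 \<psi>))"
  define G where "G y = (cmod (\<psi> y))^2 / (2 * \<beta>) + 2 * (cmod (\<psi> y) * grad_norm \<psi> y)" for y
  have G0: "0 <= G y" for y using beta by (simp add: G_def)
  have cG: "continuous_on UNIV G" unfolding G_def using beta
   by (intro continuous_intros grad_norm_continuous smooth_continuous test_smooth t) auto
  have pt: "ennreal ((cmod (\<psi> (x + t *\<^sub>R \<nu> x)))^2) <= (\<integral>\<^sup>+s. ennreal (G (x + s *\<^sub>R \<nu> x)) * indicator {-\<beta><..<\<beta>} s \<partial>lborel)" if x: "x \<in> S" for x
  proof -
   define g' where "g' = line_deriv \<psi> x (\<nu> x)"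
   note g = test_line_derivative[OF t(1) nu_norm[OF x], of x, folded g'_def]
   have ci: "F integrable_on {-\<beta>..\<beta>}" if "continuous_on UNIV F" for F :: "real => real"
    by (intro integrable_continuous_interval continuous_on_subset[OF that]) auto
   have cphi: "continuous_on UNIV (%s. \<psi> (x + s *\<^sub>R \<nu> x))"
    by (intro continuous_on_compose2[OF smooth_continuous[OF test_smooth[OF t(1)], of UNIV]] continuous_intros) auto
   have cGx: "continuous_on UNIV (%s. G (x + s *\<^sub>R \<nu> x))" by (intro continuous_on_compose2[OF cG] continuous_intros) auto
   have "(cmod (\<psi> (x + t *\<^sub>R \<nu> x)))^2 <= integral {-\<beta>..\<beta>} (%s. (cmod (\<psi> (x + s *\<^sub>R \<nu> x)))^2) / (2 * \<beta>)
     + integral {-\<beta>..\<beta>} (%s. 2 * (cmod (\<psi> (x + s *\<^sub>R \<nu> x)) * cmod (g' s)))"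
    by (rule line_sup_bound[OF g(1,2) beta t(2)])
   also have "... = integral {-\<beta>..\<beta>} (%s. (cmod (\<psi> (x + s *\<^sub>R \<nu> x)))^2 / (2 * \<beta>) + 2 * (cmod (\<psi> (x + s *\<^sub>R \<nu> x)) * cmod (g' s)))"
    using beta by (subst Henstock_Kurzweil_Integration.integral_add) (auto intro!: ci continuous_intros cphi g)
   also have "... <= integral {-\<beta>..\<beta>} (%s. G (x + s *\<^sub>R \<nu> x))"
   proof (rule integral_le)
    show "(%s. (cmod (\<psi> (x + s *\<^sub>R \<nu> x)))^2 / (2 * \<beta>) + 2 * (cmod (\<psi> (x + s *\<^sub>R \<nu> x)) * cmod (g' s))) integrable_on {-\<beta>..\<beta>}"
     using beta by (intro ci continuous_intros cphi g) auto
    show "(cmod (\<psi> (x + s *\<^sub>R \<nu> x)))^2 / (2 * \<beta>) + 2 * (cmod (\<psi> (x + s *\<^sub>R \<nu> x)) * cmod (g' s)) <= G (x + s *\<^sub>R \<nu> x)" for s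
     unfolding G_def using g(3)[of s] by (simp add: mult_left_mono)
   qed (rule ci[OF cGx])
   finally show ?thesis unfolding nn_integral_open_interval[OF cGx G0] by (rule ennreal_leI)
  qed
  have mG: "(%y. ennreal (G y)) \<in> borel_measurable borel" using borel_measurable_continuous_onI[OF cG] by simp
  have "(\<integral>\<^sup>+x. ennreal ((cmod (\<psi> (x + t *\<^sub>R \<nu> x)))^2) \<partial>\<sigma>)
    <= (\<integral>\<^sup>+x. \<integral>\<^sup>+s. ennreal (G (x + s *\<^sub>R \<nu> x)) * indicator {-\<beta><..<\<beta>} s \<partial>lborel \<partial>\<sigma>)"
   by (rule nn_integral_mono) (use pt in simp)
  also have "... = (\<integral>\<^sup>+y. ennreal (G y) \<partial>layer_measure \<beta>)" by (rule nn_integral_layer_measure[OF mG, symmetric])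
  also have "... <= ennreal K\<beta> * (\<integral>\<^sup>+y. ennreal (G y) \<partial>lborel)" by (rule nn_integral_layer_measure_le[OF order_refl mG])
  also have "(\<integral>\<^sup>+y. ennreal (G y) \<partial>lborel) <= ennreal ((1 / (2 * \<beta>) + 2) * ?N)"
  proof -
   note sq = test_square_integrable(1)[OF t(1)] sq_norm_grad_norm(1)[OF t(1)]
   note w = sq_norm_weighted_bound[OF sq, of "%_. 1" 1]
   have i1: "integrable lborel (%y. (cmod (\<psi> y))^2)" using sq by (simp add: square_integrable_def)
   have i2: "integrable lborel (%y. cmod (\<psi> y) * grad_norm \<psi> y)" using w(2) by simp
   have n1: "norm (abs_l2 \<psi>) <= sqrt (h1_sq (abs_l2 \<psi>))" using norm_le_h1[of "abs_l2 \<psi>"] by (rule real_le_rsqrt)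
   have n2: "sq_norm lborel (%x. complex_of_real (grad_norm \<psi> x)) <= sqrt (h1_sq (abs_l2 \<psi>))"
    by (rule real_le_rsqrt) (simp add: sq_norm_grad_norm(2)[OF t(1)] h1_sq_def weak_partial_test[OF t(1)])
   have gn: "(\<integral>\<^sup>+y. ennreal (G y) \<partial>lborel) = ennreal (LINT y|lborel. G y)"
    by (rule nn_integral_eq_integral) (use i1 i2 G0 in \<open>auto simp: G_def[abs_def]\<close>)
   have "(LINT y|lborel. G y) = (sq_norm lborel \<psi>)^2 / (2 * \<beta>) + 2 * (LINT y|lborel. cmod (\<psi> y) * grad_norm \<psi> y)"
    unfolding G_def[abs_def] sq_norm_sq using i1 i2 by simp
   also have "... <= ?N / (2 * \<beta>) + 2 * ?N"
   proof (intro add_mono divide_right_mono mult_left_mono)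
    show "(sq_norm lborel \<psi>)^2 <= ?N"
     using n1 by (simp add: power2_eq_square norm_l2_test[OF t(1), symmetric] mult_left_mono)
    have "(LINT y|lborel. cmod (\<psi> y) * grad_norm \<psi> y) <= sq_norm lborel \<psi> * sq_norm lborel (%x. complex_of_real (grad_norm \<psi> x))"
     using w(3) by simp
    also have "... <= ?N"
     using n2 by (simp add: norm_l2_test[OF t(1), symmetric] mult_left_mono)
    finally show "(LINT y|lborel. cmod (\<psi> y) * grad_norm \<psi> y) <= ?N" .
   qed (use beta in auto)
   finally have "(LINT y|lborel. G y) <= (1 / (2 * \<beta>) + 2) * ?N"
    by (simp add: distrib_right)
   thus ?thesis unfolding gn by (rule ennreal_leI)
  qed
  finally show ?thesis using K\<beta>(1) unfolding C_def by (simp add: ennreal_mult' mult.assoc mult_left_mono)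
 qed
 thus ?thesis using C by blast
qed

text \<open>One factor e comes from \<open>line_difference_bound\<close>, the other factor 2 e from
  the length of the interval of integration.\<close>

lemma difference_test:
 assumes t: "test_function \<psi>" and e: "0 < e"
 shows "(\<integral>\<^sup>+x. \<integral>\<^sup>+s. ennreal ((cmod (\<psi> (x + s *\<^sub>R \<nu> x) - \<psi> x))^2) * indicator {-e<..<e} s \<partial>lborel \<partial>\<sigma>)
   <= ennreal (2 * e^2) * (\<integral>\<^sup>+y. ennreal ((grad_norm \<psi> y)^2) \<partial>layer_measure e)"
proof -
 have cg: "continuous_on UNIV (%y. (grad_norm \<psi> y)^2)" by (intro continuous_intros grad_norm_continuous t)
 have mg: "(%y. ennreal ((grad_norm \<psi> y)^2)) \<in> borel_measurable borel" using borel_measurable_continuous_onI[OF cg] by simp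
 define R where "R x = (\<integral>\<^sup>+s. ennreal ((grad_norm \<psi> (x + s *\<^sub>R \<nu> x))^2) * indicator {-e<..<e} s \<partial>lborel)" for x
 have pt: "(\<integral>\<^sup>+s. ennreal ((cmod (\<psi> (x + s *\<^sub>R \<nu> x) - \<psi> x))^2) * indicator {-e<..<e} s \<partial>lborel) <= ennreal (2 * e^2) * R x" if x: "x \<in> S" for x
 proof -
  define g' where "g' = line_deriv \<psi> x (\<nu> x)"
  note g = test_line_derivative[OF t nu_norm[OF x], of x, folded g'_def]
  have cgx0: "continuous_on UNIV (%s. grad_norm \<psi> (x + s *\<^sub>R \<nu> x))"
   by (intro continuous_on_compose2[OF grad_norm_continuous[OF t, of UNIV]] continuous_intros) auto
  have cgx: "continuous_on UNIV (%s. (grad_norm \<psi> (x + s *\<^sub>R \<nu> x))^2)" by (intro continuous_intros cgx0)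
  define P where "P = integral {-e..e} (%s. (grad_norm \<psi> (x + s *\<^sub>R \<nu> x))^2)"
  have le: "(cmod (\<psi> (x + s *\<^sub>R \<nu> x) - \<psi> x))^2 <= e * P" if "\<bar>s\<bar> < e" for s
  proof -
   have "(cmod (\<psi> (x + s *\<^sub>R \<nu> x) - \<psi> (x + 0 *\<^sub>R \<nu> x)))^2 <= e * integral {-e..e} (%s. (cmod (g' s))^2)"
    by (rule line_difference_bound[OF g(1,2) that])
   also have "... <= e * P"
    unfolding P_def using e g(2,3) cgx
    by (intro mult_left_mono integral_le integrable_continuous_interval continuous_intros power_mono) (auto intro: continuous_on_subset[OF cgx0] continuous_on_subset[OF g(2)])
   finally show ?thesis by simp
  qed
  have "(\<integral>\<^sup>+s. ennreal ((cmod (\<psi> (x + s *\<^sub>R \<nu> x) - \<psi> x))^2) * indicator {-e<..<e} s \<partial>lborel)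
    <= (\<integral>\<^sup>+s. ennreal (e * P) * indicator {-e<..<e} s \<partial>lborel)"
   by (rule nn_integral_mono) (auto simp: indicator_def intro!: ennreal_leI le)
  also have "... = ennreal (e * P) * ennreal (2 * e)"
   using e by (subst nn_integral_cmult_indicator) auto
  also have "... = ennreal (2 * e^2) * ennreal P"
   using e by (simp add: ennreal_mult'[symmetric] ennreal_mult''[symmetric] power2_eq_square mult_ac)
  also have "ennreal P = R x" unfolding R_def P_def by (rule nn_integral_open_interval[OF cgx, symmetric]) simp
  finally show ?thesis .
 qed
 have "(\<integral>\<^sup>+x. \<integral>\<^sup>+s. ennreal ((cmod (\<psi> (x + s *\<^sub>R \<nu> x) - \<psi> x))^2) * indicator {-e<..<e} s \<partial>lborel \<partial>\<sigma>)
   <= (\<integral>\<^sup>+x. ennreal (2 * e^2) * R x \<partial>\<sigma>)"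
  by (rule nn_integral_mono) (use pt in simp)
 also have "... = ennreal (2 * e^2) * (\<integral>\<^sup>+x. R x \<partial>\<sigma>)"
 proof (rule nn_integral_cmult)
  have "(%z. ennreal ((grad_norm \<psi> (\<iota> z))^2) * indicator {-e<..<e} (snd z)) \<in> borel_measurable \<sigma>t"
   using measurable_compose[OF iota_measurable mg] by measurable
  hence "(%z. ennreal ((grad_norm \<psi> (fst z + snd z *\<^sub>R \<nu> (fst z)))^2) * indicator {-e<..<e} (snd z)) \<in> borel_measurable \<sigma>t"
   by (simp add: normal_shift_def case_prod_beta)
  from lborel.borel_measurable_nn_integral_fst[OF this] show "R \<in> borel_measurable \<sigma>" by (simp add: R_def[abs_def])
 qed
 also have "(\<integral>\<^sup>+x. R x \<partial>\<sigma>) = (\<integral>\<^sup>+y. ennreal ((grad_norm \<psi> y)^2) \<partial>layer_measure e)"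
  unfolding R_def by (rule nn_integral_layer_measure[OF mg, symmetric])
 finally show ?thesis .
qed

end

section \<open>Approximation in H1 and Borel representatives\<close>

lemma h1_sq_diff_le:
 assumes "f \<in> H1" "g \<in> H1"
 shows "h1_sq (f - g) <= 2 * h1_sq f + 2 * h1_sq g"
proof -
 have n: "(norm (x - y))^2 <= 2 * (norm x)^2 + 2 * (norm y)^2" for x y :: "(real^'n) l2"
 proof -
  have "(norm (x - y))^2 <= (norm x + norm y)^2" by (intro power_mono norm_triangle_ineq4) auto
  also have "... <= 2 * (norm x)^2 + 2 * (norm y)^2" using sum_squares_bound[of "norm x" "norm y"] by (simp add: power2_sum)
  finally show ?thesis .
 qed
 show ?thesis using n[of f g] sum_mono[OF n, of "%j. wD j f" "%j. wD j g" UNIV]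
  by (simp add: h1_sq_def weak_partial_diff[OF assms] sum.distrib sum_distrib_left[symmetric])
qed

lemma abs_l2_test_diff: "test_function f ==> test_function g ==> abs_l2 (%x. f x - g x) = abs_l2 f - abs_l2 g"
 by (simp add: minus_l2_abs test_square_integrable)

definition h1_approx :: "(nat => real^'n::finite => complex) => (real^'n) l2 => bool" where
 "h1_approx \<psi> f \<longleftrightarrow> (\<forall>k. test_function (\<psi> k)) \<and> (%k. abs_l2 (\<psi> k)) ----> f \<and>
   (\<forall>j. (%k. abs_l2 (pD j (\<psi> k))) ----> wD j f)"

lemma h1_approx_ex: "f \<in> H1 ==> \<exists>\<psi>. h1_approx \<psi> f"
 unfolding h1_approx_def using test_functions_dense_H1[of f "%j. wD j f"] has_weak_partial_weak_partial by blast

lemma h1_approx_test: "h1_approx \<psi> f ==> test_function (\<psi> k)"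
 by (simp add: h1_approx_def)

lemma h1_approx_h1_sq: "h1_approx \<psi> f ==> (%k. h1_sq (abs_l2 (\<psi> k))) ----> h1_sq f"
 unfolding h1_sq_def by (simp add: h1_approx_def weak_partial_test) (intro tendsto_intros; simp)

lemma h1_approx_bound: "h1_approx \<psi> f ==> (%k. norm (abs_l2 (\<psi> k)) * sqrt (h1_sq (abs_l2 (\<psi> k)))) ----> norm f * sqrt (h1_sq f)"
 by (intro tendsto_intros h1_approx_h1_sq) (simp_all add: h1_approx_def)

lemma h1_approx_diff:
 assumes a: "h1_approx \<psi> f" and f: "f \<in> H1"
 shows "(%k. h1_sq (abs_l2 (\<psi> k) - f)) ----> 0"
proof -
 have t: "test_function (\<psi> k)" for k using h1_approx_test[OF a] .
 have "(%k. (norm (abs_l2 (\<psi> k) - f))^2 + (\<Sum>j\<in>UNIV. (norm (abs_l2 (pD j (\<psi> k)) - wD j f))^2)) ----> 0^2 + (\<Sum>j\<in>(UNIV::'a set). 0^2)"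
  by (intro tendsto_intros tendsto_norm_zero[OF LIM_zero]) (use a in \<open>simp_all add: h1_approx_def\<close>)
 thus ?thesis unfolding h1_sq_def weak_partial_diff[OF test_sobolev_1[OF t] f] weak_partial_test[OF t] by simp
qed

lemma h1_approx_add:
 assumes "h1_approx \<psi> f" "h1_approx \<xi> g" "f \<in> H1" "g \<in> H1"
 shows "h1_approx (%k x. \<psi> k x + \<xi> k x) (f + g)"
proof -
 have t: "test_function (\<psi> k)" "test_function (\<xi> k)" for k using assms by (auto simp: h1_approx_def)
 have ab: "abs_l2 (%x. \<psi> k x + \<xi> k x) = abs_l2 (\<psi> k) + abs_l2 (\<xi> k)" for k
  using plus_l2_abs[OF test_square_integrable(2)[OF t(1)] test_square_integrable(2)[OF t(2)]] by simp
 have pd: "abs_l2 (pD j (%x. \<psi> k x + \<xi> k x)) = abs_l2 (pD j (\<psi> k)) + abs_l2 (pD j (\<xi> k))" for j k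
  using weak_partial_test[OF test_add[OF t(1)[of k] t(2)[of k]], of j] weak_partial_add[OF test_sobolev_1[OF t(1)[of k]] test_sobolev_1[OF t(2)[of k]], of j]
  by (simp add: ab weak_partial_test t)
 show ?thesis using assms unfolding h1_approx_def ab pd weak_partial_add[OF assms(3,4)]
  by (auto intro: test_add tendsto_add)
qed

lemma h1_approx_scale:
 assumes "h1_approx \<psi> f" "f \<in> H1"
 shows "h1_approx (%k x. c * \<psi> k x) (scaleC_l2 c f)"
proof -
 have t: "test_function (\<psi> k)" for k using assms by (auto simp: h1_approx_def)
 have ab: "abs_l2 (%x. c * \<psi> k x) = scaleC_l2 c (abs_l2 (\<psi> k))" for k
  using scaleC_l2_abs[OF test_square_integrable(2)[OF t]] by simp
 have pd: "abs_l2 (pD j (%x. c * \<psi> k x)) = scaleC_l2 c (abs_l2 (pD j (\<psi> k)))" for j k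
  using weak_partial_test[OF test_cmult[OF t[of k], of c], of j] weak_partial_scaleC[OF test_sobolev_1[OF t[of k]], of j c]
  by (simp add: ab weak_partial_test t)
 have sc: "(%k. scaleC_l2 c (X k)) ----> scaleC_l2 c x" if "X ----> x" for X and x :: "(real^'a) l2"
 using bounded_linear.tendsto[OF bounded_linear_scaleC that] .
 show ?thesis using assms unfolding h1_approx_def ab pd weak_partial_scaleC[OF assms(2)]
  by (auto intro: test_cmult sc)
qed

text \<open>A representative fixed once for all: composing with normal coordinates demands a Borel
  function, and the same one at every scale.\<close>

definition brep :: "'a::euclidean_space l2 => 'a => complex" where
 "brep f = (SOME f0. f0 \<in> borel_measurable borel \<and> (AE x in lebesgue. rep_l2 f x = f0 x) \<and> square_integrable lborel f0)"

lemma brep: "brep f \<in> borel_measurable borel" "AE x in lebesgue. rep_l2 f x = brep f x" "square_integrable lborel (brep f)"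
proof -
 from someI_ex[of "%f0. f0 \<in> borel_measurable borel \<and> (AE x in lebesgue. rep_l2 f x = f0 x) \<and> square_integrable lborel f0"]
 show "brep f \<in> borel_measurable borel" "AE x in lebesgue. rep_l2 f x = brep f x" "square_integrable lborel (brep f)"
  using l2_borel_rep[of f] unfolding brep_def by metis+
qed

lemma AE_lborel_lebesgue: "(AE x in lebesgue. P x) \<longleftrightarrow> (AE x in lborel. P x)"
 by (rule AE_completion_iff)

lemma brep_test: "test_function \<psi> ==> AE x in lborel. brep (abs_l2 \<psi>) x = \<psi> x"
 using rep_abs_l2[of \<psi>] brep(2)[of "abs_l2 \<psi>"] test_square_integrable[of \<psi>] unfolding AE_lborel_lebesgue
 by (auto elim: eventually_elim2)

lemma brep_dist: "(\<integral>\<^sup>+x. ennreal ((cmod (brep f x - brep g x))^2) \<partial>lborel) = ennreal ((norm (f - g))^2)"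
proof -
 have "(\<integral>\<^sup>+x. ennreal ((cmod (brep f x - brep g x))^2) \<partial>lborel) = (\<integral>\<^sup>+x. ennreal ((cmod (brep f x - brep g x))^2) \<partial>lebesgue)"
  by (simp add: nn_integral_completion)
 also have "... = (\<integral>\<^sup>+x. ennreal ((cmod (rep_l2 f x - rep_l2 g x))^2) \<partial>lebesgue)"
  by (rule nn_integral_cong_AE) (use brep(2)[of f] brep(2)[of g] in eventually_elim, simp)
 finally show ?thesis by (simp only: nn_integral_l2_diff)
qed

context admissible_hypersurface
begin

text \<open>The interval is imposed as a density and not as a subspace, so that the product with the
  surface has the same measurable sets as \<open>\<sigma>t\<close>.\<close>

definition Lb :: "real measure" where "Lb = density lborel (indicator {-\<beta><..<\<beta>})"

abbreviation "Ms \<equiv> surface_measure S \<Otimes>\<^sub>M Lb"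

lemma sets_Lb [simp, measurable_cong]: "sets Lb = sets borel" and space_Lb [simp]: "space Lb = UNIV"
 by (simp_all add: Lb_def)

lemma nn_integral_Lb: "f \<in> borel_measurable borel ==> (\<integral>\<^sup>+s. f s \<partial>Lb) = (\<integral>\<^sup>+s. f s * indicator {-\<beta><..<\<beta>} s \<partial>lborel)"
 unfolding Lb_def by (subst nn_integral_density) (auto simp: mult.commute)

lemma emeasure_Lb: "emeasure Lb UNIV = ennreal (2 * \<beta>)"
 using nn_integral_Lb[of "%_. 1"] beta by simp

lemma AE_Lb: "AE s in Lb. \<bar>s\<bar> < \<beta>"
 unfolding Lb_def by (subst AE_density) (auto simp: indicator_def)

sublocale Lb: finite_measure Lb
 by standard (simp add: emeasure_Lb)

sublocale sigmaL: pair_sigma_finite \<sigma> Lb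
 by (simp add: pair_sigma_finite_def sigma_finite_sigma Lb.sigma_finite_measure_axioms)

lemma Ms_sets: "sets Ms = sets \<sigma>t"
 by (rule sets_pair_measure_cong) simp_all

lemma space_Ms: "space Ms = S \<times> UNIV"
 by (simp add: space_pair_measure)

lemma nn_integral_Ms_scale:
 assumes H: "H \<in> borel_measurable \<sigma>t" and e: "0 < e"
 shows "(\<integral>\<^sup>+z. H (fst z, e / \<beta> * snd z) \<partial>Ms) = ennreal (\<beta> / e) * (\<integral>\<^sup>+x. \<integral>\<^sup>+t. H (x, t) * indicator {-e<..<e} t \<partial>lborel \<partial>\<sigma>)"
proof -
 have sc: "(%z. (fst z, e / \<beta> * snd z)) \<in> measurable Ms \<sigma>t" by measurable
 have [measurable]: "H \<in> borel_measurable \<sigma>t" by (rule H)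
 define G where "G x = (\<integral>\<^sup>+t. H (x, t) * indicator {-e<..<e} t \<partial>lborel)" for x
 have Gm: "G \<in> borel_measurable \<sigma>"
  using lborel.borel_measurable_nn_integral_fst[of "%z. H z * indicator {-e<..<e} (snd z)" \<sigma>] unfolding G_def by simp
 have "(\<integral>\<^sup>+z. H (fst z, e / \<beta> * snd z) \<partial>Ms) = (\<integral>\<^sup>+x. \<integral>\<^sup>+s. H (x, e / \<beta> * s) \<partial>Lb \<partial>\<sigma>)"
  using Lb.nn_integral_fst[OF measurable_compose[OF sc H]] by simp
 also have "... = (\<integral>\<^sup>+x. ennreal (\<beta> / e) * G x \<partial>\<sigma>)"
 proof (rule nn_integral_cong)
  fix x assume x: "x \<in> space \<sigma>"
  have Hx: "(%t. H (x, t)) \<in> borel_measurable borel" using measurable_Pair2[OF H x] by simp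
  have "G x = ennreal \<bar>e / \<beta>\<bar> * (\<integral>\<^sup>+s. H (x, 0 + e / \<beta> * s) * indicator {-e<..<e} (0 + e / \<beta> * s) \<partial>lborel)"
   unfolding G_def using Hx e beta by (intro nn_integral_real_affine) auto
  also have "(\<integral>\<^sup>+s. H (x, 0 + e / \<beta> * s) * indicator {-e<..<e} (0 + e / \<beta> * s) \<partial>lborel)
    = (\<integral>\<^sup>+s. H (x, e / \<beta> * s) * indicator {-\<beta><..<\<beta>} s \<partial>lborel)"
  proof (rule nn_integral_cong)
   fix s :: real
   have "(- e < e / \<beta> * s \<and> e / \<beta> * s < e) \<longleftrightarrow> (- \<beta> < s \<and> s < \<beta>)"
    using mult_less_cancel_left_pos[of "e / \<beta>" s \<beta>] mult_less_cancel_left_pos[of "e / \<beta>" "- \<beta>" s] e beta by simp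
   thus "H (x, 0 + e / \<beta> * s) * indicator {-e<..<e} (0 + e / \<beta> * s) = H (x, e / \<beta> * s) * indicator {-\<beta><..<\<beta>} s"
    by (auto simp: indicator_def)
  qed
  also have "... = (\<integral>\<^sup>+s. H (x, e / \<beta> * s) \<partial>Lb)"
   by (rule nn_integral_Lb[symmetric]) (use measurable_compose[OF _ Hx, of "%s. e / \<beta> * s" borel] in simp)
  finally have G: "G x = ennreal (e / \<beta>) * (\<integral>\<^sup>+s. H (x, e / \<beta> * s) \<partial>Lb)" using e beta by simp
  show "(\<integral>\<^sup>+s. H (x, e / \<beta> * s) \<partial>Lb) = ennreal (\<beta> / e) * G x"
   unfolding G mult.assoc[symmetric] using e beta by (simp add: ennreal_mult''[symmetric])
 qed
 also have "... = ennreal (\<beta> / e) * (\<integral>\<^sup>+x. G x \<partial>\<sigma>)" by (rule nn_integral_cmult[OF Gm])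
 finally show ?thesis by (simp add: G_def)
qed

text \<open>The normal coordinates compressed by e / \<beta>. At e = 0 they collapse to the foot
  point, so the delta interaction is part of the same family.\<close>

definition "kap e z = \<iota> (fst z, e / \<beta> * snd z)"

lemma kap_measurable [measurable]: "kap e \<in> measurable Ms borel"
proof -
 have "(%z. (fst z, e / \<beta> * snd z)) \<in> measurable Ms \<sigma>t" by measurable
 thus ?thesis unfolding kap_def[abs_def] by (rule measurable_compose[OF _ iota_measurable])
qed

lemma kap_zero: "kap 0 z = fst z"
 by (simp add: kap_def normal_shift_def)

lemma nn_integral_kap:
 assumes h: "h \<in> borel_measurable borel" and e: "0 < e"
 shows "(\<integral>\<^sup>+z. h (kap e z) \<partial>Ms) = ennreal (\<beta> / e) * (\<integral>\<^sup>+y. h y \<partial>layer_measure e)"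
 unfolding kap_def nn_integral_layer_measure[OF h]
 using nn_integral_Ms_scale[OF measurable_compose[OF iota_measurable h] e] by (simp add: normal_shift_def)

end

section \<open>Forms relatively bounded by an interpolation norm\<close>

text \<open>The geometric mean of the L2 and H1 norms, which is the quantity that the trace
  inequality produces. No triangle inequality is stated for it.\<close>

definition interp_norm :: "(real^'n::finite) l2 => real" where
 "interp_norm f = sqrt (norm f * sqrt (h1_sq f))"

lemma interp_norm_nonneg [simp]: "0 <= interp_norm f"
 by (simp add: interp_norm_def h1_sq_nonneg)

lemma interp_norm_sq: "(interp_norm f)^2 = norm f * sqrt (h1_sq f)"
 by (simp add: interp_norm_def h1_sq_nonneg)

lemma norm_le_interp_norm: "norm f <= interp_norm f"
 and interp_norm_le: "interp_norm f <= sqrt (h1_sq f)"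
proof -
 have n: "norm f <= sqrt (h1_sq f)" by (rule real_le_rsqrt[OF norm_le_h1])
 show "norm f <= interp_norm f" unfolding interp_norm_def using n
  by (intro real_le_rsqrt) (simp add: power2_eq_square mult_left_mono)
 show "interp_norm f <= sqrt (h1_sq f)" unfolding interp_norm_def using n h1_sq_nonneg[of f]
  by (intro real_sqrt_le_mono order_trans[OF mult_right_mono[OF n]]) auto
qed

lemma le_of_mult_self_le: "x * x <= a * x ==> 0 <= a ==> x <= (a::real)"
 by (smt (verit) mult_le_cancel_right)

locale relative_form =
 fixes b :: "(real^'n::finite) l2 => (real^'n) l2 => complex" and K :: real
 assumes b_add: "f \<in> H1 ==> g \<in> H1 ==> h \<in> H1 ==> b (f + g) h = b f h + b g h"
  and b_scale: "f \<in> H1 ==> h \<in> H1 ==> b (scaleC_l2 a f) h = a * b f h"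
  and b_sym: "f \<in> H1 ==> g \<in> H1 ==> b f g = cnj (b g f)"
  and b_bound: "f \<in> H1 ==> g \<in> H1 ==> cmod (b f g) <= K * (interp_norm f * interp_norm g)"
  and K_nonneg: "0 <= K"
begin

text \<open>By Young's inequality K |f| times the H1 norm is at most (K^2 |f|^2 +
  \<open>h1_sq f\<close>) / 2. The shift by 1 + K^2 / 2 restores the L2 part and leaves half of
  \<open>h1_sq f\<close>.\<close>

definition "bottom = - (1 + K^2 / 2)"

definition "frm \<mu> f g = grad_form f g - b f g - of_real \<mu> * cinner_l2 f g"

abbreviation "Res \<mu> \<equiv> coercive_form.Rop H1 (frm \<mu>)"

lemma frm_lower:
 assumes f: "f \<in> H1" and \<mu>: "\<mu> <= bottom"
 shows "1 / 2 * h1_sq f <= Re (frm \<mu> f f)"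
proof -
 have "\<mu> * (norm f)^2 <= bottom * (norm f)^2" by (rule mult_right_mono[OF \<mu>]) simp
 moreover have "Re (b f f) <= K * (norm f * sqrt (h1_sq f))"
  using b_bound[OF f f] complex_Re_le_cmod[of "b f f"] by (simp add: interp_norm_sq power2_eq_square[symmetric])
 moreover have "2 * ((K * norm f) * sqrt (h1_sq f)) <= (K * norm f)^2 + h1_sq f"
  using sum_squares_bound[of "K * norm f" "sqrt (h1_sq f)"] h1_sq_nonneg[of f] by simp
 ultimately show ?thesis
  unfolding frm_def grad_form_self by (simp add: cinner_self bottom_def algebra_simps power_mult_distrib)
qed

lemma coercive_frm: assumes \<mu>: "\<mu> <= bottom" shows "coercive_form H1 (frm \<mu>) (1 / 2)"
proof (rule h1_coercive_form[where C="1 + K + \<bar>\<mu>\<bar>"])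
 show "frm \<mu> (f + g) h = frm \<mu> f h + frm \<mu> g h" if "f \<in> H1" "g \<in> H1" "h \<in> H1" for f g h
  using that by (simp add: frm_def grad_form_add b_add cinner_add_left algebra_simps)
 show "frm \<mu> (scaleC_l2 a f) h = a * frm \<mu> f h" if "f \<in> H1" "h \<in> H1" for f h a
  using that by (simp add: frm_def grad_form_scale b_scale cinner_scaleC_left algebra_simps)
 show "frm \<mu> f g = cnj (frm \<mu> g f)" if "f \<in> H1" "g \<in> H1" for f g
  using b_sym[OF that] grad_form_sym[of f g] cinner_commute[of f g] by (simp add: frm_def)
 show "Re (frm \<mu> f f) <= (1 + K + \<bar>\<mu>\<bar>) * h1_sq f" if f: "f \<in> H1" for f
 proof -
  have "- Re (b f f) <= K * (interp_norm f)^2"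
   using b_bound[OF f f] abs_Re_le_cmod[of "b f f"] by (simp add: power2_eq_square)
  also have "... <= K * h1_sq f"
   using power_mono[OF interp_norm_le[of f], of 2] K_nonneg h1_sq_nonneg[of f] by (simp add: mult_left_mono)
  finally have 1: "- Re (b f f) <= K * h1_sq f" .
  have "- \<mu> * (norm f)^2 <= \<bar>\<mu>\<bar> * h1_sq f" by (rule mult_mono) (auto simp: norm_le_h1)
  moreover have "Re (frm \<mu> f f) = h1_sq f - (norm f)^2 - Re (b f f) - \<mu> * (norm f)^2"
   by (simp add: frm_def grad_form_self cinner_self)
  ultimately show ?thesis using 1 zero_le_power2[of "norm f"] unfolding distrib_right by linarith
 qed
qed (use frm_lower[OF _ \<mu>] in auto)

lemma sym_inv_Res: "\<mu> <= bottom ==> sym_inv (Res \<mu>) 2"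
 using coercive_form.sym_inv_Rop[OF coercive_frm sobolev_1_dense] by simp

lemma form_graph_Res:
 "(!!f g. f \<in> H1 ==> g \<in> H1 ==> a f g = grad_form f g - b f g) ==> \<mu> <= bottom ==> form_graph H1 a = op_of_inv (Res \<mu>) \<mu>"
 by (rule coercive_form.form_graph_eq[OF coercive_frm]) (auto simp: frm_def)

lemma form_operator_Res:
 "(!!f g. f \<in> H1 ==> g \<in> H1 ==> a f g = grad_form f g - b f g) ==> form_operator H1 a = form_graph H1 a"
 by (rule coercive_form.form_operator_eq[OF coercive_frm[OF order_refl] sobolev_1_dense, of _ bottom]) (simp add: frm_def)

text \<open>The last clause carries the regularity: the equation moves the perturbation to the
  right-hand side, where it is a functional bounded by \<open>interp_norm g\<close> instead of the
  full H1 norm of \<open>g\<close>.\<close>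

lemma Res:
 assumes \<mu>: "\<mu> <= bottom"
 shows "Res \<mu> h \<in> H1" "g \<in> H1 ==> frm \<mu> (Res \<mu> h) g = cinner_l2 h g" "sqrt (h1_sq (Res \<mu> h)) <= 2 * norm h"
  "g \<in> H1 ==> cmod (grad_form (Res \<mu> h) g + cinner_l2 (Res \<mu> h) g) <= (1 + 2 * K + 2 * \<bar>\<mu> + 1\<bar>) * norm h * interp_norm g"
proof -
 define u where "u = Res \<mu> h"
 note R = coercive_form.Rop[OF coercive_frm[OF \<mu>], where h=h, folded u_def]
 show "Res \<mu> h \<in> H1" using R(1) unfolding u_def .
 show "frm \<mu> (Res \<mu> h) g = cinner_l2 h g" if "g \<in> H1" using R(2)[OF that] unfolding u_def .
 show s: "sqrt (h1_sq (Res \<mu> h)) <= 2 * norm h"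
 proof -
  have "1 / 2 * h1_sq u <= norm h * norm u"
   using frm_lower[OF R(1) \<mu>] R(2)[OF R(1)] cinner_bound[of h u] complex_Re_le_cmod[of "cinner_l2 h u"] by simp
  also have "... <= norm h * sqrt (h1_sq u)" by (intro mult_left_mono real_le_rsqrt norm_le_h1) simp
  finally have "sqrt (h1_sq u) * sqrt (h1_sq u) <= (2 * norm h) * sqrt (h1_sq u)" using h1_sq_nonneg[of u] by simp
  thus ?thesis unfolding u_def by (rule le_of_mult_self_le) simp
 qed
 have n: "interp_norm u <= 2 * norm h" using s interp_norm_le[of u] by (simp add: u_def)
 show "cmod (grad_form (Res \<mu> h) g + cinner_l2 (Res \<mu> h) g) <= (1 + 2 * K + 2 * \<bar>\<mu> + 1\<bar>) * norm h * interp_norm g" if g: "g \<in> H1"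
 proof -
  have "grad_form u g + cinner_l2 u g = cinner_l2 h g + b u g + of_real (\<mu> + 1) * cinner_l2 u g"
   using R(2)[OF g] by (simp add: frm_def algebra_simps)
  also have "cmod ... <= norm h * interp_norm g + K * (2 * norm h * interp_norm g) + \<bar>\<mu> + 1\<bar> * (2 * norm h * interp_norm g)"
  proof (intro norm_triangle_le add_mono)
   show "cmod (cinner_l2 h g) <= norm h * interp_norm g"
    by (rule order_trans[OF cinner_bound mult_left_mono[OF norm_le_interp_norm]]) simp
   show "cmod (b u g) <= K * (2 * norm h * interp_norm g)"
    by (rule order_trans[OF b_bound[OF R(1) g]]) (intro mult_left_mono mult_right_mono n interp_norm_nonneg K_nonneg)
   have "cmod (cinner_l2 u g) <= 2 * norm h * interp_norm g"
    by (rule order_trans[OF cinner_bound]) (intro mult_mono norm_le_interp_norm order_trans[OF norm_le_interp_norm n]; simp)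
   thus "cmod (of_real (\<mu> + 1) * cinner_l2 u g) <= \<bar>\<mu> + 1\<bar> * (2 * norm h * interp_norm g)"
    unfolding norm_mult norm_of_real by (rule mult_left_mono) simp
  qed
  finally show ?thesis unfolding u_def by (simp add: algebra_simps)
 qed
qed

end

text \<open>The energy \<open>E\<close> controls s^2 |w| and the H1 norm, hence s times
  \<open>interp_norm w\<close>; the equation tested with \<open>w\<close> gives E^2 <= M E / s. The
  parameter s^4 is the square of the frequency s^2, so half-integer powers of the frequency are
  integer powers of s.\<close>

lemma energy_bound:
 assumes s: "1 <= s" and M: "0 <= M" and le: "cmod (grad_form w w + of_real (s ^ 4) * cinner_l2 w w) <= M * interp_norm w"
 shows "norm w <= M / s ^ 3" "interp_norm w <= M / s^2"
proof -
 define E where "E = sqrt (h1_sq w - (norm w)^2 + s ^ 4 * (norm w)^2)"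
 have s4: "1 <= s ^ 4" using s by (rule one_le_power)
 have E2: "E^2 = h1_sq w - (norm w)^2 + s ^ 4 * (norm w)^2"
  unfolding E_def using norm_le_h1[of w] s4 by (simp add: real_sqrt_pow2 add_nonneg_nonneg)
 have E0: "0 <= E" unfolding E_def using norm_le_h1[of w] s4 by (intro real_sqrt_ge_zero add_nonneg_nonneg) auto
 have 1: "s^2 * norm w <= E"
  by (rule power2_le_imp_le[OF _ E0]) (use norm_le_h1[of w] in \<open>simp add: E2 power_mult_distrib\<close>)
 have 2: "sqrt (h1_sq w) <= E"
  by (rule power2_le_imp_le[OF _ E0]) (use mult_right_mono[OF s4, of "(norm w)^2"] in \<open>simp add: E2 h1_sq_nonneg\<close>)
 have "(s * interp_norm w)^2 = (s^2 * norm w) * sqrt (h1_sq w)" by (simp add: power_mult_distrib interp_norm_sq)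
 also have "... <= E * E" using 1 2 E0 s by (intro mult_mono) (auto simp: h1_sq_nonneg)
 finally have "(s * interp_norm w)^2 <= E^2" by (simp add: power2_eq_square)
 hence 3: "s * interp_norm w <= E" by (rule power2_le_imp_le[OF _ E0])
 have "E^2 = cmod (grad_form w w + of_real (s ^ 4) * cinner_l2 w w)"
  unfolding grad_form_self cinner_self of_real_mult[symmetric] of_real_add[symmetric] norm_of_real using zero_le_power2[of E] by (simp add: E2)
 hence "s * E^2 <= M * (s * interp_norm w)" using mult_left_mono[OF le, of s] s by (simp add: mult_ac)
 also have "... <= M * E" by (rule mult_left_mono[OF 3 M])
 finally have "(s * E) * E <= M * E" by (simp add: power2_eq_square mult_ac)
 from le_of_mult_self_le[of E "M / s"] this have 4: "E <= M / s" using M s by (simp add: field_simps)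
 show "norm w <= M / s ^ 3" using order_trans[OF 1 4] s by (simp add: field_simps power_numeral_reduce)
 show "interp_norm w <= M / s^2" using order_trans[OF 3 4] s by (simp add: field_simps power2_eq_square)
qed

text \<open>The pieces \<open>u k - u (Suc k)\<close>, \<open>u k = u - (16 ^ k - 1) (-\<Delta> + 16 ^ k)\<inverse> u\<close>, are localised at frequency \<open>2 ^ k\<close>.
 Each contributes \<open>O(e)\<close>, and after \<open>\<bar>ln e\<bar>\<close> steps the remainder is \<open>O(e)\<close>.\<close>

lemma dyadic_estimate:
 fixes u :: "(real^'n::finite) l2"
 assumes u: "u \<in> H1" and M: "0 <= M" and l: "!!g. g \<in> H1 ==> cmod (grad_form u g + cinner_l2 u g) <= M * interp_norm g"
  and D: "!!f g. f \<in> H1 ==> g \<in> H1 ==> D (f + g) <= D f + D g" and A: "0 <= A" and e: "0 < e" "e < 1"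
  and D1: "!!f. f \<in> H1 ==> D f <= A * interp_norm f"
  and D2: "!!f. f \<in> sobolev 2 ==> D f <= A * e * (\<Sum>j\<in>UNIV. interp_norm (wD j f))"
 shows "D u <= A * M * (1 + 11 * CARD('n)) * (e * (1 + \<bar>ln e\<bar>))"
proof -
 \<comment> \<open>Zero perturbation: \<open>Z.Res (- c)\<close> is the inverse of - Laplacian + c,
   available for all c >= 1.\<close>
 interpret Z: relative_form "%(_ :: (real^'n) l2) _. 0" 0 by standard auto
 define c :: "nat => real" where "c k = 16 ^ k" for k
 have c4: "c k = (2 ^ k) ^ 4" for k by (simp add: c_def power_mult[symmetric] mult.commute[of k] power_mult)
 have c1: "- c k <= Z.bottom" for k by (simp add: c_def Z.bottom_def)
 \<comment> \<open>\<open>v k\<close> solves the equation with operator - Laplacian + c k and the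
   same right-hand side as \<open>u\<close> with - Laplacian + 1, so \<open>energy_bound\<close>
   applies with s = 2^k; moreover v 0 = u because c 0 = 1.\<close>
 define v where "v k = u - scaleC_l2 (of_real (c k - 1)) (Z.Res (- c k) u)" for k
 have v1: "v k \<in> H1" for k unfolding v_def by (intro sobolev_1_diff sobolev_1_scaleC u Z.Res(1)[OF c1])
 have v2: "grad_form (v k) g + of_real (c k) * cinner_l2 (v k) g = grad_form u g + cinner_l2 u g" if g: "g \<in> H1" for k g
 proof -
  have *: "grad_form (Z.Res (- c k) u) g = cinner_l2 u g - of_real (c k) * cinner_l2 (Z.Res (- c k) u) g"
   using Z.Res(2)[OF c1 g] by (simp add: Z.frm_def algebra_simps)
  show ?thesis
   by (simp add: v_def grad_form_diff[OF u sobolev_1_scaleC[OF Z.Res(1)[OF c1]]] grad_form_scale[OF Z.Res(1)[OF c1]] * cinner_diff_left cinner_scaleC_left)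
    (simp add: algebra_simps)
 qed
 have v3: "norm (v k) <= M / (2 ^ k) ^ 3" "interp_norm (v k) <= M / (2 ^ k)^2" for k
 proof -
  have "cmod (grad_form (v k) (v k) + of_real ((2 ^ k) ^ 4) * cinner_l2 (v k) (v k)) <= M * interp_norm (v k)"
   unfolding c4[symmetric] v2[OF v1] by (rule l[OF v1])
  from energy_bound[OF _ M this] show "norm (v k) <= M / (2 ^ k) ^ 3" "interp_norm (v k) <= M / (2 ^ k)^2" by auto
 qed
 have step: "D (v k - v (Suc k)) <= A * e * (CARD('n) * (11 * M))" for k
 proof -
  define w where "w = v k - v (Suc k)"
  define s :: real where "s = 2 ^ k"
  have s: "1 <= s" by (simp add: s_def)
  \<comment> \<open>Since c (Suc k) = 16 c k, subtracting the equations of \<open>v k\<close> and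
    \<open>v (Suc k)\<close> cancels the rough right-hand side and leaves - Laplacian w = h with
    \<open>h\<close> in L2. Thus \<open>w\<close> lies in H2 although \<open>u\<close> need
    not.\<close>
  define h where "h = scaleC_l2 (of_real (15 * c k)) (v (Suc k)) - scaleC_l2 (of_real (c k)) w"
  have w1: "w \<in> H1" unfolding w_def by (intro sobolev_1_diff v1)
  have w2: "grad_form w g = cinner_l2 h g" if g: "g \<in> H1" for g
   using v2[OF g, of k] v2[OF g, of "Suc k"]
   by (simp add: h_def w_def grad_form_diff v1 cinner_diff_left cinner_scaleC_left c_def algebra_simps)
  have er: "w \<in> sobolev 2" "(\<Sum>i\<in>UNIV. \<Sum>j\<in>UNIV. (norm (wD i (wD j w)))^2) = (norm h)^2"
   using elliptic_regularity(1,3)[OF w1 w2] by auto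
  have m: "M / s ^ 3 \<ge> 0" using s M by simp
  have nv: "norm (v (Suc k)) <= M / s ^ 3" using v3(1)[of "Suc k"] s M by (simp add: s_def power_mult_distrib field_simps)
  have nw: "norm w <= 2 * (M / s ^ 3)" unfolding w_def using norm_triangle_ineq4[of "v k" "v (Suc k)"] nv v3(1)[of k] by (simp add: s_def)
  have "norm h <= norm (scaleC_l2 (of_real (15 * c k)) (v (Suc k))) + norm (scaleC_l2 (of_real (c k)) w)" unfolding h_def by (rule norm_triangle_ineq4)
  also have "... = s ^ 4 * (15 * norm (v (Suc k)) + norm w)" by (simp add: norm_scaleC norm_mult norm_power c4 s_def algebra_simps)
  also have "... <= s ^ 4 * (17 * (M / s ^ 3))" using nv nw s by (intro mult_left_mono) auto
  also have "... = 17 * M * s" using s by (simp add: power_numeral_reduce)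
  finally have nh: "norm h <= 17 * M * s" .
  \<comment> \<open>Here 17 = 15 + 2 bounds \<open>h\<close>, 34 = 17 times 2 the gradient of
    \<open>w\<close>, 323 = 34 + 17^2 the H1 norm of a derivative, and 34 times 323 is 10982 <=
    11^4. All powers of \<open>s\<close> cancel, so every piece has the same bound.\<close>
  have "interp_norm (wD j w) <= 11 * M" for j
  proof -
   have "h1_sq w - (norm w)^2 = cmod (cinner_l2 h w)"
    using norm_le_h1[of w] by (simp add: w2[OF w1, symmetric] grad_form_self del: of_real_diff)
   also have "... <= (17 * M * s) * (2 * (M / s ^ 3))"
    by (rule order_trans[OF cinner_bound]) (intro mult_mono nh nw norm_ge_zero mult_nonneg_nonneg, use s M in auto)
   also have "... = 34 * (M / s)^2" using s by (simp add: power_numeral_reduce)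
   finally have g2: "(norm (wD j w))^2 <= 34 * (M / s)^2"
    using member_le_sum[of j UNIV "%j. (norm (wD j w))^2"] by (simp add: h1_sq_def)
   have "(\<Sum>i\<in>UNIV. (norm (wD i (wD j w)))^2) <= (\<Sum>i\<in>UNIV. \<Sum>j\<in>UNIV. (norm (wD i (wD j w)))^2)"
    by (intro sum_mono member_le_sum) auto
   also have "... <= (17 * M * s)^2" unfolding er(2) by (rule power_mono[OF nh norm_ge_zero])
   finally have "h1_sq (wD j w) <= 34 * (M / s)^2 + (17 * M * s)^2" using g2 by (simp add: h1_sq_def)
   also have "(M / s)^2 <= (M * s)^2" using s M mult_mono[of 1 s 1 s] by (intro power_mono) (auto simp: field_simps mult_le_cancel_left1)
   finally have "h1_sq (wD j w) <= 323 * (M * s)^2" by (simp add: power_mult_distrib)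
   hence "(norm (wD j w))^2 * h1_sq (wD j w) <= (34 * (M / s)^2) * (323 * (M * s)^2)"
    by (intro mult_mono g2) (auto simp: h1_sq_nonneg)
   also have "... = 10982 * M ^ 4" using s by (simp add: power_numeral_reduce)
   also have "... <= (121 * M^2)^2" using M by (simp add: power_mult_distrib power_mult[symmetric])
   finally have "((interp_norm (wD j w))^2)^2 <= (121 * M^2)^2" by (simp add: interp_norm_sq power_mult_distrib h1_sq_nonneg)
   hence "(interp_norm (wD j w))^2 <= (11 * M)^2" by (rule power2_le_imp_le[THEN order_trans]) (auto simp: power_mult_distrib)
   thus ?thesis by (rule power2_le_imp_le) (use M in simp)
  qed
  hence "(\<Sum>j\<in>UNIV. interp_norm (wD j w)) <= CARD('n) * (11 * M)" by (intro sum_bounded_above)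
  thus ?thesis unfolding w_def[symmetric] using A e by (intro order_trans[OF D2[OF er(1)] mult_left_mono]) auto
 qed
 have tele: "D u <= D (v k) + k * (A * e * (CARD('n) * (11 * M)))" for k
 proof (induction k)
  case 0 show ?case by (simp add: v_def c_def)
 next
  case (Suc k)
  have "D (v k) <= D (v (Suc k)) + A * e * (CARD('n) * (11 * M))"
   using D[OF v1 sobolev_1_diff[OF v1 v1], of "Suc k" k "Suc k"] step[of k] by simp
  thus ?case using Suc by (simp add: algebra_simps)
 qed
 \<comment> \<open>The number of pieces: k >= |ln e| gives 1 / e <= exp k <= 4^k, so the remaining
   \<open>v k\<close> has \<open>interp_norm\<close> at most M e.\<close>
 define k where "k = nat \<lceil>\<bar>ln e\<bar>\<rceil>"
 have k: "\<bar>ln e\<bar> <= k" "k <= 1 + \<bar>ln e\<bar>" unfolding k_def by linarith+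
 have "1 / e = exp \<bar>ln e\<bar>" using e by (simp add: exp_minus field_simps)
 also have "... <= exp (real k)" using k(1) by simp
 also have "... = exp 1 ^ k" by (simp add: exp_of_nat_mult[symmetric])
 also have "... <= 4 ^ k" using exp_le by (intro power_mono) auto
 also have "(4::real) ^ k = (2 ^ k)^2" by (simp add: power_mult[symmetric] mult.commute[of k] power_mult)
 finally have "M / (2 ^ k)^2 <= M * e" using e M mult_left_mono[of 1 "e * (2 ^ k)^2" M] by (simp add: field_simps)
 hence "D (v k) <= A * (M * e)" using D1[OF v1] v3(2)[of k] A by (meson mult_left_mono order_trans)
 also have "... <= A * M * (e * (1 + \<bar>ln e\<bar>))" using A M e by (simp add: mult_left_mono mult.assoc)
 finally have 1: "D (v k) <= A * M * (e * (1 + \<bar>ln e\<bar>))" .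
 have "k * (A * e * (CARD('n) * (11 * M))) <= (1 + \<bar>ln e\<bar>) * (A * e * (CARD('n) * (11 * M)))"
  using k(2) A e M by (intro mult_right_mono) auto
 thus ?thesis using 1 tele[of k] by (simp add: algebra_simps)
qed

text \<open>Duality: let \<open>k\<close> be the difference at \<open>h\<close>, \<open>u\<close>
  the perturbed solution for \<open>h\<close> and \<open>v\<close> the unperturbed solution for
  \<open>k\<close>. Then |k|^2 is the difference of the forms at (u, v), and both \<open>u\<close>
  and \<open>v\<close> have the regularity that \<open>dyadic_estimate\<close> uses. One factor |k|
  cancels.\<close>

lemma resolvent_difference:
 fixes b0 b1 :: "(real^'n::finite) l2 => (real^'n) l2 => complex"
 assumes b: "relative_form b0 K" "relative_form b1 K" and \<mu>: "\<mu> <= relative_form.bottom K"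
  and D: "!!f g. f \<in> H1 ==> g \<in> H1 ==> D (f + g) <= D f + D g" and A: "0 <= A" and e: "0 < e" "e < 1"
  and D1: "!!f. f \<in> H1 ==> D f <= A * interp_norm f"
  and D2: "!!f. f \<in> sobolev 2 ==> D f <= A * e * (\<Sum>j\<in>UNIV. interp_norm (wD j f))"
  and B: "0 <= B" "!!f g. f \<in> H1 ==> g \<in> H1 ==> cmod (b1 f g - b0 f g) <=
    B * (e * (interp_norm f * interp_norm g) + D f * interp_norm g + interp_norm f * D g)"
 shows "norm (coercive_form.Rop H1 (relative_form.frm b1 \<mu>) h - coercive_form.Rop H1 (relative_form.frm b0 \<mu>) h)
   <= B * (4 + 4 * (A * (1 + 2 * K + 2 * \<bar>\<mu> + 1\<bar>) * (1 + 11 * CARD('n)))) * (e * (1 + \<bar>ln e\<bar>)) * norm h"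
proof -
 interpret X: relative_form b0 K by (rule b)
 interpret Y: relative_form b1 K by (rule b)
 have \<mu>': "\<mu> <= X.bottom" "\<mu> <= Y.bottom" using \<mu> by auto
 define E where "E = e * (1 + \<bar>ln e\<bar>)"
 have E: "e <= E" using e by (simp add: E_def)
 with e have E: "e <= E" "0 <= E" by auto
 define P where "P = A * (1 + 2 * K + 2 * \<bar>\<mu> + 1\<bar>) * (1 + 11 * CARD('n))"
 have P: "0 <= P" using A X.K_nonneg by (simp add: P_def)
 have du: "D w <= P * E * norm k"
  if "w \<in> H1" "!!g. g \<in> H1 ==> cmod (grad_form w g + cinner_l2 w g) <= (1 + 2 * K + 2 * \<bar>\<mu> + 1\<bar>) * norm k * interp_norm g" for w k
  using dyadic_estimate[OF that(1) _ that(2) D A e D1 D2] X.K_nonneg by (simp add: P_def E_def mult_ac)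
 define k where "k = Y.Res \<mu> h - X.Res \<mu> h"
 define u v where "u = Y.Res \<mu> h" and "v = X.Res \<mu> k"
 note u = Y.Res[OF \<mu>'(2), where h=h, folded u_def] and v = X.Res[OF \<mu>'(1), where h=k, folded v_def]
 have "cinner_l2 u k = cnj (X.frm \<mu> v u)" using v(2)[OF u(1)] cinner_commute[of u k] by simp
 also have "... = X.frm \<mu> u v" using coercive_form.t_sym[OF X.coercive_frm[OF \<mu>'(1)] u(1) v(1)] by simp
 finally have 1: "cinner_l2 u k = X.frm \<mu> u v" .
 have "cinner_l2 (X.Res \<mu> h) k = cinner_l2 h v" unfolding v_def by (rule coercive_form.Rop_sym[OF X.coercive_frm[OF \<mu>'(1)]])
 hence "cinner_l2 k k = X.frm \<mu> u v - Y.frm \<mu> u v"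
  using u(2)[OF v(1)] 1 by (simp add: k_def cinner_diff_left u_def)
 hence "complex_of_real ((norm k)^2) = b1 u v - b0 u v" by (simp add: cinner_self X.frm_def Y.frm_def)
 hence "(norm k)^2 = cmod (b1 u v - b0 u v)" by (metis norm_of_real abs_of_nonneg zero_le_power2)
 also have "... <= B * (e * (interp_norm u * interp_norm v) + D u * interp_norm v + interp_norm u * D v)" by (rule B(2)[OF u(1) v(1)])
 also have "... <= B * (E * ((2 * norm h) * (2 * norm k)) + (P * E * norm h) * (2 * norm k) + (2 * norm h) * (P * E * norm k))"
 proof (intro mult_left_mono add_mono mult_mono[OF E(1)] B(1))
  note iu = order_trans[OF interp_norm_le u(3)] and iv = order_trans[OF interp_norm_le v(3)]
  show "interp_norm u * interp_norm v <= (2 * norm h) * (2 * norm k)" by (intro mult_mono iu iv) auto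
  show "D u * interp_norm v <= (P * E * norm h) * (2 * norm k)"
   by (rule order_trans[OF mult_right_mono[OF du[OF u(1,4)]] mult_left_mono[OF iv]]) (use P E in auto)
  show "interp_norm u * D v <= (2 * norm h) * (P * E * norm k)"
   by (rule order_trans[OF mult_left_mono[OF du[OF v(1,4)]] mult_right_mono[OF iu]]) (use P E in auto)
 qed (use E in auto)
 finally have "norm k * norm k <= (B * (4 + 4 * P) * E * norm h) * norm k" by (simp add: power2_eq_square algebra_simps)
 hence "norm k <= B * (4 + 4 * P) * E * norm h" by (rule le_of_mult_self_le) (use B(1) P E in simp)
 thus ?thesis unfolding k_def P_def E_def .
qed

section \<open>Convergence in the L2 space of a measure\<close>

definition L2_lim :: "'a measure => (nat => 'a => complex) => ('a => complex) => bool" where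
 "L2_lim M X F \<longleftrightarrow> (\<forall>k. square_integrable M (X k)) \<and> square_integrable M F \<and>
   (%k. sq_norm M (%x. X k x - F x)) ----> 0"

lemma tendsto_0_le: "b ----> 0 ==> (!!k. 0 <= a k) ==> (!!k. a k <= b k) ==> a ----> (0::real)"
 by (rule tendsto_sandwich[of "%_. 0" a sequentially b]) auto

lemma L2_lim_add:
 assumes "L2_lim M X F" "L2_lim M Y G" shows "L2_lim M (%k x. X k x + Y k x) (%x. F x + G x)"
proof -
 have s: "square_integrable M (X k)" "square_integrable M F" "square_integrable M (Y k)" "square_integrable M G" for k
  using assms by (auto simp: L2_lim_def)
 have "(%k. sq_norm M (%x. X k x - F x) + sq_norm M (%x. Y k x - G x)) ----> 0 + 0"
  using assms unfolding L2_lim_def by (intro tendsto_add) auto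
 moreover have "sq_norm M (%x. X k x + Y k x - (F x + G x)) <= sq_norm M (%x. X k x - F x) + sq_norm M (%x. Y k x - G x)" for k
  using sq_norm_triangle[OF square_integrable_diff[OF s(1,2)] square_integrable_diff[OF s(3,4)]] by (simp add: add_diff_add)
 ultimately show ?thesis unfolding L2_lim_def
  by (auto intro!: square_integrable_add s intro: tendsto_0_le)
qed

lemma L2_lim_scale: "L2_lim M X F ==> L2_lim M (%k x. c * X k x) (%x. c * F x)"
 using tendsto_mult_right_zero[of "%k. sq_norm M (%x. X k x - F x)" sequentially "cmod c"]
 by (simp add: L2_lim_def square_integrable_scale right_diff_distrib[symmetric] sq_norm_scale)

lemma L2_lim_diff: "L2_lim M X F ==> L2_lim M Y G ==> L2_lim M (%k x. X k x - Y k x) (%x. F x - G x)"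
 using L2_lim_add[OF _ L2_lim_scale[of M Y G "-1"]] by simp

lemma L2_lim_norm:
 assumes "L2_lim M X F" shows "(%k. sq_norm M (X k)) ----> sq_norm M F"
proof -
 have s: "square_integrable M (X k)" "square_integrable M F" for k using assms by (auto simp: L2_lim_def)
 have "\<bar>sq_norm M (X k) - sq_norm M F\<bar> <= sq_norm M (%x. X k x - F x)" for k
  using sq_norm_triangle_diff[OF s(1)[of k] s(2)] sq_norm_triangle_diff[OF s(2) s(1)[of k]] sq_norm_minus[of M "X k" F] by (simp add: abs_le_iff algebra_simps)
 hence "(%k. \<bar>sq_norm M (X k) - sq_norm M F\<bar>) ----> 0"
  using assms unfolding L2_lim_def
  by (intro tendsto_0_le[of "%k. sq_norm M (%x. X k x - F x)" "%k. \<bar>sq_norm M (X k) - sq_norm M F\<bar>"]) simp_all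
 thus ?thesis by (rule LIM_zero_cancel[OF tendsto_rabs_zero_cancel])
qed

lemma L2_lim_unique:
 assumes "L2_lim M X F" "L2_lim M X G" shows "AE x in M. F x = G x"
proof -
 have "(%k. sq_norm M (%x. X k x - X k x)) ----> sq_norm M (%x. F x - G x)"
  by (rule L2_lim_norm[OF L2_lim_diff[OF assms]])
 hence "sq_norm M (%x. F x - G x) = 0" by (simp add: sq_norm_def LIMSEQ_const_iff)
 moreover have "square_integrable M (%x. F x - G x)" using assms unfolding L2_lim_def by (blast intro: square_integrable_diff)
 ultimately have "AE x in M. (cmod (F x - G x))^2 = 0"
  using integral_nonneg_eq_0_iff_AE[of M "%x. (cmod (F x - G x))^2"] by (simp add: sq_norm_def square_integrable_def)
 thus ?thesis by simp
qed

lemma interp_norm_approx: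
 assumes "h1_approx \<psi> f" "h1_approx \<xi> f" "f \<in> H1" "0 < e"
 shows "\<exists>N. \<forall>m\<ge>N. \<forall>n\<ge>N. interp_norm (abs_l2 (%x. \<psi> m x - \<xi> n x)) < e"
proof -
 note t = h1_approx_test[OF assms(1)] h1_approx_test[OF assms(2)]
 have r: "0 < e^2 / 4" using assms(4) by simp
 have "\<forall>\<^sub>F k in sequentially. h1_sq (abs_l2 (\<psi> k) - f) < e^2 / 4 \<and> h1_sq (abs_l2 (\<xi> k) - f) < e^2 / 4"
  by (rule eventually_conj[OF order_tendstoD(2)[OF h1_approx_diff[OF assms(1,3)] r] order_tendstoD(2)[OF h1_approx_diff[OF assms(2,3)] r]])
 then obtain N where N: "!!k. k \<ge> N ==> h1_sq (abs_l2 (\<psi> k) - f) < e^2 / 4 \<and> h1_sq (abs_l2 (\<xi> k) - f) < e^2 / 4"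
  unfolding eventually_sequentially by blast
 have "interp_norm (abs_l2 (%x. \<psi> m x - \<xi> n x)) < e" if "m \<ge> N" "n \<ge> N" for m n
 proof -
  have "h1_sq (abs_l2 (%x. \<psi> m x - \<xi> n x)) = h1_sq ((abs_l2 (\<psi> m) - f) - (abs_l2 (\<xi> n) - f))"
   by (simp add: abs_l2_test_diff t)
  also have "... <= 2 * h1_sq (abs_l2 (\<psi> m) - f) + 2 * h1_sq (abs_l2 (\<xi> n) - f)"
   by (intro h1_sq_diff_le sobolev_1_diff test_sobolev_1 t assms(3))
  also have "... < e^2" using N[OF that(1)] N[OF that(2)] by simp
  finally show ?thesis using interp_norm_le[of "abs_l2 (%x. \<psi> m x - \<xi> n x)"] assms(4) by (smt (verit) real_sqrt_less_mono real_sqrt_unique)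
 qed
 thus ?thesis by blast
qed

section \<open>Values of H1 functions along scaled normals\<close>

context admissible_hypersurface
begin

lemma nn_integral_kap_le:
 assumes h: "h \<in> borel_measurable borel" and e: "0 < e" "e <= \<beta>"
 shows "(\<integral>\<^sup>+z. h (kap e z) \<partial>Ms) <= ennreal (\<beta> / e * K\<beta>) * (\<integral>\<^sup>+y. h y \<partial>lborel)"
proof -
 have "ennreal (\<beta> / e * K\<beta>) = ennreal (\<beta> / e) * ennreal K\<beta>" using e beta K\<beta>(1) by (intro ennreal_mult) auto
 thus ?thesis unfolding nn_integral_kap[OF h e(1)]
  using mult_left_mono[OF nn_integral_layer_measure_le[OF e(2) h]] by (simp add: mult.assoc)
qed

lemma nn_integral_Ms_fst: "h \<in> borel_measurable \<sigma> ==> (\<integral>\<^sup>+z. h (fst z) \<partial>Ms) = ennreal (2 * \<beta>) * (\<integral>\<^sup>+x. h x \<partial>\<sigma>)"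
 using Lb.nn_integral_fst[of "%z. h (fst z)" \<sigma>] emeasure_Lb by (simp add: nn_integral_multc mult.commute)

lemma square_integrable_Ms_fst:
 assumes g: "square_integrable \<sigma> g"
 shows "square_integrable Ms (%z. g (fst z))" "sq_norm Ms (%z. g (fst z)) = sqrt (2 * \<beta>) * sq_norm \<sigma> g"
proof -
 have [measurable]: "g \<in> borel_measurable \<sigma>" using g by (simp add: square_integrable_def)
 have eq: "(\<integral>\<^sup>+z. ennreal ((cmod (g (fst z)))^2) \<partial>Ms) = ennreal (2 * \<beta> * (sq_norm \<sigma> g)^2)"
  using nn_integral_Ms_fst[of "%x. ennreal ((cmod (g x))^2)"] nn_integral_sq_norm[OF g] beta by (simp add: ennreal_mult')
 thus s: "square_integrable Ms (%z. g (fst z))"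
  using beta by (intro square_integrableI_nn[of _ _ "2 * \<beta> * (sq_norm \<sigma> g)^2"]) auto
 have "(sq_norm Ms (%z. g (fst z)))^2 = (sqrt (2 * \<beta>) * sq_norm \<sigma> g)^2"
  using nn_integral_sq_norm[OF s] eq beta by (simp add: power_mult_distrib)
 thus "sq_norm Ms (%z. g (fst z)) = sqrt (2 * \<beta>) * sq_norm \<sigma> g" using beta by (simp add: power2_eq_iff_nonneg)
qed

definition "Ctr = (SOME C. 0 < C \<and> (\<forall>\<psi> t. test_function \<psi> --> \<bar>t\<bar> < \<beta> -->
   (\<integral>\<^sup>+x. ennreal ((cmod (\<psi> (x + t *\<^sub>R \<nu> x)))^2) \<partial>\<sigma>) <= ennreal (C * (interp_norm (abs_l2 \<psi>))^2)))"

lemma Ctr: "0 < Ctr" "test_function \<psi> ==> \<bar>t\<bar> < \<beta> ==>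
   (\<integral>\<^sup>+x. ennreal ((cmod (\<psi> (x + t *\<^sub>R \<nu> x)))^2) \<partial>\<sigma>) <= ennreal (Ctr * (interp_norm (abs_l2 \<psi>))^2)"
 using someI_ex[OF trace_test[folded interp_norm_sq]] unfolding Ctr_def by blast+

lemma test_sigma:
 assumes t: "test_function \<psi>"
 shows "square_integrable \<sigma> \<psi>" "sq_norm \<sigma> \<psi> <= sqrt Ctr * interp_norm (abs_l2 \<psi>)"
proof -
 note s = square_integrableI_nn[OF measurable_compose[OF id_sigma test_borel[OF t]], of "Ctr * (interp_norm (abs_l2 \<psi>))^2"]
 show "square_integrable \<sigma> \<psi>" by (rule s(1)) (use Ctr(2)[OF t, of 0] beta Ctr(1) in auto)
 have "(sq_norm \<sigma> \<psi>)^2 <= (sqrt Ctr * interp_norm (abs_l2 \<psi>))^2"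
  using s(2) Ctr(2)[OF t, of 0] beta Ctr(1) by (simp add: power_mult_distrib)
 thus "sq_norm \<sigma> \<psi> <= sqrt Ctr * interp_norm (abs_l2 \<psi>)" by (rule power2_le_imp_le) (use Ctr(1) in simp)
qed

definition "CJ = sqrt (2 * \<beta> * Ctr)"

lemma CJ: "0 < CJ" using beta Ctr(1) by (simp add: CJ_def)

text \<open>At each fixed \<open>s\<close> this is the trace bound on a parallel surface;
  integrating over the interval of length 2 \<beta> produces \<open>CJ\<close>, independent of
  \<open>e\<close>.\<close>

lemma test_kap:
 assumes t: "test_function \<psi>" and e: "0 <= e" "e <= \<beta>"
 shows "square_integrable Ms (%z. \<psi> (kap e z))" "sq_norm Ms (%z. \<psi> (kap e z)) <= CJ * interp_norm (abs_l2 \<psi>)"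
proof -
 have m: "(%z. \<psi> (kap e z)) \<in> borel_measurable Ms" by (rule measurable_compose[OF kap_measurable test_borel[OF t]])
 have "(\<integral>\<^sup>+z. ennreal ((cmod (\<psi> (kap e z)))^2) \<partial>Ms) = (\<integral>\<^sup>+s. \<integral>\<^sup>+x. ennreal ((cmod (\<psi> (kap e (x, s))))^2) \<partial>\<sigma> \<partial>Lb)"
  by (rule sigmaL.nn_integral_snd[symmetric]) (use measurable_compose[OF m, of "%c. ennreal ((cmod c)^2)" borel] in simp)
 also have "... <= (\<integral>\<^sup>+s. ennreal (Ctr * (interp_norm (abs_l2 \<psi>))^2) \<partial>Lb)"
 proof (rule nn_integral_mono_AE)
  show "AE s in Lb. (\<integral>\<^sup>+x. ennreal ((cmod (\<psi> (kap e (x, s))))^2) \<partial>\<sigma>) <= ennreal (Ctr * (interp_norm (abs_l2 \<psi>))^2)"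
   using AE_Lb
  proof eventually_elim
   case (elim s)
   have "\<bar>e / \<beta> * s\<bar> <= 1 * \<bar>s\<bar>" unfolding abs_mult using e beta by (intro mult_right_mono) auto
   with elim Ctr(2)[OF t, of "e / \<beta> * s"] show ?case by (simp add: kap_def normal_shift_def)
  qed
 qed
 also have "... = ennreal (CJ^2 * (interp_norm (abs_l2 \<psi>))^2)"
  using beta Ctr(1) emeasure_Lb by (simp add: CJ_def ennreal_mult'[symmetric] mult_ac)
 finally have "(\<integral>\<^sup>+z. ennreal ((cmod (\<psi> (kap e z)))^2) \<partial>Ms) <= ennreal (CJ^2 * (interp_norm (abs_l2 \<psi>))^2)" .
 note s = square_integrableI_nn[OF m this]
 show "square_integrable Ms (%z. \<psi> (kap e z))" by (rule s(1)) simp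
 have "(sq_norm Ms (%z. \<psi> (kap e z)))^2 <= (CJ * interp_norm (abs_l2 \<psi>))^2" using s(2) by (simp add: power_mult_distrib)
 thus "sq_norm Ms (%z. \<psi> (kap e z)) <= CJ * interp_norm (abs_l2 \<psi>)" by (rule power2_le_imp_le) (use CJ in simp)
qed

text \<open>The choice in \<open>sobolev_trace\<close> is meaningful because the restrictions of
  approximating test functions are Cauchy on the surface by the trace bound.\<close>

lemma has_trace_sobolev_trace:
 assumes f: "f \<in> H1" shows "has_trace S f (sobolev_trace S f)"
proof -
 obtain \<psi> where a: "h1_approx \<psi> f" using h1_approx_ex[OF f] by blast
 note t = h1_approx_test[OF a]
 have "\<exists>g. square_integrable \<sigma> g \<and> (%n. sq_norm \<sigma> (%x. \<psi> n x - g x)) ----> 0"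
 proof (rule square_integrable_complete)
  fix e :: real assume "0 < e"
  hence "0 < e / sqrt Ctr" using Ctr(1) by simp
  from interp_norm_approx[OF a a f this] obtain N
   where N: "\<forall>m\<ge>N. \<forall>n\<ge>N. interp_norm (abs_l2 (%x. \<psi> m x - \<psi> n x)) < e / sqrt Ctr" by blast
  have "sq_norm \<sigma> (%x. \<psi> m x - \<psi> n x) < e" if "m \<ge> N" "n \<ge> N" for m n
   using le_less_trans[OF test_sigma(2)[OF test_diff[OF t[of m] t[of n]]]] N that Ctr(1)
   by (simp add: pos_less_divide_eq mult.commute)
  thus "\<exists>N. \<forall>m\<ge>N. \<forall>n\<ge>N. sq_norm \<sigma> (%x. \<psi> m x - \<psi> n x) < e" by blast
 qed (rule test_sigma(1)[OF t])
 then obtain g where g: "square_integrable \<sigma> g" "(%n. sq_norm \<sigma> (%x. \<psi> n x - g x)) ----> 0" by blast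
 have "(%k. LINT x|\<sigma>. (cmod (\<psi> k x - g x))^2) ----> 0"
  using tendsto_power[OF g(2), of 2] unfolding sq_norm_sq by simp
 hence "has_trace S f g" using a g(1) test_sigma(1)[OF t] unfolding has_trace_def h1_approx_def by blast
 thus ?thesis unfolding sobolev_trace_def by (rule someI[of "has_trace S f"])
qed

text \<open>Values of \<open>f\<close> in compressed normal coordinates. For e = 0 the surface is a
  null set and a representative says nothing there; the trace takes its place, with the
  representative that \<open>delta_form\<close> uses.\<close>

definition J :: "real => (real^'n) l2 => (real^'n) \<times> real => complex" where
 "J e f z = (if e = 0 then sobolev_trace S f (fst z) else brep f (kap e z))"

lemma L2_lim_brep_kap:
 assumes t: "!!k. test_function (\<psi> k)" and l: "(%k. abs_l2 (\<psi> k)) ----> f" and e: "0 < e" "e <= \<beta>"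
 shows "L2_lim Ms (%k z. \<psi> k (kap e z)) (J e f)"
proof -
 \<comment> \<open>This constant blows up as \<open>e\<close> tends to 0, which is harmless because
   only convergence at fixed \<open>e\<close> is at stake; the uniform bound comes from the test
   functions.\<close>
 define c where "c = \<beta> / e * K\<beta>"
 have c: "0 <= c" using e beta K\<beta>(1) by (simp add: c_def)
 have J: "J e f = (%z. brep f (kap e z))" using e by (auto simp: J_def)
 have bm: "brep f \<in> borel_measurable borel" by (rule brep)
 have n: "(\<integral>\<^sup>+z. ennreal ((cmod (brep f (kap e z)))^2) \<partial>Ms) <= ennreal (c * (sq_norm lborel (brep f))^2)"
  using nn_integral_kap_le[of "%y. ennreal ((cmod (brep f y))^2)", OF _ e, folded c_def] bm nn_integral_sq_norm[OF brep(3), of f] c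
  by (simp add: ennreal_mult')
 have d: "sq_norm Ms (%z. \<psi> k (kap e z) - brep f (kap e z)) <= sqrt c * norm (abs_l2 (\<psi> k) - f)" for k
 proof -
  have pm: "\<psi> k \<in> borel_measurable borel" by (rule test_borel[OF t])
  have "(\<integral>\<^sup>+z. ennreal ((cmod (\<psi> k (kap e z) - brep f (kap e z)))^2) \<partial>Ms) <= ennreal c * (\<integral>\<^sup>+y. ennreal ((cmod (\<psi> k y - brep f y))^2) \<partial>lborel)"
   using nn_integral_kap_le[of "%y. ennreal ((cmod (\<psi> k y - brep f y))^2)", OF _ e, folded c_def] bm pm by simp
  also have "(\<integral>\<^sup>+y. ennreal ((cmod (\<psi> k y - brep f y))^2) \<partial>lborel) = (\<integral>\<^sup>+y. ennreal ((cmod (brep (abs_l2 (\<psi> k)) y - brep f y))^2) \<partial>lborel)"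
   by (rule nn_integral_cong_AE) (use brep_test[OF t[of k]] in eventually_elim, simp)
  finally have le: "(\<integral>\<^sup>+z. ennreal ((cmod (\<psi> k (kap e z) - brep f (kap e z)))^2) \<partial>Ms) <= ennreal (c * (norm (abs_l2 (\<psi> k) - f))^2)"
   unfolding brep_dist using c by (simp add: ennreal_mult')
  have "(sq_norm Ms (%z. \<psi> k (kap e z) - brep f (kap e z)))^2 <= c * (norm (abs_l2 (\<psi> k) - f))^2"
   by (rule square_integrableI_nn(2)[OF _ le]) (use bm pm c in auto)
  also have "... = (sqrt c * norm (abs_l2 (\<psi> k) - f))^2" using c by (simp add: power_mult_distrib)
  finally show ?thesis by (rule power2_le_imp_le) (use c in simp)
 qed
 have "(%k. sqrt c * norm (abs_l2 (\<psi> k) - f)) ----> sqrt c * norm (f - f)" by (intro tendsto_intros l)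
 hence "(%k. sq_norm Ms (%z. \<psi> k (kap e z) - brep f (kap e z))) ----> 0"
  by (intro tendsto_0_le[OF _ _ d]) auto
 thus ?thesis unfolding L2_lim_def J using e
  by (auto intro!: test_kap t square_integrableI_nn(1)[OF measurable_compose[OF kap_measurable bm] n] mult_nonneg_nonneg c)
qed

text \<open>For e = 0 the trace is a limit along some particular approximating sequence; any two
  such sequences have the same limit because their difference tends to 0 in
  \<open>interp_norm\<close>, which bounds the restrictions.\<close>

lemma L2_lim_J:
 assumes f: "f \<in> H1" and a: "h1_approx \<psi> f" and e: "0 <= e" "e <= \<beta>"
 shows "L2_lim Ms (%k z. \<psi> k (kap e z)) (J e f)"
proof (cases "e = 0")
 case False
 thus ?thesis using a e by (intro L2_lim_brep_kap) (auto simp: h1_approx_def)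
next
 case True
 define T where "T = sobolev_trace S f"
 obtain \<xi> where T: "square_integrable \<sigma> T" "h1_approx \<xi> f" "!!k. square_integrable \<sigma> (\<xi> k)" "(%k. LINT x|\<sigma>. (cmod (\<xi> k x - T x))^2) ----> 0"
  using has_trace_sobolev_trace[OF f, folded T_def] unfolding has_trace_def h1_approx_def by blast
 note t = h1_approx_test[OF a] h1_approx_test[OF T(2)]
 have "(%k. sqrt (2 * \<beta>) * sq_norm \<sigma> (%x. \<xi> k x - T x)) ----> sqrt (2 * \<beta>) * sqrt 0"
  unfolding sq_norm_def by (intro tendsto_intros T(4))
 hence 1: "L2_lim Ms (%k z. \<xi> k (kap 0 z)) (%z. T (fst z))"
  unfolding L2_lim_def kap_zero using square_integrable_Ms_fst(2)[OF square_integrable_diff[OF T(3,1)]]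
  by (simp add: square_integrable_Ms_fst(1) T)
 have "(%k. sq_norm Ms (%z. (\<psi> k (kap 0 z) - \<xi> k (kap 0 z)) - 0)) ----> 0"
 proof (rule LIMSEQ_I)
  fix r :: real assume "0 < r"
  hence "0 < r / CJ" using CJ by simp
  from interp_norm_approx[OF a T(2) f this] obtain N where N: "!!n. n \<ge> N ==> interp_norm (abs_l2 (%x. \<psi> n x - \<xi> n x)) < r / CJ" by blast
  have "norm (sq_norm Ms (%z. (\<psi> n (kap 0 z) - \<xi> n (kap 0 z)) - 0) - 0) < r" if "n \<ge> N" for n
   using le_less_trans[OF test_kap(2)[OF test_diff[OF t(1)[of n] t(2)[of n]], of 0]] N[OF that] CJ beta
   by (simp add: pos_less_divide_eq mult.commute)
  thus "\<exists>N. \<forall>n\<ge>N. norm (sq_norm Ms (%z. (\<psi> n (kap 0 z) - \<xi> n (kap 0 z)) - 0) - 0) < r" by blast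
 qed
 hence 2: "L2_lim Ms (%k z. \<psi> k (kap 0 z) - \<xi> k (kap 0 z)) (%_. 0)"
  unfolding L2_lim_def using beta by (auto intro!: square_integrable_diff test_kap t simp: square_integrable_def[of _ "%_. 0"])
 have "J e f = (%z. T (fst z))" using True by (auto simp: J_def T_def)
 thus ?thesis using L2_lim_add[OF 2 1] True by simp
qed

lemma J_square_integrable:
 assumes "f \<in> H1" "0 <= e" "e <= \<beta>" shows "square_integrable Ms (J e f)"
 using h1_approx_ex[OF assms(1)] L2_lim_J[OF assms(1) _ assms(2,3)] by (auto simp: L2_lim_def)

lemma J_bound:
 assumes f: "f \<in> H1" and e: "0 <= e" "e <= \<beta>" shows "sq_norm Ms (J e f) <= CJ * interp_norm f"
proof -
 obtain \<psi> where a: "h1_approx \<psi> f" using h1_approx_ex[OF f] by blast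
 have l: "(%k. CJ * interp_norm (abs_l2 (\<psi> k))) ----> CJ * interp_norm f"
  unfolding interp_norm_def by (intro tendsto_intros h1_approx_bound[OF a])
 show ?thesis
  by (rule LIMSEQ_le[OF L2_lim_norm[OF L2_lim_J[OF f a e]] l]) (use test_kap(2)[OF h1_approx_test[OF a] e] in auto)
qed

lemma J_add:
 assumes f: "f \<in> H1" and g: "g \<in> H1" and e: "0 <= e" "e <= \<beta>"
 shows "AE z in Ms. J e (f + g) z = J e f z + J e g z"
proof -
 obtain \<psi> \<xi> where a: "h1_approx \<psi> f" "h1_approx \<xi> g" using h1_approx_ex[OF f] h1_approx_ex[OF g] by blast
 show ?thesis
  by (rule L2_lim_unique[OF L2_lim_J[OF sobolev_1_add[OF f g] h1_approx_add[OF a f g] e] L2_lim_add[OF L2_lim_J[OF f a(1) e] L2_lim_J[OF g a(2) e]]])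
qed

lemma J_scale:
 assumes f: "f \<in> H1" and e: "0 <= e" "e <= \<beta>"
 shows "AE z in Ms. J e (scaleC_l2 c f) z = c * J e f z"
proof -
 obtain \<psi> where a: "h1_approx \<psi> f" using h1_approx_ex[OF f] by blast
 show ?thesis
  by (rule L2_lim_unique[OF L2_lim_J[OF sobolev_1_scaleC[OF f] h1_approx_scale[OF a f] e] L2_lim_scale[OF L2_lim_J[OF f a e]]])
qed

definition "Dst e f = sq_norm Ms (%z. J e f z - J 0 f z)"

lemma Dst_add:
 assumes f: "f \<in> H1" and g: "g \<in> H1" and e: "0 <= e" "e <= \<beta>"
 shows "Dst e (f + g) <= Dst e f + Dst e g"
proof -
 have z: "0 <= (0::real)" "0 <= \<beta>" using beta by auto
 note s = J_square_integrable[OF _ e] J_square_integrable[OF _ z]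
 note d = square_integrable_diff[OF s(1)[OF f] s(2)[OF f]] square_integrable_diff[OF s(1)[OF g] s(2)[OF g]]
 have "Dst e (f + g) = sq_norm Ms (%z. (J e f z - J 0 f z) + (J e g z - J 0 g z))"
  unfolding Dst_def
 proof (rule sq_norm_cong_AE)
  show "AE z in Ms. J e (f + g) z - J 0 (f + g) z = J e f z - J 0 f z + (J e g z - J 0 g z)"
   using J_add[OF f g e] J_add[OF f g z] by eventually_elim simp
 qed (use square_integrable_add[OF d] square_integrable_diff[OF s(1)[OF sobolev_1_add[OF f g]] s(2)[OF sobolev_1_add[OF f g]]]
   in \<open>simp_all add: square_integrable_def\<close>)
 thus ?thesis using sq_norm_triangle[OF d] by (simp add: Dst_def)
qed

lemma Dst_bound:
 assumes f: "f \<in> H1" and e: "0 <= e" "e <= \<beta>" shows "Dst e f <= 2 * CJ * interp_norm f"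
proof -
 have z: "0 <= (0::real)" "0 <= \<beta>" using beta by auto
 show ?thesis
  using sq_norm_triangle[OF J_square_integrable[OF f e] square_integrable_uminus[OF J_square_integrable[OF f z]]] J_bound[OF f e] J_bound[OF f z]
  by (simp add: Dst_def sq_norm_def)
qed

lemma Dst_test:
 assumes t: "test_function \<psi>" and e: "0 < e" "e <= \<beta>"
 shows "sq_norm Ms (%z. \<psi> (kap e z) - \<psi> (kap 0 z)) <= 2 * e * (\<Sum>j\<in>UNIV. sq_norm Ms (%z. pD j \<psi> (kap e z)))"
proof -
 note tp = test_partial_deriv[OF t]
 have m [measurable]: "\<psi> \<in> borel_measurable borel" by (rule test_borel[OF t])
 have mg [measurable]: "grad_norm \<psi> \<in> borel_measurable borel" by (rule borel_measurable_continuous_onI[OF grad_norm_continuous[OF t]])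
 define H where "H p = ennreal ((cmod (\<psi> (fst p + snd p *\<^sub>R \<nu> (fst p)) - \<psi> (fst p)))^2)" for p
 have mH: "H \<in> borel_measurable \<sigma>t"
 proof -
  have "(%p. ennreal ((cmod (\<psi> (\<iota> p) - \<psi> (fst p)))^2)) \<in> borel_measurable \<sigma>t" by measurable
  thus ?thesis by (simp add: H_def[abs_def] normal_shift_def case_prod_beta)
 qed
 define P where "P = (\<Sum>j\<in>UNIV. (sq_norm Ms (%z. pD j \<psi> (kap e z)))^2)"
 have "(\<integral>\<^sup>+z. ennreal ((cmod (\<psi> (kap e z) - \<psi> (kap 0 z)))^2) \<partial>Ms) = (\<integral>\<^sup>+z. H (fst z, e / \<beta> * snd z) \<partial>Ms)"
  by (simp add: H_def kap_def normal_shift_def)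
 also have "... <= ennreal (\<beta> / e) * (ennreal (2 * e^2) * (\<integral>\<^sup>+y. ennreal ((grad_norm \<psi> y)^2) \<partial>layer_measure e))"
  unfolding nn_integral_Ms_scale[OF mH e(1)] using difference_test[OF t e(1)] by (auto simp: H_def intro: mult_left_mono)
 also have "... = ennreal (2 * e^2) * (\<integral>\<^sup>+z. ennreal ((grad_norm \<psi> (kap e z))^2) \<partial>Ms)"
  by (subst nn_integral_kap[OF _ e(1)]) (auto simp: mult_ac)
 also have "(\<integral>\<^sup>+z. ennreal ((grad_norm \<psi> (kap e z))^2) \<partial>Ms) = ennreal P"
 proof -
  have "(\<integral>\<^sup>+z. ennreal ((grad_norm \<psi> (kap e z))^2) \<partial>Ms) = (\<integral>\<^sup>+z. (\<Sum>j\<in>UNIV. ennreal ((cmod (pD j \<psi> (kap e z)))^2)) \<partial>Ms)"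
   by (simp add: grad_norm_sq sum_ennreal)
  also have "... = (\<Sum>j\<in>UNIV. (\<integral>\<^sup>+z. ennreal ((cmod (pD j \<psi> (kap e z)))^2) \<partial>Ms))"
   using test_borel[OF tp] by (intro nn_integral_sum) auto
  also have "... = ennreal P"
   using e by (simp add: P_def nn_integral_sq_norm[OF test_kap(1)[OF tp]] sum_ennreal)
  finally show ?thesis .
 qed
 finally have le: "(\<integral>\<^sup>+z. ennreal ((cmod (\<psi> (kap e z) - \<psi> (kap 0 z)))^2) \<partial>Ms) <= ennreal (2 * e^2 * P)" by (simp add: ennreal_mult')
 have P: "0 <= P" "P <= (\<Sum>j\<in>UNIV. sq_norm Ms (%z. pD j \<psi> (kap e z)))^2"
  using power_mono[OF L2_set_le_sum L2_set_nonneg, of UNIV "%j. sq_norm Ms (%z. pD j \<psi> (kap e z))" 2]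
  by (auto simp: P_def L2_set_def sum_nonneg)
 have "(sq_norm Ms (%z. \<psi> (kap e z) - \<psi> (kap 0 z)))^2 <= 2 * e^2 * P"
  by (rule square_integrableI_nn(2)[OF _ le]) (use P in auto)
 also have "... <= (2 * e * (\<Sum>j\<in>UNIV. sq_norm Ms (%z. pD j \<psi> (kap e z))))^2"
  unfolding power_mult_distrib using P by (intro mult_mono) auto
 finally show ?thesis by (rule power2_le_imp_le) (use e in \<open>auto intro!: mult_nonneg_nonneg sum_nonneg\<close>)
qed

lemma Dst_H2:
 assumes f: "f \<in> sobolev 2" and e: "0 < e" "e <= \<beta>"
 shows "Dst e f <= 2 * CJ * e * (\<Sum>j\<in>UNIV. interp_norm (wD j f))"
proof -
 note f1 = sobolev_2D(1)[OF f]
 obtain \<psi> where a: "h1_approx \<psi> f" using h1_approx_ex[OF f1] by blast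
 note t = h1_approx_test[OF a]
 have l1: "(%k. sq_norm Ms (%z. \<psi> k (kap e z) - \<psi> k (kap 0 z))) ----> Dst e f"
  unfolding Dst_def using e beta by (intro L2_lim_norm[OF L2_lim_diff] L2_lim_J f1 a) auto
 have l2: "(%k. 2 * e * (\<Sum>j\<in>UNIV. sq_norm Ms (%z. pD j (\<psi> k) (kap e z)))) ----> 2 * e * (\<Sum>j\<in>UNIV. sq_norm Ms (J e (wD j f)))"
  by (intro tendsto_intros L2_lim_norm L2_lim_brep_kap test_partial_deriv t e) (use a in \<open>simp add: h1_approx_def\<close>)
 have "Dst e f <= 2 * e * (\<Sum>j\<in>UNIV. sq_norm Ms (J e (wD j f)))"
  by (rule LIMSEQ_le[OF l1 l2]) (use Dst_test[OF t e] in auto)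
 also have "... <= 2 * e * (\<Sum>j\<in>UNIV. CJ * interp_norm (wD j f))"
  using e by (intro mult_left_mono sum_mono J_bound sobolev_2D(2)[OF f]) auto
 finally show ?thesis by (simp add: sum_distrib_left mult_ac)
qed

end

section \<open>Comparison of the potential forms\<close>

text \<open>Measures within a factor \<open>k\<close> of each other give integrals of nonnegative
  functions that differ by at most k - 1 times the integral. Positive and negative parts add up to
  the absolute value, and the factor 2 pays for real and imaginary parts.\<close>

lemma integral_compare:
 fixes F :: "'a => complex"
 assumes sets: "sets N = sets M" and le: "M <= scale_measure (ennreal k) N" "N <= scale_measure (ennreal k) M" and k: "1 <= k"
  and F: "integrable M F"
 shows "cmod ((LINT x|N. F x) - (LINT x|M. F x)) <= 2 * (k - 1) * (LINT x|M. cmod (F x))"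
proof -
 have nn: "(\<integral>\<^sup>+x. h x \<partial>P) <= ennreal k * (\<integral>\<^sup>+x. h x \<partial>R)"
  if "P <= scale_measure (ennreal k) R" "sets P = sets R" "h \<in> borel_measurable R" for P R :: "'a measure" and h
  using nn_integral_mono_measure[of P "scale_measure (ennreal k) R" h] that by (simp add: nn_integral_scale_measure)
 have pos: "integrable N f" "\<bar>(LINT x|N. f x) - (LINT x|M. f x)\<bar> <= (k - 1) * (LINT x|M. f x)"
  if f: "integrable M f" "!!x. 0 <= f x" for f :: "'a => real"
 proof -
  have m: "f \<in> borel_measurable M" "f \<in> borel_measurable N" using f(1) measurable_cong_sets[OF sets refl] by auto
  have a: "(\<integral>\<^sup>+x. ennreal (f x) \<partial>M) = ennreal (LINT x|M. f x)" using f by (intro nn_integral_eq_integral) auto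
  have le1: "(\<integral>\<^sup>+x. ennreal (f x) \<partial>N) <= ennreal (k * (LINT x|M. f x))"
   using nn[OF le(2) sets, of "%x. ennreal (f x)"] m a k by (simp add: ennreal_mult')
  thus i: "integrable N f" using m f(2) by (intro integrableI_nonneg) (auto simp: le_less_trans)
  have b: "(\<integral>\<^sup>+x. ennreal (f x) \<partial>N) = ennreal (LINT x|N. f x)" using f i by (intro nn_integral_eq_integral) auto
  have p: "0 <= (LINT x|M. f x)" "0 <= (LINT x|N. f x)" using f(2) by auto
  have 1: "(LINT x|N. f x) <= k * (LINT x|M. f x)" using le1 b p k by simp
  have 2: "(LINT x|M. f x) <= k * (LINT x|N. f x)"
   using nn[OF le(1) sets[symmetric], of "%x. ennreal (f x)"] m a b p k by (simp add: ennreal_mult'[symmetric])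
  show "\<bar>(LINT x|N. f x) - (LINT x|M. f x)\<bar> <= (k - 1) * (LINT x|M. f x)"
  proof (cases "(LINT x|M. f x) <= (LINT x|N. f x)")
   case False
   \<comment> \<open>When the integral over \<open>N\<close> is the smaller one, the error (k - 1)
     times it is at most (k - 1) times the integral over \<open>M\<close>, so the bound can always
     be stated with \<open>M\<close>.\<close>
   hence "(k - 1) * (LINT x|N. f x) <= (k - 1) * (LINT x|M. f x)" using k by (intro mult_left_mono) auto
   thus ?thesis using 2 False by (simp add: left_diff_distrib)
  qed (use 1 in \<open>simp add: left_diff_distrib\<close>)
 qed
 have real: "integrable N f" "\<bar>(LINT x|N. f x) - (LINT x|M. f x)\<bar> <= (k - 1) * (LINT x|M. \<bar>f x\<bar>)" if f: "integrable M f" for f :: "'a => real"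
 proof -
  have "integrable M (%x. max (f x) 0)" "integrable M (%x. max (- f x) 0)" using f by auto
  note p = pos[OF this(1)] pos[OF this(2)] this
  have fe: "f = (%x. max (f x) 0 - max (- f x) 0)" and ae: "(%x. \<bar>f x\<bar>) = (%x. max (f x) 0 + max (- f x) 0)" by (auto simp: fun_eq_iff)
  show "integrable N f" by (subst fe) (use p in auto)
  have "(LINT x|N. f x) = (LINT x|N. max (f x) 0) - (LINT x|N. max (- f x) 0)" by (subst fe, rule Bochner_Integration.integral_diff; use p in simp)
  moreover have "(LINT x|M. f x) = (LINT x|M. max (f x) 0) - (LINT x|M. max (- f x) 0)" by (subst fe, rule Bochner_Integration.integral_diff; use p in simp)
  moreover have "(LINT x|M. \<bar>f x\<bar>) = (LINT x|M. max (f x) 0) + (LINT x|M. max (- f x) 0)" unfolding ae by (rule Bochner_Integration.integral_add; use p in simp)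
  ultimately show "\<bar>(LINT x|N. f x) - (LINT x|M. f x)\<bar> <= (k - 1) * (LINT x|M. \<bar>f x\<bar>)"
   using p(2,4) by (simp add: distrib_left)
 qed
 have R: "integrable M (%x. Re (F x))" "integrable M (%x. Im (F x))" using F by auto
 have "integrable N (%x. complex_of_real (Re (F x)) + \<i> * complex_of_real (Im (F x)))"
  using real(1)[OF R(1)] real(1)[OF R(2)] by (intro Bochner_Integration.integrable_add integrable_mult_right integrable_of_real)
 hence FN: "integrable N F" by (simp add: complex_eq[symmetric])
 have "cmod ((LINT x|N. F x) - (LINT x|M. F x)) <= \<bar>Re ((LINT x|N. F x) - (LINT x|M. F x))\<bar> + \<bar>Im ((LINT x|N. F x) - (LINT x|M. F x))\<bar>"
  by (rule cmod_le)
 also have "... = \<bar>(LINT x|N. Re (F x)) - (LINT x|M. Re (F x))\<bar> + \<bar>(LINT x|N. Im (F x)) - (LINT x|M. Im (F x))\<bar>"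
  using F FN by simp
 also have "... <= (k - 1) * (LINT x|M. cmod (F x)) + (k - 1) * (LINT x|M. cmod (F x))"
  by (intro add_mono order_trans[OF real(2)[OF R(1)]] order_trans[OF real(2)[OF R(2)]] mult_left_mono integral_mono)
   (use F R k in \<open>auto intro: abs_Re_le_cmod abs_Im_le_cmod\<close>)
 finally show ?thesis by (simp add: algebra_simps)
qed

text \<open>A Lebesgue measurable potential cannot be composed safely with the normal coordinates,
  so a bounded Borel version \<open>V0\<close> accompanies it; the exceptional null set is tracked
  through the rescaling.\<close>

locale hypersurface_potential = admissible_hypersurface I \<phi> U V' S \<nu> \<beta>
 for I :: "'i set" and \<phi> :: "'i => real^'m::finite => real^'n::finite" and U V' S \<nu> \<beta> +
 fixes V V0 :: "real^'n => real" and VB :: real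
 assumes V0 [measurable]: "V0 \<in> borel_measurable borel" and V0_bound: "\<bar>V0 x\<bar> <= VB"
  and V_V0: "AE x in lborel. V x = V0 x"
begin

lemma VB: "0 <= VB" using V0_bound[of 0] by linarith

lemma AE_kap:
 assumes P: "AE x in lborel. P x" and e: "0 < e" "e <= \<beta>" shows "AE z in Ms. P (kap e z)"
proof -
 obtain N where N: "{x \<in> space lborel. \<not> P x} \<subseteq> N" "emeasure lborel N = 0" "N \<in> sets lborel" using P by (rule AE_E)
 have m: "(%z. indicator N (kap e z) :: ennreal) \<in> borel_measurable Ms"
  by (rule measurable_compose[OF kap_measurable]) (use N(3) in simp)
 have "(\<integral>\<^sup>+z. indicator N (kap e z) \<partial>Ms) = (0::ennreal)"
  using nn_integral_kap_le[of "indicator N", OF _ e] N by simp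
 hence "AE z in Ms. indicator N (kap e z) = (0::ennreal)" using nn_integral_0_iff_AE[OF m] by simp
 thus ?thesis by eventually_elim (use N(1) in \<open>auto simp: indicator_def split: if_splits\<close>)
qed

definition "wgt z = V0 (kap \<beta> z)"

lemma wgt [measurable]: "wgt \<in> borel_measurable Ms" and wgt_bound: "\<bar>wgt z\<bar> <= VB"
 unfolding wgt_def[abs_def] by (rule measurable_compose[OF kap_measurable V0]) (rule V0_bound)

text \<open>The potential form in compressed normal coordinates with the Jacobian omitted. For e = 0
  it is the delta interaction.\<close>

definition "bt e f g = (LINT z|Ms. of_real (wgt z) * J e f z * cnj (J e g z))"

lemmas wgt_form = sq_norm_weighted_bound[OF _ _ wgt AE_I2[OF wgt_bound] VB]

lemma bt_relative_form:
 assumes e: "0 <= e" "e <= \<beta>" shows "relative_form (bt e) (VB * CJ^2)"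
proof
 note s = J_square_integrable[OF _ e]
 note i = wgt_form(1)[OF s s]
 fix f g h :: "(real^'n) l2" and a :: complex
 assume f: "f \<in> H1" and h: "h \<in> H1"
 show "bt e (scaleC_l2 a f) h = a * bt e f h"
 proof -
  have "bt e (scaleC_l2 a f) h = (LINT z|Ms. a * (of_real (wgt z) * J e f z * cnj (J e h z)))"
   unfolding bt_def
   by (rule integral_cong_AE) (use i[OF sobolev_1_scaleC[OF f] h] i[OF f h] J_scale[OF f e, of a] in \<open>auto elim: eventually_mono\<close>)
  thus ?thesis by (simp add: bt_def)
 qed
 show "bt e f h = cnj (bt e h f)" unfolding bt_def Bochner_Integration.integral_cnj[symmetric] by (simp add: mult_ac)
 show "cmod (bt e f h) <= VB * CJ^2 * (interp_norm f * interp_norm h)"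
 proof -
  have "cmod (bt e f h) <= VB * (sq_norm Ms (J e f) * sq_norm Ms (J e h))" unfolding bt_def by (rule wgt_form(4)[OF s[OF f] s[OF h]])
  also have "... <= VB * ((CJ * interp_norm f) * (CJ * interp_norm h))"
   using CJ by (intro mult_left_mono mult_mono J_bound f h e VB) auto
  finally show ?thesis by (simp add: power2_eq_square mult_ac)
 qed
 assume g: "g \<in> H1"
 show "bt e (f + g) h = bt e f h + bt e g h"
 proof -
  have "bt e (f + g) h = (LINT z|Ms. of_real (wgt z) * J e f z * cnj (J e h z) + of_real (wgt z) * J e g z * cnj (J e h z))"
   unfolding bt_def
   by (rule integral_cong_AE) (use i[OF sobolev_1_add[OF f g] h] i[OF f h] i[OF g h] J_add[OF f g e] in \<open>auto elim: eventually_mono simp: algebra_simps\<close>)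
  thus ?thesis unfolding bt_def using i[OF f h] i[OF g h] by simp
 qed
qed (use VB in simp)

text \<open>One factor is changed at a time, so each term contains a single difference, measured by
  \<open>Dst\<close>, beside a bounded factor.\<close>

lemma bt_diff:
 assumes f: "f \<in> H1" and g: "g \<in> H1" and e: "0 <= e" "e <= \<beta>"
 shows "cmod (bt e f g - bt 0 f g) <= VB * CJ * (Dst e f * interp_norm g + interp_norm f * Dst e g)"
proof -
 have z: "0 <= (0::real)" "0 <= \<beta>" using beta by auto
 note s = J_square_integrable[OF _ e] J_square_integrable[OF _ z]
 note d = square_integrable_diff[OF s(1)[OF f] s(2)[OF f]] square_integrable_diff[OF s(1)[OF g] s(2)[OF g]]
 note w1 = wgt_form[OF d(1) s(1)[OF g]] and w2 = wgt_form[OF s(2)[OF f] d(2)]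
 have "bt e f g - bt 0 f g = (LINT z|Ms. of_real (wgt z) * J e f z * cnj (J e g z) - of_real (wgt z) * J 0 f z * cnj (J 0 g z))"
  unfolding bt_def by (rule Bochner_Integration.integral_diff[symmetric]; rule wgt_form(1); intro s f g)
 also have "... = (LINT z|Ms. of_real (wgt z) * (J e f z - J 0 f z) * cnj (J e g z) + of_real (wgt z) * J 0 f z * cnj (J e g z - J 0 g z))"
  by (simp add: algebra_simps)
 also have "... = (LINT z|Ms. of_real (wgt z) * (J e f z - J 0 f z) * cnj (J e g z)) + (LINT z|Ms. of_real (wgt z) * J 0 f z * cnj (J e g z - J 0 g z))"
  by (rule Bochner_Integration.integral_add[OF w1(1) w2(1)])
 finally have "cmod (bt e f g - bt 0 f g) <= VB * (Dst e f * sq_norm Ms (J e g)) + VB * (sq_norm Ms (J 0 f) * Dst e g)"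
  unfolding Dst_def by (simp only: norm_triangle_le[OF add_mono[OF w1(4) w2(4)]])
 also have "... <= VB * (Dst e f * (CJ * interp_norm g)) + VB * ((CJ * interp_norm f) * Dst e g)"
  by (rule add_mono[OF mult_left_mono[OF mult_left_mono[OF J_bound[OF g e]] VB] mult_left_mono[OF mult_right_mono[OF J_bound[OF f z]] VB]])
   (simp_all add: Dst_def)
 finally show ?thesis by (simp add: algebra_simps)
qed

text \<open>At e = 0 the functions do not depend on \<open>s\<close>, and Fubini integrates the
  weight along each normal, which gives \<alpha>.\<close>

lemma delta_form_bt:
 assumes \<alpha>: "AE x in \<sigma>. \<alpha> x = (LINT s:{-\<beta>..\<beta>}|lebesgue. V (x + s *\<^sub>R \<nu> x))" and \<alpha>m [measurable]: "\<alpha> \<in> borel_measurable \<sigma>"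
  and f: "f \<in> H1" and g: "g \<in> H1"
 shows "delta_form S \<alpha> f g = grad_form f g - bt 0 f g"
proof -
 define Tf Tg where "Tf = sobolev_trace S f" and "Tg = sobolev_trace S g"
 have [measurable]: "Tf \<in> borel_measurable \<sigma>" "Tg \<in> borel_measurable \<sigma>"
  using has_trace_sobolev_trace[OF f] has_trace_sobolev_trace[OF g] by (auto simp: has_trace_def square_integrable_def Tf_def Tg_def)
 have J: "J 0 f = (%z. Tf (fst z))" "J 0 g = (%z. Tg (fst z))" by (auto simp: J_def Tf_def Tg_def)
 have b0: "0 <= \<beta>" using beta by simp
 define h where "h z = of_real (wgt z) * Tf (fst z) * cnj (Tg (fst z))" for z
 have i: "integrable Ms h"
  using wgt_form(1)[OF J_square_integrable[OF f order_refl b0] J_square_integrable[OF g order_refl b0]] unfolding J h_def[abs_def] .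
 have k1: "kap \<beta> (x, s) = x + s *\<^sub>R \<nu> x" for x s using beta by (simp add: kap_def normal_shift_def)
 have "AE z in Ms. V (kap \<beta> z) = V0 (kap \<beta> z)" using AE_kap[OF V_V0 beta order_refl] .
 hence "AE x in \<sigma>. AE s in Lb. V (kap \<beta> (x, s)) = V0 (kap \<beta> (x, s))" by (rule sigmaL.AE_pair)
 hence in_eq: "AE x in \<sigma>. (LINT s|Lb. h (x, s)) = of_real (\<alpha> x) * Tf x * cnj (Tg x)"
  using \<alpha> AE_space
 proof eventually_elim
  case (elim x)
  have wm: "(%s. wgt (x, s)) \<in> borel_measurable borel" using measurable_Pair2[OF wgt, of x] elim(3) by simp
  have "AE s in lborel. s \<in> {-\<beta><..<\<beta>} --> V (kap \<beta> (x, s)) = V0 (kap \<beta> (x, s))"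
   using elim(1) unfolding Lb_def by (subst (asm) AE_density) (auto simp: indicator_def)
  \<comment> \<open>The open interval of \<open>Lb\<close> and the closed one in the formula for
    \<alpha> differ by two endpoints, a null set.\<close>
  hence ae: "AE s in lborel. indicator {-\<beta><..<\<beta>} s *\<^sub>R wgt (x, s) = indicator {-\<beta>..\<beta>} s *\<^sub>R V (x + s *\<^sub>R \<nu> x)"
   using AE_lborel_singleton[of \<beta>] AE_lborel_singleton[of "-\<beta>"] by eventually_elim (auto simp: indicator_def wgt_def k1)
  have m: "(%s. indicator {-\<beta><..<\<beta>} s *\<^sub>R wgt (x, s)) \<in> borel_measurable borel" using wm by measurable
  have ae': "AE s in lebesgue. indicator {-\<beta><..<\<beta>} s *\<^sub>R wgt (x, s) = indicator {-\<beta>..\<beta>} s *\<^sub>R V (x + s *\<^sub>R \<nu> x)"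
   using ae unfolding AE_lborel_lebesgue .
  have mL: "(%s. indicator {-\<beta><..<\<beta>} s *\<^sub>R wgt (x, s)) \<in> borel_measurable lebesgue" using m by (intro measurable_completion) simp
  \<comment> \<open>\<open>V\<close> along this normal is only almost everywhere equal to a Borel
    function; it is measurable because Lebesgue measure is complete.\<close>
  have "\<alpha> x = (LINT s|lebesgue. indicator {-\<beta><..<\<beta>} s *\<^sub>R wgt (x, s))"
   unfolding elim(2) set_lebesgue_integral_def
   by (rule integral_cong_AE[OF borel_measurable_AE[OF mL ae'] mL]) (use ae' in \<open>auto elim: eventually_mono\<close>)
  also have "... = (LINT s|lborel. indicator {-\<beta><..<\<beta>} s *\<^sub>R wgt (x, s))" by (rule integral_completion) (use m in simp)
  also have "... = (LINT s|Lb. wgt (x, s))"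
   unfolding Lb_def using wm integral_density[of "%s. wgt (x, s)" lborel "indicator {-\<beta><..<\<beta>}"] by (simp add: ennreal_indicator)
  finally show ?case by (simp add: h_def integral_complex_of_real)
 qed
 have "bt 0 f g = (LINT z|Ms. h z)" by (simp add: bt_def J h_def[abs_def])
 also have "... = (LINT x|\<sigma>. LINT s|Lb. h (x, s))" by (rule sigmaL.integral_fst'[OF i, symmetric])
 also have "... = (LINT x|\<sigma>. of_real (\<alpha> x) * Tf x * cnj (Tg x))"
  by (rule integral_cong_AE[OF _ _ in_eq]) (use borel_measurable_integrable[OF sigmaL.integrable_fst'[OF i]] in simp_all)
 finally show ?thesis by (simp add: delta_form_def grad_form_def Tf_def Tg_def)
qed

section \<open>The scaled potentials\<close>

abbreviation "Vs e \<equiv> scaled_potential S \<nu> \<beta> V e"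
abbreviation "Vs0 e \<equiv> scaled_potential S \<nu> \<beta> V0 e"

lemma scaled_kap:
 assumes e: "0 < e" "e <= \<beta>" and z: "fst z \<in> S" "\<bar>snd z\<bar> < \<beta>"
 shows "kap e z \<in> layer S \<nu> e" "scaled_potential S \<nu> \<beta> W e (kap e z) = \<beta> / e * W (kap \<beta> z)"
proof -
 have "\<bar>e / \<beta> * snd z\<bar> < e" using mult_strict_left_mono[of "\<bar>snd z\<bar>" \<beta> "e / \<beta>"] e beta z by (simp add: abs_mult)
 hence m: "(fst z, e / \<beta> * snd z) \<in> S \<times> {-e<..<e}" unfolding abs_less_iff using z(1) by auto
 thus l: "kap e z \<in> layer S \<nu> e" unfolding kap_def layer_def by blast
 have "inj_on \<iota> (S \<times> {-e<..<e})" by (rule inj_on_subset[OF iota_inj]) (use e in auto)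
 hence "inv_into (S \<times> {-e<..<e}) \<iota> (kap e z) = (fst z, e / \<beta> * snd z)" unfolding kap_def using m by (rule inv_into_f_f)
 thus "scaled_potential S \<nu> \<beta> W e (kap e z) = \<beta> / e * W (kap \<beta> z)"
  using l e beta by (simp add: scaled_potential_def kap_def)
qed

lemma AE_Ms: "AE z in Ms. fst z \<in> S \<and> \<bar>snd z\<bar> < \<beta>"
proof -
 have "AE x in \<sigma>. AE s in Lb. x \<in> S \<and> \<bar>s\<bar> < \<beta>"
  using AE_space by eventually_elim (use AE_Lb in \<open>auto elim: eventually_mono\<close>)
 moreover have "{z \<in> space Ms. fst z \<in> S \<and> \<bar>snd z\<bar> < \<beta>} = S \<times> {-\<beta><..<\<beta>}" by (auto simp: space_Ms)
 hence "{z \<in> space Ms. fst z \<in> S \<and> \<bar>snd z\<bar> < \<beta>} \<in> sets Ms" unfolding Ms_sets using strip_sets by simp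
 ultimately show ?thesis using sigmaL.AE_pair_measure[of "%z. fst z \<in> S \<and> \<bar>snd z\<bar> < \<beta>"] by simp
qed

text \<open>The coordinates of a point of the layer depend measurably on it, because
  \<open>\<iota>\<close> sends measurable sets to Borel sets; the potential is then evaluated at the
  stretched coordinates.\<close>

lemma Vs0_measurable:
 assumes e: "0 < e" "e <= \<beta>" shows "Vs0 e \<in> borel_measurable borel"
proof -
 define p where "p = inv_into (S \<times> {-e<..<e}) \<iota>"
 have strip: "S \<times> {-e<..<e} \<subseteq> S \<times> {-\<beta><..<\<beta>}" using e by auto
 have p: "p x \<in> S \<times> {-e<..<e}" "\<iota> (p x) = x" if "x \<in> layer S \<nu> e" for x
  using that unfolding p_def layer_def by (auto intro: inv_into_into f_inv_into_f)
 have pi: "p (\<iota> z) = z" if "z \<in> S \<times> {-e<..<e}" for z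
  unfolding p_def by (rule inv_into_f_f[OF inj_on_subset[OF iota_inj strip] that])
 have pm: "p \<in> measurable (restrict_space borel (layer S \<nu> e)) \<sigma>t"
 proof (rule measurableI)
  show "p x \<in> space \<sigma>t" if "x \<in> space (restrict_space borel (layer S \<nu> e))" for x
   using p(1)[of x] that by (auto simp: space_restrict_space space_pair_measure)
  fix B assume B: "B \<in> sets \<sigma>t"
  have "p -` B \<inter> space (restrict_space borel (layer S \<nu> e)) = \<iota> ` (B \<inter> S \<times> {-e<..<e})"
  proof
   show "p -` B \<inter> space (restrict_space borel (layer S \<nu> e)) \<subseteq> \<iota> ` (B \<inter> S \<times> {-e<..<e})"
   proof
    fix x assume "x \<in> p -` B \<inter> space (restrict_space borel (layer S \<nu> e))"
    hence "x \<in> layer S \<nu> e" "p x \<in> B" by (auto simp: space_restrict_space)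
    thus "x \<in> \<iota> ` (B \<inter> S \<times> {-e<..<e})" using p[of x] image_eqI[of x \<iota> "p x"] by simp
   qed
  qed (auto simp: space_restrict_space layer_def pi)
  moreover have "\<iota> ` (B \<inter> S \<times> {-e<..<e}) \<in> sets borel"
   by (rule iota_image_borel[OF sets.Int[OF B strip_sets]]) (use strip in auto)
  ultimately show "p -` B \<inter> space (restrict_space borel (layer S \<nu> e)) \<in> sets (restrict_space borel (layer S \<nu> e))"
   by (subst sets_restrict_space_iff) (use layer_borel[OF e(2)] in \<open>auto simp: layer_def\<close>)
 qed
 define h where "h z = \<beta> / e * V0 (\<iota> (fst z, \<beta> / e * snd z))" for z
 have "h \<in> borel_measurable \<sigma>t"
  unfolding h_def[abs_def] using measurable_compose[OF measurable_compose[OF _ iota_measurable] V0, of "%z. (fst z, \<beta> / e * snd z)" \<sigma>t] by measurable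
 from measurable_compose[OF pm this]
 have "(%x. if x \<in> layer S \<nu> e then h (p x) else 0) \<in> borel_measurable borel"
  using measurable_restrict_space_iff[of "layer S \<nu> e" borel 0 borel "%x. h (p x)"] layer_borel[OF e(2)] by simp
 moreover have "Vs0 e = (%x. if x \<in> layer S \<nu> e then h (p x) else 0)"
  by (auto simp: fun_eq_iff scaled_potential_def p_def h_def case_prod_beta Let_def)
 ultimately show ?thesis by simp
qed

definition "Clay = (SOME C. 0 < C \<and> (\<forall>e. 0 < e --> e <= \<beta> / 4 --> (\<forall>D\<in>sets borel.
   emeasure (layer_measure e) D <= ennreal (1 + C * e) * emeasure lborel D \<and>
   (D \<subseteq> layer S \<nu> e --> emeasure lborel D <= ennreal (1 + C * e) * emeasure (layer_measure e) D))))"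

lemma Clay: "0 < Clay" "0 < e ==> e <= \<beta> / 4 ==> D \<in> sets borel ==> emeasure (layer_measure e) D <= ennreal (1 + Clay * e) * emeasure lborel D"
 "0 < e ==> e <= \<beta> / 4 ==> D \<in> sets borel ==> D \<subseteq> layer S \<nu> e ==> emeasure lborel D <= ennreal (1 + Clay * e) * emeasure (layer_measure e) D"
 using someI_ex[OF layer_measure_almost_lborel] unfolding Clay_def by blast+

text \<open>\<open>Mk\<close> is the model measure of the compressed coordinates and
  \<open>Nk\<close> the true one. The density \<beta> / e makes their total masses comparable, and
  they agree up to a factor 1 + O(e).\<close>

definition "Mk e = distr Ms borel (kap e)"

definition "Nk e = density lborel (%x. ennreal (\<beta> / e * indicator (layer S \<nu> e) x))"

lemma Mk_Nk:
 assumes e: "0 < e" "e <= \<beta> / 4"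
 shows "Mk e <= scale_measure (ennreal (1 + Clay * e)) (Nk e)" "Nk e <= scale_measure (ennreal (1 + Clay * e)) (Mk e)"
proof -
 have e': "e <= \<beta>" using e beta by simp
 have lb: "layer S \<nu> e \<in> sets borel" by (rule layer_borel[OF e'])
 have M: "emeasure (Mk e) D = ennreal (\<beta> / e) * emeasure (layer_measure e) (D \<inter> layer S \<nu> e)" if D: "D \<in> sets borel" for D
 proof -
  have "emeasure (Mk e) D = (\<integral>\<^sup>+x. indicator D x \<partial>Mk e)" using D by (simp add: Mk_def)
  also have "... = (\<integral>\<^sup>+z. indicator D (kap e z) \<partial>Ms)" unfolding Mk_def using D by (intro nn_integral_distr) auto
  also have "... = ennreal (\<beta> / e) * emeasure (layer_measure e) D"
   using nn_integral_kap[of "indicator D", OF _ e(1)] D by simp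
  also have "emeasure (layer_measure e) D = emeasure (layer_measure e) (D \<inter> layer S \<nu> e)"
   using D lb by (simp add: emeasure_layer_measure) (rule arg_cong[where f="emeasure \<sigma>t"], auto simp: layer_def)
  finally show ?thesis .
 qed
 have N: "emeasure (Nk e) D = ennreal (\<beta> / e) * emeasure lborel (D \<inter> layer S \<nu> e)" if D: "D \<in> sets borel" for D
 proof -
  have "emeasure (Nk e) D = (\<integral>\<^sup>+x. ennreal (\<beta> / e) * indicator (D \<inter> layer S \<nu> e) x \<partial>lborel)"
   unfolding Nk_def using D lb by (subst emeasure_density) (auto intro!: nn_integral_cong simp: indicator_def)
  thus ?thesis using D lb by (subst (asm) nn_integral_cmult_indicator) auto
 qed
 have mono: "ennreal (\<beta> / e) * a <= k * (ennreal (\<beta> / e) * b)" if "a <= k * b" for a b k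
  using mult_left_mono[OF that, of "ennreal (\<beta> / e)"] by (simp add: mult_ac)
 have sets: "sets (Mk e) = sets borel" "sets (Nk e) = sets borel" by (simp_all add: Mk_def Nk_def)
 show "Mk e <= scale_measure (ennreal (1 + Clay * e)) (Nk e)"
  using Clay(2)[OF e] lb by (subst le_measure) (auto simp: sets M N intro!: mono)
 show "Nk e <= scale_measure (ennreal (1 + Clay * e)) (Mk e)"
  using Clay(3)[OF e] lb by (subst le_measure) (auto simp: sets M N intro!: mono)
qed

text \<open>The converse of \<open>AE_kap\<close> on the layer: here Lebesgue measure must be
  dominated by the layer measure, which is the second half of the comparison.\<close>

lemma AE_of_kap:
 assumes e: "0 < e" "e <= \<beta> / 4" and P: "{x \<in> layer S \<nu> e. \<not> P x} \<in> sets borel" and ae: "AE z in Ms. P (kap e z)"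
 shows "AE x in lborel. x \<in> layer S \<nu> e --> P x"
proof -
 define D where "D = {x \<in> layer S \<nu> e. \<not> P x}"
 have D: "D \<in> sets borel" "D \<subseteq> layer S \<nu> e" using P by (auto simp: D_def)
 have "(\<integral>\<^sup>+z. indicator D (kap e z) \<partial>Ms) = (\<integral>\<^sup>+z. 0 \<partial>Ms)"
  by (rule nn_integral_cong_AE) (use ae in eventually_elim, auto simp: D_def)
 hence "emeasure (layer_measure e) D = 0"
  using nn_integral_kap[of "indicator D", OF _ e(1)] D divide_pos_pos[OF beta e(1)] by (auto simp: ennreal_eq_0_iff)
 hence "emeasure lborel D = 0" using Clay(3)[OF e D] by simp
 hence "D \<in> null_sets lborel" using D by (intro null_setsI) auto
 thus ?thesis by (rule AE_I') (auto simp: D_def)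
qed

text \<open>Two potentials that agree almost everywhere must stay so after stretching. The null set
  \<open>N\<close> where they differ is itself rescaled as a potential: its indicator vanishes
  almost everywhere in the compressed coordinates, hence in the layer.\<close>

lemma Vs_AE:
 assumes e: "0 < e" "e <= \<beta> / 4" shows "AE x in lborel. Vs e x = Vs0 e x"
proof -
 have e': "e <= \<beta>" using e beta by simp
 obtain N where N: "{x \<in> space lborel. \<not> V x = V0 x} \<subseteq> N" "emeasure lborel N = 0" "N \<in> sets lborel" using V_V0 by (rule AE_E)
 define ch where "ch x = scaled_potential S \<nu> \<beta> (indicator N) e x" for x
 have "AE x in lborel. x \<notin> N" using N(2,3) by (intro AE_not_in) auto
 from AE_kap[OF this beta order_refl] AE_Ms have "AE z in Ms. ch (kap e z) = 0"
  by eventually_elim (simp add: ch_def scaled_kap(2)[OF e(1) e'])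
 moreover have "ch \<in> borel_measurable borel"
 proof -
  \<comment> \<open>The indicator of \<open>N\<close> is taken as the potential in order to reuse
    the measurability of scaled potentials.\<close>
  interpret N: hypersurface_potential I \<phi> U V' S \<nu> \<beta> "indicator N" "indicator N" 1
   by standard (use N(3) in \<open>auto simp: indicator_def\<close>)
  show ?thesis unfolding ch_def[abs_def] using N.Vs0_measurable[OF e(1) e'] by simp
 qed
 ultimately have "AE x in lborel. x \<in> layer S \<nu> e --> ch x = 0"
  using layer_borel[OF e'] by (intro AE_of_kap[OF e]) measurable
 thus ?thesis
 proof eventually_elim
  case (elim x)
  show ?case
  proof (cases "x \<in> layer S \<nu> e")
   case True
   hence "x \<notin> layer S \<nu> e \<or> (case inv_into (S \<times> {- e<..<e}) \<iota> x of (y, t) => \<iota> (y, \<beta> / e * t)) \<notin> N"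
    using elim e beta by (auto simp: ch_def scaled_potential_def case_prod_beta indicator_def split: if_splits)
   with True N(1) show ?thesis by (auto simp: scaled_potential_def case_prod_beta)
  qed (simp add: scaled_potential_def)
 qed
qed

lemma Vs0_bound: "0 < e ==> \<bar>Vs0 e x\<bar> <= \<beta> / e * VB"
 using beta V0_bound VB by (auto simp: scaled_potential_def case_prod_beta abs_mult intro!: mult_mono divide_right_mono)

lemma Vs_L_infinity:
 assumes e: "0 < e" "e <= \<beta> / 4" shows "L_infinity lebesgue (Vs e)"
proof -
 have m: "Vs0 e \<in> borel_measurable lebesgue" using Vs0_measurable[of e] e beta by (intro measurable_completion) simp
 have ae: "AE x in lebesgue. Vs0 e x = Vs e x" using Vs_AE[OF e] unfolding AE_lborel_lebesgue by (auto elim: eventually_mono)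
 have "AE x in lebesgue. \<bar>Vs e x\<bar> <= \<beta> / e * VB" using ae by eventually_elim (use Vs0_bound[OF e(1)] in metis)
 thus ?thesis unfolding L_infinity_def using borel_measurable_AE[OF m ae] by blast
qed

definition "be e f g = cinner_l2 (mult_l2 (Vs e) f) g"

text \<open>Both forms integrate the same function, one against \<open>Nk\<close> and the other
  against \<open>Mk\<close>, so their difference is the Jacobian error of
  \<open>integral_compare\<close> with k = 1 + \<open>Clay\<close> e.\<close>

lemma be_bt:
 assumes e: "0 < e" "e <= \<beta> / 4" and f: "f \<in> H1" and g: "g \<in> H1"
 shows "cmod (be e f g - bt e f g) <= 2 * Clay * VB * CJ^2 * e * (interp_norm f * interp_norm g)"
proof -
 have e': "0 <= e" "e <= \<beta>" using e beta by auto
 note [measurable] = Vs0_measurable[OF e(1) e'(2)] brep(1)[of f] brep(1)[of g]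
 \<comment> \<open>The factor e / \<beta> undoes the amplitude of the scaled potential, so that
   \<open>F\<close> stays bounded by the weight; the density of \<open>Nk\<close> restores
   it.\<close>
 define F where "F x = of_real (e / \<beta> * Vs0 e x) * brep f x * cnj (brep g x)" for x
 have Fm [measurable]: "F \<in> borel_measurable borel"
  unfolding F_def[abs_def] by measurable
 have Gm: "(%x. of_real (Vs0 e x) * brep f x * cnj (brep g x)) \<in> borel_measurable borel" by measurable
 have Fk: "AE z in Ms. F (kap e z) = of_real (wgt z) * J e f z * cnj (J e g z)"
  using AE_Ms by eventually_elim (use e beta in \<open>simp add: F_def scaled_kap(2)[OF e(1) e'(2)] J_def wgt_def\<close>)
 note s = J_square_integrable[OF f e'] J_square_integrable[OF g e']
 note w = wgt_form[OF s]
 have Mm: "(%z. F (kap e z)) \<in> borel_measurable Ms" by measurable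
 have i: "integrable Ms (%z. F (kap e z))"
  by (rule integrable_cong_AE_imp[OF w(1) Mm]) (use Fk in \<open>auto elim: eventually_mono\<close>)
 have iM: "integrable (Mk e) F" unfolding Mk_def by (subst integrable_distr_eq) (use i in auto)
 have M: "(LINT x|Mk e. F x) = bt e f g"
  unfolding Mk_def bt_def by (subst integral_distr) (auto intro!: integral_cong_AE Fk borel_measurable_integrable[OF w(1)])
 have "(LINT x|Mk e. cmod (F x)) = (LINT z|Ms. cmod (F (kap e z)))" unfolding Mk_def by (subst integral_distr) auto
 also have "... <= (LINT z|Ms. VB * (cmod (J e f z) * cmod (J e g z)))"
 proof (rule integral_mono_AE)
  show "AE z in Ms. cmod (F (kap e z)) <= VB * (cmod (J e f z) * cmod (J e g z))"
   using Fk by eventually_elim (auto simp: norm_mult mult.assoc intro!: mult_right_mono wgt_bound)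
 qed (use i w(2) in auto)
 also have "... <= VB * ((CJ * interp_norm f) * (CJ * interp_norm g))"
  using order_trans[OF w(3) mult_mono[OF J_bound[OF f e'] J_bound[OF g e']]] CJ VB by (simp add: mult_left_mono)
 finally have A: "(LINT x|Mk e. cmod (F x)) <= VB * CJ^2 * (interp_norm f * interp_norm g)" by (simp add: power2_eq_square mult_ac)
 have "be e f g = (LINT x|lebesgue. of_real (Vs e x) * rep_l2 f x * cnj (rep_l2 g x))"
  unfolding be_def by (rule cinner_mult_l2[OF Vs_L_infinity[OF e]])
 also have "... = (LINT x|lebesgue. of_real (Vs0 e x) * brep f x * cnj (brep g x))"
 proof (rule integral_cong_AE)
  show "AE x in lebesgue. of_real (Vs e x) * rep_l2 f x * cnj (rep_l2 g x) = of_real (Vs0 e x) * brep f x * cnj (brep g x)"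
   using Vs_AE[OF e, folded AE_lborel_lebesgue] brep(2)[of f] brep(2)[of g] by eventually_elim simp
  have "Vs e \<in> borel_measurable lebesgue" using Vs_L_infinity[OF e] by (simp add: L_infinity_def)
  thus "(%x. of_real (Vs e x) * rep_l2 f x * cnj (rep_l2 g x)) \<in> borel_measurable lebesgue" by measurable
  show "(%x. of_real (Vs0 e x) * brep f x * cnj (brep g x)) \<in> borel_measurable lebesgue"
   by (rule measurable_completion) (use Gm in simp)
 qed
 also have "... = (LINT x|lborel. of_real (Vs0 e x) * brep f x * cnj (brep g x))"
  by (rule integral_completion) (use Gm in simp)
 also have "... = (LINT x|Nk e. F x)"
  unfolding Nk_def using e beta layer_borel[OF e'(2)]
  by (subst integral_density) (auto intro!: Bochner_Integration.integral_cong simp: F_def indicator_def scaled_potential_def scaleR_conv_of_real)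
 finally have "cmod (be e f g - bt e f g) <= 2 * (Clay * e) * (LINT x|Mk e. cmod (F x))"
  using integral_compare[OF _ Mk_Nk[OF e] _ iM] Clay(1) e(1) M by (simp add: Mk_def Nk_def)
 also have "... <= 2 * (Clay * e) * (VB * CJ^2 * (interp_norm f * interp_norm g))" using A Clay(1) e(1) by (intro mult_left_mono) auto
 finally show ?thesis by (simp add: mult_ac)
qed

end

section \<open>Assembly of the resolvent estimate\<close>

lemma L_infinity_borel:
 fixes V :: "'a::euclidean_space => real"
 assumes "L_infinity lebesgue V"
 shows "\<exists>V0 C. V0 \<in> borel_measurable borel \<and> (\<forall>x. \<bar>V0 x\<bar> <= C) \<and> (AE x in lborel. V x = V0 x)"
proof -
 obtain C where C: "0 <= C" "AE x in lebesgue. \<bar>V x\<bar> <= C" "V \<in> borel_measurable lebesgue" by (rule L_infinity_bound[OF assms])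
 obtain W where W: "W \<in> borel_measurable lborel" "AE x in lborel. V x = W x" using completion_ex_borel_measurable_real[OF C(3)] by blast
 have "AE x in lborel. V x = max (- C) (min C (W x))" using C(2)[unfolded AE_lborel_lebesgue] W(2) by eventually_elim auto
 thus ?thesis using W(1) C(1) by (intro exI[of _ "%x. max (- C) (min C (W x))"] exI[of _ C]) auto
qed

lemma relative_form_add:
 assumes "relative_form a K" "relative_form b L" shows "relative_form (%f g. a f g + b f g) (K + L)"
proof -
 interpret a: relative_form a K by fact
 interpret b: relative_form b L by fact
 show ?thesis
 proof
  show "cmod (a f g + b f g) <= (K + L) * (interp_norm f * interp_norm g)" if "f \<in> H1" "g \<in> H1" for f g
   unfolding distrib_right by (rule norm_triangle_le[OF add_mono[OF a.b_bound[OF that] b.b_bound[OF that]]])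
  show "a f g + b f g = cnj (a g f + b g f)" if "f \<in> H1" "g \<in> H1" for f g
   using a.b_sym[OF that] b.b_sym[OF that] by simp
 qed (auto simp: a.b_add b.b_add a.b_scale b.b_scale distrib_left a.K_nonneg b.K_nonneg)
qed

lemma relative_form_uminus:
 assumes "relative_form a K" shows "relative_form (%f g. - a f g) K"
proof -
 interpret relative_form a K by fact
 show ?thesis
 proof
  show "- a f g = cnj (- a g f)" if "f \<in> H1" "g \<in> H1" for f g using b_sym[OF that] by simp
 qed (auto simp: b_add b_scale b_bound K_nonneg)
qed

lemma relative_form_mono: "relative_form a K ==> K <= L ==> relative_form a L"
 unfolding relative_form_def by (meson interp_norm_nonneg mult_nonneg_nonneg mult_right_mono order_trans)

lemma relative_form_mult:
 assumes q: "L_infinity lebesgue q" and C: "0 <= C" "!!f. norm (mult_l2 q f) <= C * norm f"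
 shows "relative_form (%f g. cinner_l2 (mult_l2 q f) g) C"
proof
 show "cmod (cinner_l2 (mult_l2 q f) g) <= C * (interp_norm f * interp_norm g)" for f g
 proof -
  have "cmod (cinner_l2 (mult_l2 q f) g) <= (C * norm f) * norm g"
   by (rule order_trans[OF cinner_bound mult_right_mono[OF C(2)]]) simp
  also have "... <= C * (interp_norm f * interp_norm g)"
   unfolding mult.assoc by (intro mult_left_mono mult_mono norm_le_interp_norm C(1)) auto
  finally show ?thesis .
 qed
 show "cinner_l2 (mult_l2 q f) g = cnj (cinner_l2 (mult_l2 q g) f)" for f g by (rule mult_l2_sym[OF q])
qed (auto simp: C(1) mult_l2_add[OF q] mult_l2_scaleC[OF q] cinner_add_left cinner_scaleC_left)

text \<open>From - ln e = 2 ln (1 / sqrt e) <= 2 / sqrt e one gets e |ln e| <= 2 sqrt e.\<close>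

lemma tendsto_mult_1_plus_abs_ln: "((%e. e * (1 + \<bar>ln e\<bar>)) \<longlongrightarrow> 0) (at_right (0::real))"
proof (rule tendsto_sandwich)
 have "e * (1 + \<bar>ln e\<bar>) <= e + 2 * sqrt e" if e: "0 < e" "e < 1" for e :: real
 proof -
  have "- ln e = 2 * ln (1 / sqrt e)" using e by (simp add: ln_div ln_sqrt)
  also have "ln (1 / sqrt e) <= 1 / sqrt e" using ln_le_minus_one[of "1 / sqrt e"] e by simp
  finally have "e * \<bar>ln e\<bar> <= e * (2 * (1 / sqrt e))" using e by (intro mult_left_mono) auto
  also have "... = 2 * (e / sqrt e)" by simp
  also have "e / sqrt e = sqrt e" by (rule real_div_sqrt) (use e in simp)
  finally show ?thesis by (simp add: distrib_left)
 qed
 thus "\<forall>\<^sub>F e in at_right (0::real). e * (1 + \<bar>ln e\<bar>) <= e + 2 * sqrt e"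
  by (intro eventually_at_rightI[of 0 1]) auto
 show "\<forall>\<^sub>F e in at_right (0::real). 0 <= e * (1 + \<bar>ln e\<bar>)"
  by (intro eventually_at_rightI[of 0 1] mult_nonneg_nonneg add_nonneg_nonneg) auto
 have "((%e. e + 2 * sqrt e) \<longlongrightarrow> 0 + 2 * sqrt 0) (at_right (0::real))" by (intro tendsto_intros)
 thus "((%e. e + 2 * sqrt e) \<longlongrightarrow> 0) (at_right (0::real))" by simp
qed simp

theorem theorem1p1:
  fixes I :: "'i set"
    and \<phi> :: "'i \<Rightarrow> real^'m::finite \<Rightarrow> real^'n::finite"
    and U :: "'i \<Rightarrow> (real^'m) set"
    and V' :: "'i \<Rightarrow> (real^'n) set"
    and S :: "(real^'n) set"
    and \<nu> :: "real^'n \<Rightarrow> real^'n"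
    and \<beta> :: real
    and Q V \<alpha> :: "real^'n \<Rightarrow> real"
  assumes dim: "2 \<le> CARD('n)"
    and adm: "admissible I \<phi> U V' S \<nu> \<beta>"
    and Q: "L_infinity lebesgue Q"
    and V: "L_infinity lebesgue V"
    and supp_V: "AE x in lebesgue. x \<notin> layer S \<nu> \<beta> \<longrightarrow> V x = 0"
    and \<alpha>: "L_infinity (surface_measure S) \<alpha>"
    and \<alpha>_eq: "AE x in surface_measure S.
                  \<alpha> x = (LINT s:{-\<beta>..\<beta>}|lebesgue. V (x + s *\<^sub>R \<nu> x))"
  defines "A \<equiv> perturb (delta_operator S \<alpha>) Q"
    and "H \<equiv> (\<lambda>\<epsilon>. perturb (schroedinger (scaled_potential S \<nu> \<beta> V \<epsilon>)) Q)"
  shows "(\<exists>\<mu>\<^sub>0<0.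
            (\<forall>\<^sub>F \<epsilon> in at_right 0. \<forall>\<mu><\<mu>\<^sub>0.
               complex_of_real \<mu> \<in> resolvent_set A \<inter> resolvent_set (H \<epsilon>)) \<and>
            (\<forall>\<mu><\<mu>\<^sub>0. \<exists>c>0. \<forall>\<^sub>F \<epsilon> in at_right 0.
               onorm (\<lambda>f. resolvent (H \<epsilon>) (complex_of_real \<mu>) f
                            - resolvent A (complex_of_real \<mu>) f)
                 \<le> c * \<epsilon> * (1 + \<bar>ln \<epsilon>\<bar>))) \<and>
         norm_resolvent_convergent H A (at_right 0)"

proof -
 interpret admissible_hypersurface I \<phi> U V' S \<nu> \<beta> by (rule admissible_hypersurface.intro[OF dim adm])
 obtain V0 VB where V0: "V0 \<in> borel_measurable borel" "!!x. \<bar>V0 x\<bar> <= VB" "AE x in lborel. V x = V0 x" using L_infinity_borel[OF V] by blast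
 interpret hypersurface_potential I \<phi> U V' S \<nu> \<beta> V V0 VB by standard (use V0 in auto)
 obtain CQ where CQ: "0 <= CQ" "!!f. norm (mult_l2 Q f) <= CQ * norm f" by (rule norm_mult_l2[OF Q]) blast
 define q where "q f g = cinner_l2 (mult_l2 Q f) g" for f g
 have q: "relative_form (%f g. - q f g) CQ"
  unfolding q_def by (rule relative_form_uminus[OF relative_form_mult[OF Q CQ]])
 \<comment> \<open>One bound for all small \<epsilon> and for the limit: the potential form, the
   largest Jacobian error, and \<open>Q\<close>. The spectral threshold \<open>bottom\<close>
   depends on it alone and is therefore independent of \<epsilon>.\<close>
 define K where "K = VB * CJ^2 + 2 * Clay * VB * CJ^2 * \<beta> + CQ"
 \<comment> \<open>Below 1 for the dyadic estimate, and at most \<beta> / 4 for the comparison of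
   the layer measure with volume.\<close>
 define \<epsilon>0 where "\<epsilon>0 = min 1 (\<beta> / 4)"
 have \<epsilon>0: "0 < \<epsilon>0" using beta by (simp add: \<epsilon>0_def)
 have pos: "0 <= VB * CJ^2" "0 <= 2 * Clay * VB * CJ^2" using VB Clay(1) by auto
 define b0 where "b0 f g = bt 0 f g + - q f g" for f g
 define b1 where "b1 e f g = be e f g + - q f g" for e f g
 have b0: "relative_form b0 K"
  unfolding b0_def[abs_def] using pos beta
  by (intro relative_form_mono[OF relative_form_add[OF bt_relative_form q]]) (auto simp: K_def)
 have b1: "relative_form (b1 e) K" if e: "0 < e" "e < \<epsilon>0" for e
 proof -
  have e': "e <= \<beta> / 4" "0 <= e" "e <= \<beta>" using e beta by (auto simp: \<epsilon>0_def)
  obtain Ce where Ce: "0 <= Ce" "!!f. norm (mult_l2 (Vs e) f) <= Ce * norm f" by (rule norm_mult_l2[OF Vs_L_infinity[OF e(1) e'(1)]]) blast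
  interpret Y: relative_form "be e" Ce unfolding be_def[abs_def] by (rule relative_form_mult[OF Vs_L_infinity[OF e(1) e'(1)] Ce])
  have le: "cmod (be e f g) <= (VB * CJ^2 + 2 * Clay * VB * CJ^2 * \<beta>) * (interp_norm f * interp_norm g)" if f: "f \<in> H1" and g: "g \<in> H1" for f g
  proof -
   have "cmod (be e f g) <= cmod (bt e f g) + cmod (be e f g - bt e f g)" by (rule norm_triangle_sub)
   also have "... <= VB * CJ^2 * (interp_norm f * interp_norm g) + 2 * Clay * VB * CJ^2 * e * (interp_norm f * interp_norm g)"
    by (rule add_mono[OF relative_form.b_bound[OF bt_relative_form[OF e'(2,3)] f g] be_bt[OF e(1) e'(1) f g]])
   also have "2 * Clay * VB * CJ^2 * e * (interp_norm f * interp_norm g) <= 2 * Clay * VB * CJ^2 * \<beta> * (interp_norm f * interp_norm g)"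
    by (rule mult_right_mono[OF mult_left_mono[OF e'(3) pos(2)]]) simp
   finally show ?thesis by (simp add: distrib_right)
  qed
  have "relative_form (be e) (VB * CJ^2 + 2 * Clay * VB * CJ^2 * \<beta>)"
   by standard (use pos beta in \<open>auto intro: Y.b_add Y.b_scale Y.b_sym le\<close>)
  from relative_form_add[OF this q] show ?thesis by (simp add: b1_def[abs_def] K_def)
 qed
 interpret X: relative_form b0 K by (rule b0)
 let ?Y = "%e \<mu>. coercive_form.Rop H1 (relative_form.frm (b1 e) \<mu>)"
 define \<mu>0 where "\<mu>0 = X.bottom"
 have A_eq: "A = op_of_inv (X.Res \<mu>) \<mu>" if "\<mu> <= \<mu>0" for \<mu>
 proof -
  have bt0: "relative_form (bt 0) (VB * CJ^2)" using beta by (intro bt_relative_form) auto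
  have \<alpha>m: "\<alpha> \<in> borel_measurable \<sigma>" using \<alpha> by (simp add: L_infinity_def)
  have "delta_operator S \<alpha> = form_graph H1 (delta_form S \<alpha>)"
   unfolding delta_operator_def H1_def[symmetric] by (rule relative_form.form_operator_Res[OF bt0 delta_form_bt[OF \<alpha>_eq \<alpha>m]])
  hence "A = form_graph H1 (%f g. delta_form S \<alpha> f g + q f g)" unfolding A_def by (simp add: perturb_form_graph[of Q q] q_def)
  also have "... = op_of_inv (X.Res \<mu>) \<mu>"
   by (rule X.form_graph_Res) (use that in \<open>auto simp: delta_form_bt[OF \<alpha>_eq \<alpha>m] b0_def \<mu>0_def\<close>)
  finally show ?thesis .
 qed
 have H_eq: "H e = op_of_inv (?Y e \<mu>) \<mu>" if "\<mu> <= \<mu>0" "0 < e" "e < \<epsilon>0" for \<mu> e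
 proof -
  have "H e = form_graph H1 (%f g. (grad_form f g - be e f g) + q f g)"
   unfolding H_def schroedinger_form_graph be_def by (simp add: perturb_form_graph[of Q q] q_def)
  also have "... = op_of_inv (?Y e \<mu>) \<mu>"
   by (rule relative_form.form_graph_Res[OF b1[OF that(2,3)]]) (use that in \<open>auto simp: b1_def \<mu>0_def\<close>)
  finally show ?thesis .
 qed
 \<comment> \<open>The first summand is the Jacobian error of \<open>be_bt\<close>, the second the
   displacement error of \<open>bt_diff\<close>.\<close>
 define B where "B = 2 * Clay * VB * CJ^2 + VB * CJ"
 define c where "c \<mu> = B * (4 + 4 * (2 * CJ * (1 + 2 * K + 2 * \<bar>\<mu> + 1\<bar>) * (1 + 11 * CARD('n))))" for \<mu>
 have B: "0 <= B" using pos VB CJ by (simp add: B_def)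
 have c: "0 <= c \<mu>" for \<mu> unfolding c_def using B CJ X.K_nonneg by (intro mult_nonneg_nonneg add_nonneg_nonneg) auto
 have diff: "norm (?Y e \<mu> h - X.Res \<mu> h) <= c \<mu> * (e * (1 + \<bar>ln e\<bar>)) * norm h"
  if \<mu>: "\<mu> <= \<mu>0" and e: "0 < e" "e < \<epsilon>0" for \<mu> e h
  unfolding c_def
 proof (rule resolvent_difference[OF b0 b1[OF e] \<mu>[unfolded \<mu>0_def], of "Dst e"])
  have e': "e <= \<beta> / 4" "0 <= e" "e <= \<beta>" using e beta by (auto simp: \<epsilon>0_def)
  show "0 < e" "e < 1" "0 <= 2 * CJ" "0 <= B" using e CJ B by (auto simp: \<epsilon>0_def)
  show "Dst e f <= 2 * CJ * interp_norm f" if "f \<in> H1" for f by (rule Dst_bound[OF that e'(2,3)])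
  show "Dst e f <= 2 * CJ * e * (\<Sum>j\<in>UNIV. interp_norm (wD j f))" if "f \<in> sobolev 2" for f by (rule Dst_H2[OF that e(1) e'(3)])
  fix f g :: "(real^'n) l2" assume f: "f \<in> H1" and g: "g \<in> H1"
  show "Dst e (f + g) <= Dst e f + Dst e g" by (rule Dst_add[OF f g e'(2,3)])
  define y where "y = Dst e f * interp_norm g + interp_norm f * Dst e g"
  have y: "0 <= y" by (simp add: y_def Dst_def)
  have "cmod (b1 e f g - b0 f g) <= cmod (be e f g - bt e f g) + cmod (bt e f g - bt 0 f g)"
   unfolding b0_def b1_def using norm_triangle_ineq[of "be e f g - bt e f g" "bt e f g - bt 0 f g"] by simp
  also have "... <= 2 * Clay * VB * CJ^2 * e * (interp_norm f * interp_norm g) + VB * CJ * y"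
   unfolding y_def by (rule add_mono[OF be_bt[OF e(1) e'(1) f g] bt_diff[OF f g e'(2,3)]])
  also have "... <= B * (e * (interp_norm f * interp_norm g)) + B * y"
   using pos VB CJ e y unfolding mult.assoc[of _ e] by (intro add_mono mult_right_mono) (auto simp: B_def)
  finally show "cmod (b1 e f g - b0 f g) <= B * (e * (interp_norm f * interp_norm g) + Dst e f * interp_norm g + interp_norm f * Dst e g)"
   by (simp add: y_def algebra_simps)
 qed
 have ev: "\<forall>\<^sub>F e in at_right 0. P e" if "!!e. 0 < e ==> e < \<epsilon>0 ==> P e" for P
  by (rule eventually_at_rightI[OF _ \<epsilon>0]) (use that in auto)
 note sX = X.sym_inv_Res[folded \<mu>0_def]
 have sY: "sym_inv (?Y e \<mu>) 2" if "\<mu> <= \<mu>0" "0 < e" "e < \<epsilon>0" for \<mu> e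
  by (rule relative_form.sym_inv_Res[OF b1[OF that(2,3)]]) (use that in \<open>simp add: \<mu>0_def\<close>)
 have "norm_resolvent_convergent H A (at_right 0)"
 proof (rule norm_resolvent_convergentI[OF sX[OF order_refl], of "%e. ?Y e \<mu>0" "%_. 2" _ "%e. c \<mu>0 * (e * (1 + \<bar>ln e\<bar>))" A \<mu>0 H])
  show "((%e. c \<mu>0 * (e * (1 + \<bar>ln e\<bar>))) \<longlongrightarrow> 0) (at_right 0)"
   by (rule tendsto_mult_right_zero[OF tendsto_mult_1_plus_abs_ln])
  show "\<forall>\<^sub>F e in at_right 0. sym_inv (?Y e \<mu>0) 2" by (rule ev[OF sY[OF order_refl]])
  show "\<forall>\<^sub>F e in at_right 0. 0 <= c \<mu>0 * (e * (1 + \<bar>ln e\<bar>)) \<and>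
    (\<forall>h. norm (?Y e \<mu>0 h - X.Res \<mu>0 h) <= c \<mu>0 * (e * (1 + \<bar>ln e\<bar>)) * norm h)"
   by (rule ev) (intro conjI allI diff[OF order_refl] mult_nonneg_nonneg c; simp)
  show "A = op_of_inv (X.Res \<mu>0) \<mu>0" by (rule A_eq[OF order_refl])
  show "\<forall>\<^sub>F e in at_right 0. H e = op_of_inv (?Y e \<mu>0) \<mu>0" by (rule ev[OF H_eq[OF order_refl]])
 qed
 moreover have "\<forall>\<^sub>F \<epsilon> in at_right 0. \<forall>\<mu><\<mu>0. of_real \<mu> \<in> resolvent_set A \<inter> resolvent_set (H \<epsilon>)"
 proof (rule ev, intro allI impI)
  fix e \<mu> assume e: "0 < e" "e < \<epsilon>0" and "\<mu> < \<mu>0"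
  hence \<mu>: "\<mu> <= \<mu>0" by simp
  show "of_real \<mu> \<in> resolvent_set A \<inter> resolvent_set (H e)"
   using sym_inv.resolvent_base(1)[OF sX[OF \<mu>]] sym_inv.resolvent_base(1)[OF sY[OF \<mu> e]] by (simp add: A_eq[OF \<mu>] H_eq[OF \<mu> e])
 qed
 moreover have "\<exists>c>0. \<forall>\<^sub>F \<epsilon> in at_right 0. onorm (%f. resolvent (H \<epsilon>) (of_real \<mu>) f - resolvent A (of_real \<mu>) f) <= c * \<epsilon> * (1 + \<bar>ln \<epsilon>\<bar>)"
  if "\<mu> < \<mu>0" for \<mu>
 proof (intro exI conjI ev)
  have \<mu>: "\<mu> <= \<mu>0" using that by simp
  \<comment> \<open>\<open>c \<mu>\<close> is 0 when \<open>VB\<close> is 0, whereas a positive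
    constant is asked for.\<close>
  show "0 < c \<mu> + 1" using c[of \<mu>] by simp
  fix e :: real assume e: "0 < e" "e < \<epsilon>0"
  show "onorm (%f. resolvent (H e) (of_real \<mu>) f - resolvent A (of_real \<mu>) f) <= (c \<mu> + 1) * e * (1 + \<bar>ln e\<bar>)"
  proof (rule onorm_bound)
   show "0 <= (c \<mu> + 1) * e * (1 + \<bar>ln e\<bar>)" using c[of \<mu>] e by (intro mult_nonneg_nonneg add_nonneg_nonneg) auto
   fix h
   have "norm (resolvent (H e) (of_real \<mu>) h - resolvent A (of_real \<mu>) h) <= c \<mu> * (e * (1 + \<bar>ln e\<bar>)) * norm h"
    using diff[OF \<mu> e] by (simp add: A_eq[OF \<mu>] H_eq[OF \<mu> e] sym_inv.resolvent_base(2)[OF sX[OF \<mu>]] sym_inv.resolvent_base(2)[OF sY[OF \<mu> e]])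
   also have "... <= (c \<mu> + 1) * e * (1 + \<bar>ln e\<bar>) * norm h"
    using e by (intro mult_right_mono) (auto simp: algebra_simps)
   finally show "norm (resolvent (H e) (of_real \<mu>) h - resolvent A (of_real \<mu>) h) <= (c \<mu> + 1) * e * (1 + \<bar>ln e\<bar>) * norm h" .
  qed
 qed
 moreover have "\<mu>0 < 0" unfolding \<mu>0_def X.bottom_def using zero_le_power2[of K] by linarith
 ultimately show ?thesis by blast
qed

end
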